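(* Let $Z=X\times M$ and $\mu=\ell\otimes\nu$ be as in the context, let $k\ge1$, and let $h\in L^1(\mu^k)\cap L^2(\mu^k)$ be symmetric and not a.e. zero. For $\lambda>0$ let $\eta_\lambda$ be a Poisson measure on $Z$ with control measure $\mu_\lambda=\lambda\mu$ and let $$F_\lambda=\sum_{\mathbf{x}\in\eta^k_{\lambda,\neq}}h(\mathbf{x}),$$ assumed to be square-integrable for every $\lambda>0$. For $1\le i\le k$ put $$h_i(\mathbf{x}_i)=\binom ki\int_{Z^{k-i}}h(\mathbf{x}_i,\mathbf{x}_{k-i})\,d\mu^{k-i}(\mathbf{x}_{k-i}),\quad \mathbf{x}_i\in Z^i,$$ and let $F_{i,\lambda}=I_i(\lambda^{k-i}h_i)$, the multiple Wiener-Itô integral being with respect to $\hat\eta_\lambda=\eta_\lambda-\lambda\mu$, so that $F_\lambda=E[F_\lambda]+\sum_{i=1}^kF_{i,\lambda}$. Assume that the kernels $\lambda^{k-i}h_i$, $i=1,\dots,k$, satisfy the technical Assumption (T) of the context for every $\lambda$. Let $q_1\ge1$ be the smallest integer such that $\|h_{q_1}\|_{L^2(\mu^{q_1})}>0$. Then, as $\lambda\to\infty$, $$\mathrm{Var}(F_\lambda)\sim\mathrm{Var}(F_{q_1,\lambda})\sim c\,\lambda^{2k-q_1}$$ for some $c>0$, and moreover: 1. If $q_1=1$, then $\tilde F_\lambda=(F_\lambda-E[F_\lambda])/\sqrt{\mathrm{Var}(F_\lambda)}$ converges in law to $N\sim\mathscr N(0,1)$, and $d_W(\tilde F_\lambda,N)=O(\lambda^{-1/2})$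 as $\lambda\to\infty$. 2. If $q_1\ge2$, then $\lambda^{q_1/2-k}F_\lambda$ converges in distribution, as $\lambda\to\infty$, to $$V(q_1):=\mu(Z)^{q_1/2}\,I^{\hat G}_{q_1}(h_{q_1})\stackrel{\rm Law}{=}I^{G}_{q_1}(h_{q_1}),$$ where $I^{\hat G}_{q_1}$ (resp. $I^G_{q_1}$) denotes the multiple Wiener-Itô integral of order $q_1$ with respect to a Gaussian measure $\hat G$ (resp. $G$) on $Z$ with control $\hat\mu=\mu/\mu(Z)$ (resp. $\mu$).
   Context: Setting: $X\subset\mathbb{R}^d$ is compact, symmetric ($X=-X$), contains $0$ in its interior and has Lebesgue-negligible boundary; $\ell$ is Lebesgue measure; $M$ is a locally compact space with a probability measure $\nu$. $\eta^k_{\lambda,\neq}$ is the set of $k$-tuples of pairwise distinct points in the support of $\eta_\lambda$. A Gaussian measure on $Z$ with control $\mu$ is a centered Gaussian family $G=\{G(B):\mu(B)<\infty\}$ with $E[G(B)G(C)]=\mu(B\cap C)$. Multiple Wiener-Itô integrals with respect to $\hat\eta_\lambda$, $G$, $\hat G$ are the usual ones (diagonals excluded). Contractions (with respect to a control measure $\mu$): $u\star_r^lv(\mathbf{x}_{p-r},\mathbf{x}'_{q-r},\mathbf{y}_{r-l})=\int u(\mathbf{x}_{p-r},\mathbf{y}_{r-l},\mathbf{z}_l)v(\mathbf{x}'_{q-r},\mathbf{y}_{r-l},\mathbf{z}_l)\,\mu^l(d\mathbf{z}_l)$ for $u,v$ symmetric functions of $p,q$ variables, $0\le l\le r\le\min(p,q)$.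 Assumption (T), for symmetric kernels $f_i\in L^2(\mu^{i})$, $i=1,\dots,k$, and control measure $\mu$ (here applied with $\mu_\lambda$): (1) for every $i$ and $r=1,\dots,i$, $f_i\star_{i}^{i-r}f_i\in L^2(\mu^r)$; (2) for every $i\ge2$, $|f_i|\star_r^l|f_i|$ is well defined and finite at every point for all $1\le l\le r\le i$; (3) for all $i,j$ with $\max(i,j)>1$, every $n\in\{|i-j|\vee1,\dots,i+j-2\}$ and all $0\le l\le r\le\min(i,j)-1$ with $n=i+j-2-r-l$, $\int_Z\big[\int_{Z^n}(f_i(z,\cdot)\star_r^lf_j(z,\cdot))^2d\mu^n\big]^{1/2}\mu(dz)<\infty$. $a_\lambda\sim b_\lambda$ means $a_\lambda/b_\lambda\to1$. $d_W(F,N)=\sup_g|E[g(F)]-E[g(N)]|$ over $1$-Lipschitz $g:\mathbb{R}\to\mathbb{R}$. *)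

theory Defs
  imports "HOL-Probability.Probability" "HOL-Library.Landau_Symbols"
    "HOL-Combinatorics.Permutations"
begin

text \<open>Points of \<open>Z\<^sup>n\<close> are the elements of \<open>space (power_measure \<mu> n)\<close>, that is, extensional
  functions on \<open>{..<n}\<close>. The argument \<open>x\<close> of \<open>append_tuple\<close> is read at the indices below \<open>m\<close> and
  \<open>y\<close> at those below \<open>n\<close>; neither has to be extensional.\<close>

abbreviation power_measure :: "'z measure \<Rightarrow> nat \<Rightarrow> (nat \<Rightarrow> 'z) measure" where
  "power_measure \<mu> n \<equiv> PiM {..<n} (\<lambda>_. \<mu>)"

definition append_tuple :: "nat \<Rightarrow> nat \<Rightarrow> (nat \<Rightarrow> 'z) \<Rightarrow> (nat \<Rightarrow> 'z) \<Rightarrow> nat \<Rightarrow> 'z" where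
  "append_tuple m n x y = (\<lambda>i\<in>{..<m + n}. if i < m then x i else y (i - m))"

definition symmetric_kernel :: "'z measure \<Rightarrow> nat \<Rightarrow> ((nat \<Rightarrow> 'z) \<Rightarrow> real) \<Rightarrow> bool" where
  "symmetric_kernel \<mu> n f \<longleftrightarrow>
     (\<forall>x\<in>space (power_measure \<mu> n). \<forall>\<pi>. \<pi> permutes {..<n} \<longrightarrow> f (x \<circ> \<pi>) = f x)"

definition square_integrable :: "'a measure \<Rightarrow> ('a \<Rightarrow> real) \<Rightarrow> bool" where
  "square_integrable M f \<longleftrightarrow> f \<in> borel_measurable M \<and> integrable M (\<lambda>x. (f x)\<^sup>2)"

definition L2_norm :: "'a measure \<Rightarrow> ('a \<Rightarrow> real) \<Rightarrow> real" where
  "L2_norm M f = sqrt (\<integral>x. (f x)\<^sup>2 \<partial>M)"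

definition L2_tendsto :: "'a measure \<Rightarrow> (nat \<Rightarrow> 'a \<Rightarrow> real) \<Rightarrow> ('a \<Rightarrow> real) \<Rightarrow> bool" where
  "L2_tendsto M s f \<longleftrightarrow> (\<lambda>m. \<integral>\<^sup>+x. ennreal ((s m x - f x)\<^sup>2) \<partial>M) \<longlonglongrightarrow> 0"


section \<open>Poisson and Gaussian measures\<close>

text \<open>A Poisson measure is a random point measure (almost surely a countable sum of Dirac masses).
  On a second countable locally compact Hausdorff space this is automatic; on an arbitrary one it
  has to be required, since for instance the Dieudonne measure on the first uncountable ordinal is
  \<open>{0,1}\<close>-valued without being a Dirac mass.\<close>

definition poisson_measure :: "'w measure \<Rightarrow> 'z measure \<Rightarrow> ('w \<Rightarrow> 'z measure) \<Rightarrow> bool" where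
  "poisson_measure P \<mu> \<eta> \<longleftrightarrow>
     prob_space P \<and>
     (\<forall>\<omega>\<in>space P. sets (\<eta> \<omega>) = sets \<mu>) \<and>
     (AE \<omega> in P. \<exists>(I :: nat set) z. z \<in> I \<rightarrow> space \<mu> \<and> \<eta> \<omega> = distr (count_space I) \<mu> z) \<and>
     (\<forall>B\<in>sets \<mu>. (\<lambda>\<omega>. emeasure (\<eta> \<omega>) B) \<in> borel_measurable P) \<and>
     (\<forall>B\<in>sets \<mu>. emeasure \<mu> B < \<infinity> \<longrightarrow>
        (\<forall>n. measure P {\<omega> \<in> space P. emeasure (\<eta> \<omega>) B = of_nat n} =
             exp (- measure \<mu> B) * measure \<mu> B ^ n / fact n)) \<and>
     (\<forall>(J :: nat set) B. finite J \<longrightarrow> disjoint_family_on B J \<longrightarrow>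
        (\<forall>j\<in>J. B j \<in> sets \<mu> \<and> emeasure \<mu> (B j) < \<infinity>) \<longrightarrow>
        prob_space.indep_vars P (\<lambda>_. borel) (\<lambda>j \<omega>. emeasure (\<eta> \<omega>) (B j)) J)"

definition compensated ::
  "'z measure \<Rightarrow> ('w \<Rightarrow> 'z measure) \<Rightarrow> 'z set \<Rightarrow> 'w \<Rightarrow> real" where
  "compensated \<mu> \<eta> B \<omega> = measure (\<eta> \<omega>) B - measure \<mu> B"

text \<open>For a point measure the support is the set of its atoms.\<close>

definition support_points :: "'z measure \<Rightarrow> 'z set" where
  "support_points N = {z \<in> space N. emeasure N {z} \<noteq> 0}"

definition distinct_tuples :: "nat \<Rightarrow> 'z set \<Rightarrow> (nat \<Rightarrow> 'z) set" where
  "distinct_tuples k S = {x \<in> {..<k} \<rightarrow>\<^sub>E S. inj_on x {..<k}}"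

definition U_statistic ::
  "nat \<Rightarrow> ((nat \<Rightarrow> 'z) \<Rightarrow> real) \<Rightarrow> ('w \<Rightarrow> 'z measure) \<Rightarrow> 'w \<Rightarrow> real" where
  "U_statistic k h \<eta> \<omega> = (\<Sum>\<^sub>\<infinity>x\<in>distinct_tuples k (support_points (\<eta> \<omega>)). h x)"

text \<open>The degenerate law, standard deviation \<open>0\<close>, is included.\<close>

definition centered_gaussian :: "'w measure \<Rightarrow> ('w \<Rightarrow> real) \<Rightarrow> bool" where
  "centered_gaussian P Y \<longleftrightarrow>
     Y \<in> borel_measurable P \<and>
     ((AE \<omega> in P. Y \<omega> = 0) \<or> (\<exists>\<sigma>>0. distributed P lborel Y (normal_density 0 \<sigma>)))"

definition gaussian_measure ::
  "'w measure \<Rightarrow> 'z measure \<Rightarrow> ('z set \<Rightarrow> 'w \<Rightarrow> real) \<Rightarrow> bool" where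
  "gaussian_measure P \<mu> G \<longleftrightarrow>
     prob_space P \<and>
     (\<forall>\<B> a. finite \<B> \<longrightarrow> (\<forall>B\<in>\<B>. B \<in> sets \<mu> \<and> emeasure \<mu> B < \<infinity>) \<longrightarrow>
        centered_gaussian P (\<lambda>\<omega>. \<Sum>B\<in>\<B>. a B * G B \<omega>)) \<and>
     (\<forall>B\<in>sets \<mu>. \<forall>C\<in>sets \<mu>. emeasure \<mu> B < \<infinity> \<longrightarrow> emeasure \<mu> C < \<infinity> \<longrightarrow>
        (\<integral>\<omega>. G B \<omega> * G C \<omega> \<partial>P) = measure \<mu> (B \<inter> C))"


section \<open>Multiple Wiener-Ito integrals\<close>

text \<open>The integral of order \<open>q\<close> with respect to a random measure \<open>W\<close> (a compensated Poisson or a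
  Gaussian measure) with control \<open>\<mu>\<close> is the \<open>L\<^sup>2\<close>-continuous extension of
  \<open>\<Sum>\<phi>. a \<phi> * 1(A (\<phi> 0) \<times> \<dots> \<times> A (\<phi> (q - 1)))  \<mapsto>  \<Sum>\<phi>. a \<phi> * W (A (\<phi> 0)) * \<dots> * W (A (\<phi> (q - 1)))\<close>,
  where the \<open>A i\<close> are pairwise disjoint of finite measure and only injective \<open>\<phi>\<close> occur, so that the
  kernel vanishes on the diagonals. It is determined up to almost sure equality.\<close>

definition injective_indices :: "nat \<Rightarrow> nat \<Rightarrow> (nat \<Rightarrow> nat) set" where
  "injective_indices q N = {\<phi> \<in> {..<q} \<rightarrow>\<^sub>E {..<N}. inj_on \<phi> {..<q}}"

definition simple_kernel ::
  "nat \<Rightarrow> nat \<Rightarrow> (nat \<Rightarrow> 'z set) \<Rightarrow> ((nat \<Rightarrow> nat) \<Rightarrow> real) \<Rightarrow> (nat \<Rightarrow> 'z) \<Rightarrow> real" where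
  "simple_kernel q N A a x =
     (\<Sum>\<phi>\<in>injective_indices q N. a \<phi> * (\<Prod>j<q. indicator (A (\<phi> j)) (x j)))"

definition simple_integral ::
  "('z set \<Rightarrow> 'w \<Rightarrow> real) \<Rightarrow> nat \<Rightarrow> nat \<Rightarrow> (nat \<Rightarrow> 'z set) \<Rightarrow> ((nat \<Rightarrow> nat) \<Rightarrow> real) \<Rightarrow> 'w \<Rightarrow> real"
  where
  "simple_integral W q N A a \<omega> =
     (\<Sum>\<phi>\<in>injective_indices q N. a \<phi> * (\<Prod>j<q. W (A (\<phi> j)) \<omega>))"

definition is_multiple_integral ::
  "'w measure \<Rightarrow> 'z measure \<Rightarrow> ('z set \<Rightarrow> 'w \<Rightarrow> real) \<Rightarrow> nat \<Rightarrow>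
     ((nat \<Rightarrow> 'z) \<Rightarrow> real) \<Rightarrow> ('w \<Rightarrow> real) \<Rightarrow> bool" where
  "is_multiple_integral P \<mu> W q f Y \<longleftrightarrow>
     square_integrable P Y \<and>
     (\<exists>N A a.
        (\<forall>m. disjoint_family_on (A m) {..<N m} \<and>
             (\<forall>i<N m. A m i \<in> sets \<mu> \<and> emeasure \<mu> (A m i) < \<infinity>)) \<and>
        L2_tendsto (power_measure \<mu> q) (\<lambda>m. simple_kernel q (N m) (A m) (a m)) f \<and>
        L2_tendsto P (\<lambda>m. simple_integral W q (N m) (A m) (a m)) Y)"

definition multiple_integral ::
  "'w measure \<Rightarrow> 'z measure \<Rightarrow> ('z set \<Rightarrow> 'w \<Rightarrow> real) \<Rightarrow> nat \<Rightarrow>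
     ((nat \<Rightarrow> 'z) \<Rightarrow> real) \<Rightarrow> 'w \<Rightarrow> real" where
  "multiple_integral P \<mu> W q f = (SOME Y. is_multiple_integral P \<mu> W q f Y)"

definition projected_kernel ::
  "'z measure \<Rightarrow> nat \<Rightarrow> ((nat \<Rightarrow> 'z) \<Rightarrow> real) \<Rightarrow> nat \<Rightarrow> (nat \<Rightarrow> 'z) \<Rightarrow> real" where
  "projected_kernel \<mu> k h i x =
     real (k choose i) * (\<integral>y. h (append_tuple i (k - i) x y) \<partial>power_measure \<mu> (k - i))"


section \<open>Contractions and the technical assumption\<close>

text \<open>A point \<open>w\<close> of \<open>Z\<^sup>p\<^sup>+\<^sup>q\<^sup>-\<^sup>r\<^sup>-\<^sup>l\<close> consists of three consecutive blocks: \<open>x\<close> of length \<open>p - r\<close>,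
  \<open>x'\<close> of length \<open>q - r\<close> and \<open>y\<close> of length \<open>r - l\<close>. The block \<open>(x, y)\<close> is read off by skipping \<open>x'\<close>,
  while \<open>(x', y)\<close> is contiguous.\<close>

definition contraction_integrand ::
  "nat \<Rightarrow> nat \<Rightarrow> nat \<Rightarrow> nat \<Rightarrow> ((nat \<Rightarrow> 'z) \<Rightarrow> real) \<Rightarrow> ((nat \<Rightarrow> 'z) \<Rightarrow> real) \<Rightarrow>
     (nat \<Rightarrow> 'z) \<Rightarrow> (nat \<Rightarrow> 'z) \<Rightarrow> real" where
  "contraction_integrand p q r l u v w z =
     u (append_tuple (p - l) l (\<lambda>i. if i < p - r then w i else w (i + (q - r))) z) *
     v (append_tuple (q - l) l (\<lambda>i. w (p - r + i)) z)"

definition contraction ::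
  "'z measure \<Rightarrow> nat \<Rightarrow> nat \<Rightarrow> nat \<Rightarrow> nat \<Rightarrow> ((nat \<Rightarrow> 'z) \<Rightarrow> real) \<Rightarrow> ((nat \<Rightarrow> 'z) \<Rightarrow> real) \<Rightarrow>
     (nat \<Rightarrow> 'z) \<Rightarrow> real" where
  "contraction \<mu> p q r l u v w =
     (\<integral>z. contraction_integrand p q r l u v w z \<partial>power_measure \<mu> l)"

definition section_at ::
  "nat \<Rightarrow> ((nat \<Rightarrow> 'z) \<Rightarrow> real) \<Rightarrow> 'z \<Rightarrow> (nat \<Rightarrow> 'z) \<Rightarrow> real" where
  "section_at i f z x = f (append_tuple 1 (i - 1) (\<lambda>_. z) x)"

definition ennreal_sqrt :: "ennreal \<Rightarrow> ennreal" where
  "ennreal_sqrt x = (if x = \<infinity> then \<infinity> else ennreal (sqrt (enn2real x)))"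

text \<open>By the second clause (and, where a kernel of order \<open>1\<close> occurs, because then \<open>l = 0\<close>) the
  integrals defining the contractions in the third one converge. In the first clause they converge
  almost everywhere, the kernels being square integrable.\<close>

definition assumption_T ::
  "'z measure \<Rightarrow> nat \<Rightarrow> (nat \<Rightarrow> (nat \<Rightarrow> 'z) \<Rightarrow> real) \<Rightarrow> bool" where
  "assumption_T \<mu> k f \<longleftrightarrow>
     (\<forall>i\<in>{1..k}. \<forall>r\<in>{1..i}.
        square_integrable (power_measure \<mu> r) (contraction \<mu> i i i (i - r) (f i) (f i))) \<and>
     (\<forall>i\<in>{2..k}. \<forall>l r. 1 \<le> l \<longrightarrow> l \<le> r \<longrightarrow> r \<le> i \<longrightarrow>
        (\<forall>w\<in>space (power_measure \<mu> (i + i - r - l)).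
           integrable (power_measure \<mu> l)
             (contraction_integrand i i r l (\<lambda>x. \<bar>f i x\<bar>) (\<lambda>x. \<bar>f i x\<bar>) w))) \<and>
     (\<forall>i\<in>{1..k}. \<forall>j\<in>{1..k}. max i j > 1 \<longrightarrow>
        (\<forall>n\<in>{max (max i j - min i j) 1..i + j - 2}. \<forall>l r.
           l \<le> r \<longrightarrow> r \<le> min i j - 1 \<longrightarrow> n = i + j - 2 - r - l \<longrightarrow>
           (\<integral>\<^sup>+z. ennreal_sqrt
               (\<integral>\<^sup>+w. ennreal ((contraction \<mu> (i - 1) (j - 1) r l
                                (section_at i (f i) z) (section_at j (f j) z) w)\<^sup>2)
                  \<partial>power_measure \<mu> n) \<partial>\<mu>) < \<infinity>))"


section \<open>Convergence in law and Wasserstein distance\<close>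

text \<open>\<open>weak_conv_m\<close> for a filter in place of a sequence.\<close>

definition weak_conv_along :: "('i \<Rightarrow> real measure) \<Rightarrow> real measure \<Rightarrow> 'i filter \<Rightarrow> bool" where
  "weak_conv_along Ms M \<F> \<longleftrightarrow>
     (\<forall>x. isCont (cdf M) x \<longrightarrow> ((\<lambda>i. cdf (Ms i) x) \<longlongrightarrow> cdf M x) \<F>)"

text \<open>Meant for laws with finite first moment, for which every Lipschitz function is integrable.\<close>

definition wasserstein_dist :: "real measure \<Rightarrow> real measure \<Rightarrow> ennreal" where
  "wasserstein_dist M N =
     (SUP g\<in>{g :: real \<Rightarrow> real. 1-lipschitz_on UNIV g}. ennreal \<bar>(\<integral>x. g x \<partial>M) - (\<integral>x. g x \<partial>N)\<bar>)"

end

theory Submission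
  imports Defs "HOL-Real_Asymp.Real_Asymp"
begin

text \<open>The kernels \<open>h\<close>, \<open>h\<^sub>i\<close> are approximated in \<open>L\<^sup>2\<close> by off-diagonal simple kernels, on which everything is a
  polynomial in the masses of disjoint sets; expanding \<open>\<eta> = (\<eta> - t\<mu>) + t\<mu>\<close> in such a polynomial gives the
  chaos decomposition of \<open>F\<close>. By orthogonality \<open>Var F\<close> is the sum over \<open>i\<close> of \<open>i! \<parallel>h\<^sub>i\<parallel>\<^sup>2 t\<^bsup>2k-i\<^esup>\<close>, so the chaos
  of order \<open>q\<^sub>1\<close> dominates. If \<open>q\<^sub>1 = 1\<close> it is a linear functional, to which Stein's method and the Chen--Stein
  identity apply with a bound in terms of \<open>\<integral>\<bar>h\<^sub>1\<bar>\<^sup>3\<close>; the other chaoses cost \<open>O(t\<^bsup>-1/2\<^esup>)\<close> in \<open>L\<^sup>2\<close>. If \<open>q\<^sub>1 \<ge> 2\<close>,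
  rescaled Poisson masses of disjoint sets converge jointly to Gaussian ones, hence the integrals of simple
  kernels converge, and the isometry passes to \<open>h\<close> uniformly in \<open>t\<close>. The last limit does not depend on
  the Gaussian measure used to write it, which gives the equality of the two limit laws; here \<open>\<mu>(Z)\<^bsup>1/2\<^esup>\<close> times a
  Gaussian measure with control \<open>\<mu>/\<mu>(Z)\<close> is one with control \<open>\<mu>\<close>.\<close>

text \<open>\<open>M\<close> need not be second countable, so the diagonals of the powers of
  \<open>Z\<close> may fail to be measurable, and the number of tuples of atoms in a measurable set
  is not assumed to be a random variable. Hence tuples are approximated from inside by those whose
  points lie in different cells of a partition, measurable sets are reached up to null sets, and a
  count of tuples is only required to agree almost surely with an integrable function of the right
  mean. One sequence of symmetric simple kernels for \<open>h\<close> yields, by integrating out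
  variables, sequences for all \<open>h_i\<close> on the same disjoint sets; projection is
  continuous in L2 because the total mass is finite. Passing from intensity 1 to \<open>t\<close>
  multiplies squared norms on \<open>Z^i\<close> by \<open>t^i\<close> and the kernel by
  \<open>t^(k-i)\<close>. With \<open>c = t^(q/2-k)\<close> one has
  \<open>c^2 t^(2k-i) = t^(q-i)\<close>, so the error of approximating \<open>h_q\<close> is
  independent of \<open>t\<close>, while the orders above \<open>q\<close> gain a factor
  \<open>1/t\<close>. Order 0 disappears when \<open>h_1\<close> vanishes, since the integral of
  \<open>h\<close> is that of \<open>h_1\<close> divided by \<open>k\<close>; hence no centring for
  \<open>q1 >= 2\<close>.\<close>

abbreviation pow :: "'z measure \<Rightarrow> nat \<Rightarrow> (nat \<Rightarrow> 'z) measure" where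
  "pow M n \<equiv> power_measure M n"

section \<open>Off-diagonal sums\<close>

text \<open>Common form of simple kernels (\<open>Y j r\<close> an indicator at the j-th coordinate)
  and simple integrals (\<open>Y j r\<close> the mass of the r-th set, whatever \<open>j\<close>),
  so that refinement, linearity and expansion are proved once for both.\<close>

definition off_diagonal_sum ::
  "nat \<Rightarrow> nat \<Rightarrow> ((nat \<Rightarrow> nat) \<Rightarrow> real) \<Rightarrow> (nat \<Rightarrow> nat \<Rightarrow> real) \<Rightarrow> real" where
  "off_diagonal_sum q N a Y = (\<Sum>f\<in>injective_indices q N. a f * (\<Prod>j<q. Y j (f j)))"

lemma simple_kernel_off_diagonal_sum:
  "simple_kernel q N A a x = off_diagonal_sum q N a (\<lambda>j r. indicator (A r) (x j))"
  by (simp add: simple_kernel_def off_diagonal_sum_def)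

lemma simple_integral_off_diagonal_sum:
  "simple_integral W q N A a w = off_diagonal_sum q N a (\<lambda>j r. W (A r) w)"
  by (simp add: simple_integral_def off_diagonal_sum_def)

lemma finite_injective_indices [simp]: "finite (injective_indices q N)"
  unfolding injective_indices_def
  by (rule finite_subset[of _ "{..<q} \<rightarrow>\<^sub>E {..<N}"]) (auto intro: finite_PiE)

lemma injective_indices_less: "f \<in> injective_indices q N \<Longrightarrow> j < q \<Longrightarrow> f j < N"
  by (auto simp: injective_indices_def)

lemma injective_indices_comp_permutes:
  assumes "f \<in> injective_indices q N" "p permutes {..<q}"
  shows "f \<circ> p \<in> injective_indices q N"
proof -
  have "inj_on (f \<circ> p) {..<q}"
    using assms permutes_image[OF assms(2)] permutes_inj_on[OF assms(2)]
    by (intro comp_inj_on) (auto simp: injective_indices_def)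
  moreover have "f \<circ> p \<in> {..<q} \<rightarrow>\<^sub>E {..<N}"
    using assms permutes_in_image[OF assms(2)] permutes_not_in[OF assms(2)]
    by (auto simp: injective_indices_def PiE_iff extensional_def)
  ultimately show ?thesis by (auto simp: injective_indices_def)
qed

lemma sum_injective_indices_permute:
  assumes "s permutes {..<q}"
  shows "(\<Sum>p\<in>injective_indices q N. f (p \<circ> s)) = (\<Sum>p\<in>injective_indices q N. f p)"
proof (rule sum.reindex_bij_witness[of _ "\<lambda>p. p \<circ> inv s" "\<lambda>p. p \<circ> s"])
  have 1: "inv s \<circ> s = id" "s \<circ> inv s = id"
    using permutes_inv_o[OF assms] by auto
  show "p \<circ> inv s \<circ> s = p" "p \<circ> s \<circ> inv s = p" for p :: "nat \<Rightarrow> nat"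
    by (simp_all add: o_assoc[symmetric] 1)
qed (auto intro!: injective_indices_comp_permutes assms permutes_inv[OF assms])

lemma prod_comp_permutes:
  fixes f :: "nat \<Rightarrow> 'a :: comm_monoid_mult"
  assumes "p permutes {..<q}"
  shows "(\<Prod>j<q. f (p j)) = (\<Prod>j<q. f j)"
  using prod.permute[OF assms, of f] by (simp add: comp_def)

text \<open>Coefficients after the i-th set has been cut into the pieces \<open>r\<close> with label
  \<open>i\<close>. An index tuple that uses two pieces of one set, or a piece of no set, gets
  coefficient 0; otherwise the refined sum would contain products absent from the original
  one.\<close>

definition refined_coeff ::
  "nat \<Rightarrow> nat \<Rightarrow> (nat \<Rightarrow> nat) \<Rightarrow> ((nat \<Rightarrow> nat) \<Rightarrow> real) \<Rightarrow> (nat \<Rightarrow> nat) \<Rightarrow> real" where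
  "refined_coeff q N r a f =
     (if restrict (r \<circ> f) {..<q} \<in> injective_indices q N then a (restrict (r \<circ> f) {..<q}) else 0)"

text \<open>Distributing the product over the sums gives one term for each pair of an index
  \<open>v\<close> and a choice \<open>u\<close> of pieces. Then \<open>v\<close> is recovered as
  the label of \<open>u\<close>, and \<open>u\<close> is injective because its labels are.\<close>

lemma off_diagonal_sum_refine:
  assumes Y: "\<And>j i. j < q \<Longrightarrow> i < N \<Longrightarrow> Y j i = (\<Sum>r | r < K \<and> s r = i. Y' j r)"
  shows "off_diagonal_sum q N a Y = off_diagonal_sum q K (refined_coeff q N s a) Y'"
proof -
  let ?I = "injective_indices q" and ?R = "\<lambda>u. restrict (s \<circ> u) {..<q}"
  let ?F = "\<lambda>v. PiE {..<q} (\<lambda>j. {r. r < K \<and> s r = v j})"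
  have "off_diagonal_sum q N a Y = (\<Sum>v\<in>?I N. a v * (\<Prod>j<q. \<Sum>r | r < K \<and> s r = v j. Y' j r))"
    unfolding off_diagonal_sum_def
    by (intro sum.cong refl arg_cong2[where f = "(*)"] prod.cong Y) (auto dest: injective_indices_less)
  also have "\<dots> = (\<Sum>v\<in>?I N. \<Sum>u\<in>?F v. a v * (\<Prod>j<q. Y' j (u j)))"
    by (simp add: prod_sum_PiE sum_distrib_left)
  also have "\<dots> = (\<Sum>(v, u)\<in>Sigma (?I N) ?F. a v * (\<Prod>j<q. Y' j (u j)))"
    by (rule sum.Sigma) (auto intro: finite_PiE)
  also have "\<dots> = (\<Sum>u\<in>{u\<in>?I K. ?R u \<in> ?I N}. a (?R u) * (\<Prod>j<q. Y' j (u j)))"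
  proof (rule sum.reindex_bij_witness[of _ "\<lambda>u. (?R u, u)" snd])
    fix p assume p: "p \<in> Sigma (?I N) ?F"
    obtain v u where [simp]: "p = (v, u)" by force
    have v: "v \<in> ?I N" and u: "u \<in> ?F v" using p by auto
    have R: "?R u = v" using v u
      by (intro ext) (auto simp: injective_indices_def PiE_iff extensional_def restrict_def)
    have "inj_on u {..<q}"
    proof (rule inj_onI)
      fix i j assume ij: "i \<in> {..<q}" "j \<in> {..<q}" "u i = u j"
      then have "v i = v j" using u by (auto simp: PiE_iff) (metis lessThan_iff)
      then show "i = j" using v ij by (auto simp: injective_indices_def inj_on_def)
    qed
    then have "u \<in> ?I K" using u by (auto simp: injective_indices_def PiE_iff)
    then show "(?R (snd p), snd p) = p" "snd p \<in> {u\<in>?I K. ?R u \<in> ?I N}"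
      "a (?R (snd p)) * (\<Prod>j<q. Y' j (snd p j)) = (case p of (v, u) \<Rightarrow> a v * (\<Prod>j<q. Y' j (u j)))"
      using R v by auto
  next
    fix u assume "u \<in> {u\<in>?I K. ?R u \<in> ?I N}"
    then show "(?R u, u) \<in> Sigma (?I N) ?F" by (auto simp: injective_indices_def PiE_iff)
  qed simp
  also have "\<dots> = off_diagonal_sum q K (refined_coeff q N s a) Y'"
    unfolding off_diagonal_sum_def refined_coeff_def
    by (rule sum.mono_neutral_cong_left) auto
  finally show ?thesis .
qed

definition symmetric_coeff :: "nat \<Rightarrow> nat \<Rightarrow> ((nat \<Rightarrow> nat) \<Rightarrow> real) \<Rightarrow> bool" where
  "symmetric_coeff q N a \<longleftrightarrow>
     (\<forall>f\<in>injective_indices q N. \<forall>p. p permutes {..<q} \<longrightarrow> a (f \<circ> p) = a f)"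

definition symmetrized_coeff :: "nat \<Rightarrow> ((nat \<Rightarrow> nat) \<Rightarrow> real) \<Rightarrow> (nat \<Rightarrow> nat) \<Rightarrow> real" where
  "symmetrized_coeff q a f = (\<Sum>p | p permutes {..<q}. a (f \<circ> p)) / fact q"

lemma symmetric_symmetrized_coeff: "symmetric_coeff q N (symmetrized_coeff q a)"
  unfolding symmetric_coeff_def symmetrized_coeff_def
proof (intro ballI allI impI arg_cong2[where f = "(/)"] refl)
  fix p u :: "nat \<Rightarrow> nat" assume u: "u permutes {..<q}"
  have "(\<Sum>s | s permutes {..<q}. a (p \<circ> s)) = (\<Sum>s | s permutes {..<q}. a (p \<circ> (u \<circ> s)))"
    by (rule setum_permutations_compose_left[OF u])
  then show "(\<Sum>s | s permutes {..<q}. a (p \<circ> u \<circ> s)) = (\<Sum>s | s permutes {..<q}. a (p \<circ> s))"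
    by (simp add: o_assoc)
qed

lemma simple_kernel_permute:
  assumes s: "s permutes {..<q}"
  shows "simple_kernel q N A a (x \<circ> inv s) = simple_kernel q N A (\<lambda>p. a (p \<circ> inv s)) x"
proof -
  let ?f = "\<lambda>p. a p * (\<Prod>j<q. indicator (A (p j)) ((x \<circ> inv s) j))"
  have "simple_kernel q N A a (x \<circ> inv s) = (\<Sum>p\<in>injective_indices q N. ?f (p \<circ> inv s))"
    unfolding simple_kernel_def by (rule sum_injective_indices_permute[symmetric, OF permutes_inv[OF s]])
  also have "\<dots> = simple_kernel q N A (\<lambda>p. a (p \<circ> inv s)) x"
    unfolding simple_kernel_def
  proof (intro sum.cong refl)
    fix p :: "nat \<Rightarrow> nat"
    have "(\<Prod>j<q. indicat_real (A ((p \<circ> inv s) j)) ((x \<circ> inv s) j)) = (\<Prod>j<q. indicator (A (p j)) (x j))"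
      using prod_comp_permutes[OF permutes_inv[OF s], of "\<lambda>j. indicat_real (A (p j)) (x j)"] by simp
    then show "?f (p \<circ> inv s) = a (p \<circ> inv s) * (\<Prod>j<q. indicator (A (p j)) (x j))" by simp
  qed
  finally show ?thesis .
qed

text \<open>Density yields approximants of a symmetric kernel that need not be symmetric themselves.
  Averaging their coefficients is averaging the kernels over permuted arguments, which keeps the
  limit.\<close>

lemma simple_kernel_symmetrized:
  "simple_kernel q N A (symmetrized_coeff q a) x =
     (\<Sum>s | s permutes {..<q}. simple_kernel q N A a (x \<circ> s)) / fact q"
proof -
  have "simple_kernel q N A (symmetrized_coeff q a) x =
     (\<Sum>s | s permutes {..<q}. simple_kernel q N A (\<lambda>p. a (p \<circ> s)) x) / fact q"
    unfolding simple_kernel_def symmetrized_coeff_def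
    by (subst sum.swap) (simp add: sum_distrib_left sum_distrib_right sum_divide_distrib mult_ac)
  also have "\<dots> = (\<Sum>s | s permutes {..<q}. simple_kernel q N A a (x \<circ> s)) / fact q"
  proof (intro arg_cong2[where f = "(/)"] refl sum.cong)
    fix s assume "s \<in> {s. s permutes {..<q}}"
    then have s: "s permutes {..<q}" by simp
    show "simple_kernel q N A (\<lambda>p. a (p \<circ> s)) x = simple_kernel q N A a (x \<circ> s)"
      using simple_kernel_permute[OF permutes_inv[OF s], of N A a x] permutes_inv_inv[OF s] by simp
  qed
  finally show ?thesis .
qed

text \<open>With \<open>m\<close> the masses of the sets, these are the coefficients of the
  projection of a simple kernel. The same coefficients come out when a sum \<open>u + m\<close> is
  expanded, and this coincidence is what produces the chaos decomposition.\<close>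

definition projected_coeff ::
  "nat \<Rightarrow> nat \<Rightarrow> (nat \<Rightarrow> real) \<Rightarrow> ((nat \<Rightarrow> nat) \<Rightarrow> real) \<Rightarrow> nat \<Rightarrow> (nat \<Rightarrow> nat) \<Rightarrow> real" where
  "projected_coeff k N m a i g =
     real (k choose i) * (\<Sum>f | f \<in> injective_indices k N \<and> restrict f {..<i} = g.
        a f * (\<Prod>j\<in>{i..<k}. m (f j)))"

lemma restrict_injective_indices:
  "f \<in> injective_indices k N \<Longrightarrow> i \<le> k \<Longrightarrow> restrict f {..<i} \<in> injective_indices i N"
  by (auto simp: injective_indices_def PiE_iff inj_on_def)

lemma off_diagonal_sum_projected:
  assumes "i \<le> k"
  shows "off_diagonal_sum i N (projected_coeff k N m a i) Y =
    real (k choose i) * (\<Sum>f\<in>injective_indices k N. a f * (\<Prod>j<i. Y j (f j)) * (\<Prod>j\<in>{i..<k}. m (f j)))"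
proof -
  have "off_diagonal_sum i N (projected_coeff k N m a i) Y =
     real (k choose i) * (\<Sum>g\<in>injective_indices i N. \<Sum>f | f \<in> injective_indices k N \<and> restrict f {..<i} = g.
        a f * (\<Prod>j<i. Y j (f j)) * (\<Prod>j\<in>{i..<k}. m (f j)))"
    unfolding off_diagonal_sum_def projected_coeff_def sum_distrib_left sum_distrib_right
  proof (intro sum.cong refl, clarify)
    fix f assume "f \<in> injective_indices k N"
    have "(\<Prod>j<i. Y j (restrict f {..<i} j)) = (\<Prod>j<i. Y j (f j))" by (intro prod.cong) auto
    then show "real (k choose i) * (a f * (\<Prod>j = i..<k. m (f j))) * (\<Prod>j<i. Y j (restrict f {..<i} j)) =
      real (k choose i) * (a f * (\<Prod>j<i. Y j (f j)) * (\<Prod>j = i..<k. m (f j)))" by simp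
  qed
  also have "(\<Sum>g\<in>injective_indices i N. \<Sum>f | f \<in> injective_indices k N \<and> restrict f {..<i} = g.
        a f * (\<Prod>j<i. Y j (f j)) * (\<Prod>j\<in>{i..<k}. m (f j))) =
     (\<Sum>f\<in>injective_indices k N. a f * (\<Prod>j<i. Y j (f j)) * (\<Prod>j\<in>{i..<k}. m (f j)))"
    by (rule sum.group) (auto intro: restrict_injective_indices assms)
  finally show ?thesis .
qed

lemma ex_permutes_image_lessThan:
  assumes "S \<subseteq> {..<k}" "card S = i"
  obtains p where "p permutes {..<k}" "p ` {..<i} = S"
proof -
  have fS: "finite S" using assms(1) finite_subset by blast
  have ik: "i \<le> k" using card_mono[OF _ assms(1)] assms(2) by simp
  obtain f where f: "bij_betw f {..<i} S"
    using finite_same_card_bij[of "{..<i}" S] fS assms(2) by auto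
  have "card ({..<k} - {..<i}) = card ({..<k} - S)"
    using card_Diff_subset[of S "{..<k}"] card_Diff_subset[of "{..<i}" "{..<k}"] fS assms ik by simp
  then obtain g where g: "bij_betw g ({..<k} - {..<i}) ({..<k} - S)"
    using finite_same_card_bij[of "{..<k} - {..<i}" "{..<k} - S"] by auto
  define p where "p j = (if j < i then f j else if j < k then g j else j)" for j
  have 1: "bij_betw p {..<i} S" using f by (subst bij_betw_cong[of _ _ f]) (auto simp: p_def)
  have 2: "bij_betw p ({..<k} - {..<i}) ({..<k} - S)"
    using g by (subst bij_betw_cong[of _ _ g]) (auto simp: p_def)
  have "bij_betw p ({..<i} \<union> ({..<k} - {..<i})) (S \<union> ({..<k} - S))"
    by (rule bij_betw_combine[OF 1 2]) auto
  moreover have "{..<i} \<union> ({..<k} - {..<i}) = {..<k}" "S \<union> ({..<k} - S) = {..<k}" using ik assms by auto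
  ultimately have "bij_betw p {..<k} {..<k}" by simp
  then have "p permutes {..<k}" by (rule bij_imp_permutes) (use ik in \<open>auto simp: p_def\<close>)
  with 1 show ?thesis using that by (auto simp: bij_betw_def)
qed

text \<open>Expanding the product over subsets \<open>S\<close> of the coordinates, symmetry makes all subsets of the
  same cardinality contribute equally.\<close>

lemma off_diagonal_sum_add:
  assumes sym: "symmetric_coeff k N a"
  shows "off_diagonal_sum k N a (\<lambda>j r. u r + m r) =
     (\<Sum>i\<le>k. off_diagonal_sum i N (projected_coeff k N m a i) (\<lambda>j. u))"
proof -
  \<comment> \<open>\<open>T S\<close> is the part of the expansion in which the coordinates in
    \<open>S\<close> carry \<open>u\<close> and the others carry \<open>m\<close>.\<close>
  define T where "T S = (\<Sum>p\<in>injective_indices k N. a p * (\<Prod>j\<in>S. u (p j)) * (\<Prod>j\<in>{..<k} - S. m (p j)))" for S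
  have T: "T S = T {..<i}" if S: "S \<subseteq> {..<k}" "card S = i" for S i
  proof -
    obtain s where s: "s permutes {..<k}" "s ` {..<i} = S" using ex_permutes_image_lessThan[OF S] .
    have inj: "inj s" using s(1) permutes_inj by blast
    have im: "s ` ({..<k} - {..<i}) = {..<k} - S"
      using s(2) permutes_image[OF s(1)] by (simp only: image_set_diff[OF inj])
    let ?f = "\<lambda>p. a p * (\<Prod>j<i. u (p j)) * (\<Prod>j\<in>{..<k} - {..<i}. m (p j))"
    have "T {..<i} = (\<Sum>p\<in>injective_indices k N. ?f (p \<circ> s))"
      unfolding T_def by (rule sum_injective_indices_permute[symmetric, OF s(1)])
    also have "\<dots> = T S" unfolding T_def
    proof (intro sum.cong refl arg_cong2[where f = "(*)"])
      fix p assume p: "p \<in> injective_indices k N"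
      show "a (p \<circ> s) = a p" using sym s p by (auto simp: symmetric_coeff_def)
      show "(\<Prod>j<i. u ((p \<circ> s) j)) = (\<Prod>j\<in>S. u (p j))"
        unfolding s(2)[symmetric] by (subst prod.reindex) (use inj in \<open>auto intro: inj_on_subset\<close>)
      show "(\<Prod>j\<in>{..<k} - {..<i}. m ((p \<circ> s) j)) = (\<Prod>j\<in>{..<k} - S. m (p j))"
        unfolding im[symmetric] by (subst prod.reindex) (use inj in \<open>auto intro: inj_on_subset\<close>)
    qed
    finally show ?thesis ..
  qed
  have "off_diagonal_sum k N a (\<lambda>j r. u r + m r) = (\<Sum>S\<in>Pow {..<k}. T S)"
    unfolding off_diagonal_sum_def T_def
    by (subst sum.swap) (simp add: prod_add sum_distrib_left mult_ac)
  also have "\<dots> = (\<Sum>i\<le>k. \<Sum>S | S \<in> Pow {..<k} \<and> card S = i. T S)"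
    by (rule sum.group[symmetric]) (auto dest: card_mono[rotated])
  also have "\<dots> = (\<Sum>i\<le>k. real (k choose i) * T {..<i})"
  proof (intro sum.cong refl)
    fix i assume "i \<in> {..k}"
    have "(\<Sum>S | S \<in> Pow {..<k} \<and> card S = i. T S) = (\<Sum>S | S \<subseteq> {..<k} \<and> card S = i. T {..<i})"
      using T by (intro sum.cong) auto
    then show "(\<Sum>S | S \<in> Pow {..<k} \<and> card S = i. T S) = real (k choose i) * T {..<i}"
      using n_subsets[of "{..<k}" i] by simp
  qed
  also have "\<dots> = (\<Sum>i\<le>k. off_diagonal_sum i N (projected_coeff k N m a i) (\<lambda>j. u))"
  proof (intro sum.cong refl)
    fix i assume i: "i \<in> {..k}"
    have "{..<k} - {..<i} = {i..<k}" by auto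
    then show "real (k choose i) * T {..<i} = off_diagonal_sum i N (projected_coeff k N m a i) (\<lambda>j. u)"
      unfolding T_def using i by (subst off_diagonal_sum_projected) auto
  qed
  finally show ?thesis .
qed

text \<open>A permutation of the first \<open>i\<close> indices is one of all \<open>k\<close>
  indices that fixes the integrated coordinates, so composing with it maps the fibre of the
  restriction over \<open>g\<close> onto the fibre over the permuted index without changing the
  summand.\<close>

lemma symmetric_projected_coeff:
  assumes sym: "symmetric_coeff k N a" and i: "i \<le> k"
  shows "symmetric_coeff i N (projected_coeff k N m a i)"
  unfolding symmetric_coeff_def
proof (intro ballI allI impI)
  fix g p assume g: "g \<in> injective_indices i N" and p: "p permutes {..<i}"
  have p': "p permutes {..<k}" using permutes_subset[OF p] i by auto
  have inv: "inv p \<circ> p = id" "p \<circ> inv p = id" using permutes_inv_o[OF p] by auto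
  have r: "restrict (f \<circ> p) {..<i} = restrict f {..<i} \<circ> p" if "p permutes {..<i}" for f :: "nat \<Rightarrow> nat" and p
    using permutes_in_image[OF that] permutes_not_in[OF that] by (auto simp: fun_eq_iff restrict_def)
  have "(\<Sum>f | f \<in> injective_indices k N \<and> restrict f {..<i} = g \<circ> p. a f * (\<Prod>j\<in>{i..<k}. m (f j))) =
    (\<Sum>f | f \<in> injective_indices k N \<and> restrict f {..<i} = g. a f * (\<Prod>j\<in>{i..<k}. m (f j)))"
  proof (rule sum.reindex_bij_witness[of _ "\<lambda>f. f \<circ> p" "\<lambda>f. f \<circ> inv p"])
    fix f assume "f \<in> {f \<in> injective_indices k N. restrict f {..<i} = g \<circ> p}"
    then have f: "f \<in> injective_indices k N" "restrict f {..<i} = g \<circ> p" by auto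
    show "f \<circ> inv p \<circ> p = f" by (simp add: o_assoc[symmetric] inv)
    show "f \<circ> inv p \<in> {f \<in> injective_indices k N. restrict f {..<i} = g}"
      using f injective_indices_comp_permutes[OF f(1) permutes_inv[OF p']] r[OF permutes_inv[OF p], of f]
      by (simp add: o_assoc[symmetric] inv)
    have "(\<Prod>j\<in>{i..<k}. m ((f \<circ> inv p) j)) = (\<Prod>j\<in>{i..<k}. m (f j))"
      using permutes_not_in[OF permutes_inv[OF p]] by (intro prod.cong) auto
    moreover have "a (f \<circ> inv p) = a f"
      using sym f(1) permutes_inv[OF p'] by (auto simp: symmetric_coeff_def)
    ultimately show "a (f \<circ> inv p) * (\<Prod>j\<in>{i..<k}. m ((f \<circ> inv p) j)) = a f * (\<Prod>j\<in>{i..<k}. m (f j))" by simp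
  next
    fix f assume "f \<in> {f \<in> injective_indices k N. restrict f {..<i} = g}"
    then have f: "f \<in> injective_indices k N" "restrict f {..<i} = g" by auto
    show "f \<circ> p \<circ> inv p = f" by (simp add: o_assoc[symmetric] inv)
    show "f \<circ> p \<in> {f \<in> injective_indices k N. restrict f {..<i} = g \<circ> p}"
      using f injective_indices_comp_permutes[OF f(1) p'] r[OF p, of f] by simp
  qed
  then show "projected_coeff k N m a i (g \<circ> p) = projected_coeff k N m a i g"
    unfolding projected_coeff_def by simp
qed

text \<open>Two injective indices with the same image differ by exactly one permutation. In second
  moments only such pairs contribute, which is where the factorial in the isometry comes
  from.\<close>

lemma sum_injective_indices_same_image:
  assumes p: "p \<in> injective_indices q N"
  shows "(\<Sum>u | u \<in> injective_indices q N \<and> u ` {..<q} = p ` {..<q}. f u) =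
    (\<Sum>s | s permutes {..<q}. f (p \<circ> s))"
proof -
  have inj: "inj_on p {..<q}" and ext: "p \<in> extensional {..<q}"
    using p by (auto simp: injective_indices_def PiE_iff)
  let ?g = "\<lambda>u j. if j < q then the_inv_into {..<q} p (u j) else j"
  show ?thesis
  proof (rule sum.reindex_bij_witness[of _ "\<lambda>s. p \<circ> s" ?g])
    fix u assume "u \<in> {u \<in> injective_indices q N. u ` {..<q} = p ` {..<q}}"
    then have u: "inj_on u {..<q}" "u \<in> extensional {..<q}" "u ` {..<q} = p ` {..<q}"
      by (auto simp: injective_indices_def PiE_iff)
    have *: "p (the_inv_into {..<q} p (u j)) = u j" if "j < q" for j
      using that u(3) by (intro f_the_inv_into_f[OF inj]) auto
    show comp: "p \<circ> ?g u = u"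
      using * ext u(2) by (auto simp: fun_eq_iff extensional_def)
    have "bij_betw (?g u) {..<q} {..<q}"
      using bij_betw_trans[OF inj_on_imp_bij_betw[OF u(1), unfolded u(3)] bij_betw_the_inv_into[OF inj_on_imp_bij_betw[OF inj]]]
      by (subst bij_betw_cong[of _ _ "the_inv_into {..<q} p \<circ> u"]) auto
    then show "?g u \<in> {s. s permutes {..<q}}"
      by (intro CollectI bij_imp_permutes) auto
    show "f (p \<circ> ?g u) = f u" using comp by simp
  next
    fix s assume "s \<in> {s. s permutes {..<q}}"
    then have s: "s permutes {..<q}" by simp
    show "?g (p \<circ> s) = s"
      using permutes_in_image[OF s] permutes_not_in[OF s]
      by (auto simp: fun_eq_iff the_inv_into_f_f[OF inj])
    show "p \<circ> s \<in> {u \<in> injective_indices q N. u ` {..<q} = p ` {..<q}}"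
      using injective_indices_comp_permutes[OF p s] image_comp[of p s "{..<q}"]
      by (simp add: permutes_image[OF s])
  qed
qed

text \<open>With \<open>v\<close> the masses of disjoint sets, this is the squared L2 norm of the
  simple kernel.\<close>

definition coeff_norm2 :: "nat \<Rightarrow> nat \<Rightarrow> (nat \<Rightarrow> real) \<Rightarrow> ((nat \<Rightarrow> nat) \<Rightarrow> real) \<Rightarrow> real" where
  "coeff_norm2 q N v a = (\<Sum>f\<in>injective_indices q N. (a f)\<^sup>2 * (\<Prod>j<q. v (f j)))"

lemma coeff_norm2_permute:
  assumes p: "p permutes {..<q}"
  shows "coeff_norm2 q N v (\<lambda>f. a (f \<circ> p)) = coeff_norm2 q N v a"
proof -
  have "coeff_norm2 q N v (\<lambda>f. a (f \<circ> p)) =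
    (\<Sum>f\<in>injective_indices q N. (a (f \<circ> p))\<^sup>2 * (\<Prod>j<q. v ((f \<circ> p) j)))"
    using prod_comp_permutes[OF p, of "\<lambda>j. v (_ j)"] by (simp add: coeff_norm2_def)
  then show ?thesis
    by (simp only: sum_injective_indices_permute[OF p, of "\<lambda>f. (a f)\<^sup>2 * (\<Prod>j<q. v (f j))"] coeff_norm2_def)
qed

text \<open>Two simple kernels or integrals can be subtracted once they are written over one
  disjoint family, that of all intersections of a set of the first family with one of the
  second.\<close>

lemma refinement:
  assumes A: "disjoint_family_on A {..<N::nat}" "\<And>i. i < N \<Longrightarrow> A i \<in> sets M"
    and A': "disjoint_family_on A' {..<N'::nat}" "\<And>i. i < N' \<Longrightarrow> A' i \<in> sets M"
  obtains K C u u' where "disjoint_family_on C {..<K::nat}" "\<forall>r<K. C r \<in> sets M"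
    "\<forall>i<N. A i = (\<Union>r\<in>{r. r < K \<and> u r = i}. C r)"
    "\<forall>i<N'. A' i = (\<Union>r\<in>{r. r < K \<and> u' r = i}. C r)"
proof -
  \<comment> \<open>The extra index \<open>N\<close> receives the complement of the union; without
    it the part of a set of the other family that lies outside all \<open>A i\<close> would be
    lost.\<close>
  define B where "B i = (if i < N then A i else space M - (\<Union>i<N. A i))" for i
  define B' where "B' i = (if i < N' then A' i else space M - (\<Union>i<N'. A' i))" for i
  \<comment> \<open>The pair \<open>(i, j)\<close> is coded as the number
    \<open>i * (N' + 1) + j\<close>.\<close>
  define C where "C r = B (r div (N' + 1)) \<inter> B' (r mod (N' + 1))" for r
  define K where "K = (N + 1) * (N' + 1)"
  have less: "r div (N' + 1) < N + 1" "r mod (N' + 1) < N' + 1" if "r < K" for r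
    using that by (auto simp: K_def less_mult_imp_div_less)
  have dB: "disjoint_family_on B {..<N + 1}"
    using A(1) by (fastforce simp: disjoint_family_on_def B_def)
  have dB': "disjoint_family_on B' {..<N' + 1}"
    using A'(1) by (fastforce simp: disjoint_family_on_def B'_def)
  have sB: "B i \<in> sets M" for i unfolding B_def by (auto intro!: A sets.Diff sets.finite_UN)
  have sB': "B' i \<in> sets M" for i unfolding B'_def by (auto intro!: A' sets.Diff sets.finite_UN)
  have UB: "(\<Union>i<N + 1. B i) = space M"
  proof -
    have "(\<Union>i<N. B i) = (\<Union>i<N. A i)" by (auto simp: B_def)
    then show ?thesis using A(2) sets.sets_into_space by (auto simp: lessThan_Suc B_def) 
  qed
  have UB': "(\<Union>i<N' + 1. B' i) = space M"
  proof -
    have "(\<Union>i<N'. B' i) = (\<Union>i<N'. A' i)" by (auto simp: B'_def)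
    then show ?thesis using A'(2) sets.sets_into_space by (auto simp: lessThan_Suc B'_def) 
  qed
  have idx: "i * (N' + 1) + j < K" "(i * (N' + 1) + j) div (N' + 1) = i" "(i * (N' + 1) + j) mod (N' + 1) = j"
    if "i < N + 1" "j < N' + 1" for i j
  proof -
    have "i * (N' + 1) + j < i * (N' + 1) + (N' + 1)" using that by simp
    also have "\<dots> = (i + 1) * (N' + 1)" by simp
    also have "\<dots> \<le> K" unfolding K_def using that by (intro mult_right_mono) auto
    finally show "i * (N' + 1) + j < K" .
    show "(i * (N' + 1) + j) div (N' + 1) = i" "(i * (N' + 1) + j) mod (N' + 1) = j" 
      using that(2) div_mult_self3[of "N'+1" i j] mod_mult_self3[of i "N'+1" j] by auto
  qed
  show ?thesis
  proof (rule that[of C K "\<lambda>r. r div (N' + 1)" "\<lambda>r. r mod (N' + 1)"])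
    show "disjoint_family_on C {..<K}" unfolding disjoint_family_on_def
    proof (intro ballI impI)
      fix r s assume rs: "r \<in> {..<K}" "s \<in> {..<K}" "r \<noteq> s"
      then have "r div (N' + 1) \<noteq> s div (N' + 1) \<or> r mod (N' + 1) \<noteq> s mod (N' + 1)"
        by (metis div_mult_mod_eq)
      then show "C r \<inter> C s = {}"
      proof
        assume "r div (N' + 1) \<noteq> s div (N' + 1)"
        then have "B (r div (N' + 1)) \<inter> B (s div (N' + 1)) = {}"
          using dB less rs unfolding disjoint_family_on_def by (metis lessThan_iff)
        then show ?thesis by (auto simp: C_def)
      next
        assume "r mod (N' + 1) \<noteq> s mod (N' + 1)"
        then have "B' (r mod (N' + 1)) \<inter> B' (s mod (N' + 1)) = {}"
          using dB' less rs unfolding disjoint_family_on_def by (metis lessThan_iff)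
        then show ?thesis by (auto simp: C_def)
      qed
    qed
    show "\<forall>r<K. C r \<in> sets M" using sB sB' by (auto simp: C_def)
    show "\<forall>i<N. A i = (\<Union>r\<in>{r. r < K \<and> r div (N' + 1) = i}. C r)"
    proof (intro allI impI)
    fix i assume i: "i < N"
    show "A i = (\<Union>r\<in>{r. r < K \<and> r div (N' + 1) = i}. C r)"
    proof (intro subset_antisym subsetI)
      fix z assume z: "z \<in> A i"
      then have "z \<in> space M" using A(2)[OF i] sets.sets_into_space by blast
      then obtain j where j: "j < N' + 1" "z \<in> B' j" using UB' by auto
      have "z \<in> C (i * (N' + 1) + j)" using j i z idx(2,3)[of i j] unfolding C_def by (simp add: B_def)
      then show "z \<in> (\<Union>r\<in>{r. r < K \<and> r div (N' + 1) = i}. C r)"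
        using idx[of i j] i j by auto
    qed (use i in \<open>auto simp: C_def B_def\<close>)
    qed
    show "\<forall>j<N'. A' j = (\<Union>r\<in>{r. r < K \<and> r mod (N' + 1) = j}. C r)"
    proof (intro allI impI)
    fix j assume j: "j < N'"
    show "A' j = (\<Union>r\<in>{r. r < K \<and> r mod (N' + 1) = j}. C r)"
    proof (intro subset_antisym subsetI)
      fix z assume z: "z \<in> A' j"
      then have "z \<in> space M" using A'(2)[OF j] sets.sets_into_space by blast
      then obtain i where i: "i < N + 1" "z \<in> B i" using UB by auto
      have "z \<in> C (i * (N' + 1) + j)" using j i z idx(2,3)[of i j] unfolding C_def by (simp add: B'_def)
      then show "z \<in> (\<Union>r\<in>{r. r < K \<and> r mod (N' + 1) = j}. C r)"
        using idx[of i j] i j by auto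
    qed (use j in \<open>auto simp: C_def B'_def\<close>)
    qed
  qed
qed

lemma indicator_refinement:
  assumes "disjoint_family_on C {..<K::nat}" "A = (\<Union>r\<in>{r. r < K \<and> u r = i}. C r)"
  shows "indicat_real A z = (\<Sum>r | r < K \<and> u r = i. indicator (C r) z)"
  unfolding assms(2) by (rule indicator_UN_disjoint) (use assms(1) in \<open>auto simp: disjoint_family_on_def\<close>)

lemma off_diagonal_sum_linear:
  "u * off_diagonal_sum q N a Y + v * off_diagonal_sum q N b Y =
     off_diagonal_sum q N (\<lambda>f. u * a f + v * b f) Y"
  by (simp add: off_diagonal_sum_def sum_distrib_left sum.distrib algebra_simps)

text \<open>The properties shared by a compensated Poisson measure and a Gaussian measure.\<close>

locale centered_noise = P: prob_space P + \<mu>: finite_measure \<mu>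
  for P :: "'w measure" and \<mu> :: "'z measure" +
  fixes W :: "'z set \<Rightarrow> 'w \<Rightarrow> real"
  assumes noise_L2: "B \<in> sets \<mu> \<Longrightarrow> square_integrable P (W B)"
    and noise_mean: "B \<in> sets \<mu> \<Longrightarrow> (\<integral>w. W B w \<partial>P) = 0"
    and noise_variance: "B \<in> sets \<mu> \<Longrightarrow> (\<integral>w. (W B w)\<^sup>2 \<partial>P) = measure \<mu> B"
    and noise_indep: "finite (J :: nat set) \<Longrightarrow> disjoint_family_on D J \<Longrightarrow> (\<And>j. j \<in> J \<Longrightarrow> D j \<in> sets \<mu>) \<Longrightarrow>
      P.indep_vars (\<lambda>_. borel) (\<lambda>j. W (D j)) J"
    and noise_add: "B \<in> sets \<mu> \<Longrightarrow> C \<in> sets \<mu> \<Longrightarrow> B \<inter> C = {} \<Longrightarrow>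
      AE w in P. W (B \<union> C) w = W B w + W C w"
begin

lemma noise_measurable [measurable]: "B \<in> sets \<mu> \<Longrightarrow> W B \<in> borel_measurable P"
  using noise_L2 by (auto simp: square_integrable_def)

lemma noise_integrable_sq: "B \<in> sets \<mu> \<Longrightarrow> integrable P (\<lambda>w. (W B w)\<^sup>2)"
  using noise_L2 by (auto simp: square_integrable_def)

lemma noise_integrable: "B \<in> sets \<mu> \<Longrightarrow> integrable P (W B)"
  using P.square_integrable_imp_integrable[of "W B"] noise_integrable_sq by auto

lemma noise_empty: "AE w in P. W {} w = 0"
  using noise_add[of "{}" "{}"] by auto

lemma noise_UN:
  assumes "finite J" "disjoint_family_on C J" "\<And>j. j \<in> J \<Longrightarrow> C j \<in> sets \<mu>"
  shows "AE w in P. W (\<Union>j\<in>J. C j) w = (\<Sum>j\<in>J. W (C j) w)"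
  using assms
proof (induction J)
  case empty
  then show ?case using noise_empty by simp
next
  case (insert j J)
  have "C j \<inter> (\<Union>j\<in>J. C j) = {}" using insert.prems(1) insert.hyps by (auto simp: disjoint_family_on_def)
  then have "AE w in P. W (C j \<union> (\<Union>j\<in>J. C j)) w = W (C j) w + W (\<Union>j\<in>J. C j) w"
    using insert.prems(2) insert.hyps by (intro noise_add sets.finite_UN) auto
  moreover have "AE w in P. W (\<Union>j\<in>J. C j) w = (\<Sum>j\<in>J. W (C j) w)"
    using insert.prems by (intro insert.IH) (auto simp: disjoint_family_on_def)
  ultimately show ?case by eventually_elim (use insert.hyps in simp)
qed

text \<open>Additivity of the noise holds only almost surely, but finitely many sets are involved,
  so the exceptional events can be united.\<close>

lemma noise_refinement:
  assumes C: "disjoint_family_on C {..<K::nat}" "\<And>r. r < K \<Longrightarrow> C r \<in> sets \<mu>"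
    and A: "\<And>i. i < (N::nat) \<Longrightarrow> A i = (\<Union>r\<in>{r. r < K \<and> u r = i}. C r)"
  shows "AE w in P. simple_integral W q N A a w = simple_integral W q K C (refined_coeff q N u a) w"
proof -
  have "AE w in P. \<forall>i\<in>{..<N}. W (A i) w = (\<Sum>r | r < K \<and> u r = i. W (C r) w)"
  proof (rule AE_finite_allI)
    fix i assume "i \<in> {..<N}"
    then have "A i = (\<Union>r\<in>{r. r < K \<and> u r = i}. C r)" using A by auto
    then show "AE w in P. W (A i) w = (\<Sum>r | r < K \<and> u r = i. W (C r) w)"
      using noise_UN[of "{r. r < K \<and> u r = i}" C] C by (auto simp: disjoint_family_on_def)
  qed simp
  then show ?thesis
    unfolding simple_integral_off_diagonal_sum
    by eventually_elim (rule off_diagonal_sum_refine, auto)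
qed

text \<open>Each set occurs with exponent 0, 1 or 2, and independence factorises the mean. A factor
  with exponent 1 is centred and kills the product; one with exponent 2 contributes the mass of its
  set. Exponent 1 occurs unless the two index sets agree.\<close>

lemma noise_product:
  assumes A: "disjoint_family_on A {..<N::nat}" "\<And>i. i < N \<Longrightarrow> A i \<in> sets \<mu>"
    and IJ: "I \<subseteq> {..<N}" "J \<subseteq> {..<N}"
  shows "integrable P (\<lambda>w. (\<Prod>r\<in>I. W (A r) w) * (\<Prod>r\<in>J. W (A r) w))"
    and "(\<integral>w. (\<Prod>r\<in>I. W (A r) w) * (\<Prod>r\<in>J. W (A r) w) \<partial>P) =
      (if I = J then \<Prod>r\<in>I. measure \<mu> (A r) else 0)"
proof -
  define e :: "nat \<Rightarrow> nat" where "e r = (if r \<in> I then 1 else 0) + (if r \<in> J then 1 else 0)" for r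
  have *: "(\<Prod>r\<in>I. W (A r) w) * (\<Prod>r\<in>J. W (A r) w) = (\<Prod>r<N. W (A r) w ^ e r)" for w
  proof -
    have "(\<Prod>r\<in>I. W (A r) w) = (\<Prod>r<N. W (A r) w ^ (if r \<in> I then 1 else 0))"
      "(\<Prod>r\<in>J. W (A r) w) = (\<Prod>r<N. W (A r) w ^ (if r \<in> J then 1 else 0))"
      using IJ by (auto intro!: prod.mono_neutral_cong_left)
    then show ?thesis by (simp add: e_def power_add prod.distrib)
  qed
  have ind: "P.indep_vars (\<lambda>_. borel) (\<lambda>r w. W (A r) w ^ e r) {..<N}"
    by (rule P.indep_vars_compose2[where M' = "\<lambda>_. borel"]) (auto intro!: noise_indep A)
  have int: "integrable P (\<lambda>w. W (A r) w ^ e r)" if "r < N" for r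
    using noise_integrable[OF A(2)[OF that]] noise_integrable_sq[OF A(2)[OF that]]
    by (auto simp: e_def power2_eq_square)
  show "integrable P (\<lambda>w. (\<Prod>r\<in>I. W (A r) w) * (\<Prod>r\<in>J. W (A r) w))"
    unfolding * by (rule P.indep_vars_integrable[OF _ ind]) (auto intro: int)
  have "(\<integral>w. (\<Prod>r<N. W (A r) w ^ e r) \<partial>P) = (\<Prod>r<N. \<integral>w. W (A r) w ^ e r \<partial>P)"
    by (rule P.indep_vars_lebesgue_integral[OF _ ind]) (auto intro: int)
  also have "\<dots> = (if I = J then \<Prod>r\<in>I. measure \<mu> (A r) else 0)"
  proof (cases "I = J")
    case True
    have "(\<Prod>r<N. \<integral>w. W (A r) w ^ e r \<partial>P) = (\<Prod>r\<in>I. measure \<mu> (A r))"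
      using IJ(1) noise_variance A(2) True
      by (intro prod.mono_neutral_cong_right) (auto simp: e_def numeral_2_eq_2[symmetric] P.prob_space)
    then show ?thesis using True by simp
  next
    case False
    then obtain r where r: "r \<in> I \<and> r \<notin> J \<or> r \<in> J \<and> r \<notin> I" by auto
    then have "r < N" "e r = 1" using IJ by (auto simp: e_def)
    then have "(\<Prod>r<N. \<integral>w. W (A r) w ^ e r \<partial>P) = 0"
      using noise_mean[OF A(2)[of r]] by (intro prod_zero bexI[of _ r]) auto
    then show ?thesis using False by simp
  qed
  finally show "(\<integral>w. (\<Prod>r\<in>I. W (A r) w) * (\<Prod>r\<in>J. W (A r) w) \<partial>P) =
      (if I = J then \<Prod>r\<in>I. measure \<mu> (A r) else 0)" unfolding * .
qed

lemma simple_integral_covariance: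
  assumes A: "disjoint_family_on A {..<N::nat}" "\<And>i. i < N \<Longrightarrow> A i \<in> sets \<mu>"
  shows "integrable P (\<lambda>w. simple_integral W q N A a w * simple_integral W p N A b w)" (is ?int)
    and "(\<integral>w. simple_integral W q N A a w * simple_integral W p N A b w \<partial>P) =
      (\<Sum>f\<in>injective_indices q N. \<Sum>g\<in>injective_indices p N.
         a f * b g * (if f ` {..<q} = g ` {..<p} then \<Prod>j<q. measure \<mu> (A (f j)) else 0))" (is ?eq)
proof -
  have r: "\<And>Y. (\<Prod>j<q. Y (f j) :: real) = (\<Prod>r\<in>f ` {..<q}. Y r)" if "f \<in> injective_indices q N" for f q
    using that by (subst prod.reindex) (auto simp: injective_indices_def)
  have s: "f ` {..<q} \<subseteq> {..<N}" if "f \<in> injective_indices q N" for f q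
    using that by (auto simp: injective_indices_def)
  have *: "simple_integral W q N A a w * simple_integral W p N A b w =
    (\<Sum>f\<in>injective_indices q N. \<Sum>g\<in>injective_indices p N. a f * b g *
       ((\<Prod>r\<in>f ` {..<q}. W (A r) w) * (\<Prod>r\<in>g ` {..<p}. W (A r) w)))" for w
    unfolding simple_integral_def sum_product
    by (intro sum.cong refl) (simp add: r[of _ _ "\<lambda>r. W (A r) w"] mult_ac)
  define T where "T f g w = a f * b g * ((\<Prod>r\<in>f ` {..<q}. W (A r) w) * (\<Prod>r\<in>g ` {..<p}. W (A r) w))" for f g w
  have T_int: "integrable P (T f g)" if "f \<in> injective_indices q N" "g \<in> injective_indices p N" for f g
    unfolding T_def by (rule integrable_mult_right, rule noise_product(1)[where N = N]) (simp_all add: A s that)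
  have T_eq: "(\<integral>w. T f g w \<partial>P) = a f * b g *
       (if f ` {..<q} = g ` {..<p} then \<Prod>r\<in>f ` {..<q}. measure \<mu> (A r) else 0)"
    if "f \<in> injective_indices q N" "g \<in> injective_indices p N" for f g
    unfolding T_def integral_mult_right_zero by (subst noise_product(2)[where N = N]) (simp_all add: A s that)
  note * = *[folded T_def]
  show ?int unfolding * by (intro Bochner_Integration.integrable_sum T_int)
  have "(\<integral>w. simple_integral W q N A a w * simple_integral W p N A b w \<partial>P) =
    (\<Sum>f\<in>injective_indices q N. \<Sum>g\<in>injective_indices p N. a f * b g *
       (if f ` {..<q} = g ` {..<p} then \<Prod>r\<in>f ` {..<q}. measure \<mu> (A r) else 0))"
    unfolding * by (simp add: Bochner_Integration.integral_sum Bochner_Integration.integrable_sum T_int T_eq)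
  then show ?eq
    using r[of _ _ "\<lambda>r. measure \<mu> (A r)"] by (simp cong: if_cong)
qed

lemma simple_integral_measurable [measurable]:
  assumes "\<And>i. i < N \<Longrightarrow> A i \<in> sets \<mu>"
  shows "simple_integral W q N A a \<in> borel_measurable P"
  unfolding simple_integral_def
  by (intro borel_measurable_sum borel_measurable_times borel_measurable_prod noise_measurable assms
      borel_measurable_const) (auto dest: injective_indices_less)

text \<open>Injective indices of different lengths have images of different cardinality, so no pair
  of products has a nonzero mean.\<close>

lemma simple_integral_orthogonal:
  assumes A: "disjoint_family_on A {..<N::nat}" "\<And>i. i < N \<Longrightarrow> A i \<in> sets \<mu>" and "q \<noteq> p"
  shows "(\<integral>w. simple_integral W q N A a w * simple_integral W p N A b w \<partial>P) = 0"
proof -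
  have "f ` {..<q} \<noteq> g ` {..<p}" if "f \<in> injective_indices q N" "g \<in> injective_indices p N" for f g
  proof
    assume "f ` {..<q} = g ` {..<p}"
    then have "card (f ` {..<q}) = card (g ` {..<p})" by simp
    then show False using that \<open>q \<noteq> p\<close> by (auto simp: injective_indices_def card_image)
  qed
  then show ?thesis
    by (subst simple_integral_covariance(2)[OF A]) (auto intro!: sum.neutral)
qed

lemma simple_integral_second_moment:
  assumes A: "disjoint_family_on A {..<N::nat}" "\<And>i. i < N \<Longrightarrow> A i \<in> sets \<mu>"
  shows "(\<integral>x. (simple_integral W q N A a x)\<^sup>2 \<partial>P) =
     (\<Sum>p | p permutes {..<q}. \<Sum>f\<in>injective_indices q N. a f * a (f \<circ> p) * (\<Prod>j<q. measure \<mu> (A (f j))))"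
proof -
  have e: "(\<Sum>g\<in>injective_indices q N. a f * a g * (if f ` {..<q} = g ` {..<q} then w else 0)) =
    (\<Sum>g | g \<in> injective_indices q N \<and> g ` {..<q} = f ` {..<q}. a f * a g * w)" for f w
    by (subst sum.inter_filter[OF finite_injective_indices], rule sum.cong[OF refl])
      (simp add: eq_commute[of "f ` {..<q}"])
  have "(\<integral>x. (simple_integral W q N A a x)\<^sup>2 \<partial>P) =
      (\<Sum>f\<in>injective_indices q N. \<Sum>g | g \<in> injective_indices q N \<and> g ` {..<q} = f ` {..<q}.
         a f * a g * (\<Prod>j<q. measure \<mu> (A (f j))))"
    unfolding power2_eq_square by (subst simple_integral_covariance(2)) (simp_all add: A e)
  also have "\<dots> = (\<Sum>f\<in>injective_indices q N. \<Sum>p | p permutes {..<q}.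
         a f * a (f \<circ> p) * (\<Prod>j<q. measure \<mu> (A (f j))))"
    by (intro sum.cong refl sum_injective_indices_same_image)
  finally show ?thesis by (simp only: sum.swap[of _ "injective_indices q N"])
qed

lemma simple_integral_isometry:
  assumes A: "disjoint_family_on A {..<N::nat}" "\<And>i. i < N \<Longrightarrow> A i \<in> sets \<mu>" and a: "symmetric_coeff q N a"
  shows "(\<integral>w. (simple_integral W q N A a w)\<^sup>2 \<partial>P) = fact q * coeff_norm2 q N (\<lambda>r. measure \<mu> (A r)) a"
proof -
  have "(\<Sum>f\<in>injective_indices q N. a f * a (f \<circ> p) * (\<Prod>j<q. measure \<mu> (A (f j)))) =
      coeff_norm2 q N (\<lambda>r. measure \<mu> (A r)) a" if "p permutes {..<q}" for p
    unfolding coeff_norm2_def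
    using a that by (intro sum.cong refl) (auto simp: symmetric_coeff_def power2_eq_square)
  then show ?thesis
    by (simp add: simple_integral_second_moment[OF A] card_permutations)
qed

text \<open>Without symmetry the cross term of each permutation is estimated by
  \<open>2ab <= a^2 + b^2\<close>; the two halves have the same sum because permuting the
  coefficients preserves the norm.\<close>

lemma simple_integral_bound:
  assumes A: "disjoint_family_on A {..<N::nat}" "\<And>i. i < N \<Longrightarrow> A i \<in> sets \<mu>"
  shows "(\<integral>x. (simple_integral W q N A a x)\<^sup>2 \<partial>P) \<le> fact q * coeff_norm2 q N (\<lambda>r. measure \<mu> (A r)) a"
proof -
  let ?n = "coeff_norm2 q N (\<lambda>r. measure \<mu> (A r))" and ?w = "\<lambda>f. \<Prod>j<q. measure \<mu> (A (f j))"
  have "(\<Sum>f\<in>injective_indices q N. a f * a (f \<circ> p) * ?w f) \<le> ?n a" if p: "p permutes {..<q}" for p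
  proof -
    have "(\<Sum>f\<in>injective_indices q N. a f * a (f \<circ> p) * ?w f) \<le>
      (\<Sum>f\<in>injective_indices q N. ((a f)\<^sup>2 * ?w f + (a (f \<circ> p))\<^sup>2 * ?w f) / 2)"
    proof (rule sum_mono)
      fix f
      have "a f * a (f \<circ> p) \<le> ((a f)\<^sup>2 + (a (f \<circ> p))\<^sup>2) / 2"
        using sum_squares_bound[of "a f" "a (f \<circ> p)"] by simp
      moreover have "0 \<le> ?w f" by (intro prod_nonneg) auto
      ultimately have "a f * a (f \<circ> p) * ?w f \<le> ((a f)\<^sup>2 + (a (f \<circ> p))\<^sup>2) / 2 * ?w f"
        by (rule mult_right_mono)
      then show "a f * a (f \<circ> p) * ?w f \<le> ((a f)\<^sup>2 * ?w f + (a (f \<circ> p))\<^sup>2 * ?w f) / 2"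
        by (simp add: algebra_simps)
    qed
    also have "\<dots> = (?n a + ?n (\<lambda>f. a (f \<circ> p))) / 2"
      by (simp add: coeff_norm2_def sum.distrib sum_divide_distrib[symmetric])
    also have "\<dots> = ?n a" by (simp add: coeff_norm2_permute[OF p])
    finally show ?thesis .
  qed
  then have "(\<Sum>p | p permutes {..<q}. \<Sum>f\<in>injective_indices q N. a f * a (f \<circ> p) * ?w f) \<le>
    (\<Sum>p | p permutes {..<q}. ?n a)" by (intro sum_mono) auto
  then show ?thesis by (simp add: simple_integral_second_moment[OF A] card_permutations)
qed

text \<open>This is orthogonality to the integral of order 0 with coefficient 1, which is the
  constant 1.\<close>

lemma simple_integral_mean:
  assumes A: "disjoint_family_on A {..<N::nat}" "\<And>i. i < N \<Longrightarrow> A i \<in> sets \<mu>" and "q \<ge> 1"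
  shows "(\<integral>w. simple_integral W q N A a w \<partial>P) = 0"
proof -
  have 0: "injective_indices 0 N = {\<lambda>_. undefined}" by (auto simp: injective_indices_def)
  have "simple_integral W 0 N A (\<lambda>_. 1) w = 1" for w
    by (simp add: simple_integral_def 0)
  then show ?thesis
    using simple_integral_orthogonal[OF A, of q 0 a "\<lambda>_. 1"] \<open>q \<ge> 1\<close> by simp
qed

end

section \<open>Square integrable functions\<close>

abbreviation nn_dist2 :: "'a measure \<Rightarrow> ('a \<Rightarrow> real) \<Rightarrow> ('a \<Rightarrow> real) \<Rightarrow> ennreal" where
  "nn_dist2 M f g \<equiv> \<integral>\<^sup>+x. ennreal ((f x - g x)\<^sup>2) \<partial>M"

abbreviation L2_dist2 :: "'a measure \<Rightarrow> ('a \<Rightarrow> real) \<Rightarrow> ('a \<Rightarrow> real) \<Rightarrow> real" where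
  "L2_dist2 M f g \<equiv> \<integral>x. (f x - g x)\<^sup>2 \<partial>M"

lemma square_integrable_measurable [measurable_dest]: "square_integrable M f \<Longrightarrow> f \<in> borel_measurable M"
  by (simp add: square_integrable_def)

lemma square_integrable_integrable: "square_integrable M f \<Longrightarrow> integrable M (\<lambda>x. (f x)\<^sup>2)"
  by (simp add: square_integrable_def)

lemma square_integrable_mult:
  assumes "square_integrable M f" "square_integrable M g"
  shows "integrable M (\<lambda>x. f x * g x)"
proof (rule Bochner_Integration.integrable_bound)
  show "integrable M (\<lambda>x. (f x)\<^sup>2 + (g x)\<^sup>2)" using assms by (auto simp: square_integrable_def)
  show "(\<lambda>x. f x * g x) \<in> borel_measurable M" using assms by (auto simp: square_integrable_def)
  have "norm (f x * g x) \<le> norm ((f x)\<^sup>2 + (g x)\<^sup>2)" for x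
  proof -
    have "2 * (\<bar>f x\<bar> * \<bar>g x\<bar>) \<le> (f x)\<^sup>2 + (g x)\<^sup>2"
      using sum_squares_bound[of "\<bar>f x\<bar>" "\<bar>g x\<bar>"] by (simp add: mult.assoc)
    moreover have "0 \<le> \<bar>f x\<bar> * \<bar>g x\<bar>" by simp
    ultimately show ?thesis unfolding real_norm_def abs_mult by linarith
  qed
  then show "AE x in M. norm (f x * g x) \<le> norm ((f x)\<^sup>2 + (g x)\<^sup>2)" by simp
qed

lemma square_integrable_add:
  assumes "square_integrable M f" "square_integrable M g"
  shows "square_integrable M (\<lambda>x. f x + g x)"
  using assms square_integrable_mult[OF assms]
  by (auto simp: square_integrable_def power2_sum mult.assoc)

lemma square_integrable_cmult:
  "square_integrable M f \<Longrightarrow> square_integrable M (\<lambda>x. c * f x)"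
  by (auto simp: square_integrable_def power_mult_distrib)

lemma square_integrable_diff:
  assumes "square_integrable M f" "square_integrable M g"
  shows "square_integrable M (\<lambda>x. f x - g x)"
  using square_integrable_add[OF assms(1) square_integrable_cmult[OF assms(2), of "-1"]] by simp

lemma square_integrable_zero: "square_integrable M (\<lambda>_. 0)"
  by (simp add: square_integrable_def)

lemma square_integrable_sum:
  "(\<And>i. i \<in> I \<Longrightarrow> square_integrable M (f i)) \<Longrightarrow> square_integrable M (\<lambda>x. \<Sum>i\<in>I. f i x)"
  by (induction I rule: infinite_finite_induct) (auto intro: square_integrable_add square_integrable_zero)

lemma square_integrable_iff_nn_integral:
  "square_integrable M f \<longleftrightarrow> f \<in> borel_measurable M \<and> (\<integral>\<^sup>+x. ennreal ((f x)\<^sup>2) \<partial>M) < \<infinity>"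
  by (auto simp: square_integrable_def integrable_iff_bounded)

lemma nn_integral_square_eq:
  "square_integrable M f \<Longrightarrow> (\<integral>\<^sup>+x. ennreal ((f x)\<^sup>2) \<partial>M) = ennreal (\<integral>x. (f x)\<^sup>2 \<partial>M)"
  by (auto simp: square_integrable_def intro!: nn_integral_eq_integral)

lemma Cauchy_Schwarz_integral:
  assumes f: "square_integrable M f" and g: "square_integrable M g"
  shows "(\<integral>x. f x * g x \<partial>M)\<^sup>2 \<le> (\<integral>x. (f x)\<^sup>2 \<partial>M) * (\<integral>x. (g x)\<^sup>2 \<partial>M)"
proof -
  let ?A = "\<integral>x. (f x)\<^sup>2 \<partial>M" and ?B = "\<integral>x. f x * g x \<partial>M" and ?C = "\<integral>x. (g x)\<^sup>2 \<partial>M"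
  note i = square_integrable_integrable[OF f] square_integrable_integrable[OF g] square_integrable_mult[OF f g]
  show ?thesis
  proof (cases "?C = 0")
    case True
    then have "AE x in M. (g x)\<^sup>2 = 0"
      using integral_nonneg_eq_0_iff_AE[OF i(2)] by auto
    then have "?B = 0" by (intro integral_eq_zero_AE) auto
    then show ?thesis using True by simp
  next
    case False
    moreover have "?C \<ge> 0" by simp
    moreover have sq: "(f x - c * g x)\<^sup>2 = (f x)\<^sup>2 - 2 * c * (f x * g x) + c\<^sup>2 * (g x)\<^sup>2" for c x
      by (simp add: power2_eq_square algebra_simps)
    ultimately have C: "?C > 0" by linarith
    have "0 \<le> (\<integral>x. (f x - ?B / ?C * g x)\<^sup>2 \<partial>M)" by simp
    also have "\<dots> = (\<integral>x. (f x)\<^sup>2 - 2 * (?B / ?C) * (f x * g x) + (?B / ?C)\<^sup>2 * (g x)\<^sup>2 \<partial>M)"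
      by (simp only: sq)
    also have "\<dots> = ?A - 2 * (?B / ?C) * ?B + (?B / ?C)\<^sup>2 * ?C"
      using i by simp
    also have "\<dots> = ?A - ?B\<^sup>2 / ?C" using C by (simp add: power2_eq_square field_simps)
    finally show ?thesis using C by (simp add: field_simps)
  qed
qed

lemma (in finite_measure) integral_square_le:
  assumes f: "square_integrable M f"
  shows "(\<integral>x. f x \<partial>M)\<^sup>2 \<le> measure M (space M) * (\<integral>x. (f x)\<^sup>2 \<partial>M)"
proof -
  have "square_integrable M (\<lambda>_. 1)" by (simp add: square_integrable_def)
  from Cauchy_Schwarz_integral[OF this f] show ?thesis by simp
qed

lemma L2_tendsto_iff:
  assumes s: "\<And>m. square_integrable M (s m)" and f: "square_integrable M f"
  shows "L2_tendsto M s f \<longleftrightarrow> (\<lambda>m. L2_dist2 M (s m) f) \<longlonglongrightarrow> 0"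
proof -
  have "L2_tendsto M s f \<longleftrightarrow> (\<lambda>m. ennreal (L2_dist2 M (s m) f)) \<longlonglongrightarrow> ennreal 0"
    unfolding L2_tendsto_def using nn_integral_square_eq[OF square_integrable_diff[OF s f]] by simp
  also have "\<dots> \<longleftrightarrow> (\<lambda>m. L2_dist2 M (s m) f) \<longlonglongrightarrow> 0"
    by (subst tendsto_ennreal_iff) auto
  finally show ?thesis .
qed

lemma square_add_le: "(a + b)\<^sup>2 \<le> 2 * a\<^sup>2 + 2 * (b::real)\<^sup>2"
  using sum_squares_bound[of a b] by (simp add: power2_sum)

lemma nn_integral_square_add_le:
  assumes [measurable]: "f \<in> borel_measurable M" "g \<in> borel_measurable M"
  shows "(\<integral>\<^sup>+x. ennreal ((f x + g x)\<^sup>2) \<partial>M) \<le>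
    2 * (\<integral>\<^sup>+x. ennreal ((f x)\<^sup>2) \<partial>M) + 2 * (\<integral>\<^sup>+x. ennreal ((g x)\<^sup>2) \<partial>M)"
proof -
  have "(\<integral>\<^sup>+x. ennreal ((f x + g x)\<^sup>2) \<partial>M) \<le> (\<integral>\<^sup>+x. 2 * ennreal ((f x)\<^sup>2) + 2 * ennreal ((g x)\<^sup>2) \<partial>M)"
    using square_add_le[of "f _" "g _"]
    by (intro nn_integral_mono) (auto simp: ennreal_mult'[symmetric] ennreal_plus[symmetric] ennreal_numeral[symmetric] simp del: ennreal_plus ennreal_numeral intro!: ennreal_leI)
  then show ?thesis by (simp add: nn_integral_add nn_integral_cmult)
qed

lemma L2_tendsto_triangle:
  assumes [measurable]: "\<And>m. s m \<in> borel_measurable M" "f \<in> borel_measurable M" "\<And>m. u m \<in> borel_measurable M"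
    and s: "L2_tendsto M s f" and u: "(\<lambda>m. nn_dist2 M (u m) (s m)) \<longlonglongrightarrow> 0"
  shows "L2_tendsto M u f"
  unfolding L2_tendsto_def
proof (rule tendsto_sandwich[OF _ _ tendsto_const])
  have "(\<lambda>m. 2 * nn_dist2 M (u m) (s m) + 2 * nn_dist2 M (s m) f) \<longlonglongrightarrow> 2 * 0 + 2 * 0"
    using s u unfolding L2_tendsto_def by (intro tendsto_add ennreal_tendsto_cmult) auto
  then show "(\<lambda>m. 2 * nn_dist2 M (u m) (s m) + 2 * nn_dist2 M (s m) f) \<longlonglongrightarrow> 0" by simp
  show "\<forall>\<^sub>F m in sequentially. (nn_dist2 M (u m) f) \<le>
      2 * nn_dist2 M (u m) (s m) + 2 * nn_dist2 M (s m) f"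
  proof (intro always_eventually allI)
    fix m show "nn_dist2 M (u m) f \<le>
      2 * nn_dist2 M (u m) (s m) + 2 * nn_dist2 M (s m) f"
      using nn_integral_square_add_le[of "\<lambda>x. u m x - s m x" M "\<lambda>x. s m x - f x"] by simp
  qed
qed auto

lemma L2_tendsto_square_integrable:
  assumes s: "\<And>m. square_integrable M (s m)" and [measurable]: "f \<in> borel_measurable M"
    and L: "L2_tendsto M s f"
  shows "square_integrable M f"
proof -
  have "eventually (\<lambda>m. (nn_dist2 M (s m) f) < 1) sequentially"
    using L unfolding L2_tendsto_def by (rule order_tendstoD) simp
  then obtain m where m: "nn_dist2 M (s m) f < 1"
    by (auto simp: eventually_sequentially)
  have [measurable]: "s m \<in> borel_measurable M" using s by (auto simp: square_integrable_def)
  have "square_integrable M (\<lambda>x. s m x - f x)"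
    using m unfolding square_integrable_iff_nn_integral by (auto simp: less_top intro: order.strict_trans)
  from square_integrable_diff[OF s[of m] this] show ?thesis by simp
qed

lemma L2_tendsto_add:
  assumes [measurable]: "\<And>m. s m \<in> borel_measurable M" "f \<in> borel_measurable M"
      "\<And>m. u m \<in> borel_measurable M" "g \<in> borel_measurable M"
    and "L2_tendsto M s f" "L2_tendsto M u g"
  shows "L2_tendsto M (\<lambda>m x. s m x + u m x) (\<lambda>x. f x + g x)"
  unfolding L2_tendsto_def
proof (rule tendsto_sandwich[OF _ _ tendsto_const])
  have "(\<lambda>m. 2 * nn_dist2 M (s m) f + 2 * nn_dist2 M (u m) g) \<longlonglongrightarrow> 2 * 0 + 2 * 0"
    using assms unfolding L2_tendsto_def by (intro tendsto_add ennreal_tendsto_cmult) auto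
  then show "(\<lambda>m. 2 * nn_dist2 M (s m) f + 2 * nn_dist2 M (u m) g) \<longlonglongrightarrow> 0" by simp
  show "\<forall>\<^sub>F m in sequentially. (\<integral>\<^sup>+x. ennreal ((s m x + u m x - (f x + g x))\<^sup>2) \<partial>M) \<le>
     2 * nn_dist2 M (s m) f + 2 * nn_dist2 M (u m) g"
  proof (intro always_eventually allI)
    fix m show "(\<integral>\<^sup>+x. ennreal ((s m x + u m x - (f x + g x))\<^sup>2) \<partial>M) \<le>
     2 * nn_dist2 M (s m) f + 2 * nn_dist2 M (u m) g"
      using nn_integral_square_add_le[of "\<lambda>x. s m x - f x" M "\<lambda>x. u m x - g x"]
      by (simp add: add_diff_add)
  qed
qed auto

lemma L2_tendsto_cmult:
  assumes [measurable]: "\<And>m. s m \<in> borel_measurable M" "f \<in> borel_measurable M"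
    and "L2_tendsto M s f"
  shows "L2_tendsto M (\<lambda>m x. c * s m x) (\<lambda>x. c * f x)"
proof -
  have "(\<integral>\<^sup>+x. ennreal ((c * s m x - c * f x)\<^sup>2) \<partial>M) = ennreal (c\<^sup>2) * nn_dist2 M (s m) f" for m
  proof -
    have "(c * a - c * b)\<^sup>2 = c\<^sup>2 * (a - b)\<^sup>2" for a b :: real
      by (simp add: power2_eq_square algebra_simps)
    then show ?thesis by (simp add: nn_integral_cmult[symmetric] ennreal_mult')
  qed
  then show ?thesis
    using assms(3) ennreal_tendsto_cmult[of "ennreal (c\<^sup>2)" "\<lambda>m. nn_dist2 M (s m) f" 0 sequentially]
    unfolding L2_tendsto_def by simp
qed

lemma L2_tendsto_const: "L2_tendsto M (\<lambda>_. f) f"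
  by (simp add: L2_tendsto_def)

lemma L2_tendsto_sum:
  assumes "\<And>i m. i \<in> I \<Longrightarrow> s i m \<in> borel_measurable M" "\<And>i. i \<in> I \<Longrightarrow> f i \<in> borel_measurable M"
    and "\<And>i. i \<in> I \<Longrightarrow> L2_tendsto M (s i) (f i)"
  shows "L2_tendsto M (\<lambda>m x. \<Sum>i\<in>I. s i m x) (\<lambda>x. \<Sum>i\<in>I. f i x)"
  using assms by (induction I rule: infinite_finite_induct)
    (auto intro!: L2_tendsto_add L2_tendsto_const)

lemma L2_tendsto_subseq: "L2_tendsto M s f \<Longrightarrow> strict_mono r \<Longrightarrow> L2_tendsto M (\<lambda>m. s (r m)) f"
  unfolding L2_tendsto_def
  using LIMSEQ_subseq_LIMSEQ[of "\<lambda>m. nn_dist2 M (s m) f" 0 r] by (simp add: comp_def)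

lemma L2_tendsto_cong_AE:
  assumes "\<And>m. AE x in M. s m x = s' m x" "AE x in M. f x = f' x"
  shows "L2_tendsto M s f \<longleftrightarrow> L2_tendsto M s' f'"
proof -
  have "nn_dist2 M (s m) f = nn_dist2 M (s' m) f'" for m
    using assms(1)[of m] assms(2) by (intro nn_integral_cong_AE) auto
  then show ?thesis by (simp add: L2_tendsto_def)
qed

lemma L2_tendsto_inner:
  assumes s: "\<And>m. square_integrable M (s m)" "square_integrable M f" "L2_tendsto M s f"
    and u: "\<And>m. square_integrable M (u m)" "square_integrable M g" "L2_tendsto M u g"
  shows "(\<lambda>m. \<integral>x. s m x * u m x \<partial>M) \<longlonglongrightarrow> (\<integral>x. f x * g x \<partial>M)"
proof -
  let ?S = "\<lambda>m. L2_dist2 M (s m) f" and ?U = "\<lambda>m. L2_dist2 M (u m) g"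
  let ?F = "\<integral>x. (f x)\<^sup>2 \<partial>M" and ?G = "\<integral>x. (g x)\<^sup>2 \<partial>M"
  have S: "?S \<longlonglongrightarrow> 0" and U: "?U \<longlonglongrightarrow> 0" using L2_tendsto_iff s u by blast+
  note d = square_integrable_diff[OF s(1,2)] square_integrable_diff[OF u(1,2)]
  have CS: "\<bar>\<integral>x. p x * q x \<partial>M\<bar> \<le> sqrt ((\<integral>x. (p x)\<^sup>2 \<partial>M) * (\<integral>x. (q x)\<^sup>2 \<partial>M))"
    if "square_integrable M p" "square_integrable M q" for p q
    using real_sqrt_le_mono[OF Cauchy_Schwarz_integral[OF that]] by simp
  have le: "\<bar>(\<integral>x. s m x * u m x \<partial>M) - (\<integral>x. f x * g x \<partial>M)\<bar> \<le>
     sqrt (?S m * ?U m) + sqrt (?S m * ?G) + sqrt (?F * ?U m)" for m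
  proof -
    have "(\<integral>x. s m x * u m x \<partial>M) - (\<integral>x. f x * g x \<partial>M) = (\<integral>x. s m x * u m x - f x * g x \<partial>M)"
      using square_integrable_mult s u by (intro Bochner_Integration.integral_diff[symmetric]) auto
    also have "\<dots> = (\<integral>x. (s m x - f x) * (u m x - g x) + (s m x - f x) * g x + f x * (u m x - g x) \<partial>M)"
      by (intro Bochner_Integration.integral_cong) (auto simp: algebra_simps)
    also have "\<dots> = (\<integral>x. (s m x - f x) * (u m x - g x) \<partial>M) + (\<integral>x. (s m x - f x) * g x \<partial>M) + (\<integral>x. f x * (u m x - g x) \<partial>M)"
      using square_integrable_mult[OF d(1) d(2)] square_integrable_mult[OF d(1) u(2)] square_integrable_mult[OF s(2) d(2)]
      by simp
    finally show ?thesis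
      using CS[OF d(1)[of m] d(2)[of m]] CS[OF d(1)[of m] u(2)] CS[OF s(2) d(2)[of m]] by linarith
  qed
  have "(\<lambda>m. sqrt (?S m * ?U m) + sqrt (?S m * ?G) + sqrt (?F * ?U m)) \<longlonglongrightarrow> sqrt (0 * 0) + sqrt (0 * ?G) + sqrt (?F * 0)"
    by (intro tendsto_intros S U)
  then have "(\<lambda>m. sqrt (?S m * ?U m) + sqrt (?S m * ?G) + sqrt (?F * ?U m)) \<longlonglongrightarrow> 0" by simp
  then have "(\<lambda>m. (\<integral>x. s m x * u m x \<partial>M) - (\<integral>x. f x * g x \<partial>M)) \<longlonglongrightarrow> 0"
    by (rule Lim_null_comparison[rotated]) (intro always_eventually allI, unfold real_norm_def, rule le)
  then show ?thesis by (simp add: LIM_zero_iff)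
qed

lemma L2_tendsto_unique:
  assumes s: "\<And>m. s m \<in> borel_measurable M" and f: "f \<in> borel_measurable M" "L2_tendsto M s f"
    and g: "g \<in> borel_measurable M" "L2_tendsto M s g"
  shows "AE x in M. f x = g x"
proof -
  have "L2_tendsto M (\<lambda>m x. s m x + (-1) * s m x) (\<lambda>x. f x + (-1) * g x)"
    by (intro L2_tendsto_add L2_tendsto_cmult borel_measurable_times borel_measurable_const s f g)
  then have "(\<lambda>_::nat. nn_dist2 M f g) \<longlonglongrightarrow> 0"
    by (simp add: L2_tendsto_def power2_commute)
  then have "nn_dist2 M f g = 0"
    by (simp add: LIMSEQ_const_iff)
  then have "AE x in M. ennreal ((f x - g x)\<^sup>2) = 0"
    using f(1) g(1) by (subst (asm) nn_integral_0_iff_AE) auto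
  then show ?thesis by (auto simp: ennreal_eq_0_iff)
qed

text \<open>The Riesz-Fischer argument: along \<open>r\<close> the increments have L1 norm at most
  \<open>2^-j\<close>, hence the sequence converges almost surely along \<open>r\<close>, and
  Fatou's lemma turns this into a rate for the whole sequence.\<close>

lemma (in prob_space) L2_complete:
  fixes s :: "nat \<Rightarrow> 'a \<Rightarrow> real"
  assumes s: "\<And>m. square_integrable M (s m)"
    and C: "\<And>e. e > 0 \<Longrightarrow> \<exists>m0. \<forall>m\<ge>m0. \<forall>n\<ge>m0. (L2_dist2 M (s m) (s n)) < e"
  obtains Y where "square_integrable M Y" "L2_tendsto M s Y"
proof -
  have [measurable]: "s m \<in> borel_measurable M" for m using s by (auto simp: square_integrable_def)
  have "\<forall>j. \<exists>m0. \<forall>m\<ge>m0. \<forall>n\<ge>m0. (L2_dist2 M (s m) (s n)) < (1/4) ^ j"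
    using C by simp
  then obtain m0 where m0: "\<And>j m n. m \<ge> m0 j \<Longrightarrow> n \<ge> m0 j \<Longrightarrow> (L2_dist2 M (s m) (s n)) < (1/4) ^ j" by metis
  define r where "r j = (\<Sum>i\<le>j. m0 i)" for j
  have r0: "r j \<ge> m0 j" for j unfolding r_def by (rule member_le_sum) auto
  have rS: "r (Suc j) \<ge> r j" for j by (simp add: r_def)
  have L1: "(\<integral>x. \<bar>s (r (Suc j)) x - s (r j) x\<bar> \<partial>M) \<le> (1/2) ^ j" for j
  proof -
    have q: "square_integrable M (\<lambda>x. \<bar>s (r (Suc j)) x - s (r j) x\<bar>)"
      using square_integrable_diff[OF s[of "r (Suc j)"] s[of "r j"]] by (auto simp: square_integrable_def)
    have "(\<integral>x. \<bar>s (r (Suc j)) x - s (r j) x\<bar> \<partial>M)\<^sup>2 \<le> (L2_dist2 M (s (r (Suc j))) (s (r j)))"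
      using integral_square_le[OF q] by (simp add: prob_space)
    also have "\<dots> \<le> (1/4) ^ j" using m0[of j "r (Suc j)" "r j"] r0[of j] rS[of j] by simp
    also have "\<dots> = ((1/2)\<^sup>2) ^ j" by (simp add: power2_eq_square)
    also have "\<dots> = ((1/2) ^ j)\<^sup>2" by (simp only: power_mult[symmetric] mult.commute)
    finally show ?thesis by (rule power2_le_imp_le) simp
  qed
  have "(\<integral>\<^sup>+x. (\<Sum>j. ennreal \<bar>s (r (Suc j)) x - s (r j) x\<bar>) \<partial>M) = (\<Sum>j. \<integral>\<^sup>+x. ennreal \<bar>s (r (Suc j)) x - s (r j) x\<bar> \<partial>M)"
    by (rule nn_integral_suminf) auto
  also have "\<dots> \<le> (\<Sum>j. ennreal ((1/2) ^ j))"
  proof (intro suminf_le)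
    fix j
    have "square_integrable M (\<lambda>x. s (r (Suc j)) x - s (r j) x)" by (intro square_integrable_diff s)
    then have "integrable M (\<lambda>x. s (r (Suc j)) x - s (r j) x)"
      unfolding square_integrable_def using square_integrable_imp_integrable by blast
    then show "(\<integral>\<^sup>+x. ennreal \<bar>s (r (Suc j)) x - s (r j) x\<bar> \<partial>M) \<le> ennreal ((1/2) ^ j)"
      using L1[of j] by (subst nn_integral_eq_integral) (auto intro!: ennreal_leI)
  qed auto
  also have "\<dots> = ennreal (\<Sum>j. (1/2) ^ j)"
    by (rule suminf_ennreal2) (auto intro: summable_geometric)
  also have "\<dots> < \<infinity>" by simp
  finally have "AE x in M. (\<Sum>j. ennreal \<bar>s (r (Suc j)) x - s (r j) x\<bar>) \<noteq> \<infinity>"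
    by (intro nn_integral_PInf_AE) (auto simp: less_top)
  then have conv: "AE x in M. convergent (\<lambda>j. s (r j) x)"
  proof eventually_elim
    case (elim x)
    then have "summable (\<lambda>j. \<bar>s (r (Suc j)) x - s (r j) x\<bar>)"
      by (intro summable_suminf_not_top) auto
    then have "summable (\<lambda>j. s (r (Suc j)) x - s (r j) x)" by (rule summable_rabs_cancel)
    then have "convergent (\<lambda>n. (\<Sum>j<n. s (r (Suc j)) x - s (r j) x) + s (r 0) x)"
      by (intro convergent_add convergent_const) (simp add: summable_iff_convergent)
    then show ?case by (simp add: sum_lessThan_telescope[of "\<lambda>j. s (r j) x"])
  qed
  define Y where "Y x = lim (\<lambda>j. s (r j) x)" for x
  have Ym[measurable]: "Y \<in> borel_measurable M" unfolding Y_def by measurable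
  have lim: "AE x in M. (\<lambda>j. s (r j) x) \<longlonglongrightarrow> Y x"
    using conv by eventually_elim (simp add: Y_def convergent_LIMSEQ_iff)
  have bd: "nn_dist2 M (s m) Y \<le> ennreal ((1/4) ^ i)" if m: "m \<ge> m0 i" for m i
  proof -
    have "nn_dist2 M (s m) Y = (\<integral>\<^sup>+x. liminf (\<lambda>j. ennreal ((s m x - s (r j) x)\<^sup>2)) \<partial>M)"
    proof (rule nn_integral_cong_AE)
      show "AE x in M. ennreal ((s m x - Y x)\<^sup>2) = liminf (\<lambda>j. ennreal ((s m x - s (r j) x)\<^sup>2))"
        using lim
      proof eventually_elim
        case (elim x)
        then have "(\<lambda>j. ennreal ((s m x - s (r j) x)\<^sup>2)) \<longlonglongrightarrow> ennreal ((s m x - Y x)\<^sup>2)"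
          by (intro tendsto_intros)
        then show ?case by (intro lim_imp_Liminf[symmetric]) auto
      qed
    qed
    also have "\<dots> \<le> liminf (\<lambda>j. nn_dist2 M (s m) (s (r j)))"
      by (rule nn_integral_liminf) auto
    also have "\<dots> \<le> limsup (\<lambda>j. nn_dist2 M (s m) (s (r j)))"
      by (rule Liminf_le_Limsup) simp
    also have "\<dots> \<le> ennreal ((1/4) ^ i)"
    proof (rule Limsup_bounded)
      have "nn_dist2 M (s m) (s (r j)) \<le> ennreal ((1/4) ^ i)" if "j \<ge> i" for j
      proof -
        have "r j \<ge> m0 i" unfolding r_def using that by (intro member_le_sum) auto
        then show ?thesis
          using m0[OF m] nn_integral_square_eq[OF square_integrable_diff[OF s[of m] s[of "r j"]]]
          by (simp add: ennreal_leI less_imp_le)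
      qed
      then show "\<forall>\<^sub>F j in sequentially. (nn_dist2 M (s m) (s (r j))) \<le> ennreal ((1/4) ^ i)"
        by (auto simp: eventually_sequentially)
    qed
    finally show ?thesis .
  qed
  have L: "L2_tendsto M s Y" unfolding L2_tendsto_def
  proof (rule order_tendstoI)
    fix a :: ennreal assume "a > 0"
    have "(\<lambda>i. ennreal ((1/4) ^ i)) \<longlonglongrightarrow> ennreal 0" by (intro tendsto_ennrealI LIMSEQ_realpow_zero) auto
    then have "\<forall>\<^sub>F i in sequentially. ennreal ((1/4) ^ i) < a" using \<open>a > 0\<close> by (intro order_tendstoD) auto
    then obtain i where "ennreal ((1/4) ^ i) < a" by (auto simp: eventually_sequentially)
    then show "\<forall>\<^sub>F m in sequentially. (nn_dist2 M (s m) Y) < a"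
      using bd by (auto simp: eventually_sequentially intro!: exI[of _ "m0 i"] le_less_trans[OF bd])
  qed auto
  show ?thesis using that[OF L2_tendsto_square_integrable[OF s Ym L] L] .
qed

text \<open>The rectangles belonging to different injective indices are disjoint, so mixed products
  vanish, and indicators are idempotent.\<close>

lemma simple_kernel_square:
  assumes A: "disjoint_family_on A {..<N}"
  shows "(simple_kernel q N A a x)\<^sup>2 = simple_kernel q N A (\<lambda>f. (a f)\<^sup>2) x"
proof -
  let ?P = "\<lambda>f. \<Prod>j<q. indicat_real (A (f j)) (x j)"
  have "(a f * ?P f) * (a g * ?P g) = (if g = f then (a f)\<^sup>2 * ?P f else 0)"
    if f: "f \<in> injective_indices q N" and g: "g \<in> injective_indices q N" for f g
  proof (cases "g = f")
    case True
    have P: "?P f * ?P f = ?P f" unfolding prod.distrib[symmetric] by (intro prod.cong) (auto simp: indicator_def)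
    have "a f * ?P f * (a f * ?P f) = (a f)\<^sup>2 * (?P f * ?P f)" by (simp add: power2_eq_square)
    then show ?thesis using True P by simp
  next
    case False
    then obtain j where "g j \<noteq> f j" by auto
    moreover from this have "j < q" using f g PiE_arb[of f "{..<q}" _ j] PiE_arb[of g "{..<q}" _ j]
      by (fastforce simp: injective_indices_def)
    ultimately have j: "j < q" "A (f j) \<inter> A (g j) = {}"
      using A injective_indices_less[OF f, of j] injective_indices_less[OF g, of j]
      unfolding disjoint_family_on_def by (auto simp: lessThan_iff) 
    then have "?P f = 0 \<or> ?P g = 0"
      by (cases "x j \<in> A (f j)") (auto simp: indicator_def intro!: bexI[of _ j])
    then show ?thesis using False by auto
  qed
  then show ?thesis
    unfolding simple_kernel_def power2_eq_square[of "sum _ _"] sum_product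
    by (auto intro!: sum.cong simp: sum.delta)
qed

section \<open>Powers of a finite measure and integration over some of the coordinates\<close>

lemma append_tuple_measurable [measurable]:
  assumes "i \<le> k"
  shows "(\<lambda>(x, y). append_tuple i (k - i) x y) \<in> pow M i \<Otimes>\<^sub>M pow M (k - i) \<rightarrow>\<^sub>M pow M k"
proof -
  have "(\<lambda>(x, y). append_tuple i (k - i) x y) = (\<lambda>p. \<lambda>j\<in>{..<k}. if j < i then fst p j else snd p (j - i))"
    using assms by (auto simp: append_tuple_def fun_eq_iff)
  also have "\<dots> \<in> pow M i \<Otimes>\<^sub>M pow M (k - i) \<rightarrow>\<^sub>M pow M k"
  proof (rule measurable_restrict)
    fix j assume "j \<in> {..<k}"
    show "(\<lambda>p. if j < i then fst p j else snd p (j - i)) \<in> pow M i \<Otimes>\<^sub>M pow M (k - i) \<rightarrow>\<^sub>M M"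
    proof (cases "j < i")
      case True
      have "(\<lambda>p. fst p j) \<in> pow M i \<Otimes>\<^sub>M pow M (k - i) \<rightarrow>\<^sub>M M"
        by (rule measurable_compose[OF measurable_fst measurable_component_singleton]) (use True in auto)
      then show ?thesis using True by simp
    next
      case False
      have "(\<lambda>p. snd p (j - i)) \<in> pow M i \<Otimes>\<^sub>M pow M (k - i) \<rightarrow>\<^sub>M M"
        by (rule measurable_compose[OF measurable_snd measurable_component_singleton]) (use False \<open>j \<in> {..<k}\<close> in auto)
      then show ?thesis using False by simp
    qed
  qed
  finally show ?thesis .
qed

context finite_measure begin

lemma product_sigma_finite_const: "product_sigma_finite (\<lambda>_ :: nat. M)"
  by (intro product_sigma_finite.intro sigma_finite_measure_axioms)

lemma emeasure_power_rectangle: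
  assumes "\<And>j. j < n \<Longrightarrow> A j \<in> sets M"
  shows "emeasure (pow M n) (PiE {..<n} A) = (\<Prod>j<n. emeasure M (A j))"
proof -
  interpret product_sigma_finite "\<lambda>_ :: nat. M" by (rule product_sigma_finite_const)
  show ?thesis using assms by (intro emeasure_PiM) auto
qed

lemma finite_power_measure: "finite_measure (pow M n)"
proof
  show "emeasure (pow M n) (space (pow M n)) \<noteq> \<infinity>"
    unfolding space_PiM by (subst emeasure_power_rectangle)
      (auto simp: emeasure_eq_measure ennreal_power)
qed

lemma measure_power_space: "measure (pow M n) (space (pow M n)) = measure M (space M) ^ n"
proof -
  have "emeasure (pow M n) (space (pow M n)) = ennreal (measure M (space M) ^ n)"
    unfolding space_PiM by (subst emeasure_power_rectangle) (auto simp: emeasure_eq_measure ennreal_power)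
  then show ?thesis by (simp add: measure_def)
qed

lemma power_measure_eqI:
  assumes "sets N = sets (pow M n)"
    and "\<And>A. (\<And>j. j < n \<Longrightarrow> A j \<in> sets M) \<Longrightarrow> emeasure N (PiE {..<n} A) = (\<Prod>j<n. emeasure M (A j))"
  shows "N = pow M n"
proof -
  interpret product_sigma_finite "\<lambda>_ :: nat. M" by (rule product_sigma_finite_const)
  show ?thesis by (rule PiM_eqI) (use assms in auto)
qed

lemma measurable_comp_permutes:
  assumes "p permutes {..<n}"
  shows "(\<lambda>x. x \<circ> p) \<in> pow M n \<rightarrow>\<^sub>M pow M n"
proof -
  have "(\<lambda>x. \<lambda>j\<in>{..<n}. x (p j)) \<in> pow M n \<rightarrow>\<^sub>M pow M n"
    using permutes_in_image[OF assms] by (intro measurable_restrict measurable_component_singleton) auto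
  then show ?thesis
    using permutes_not_in[OF assms]
    by (subst measurable_cong[of _ _ "\<lambda>x. \<lambda>j\<in>{..<n}. x (p j)"])
      (auto simp: space_PiM PiE_iff extensional_def fun_eq_iff restrict_def)
qed

lemma distr_comp_permutes:
  assumes p: "p permutes {..<n}"
  shows "distr (pow M n) (pow M n) (\<lambda>x. x \<circ> p) = pow M n"
proof (rule power_measure_eqI)
  fix A assume A: "\<And>j. j < n \<Longrightarrow> A j \<in> sets M"
  have in': "inv p j < n \<longleftrightarrow> j < n" "p j < n \<longleftrightarrow> j < n" for j
    using permutes_in_image[OF permutes_inv[OF p], of j] permutes_in_image[OF p, of j] by auto
  have "(\<lambda>x. x \<circ> p) -` (PiE {..<n} A) \<inter> space (pow M n) = PiE {..<n} (\<lambda>j. A (inv p j))"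
  proof (intro equalityI subsetI)
    fix x assume x: "x \<in> (\<lambda>x. x \<circ> p) -` (PiE {..<n} A) \<inter> space (pow M n)"
    then have "x \<in> extensional {..<n}" by (auto simp: space_PiM PiE_iff)
    moreover have "x j \<in> A (inv p j)" if "j < n" for j
    proof -
      have "(x \<circ> p) (inv p j) \<in> A (inv p j)" using x that in' by (auto simp: PiE_iff)
      then show ?thesis using permutes_inverses[OF p] by simp
    qed
    ultimately show "x \<in> PiE {..<n} (\<lambda>j. A (inv p j))" by (auto simp: PiE_iff)
  next
    fix x assume x: "x \<in> PiE {..<n} (\<lambda>j. A (inv p j))"
    then have xj: "x j \<in> A (inv p j)" if "j < n" for j using that by (auto simp: PiE_iff)
    have ext: "x j = undefined" if "\<not> j < n" for j using x that by (auto simp: PiE_iff extensional_def)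
    have "x j \<in> space M" if "j < n" for j
      using xj[OF that] sets.sets_into_space[OF A[of "inv p j"]] in'(1) that by blast
    then have "x \<in> space (pow M n)"
      using ext by (auto simp: space_PiM PiE_iff extensional_def)
    moreover have "x \<circ> p \<in> PiE {..<n} A"
      using xj[of "p _"] ext in'(2) permutes_inverses(2)[OF p] by (auto simp: PiE_iff extensional_def)
    ultimately show "x \<in> (\<lambda>x. x \<circ> p) -` (PiE {..<n} A) \<inter> space (pow M n)" by auto
  qed
  moreover have "PiE {..<n} A \<in> sets (pow M n)" using A by (intro sets_PiM_I_finite) auto
  ultimately have "emeasure (distr (pow M n) (pow M n) (\<lambda>x. x \<circ> p)) (PiE {..<n} A) =
    emeasure (pow M n) (PiE {..<n} (\<lambda>j. A (inv p j)))"
    using measurable_comp_permutes[OF p] by (subst emeasure_distr) auto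
  also have "\<dots> = (\<Prod>j<n. emeasure M (A (inv p j)))"
    using A in' by (intro emeasure_power_rectangle) auto
  also have "\<dots> = (\<Prod>j<n. emeasure M (A j))"
    by (rule prod_comp_permutes[OF permutes_inv[OF p], of "\<lambda>j. emeasure M (A j)"])
  finally show "emeasure (distr (pow M n) (pow M n) (\<lambda>x. x \<circ> p)) (PiE {..<n} A) =
    (\<Prod>j<n. emeasure M (A j))" .
qed simp

text \<open>Points of a power are functions on an initial segment and not pairs; this identification
  is what makes Fubini's theorem available on powers.\<close>

lemma distr_append_tuple:
  assumes ik: "i \<le> k"
  shows "distr (pow M i \<Otimes>\<^sub>M pow M (k - i)) (pow M k)
    (\<lambda>(x, y). append_tuple i (k - i) x y) = pow M k"
proof (rule power_measure_eqI)
  interpret I: finite_measure "pow M (k - i)" by (rule finite_power_measure)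
  fix A assume A: "\<And>j. j < k \<Longrightarrow> A j \<in> sets M"
  let ?Q = "pow M i \<Otimes>\<^sub>M pow M (k - i)"
  have [simp]: "PiE {..<i} A \<in> sets (pow M i)" using A ik by (intro sets_PiM_I_finite) auto
  have [simp]: "PiE {..<k - i} (\<lambda>j. A (i + j)) \<in> sets (pow M (k - i))" using A ik by (intro sets_PiM_I_finite) auto
  have Ak: "PiE {..<k} A \<in> sets (pow M k)" using A by (intro sets_PiM_I_finite) auto
  have "(\<lambda>(x, y). append_tuple i (k - i) x y) -` (PiE {..<k} A) \<inter> space ?Q =
    PiE {..<i} A \<times> PiE {..<k - i} (\<lambda>j. A (i + j))"
  proof (intro equalityI subsetI)
    fix p assume p: "p \<in> (\<lambda>(x, y). append_tuple i (k - i) x y) -` (PiE {..<k} A) \<inter> space ?Q"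
    obtain x y where [simp]: "p = (x, y)" by force
    have "x \<in> extensional {..<i}" "y \<in> extensional {..<k - i}"
      using p by (auto simp: space_pair_measure space_PiM PiE_iff)
    moreover have *: "append_tuple i (k - i) x y j \<in> A j" if "j < k" for j using p that by (auto simp: PiE_iff)
    have "x j \<in> A j" if "j < i" for j using *[of j] that ik by (simp add: append_tuple_def)
    moreover have "y j \<in> A (i + j)" if "j < k - i" for j using *[of "i + j"] that ik by (simp add: append_tuple_def)
    ultimately show "p \<in> PiE {..<i} A \<times> PiE {..<k - i} (\<lambda>j. A (i + j))" by (auto simp: PiE_iff)
  next
    fix p assume p: "p \<in> PiE {..<i} A \<times> PiE {..<k - i} (\<lambda>j. A (i + j))"
    obtain x y where [simp]: "p = (x, y)" by force
    have "x j \<in> space M" if "j < i" for j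
      using p that ik sets.sets_into_space[OF A[of j]] by (auto simp: PiE_iff)
    moreover have "y j \<in> space M" if "j < k - i" for j
    proof -
      have "y j \<in> A (i + j)" using p that by (auto simp: PiE_iff)
      then show ?thesis using sets.sets_into_space[OF A[of "i + j"]] that by (auto simp: less_diff_conv add.commute)
    qed
    ultimately have "x \<in> space (pow M i)" "y \<in> space (pow M (k - i))"
      using p by (auto simp: space_PiM PiE_iff)
    moreover have "append_tuple i (k - i) x y j \<in> A j" if "j < k" for j
    proof (cases "j < i")
      case True
      then show ?thesis using p that ik by (auto simp: append_tuple_def PiE_iff)
    next
      case False
      then have "j - i < k - i" using that by auto
      then have "y (j - i) \<in> A (i + (j - i))"
        using PiE_mem[of y "{..<k - i}" "\<lambda>j. A (i + j)" "j - i"] p by simp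
      then show ?thesis using False that ik by (simp add: append_tuple_def)
    qed
    then have "append_tuple i (k - i) x y \<in> PiE {..<k} A"
      using ik by (auto simp: PiE_iff append_tuple_def extensional_def)
    ultimately show "p \<in> (\<lambda>(x, y). append_tuple i (k - i) x y) -` (PiE {..<k} A) \<inter> space ?Q"
      by (auto simp: space_pair_measure)
  qed
  then have "emeasure (distr ?Q (pow M k) (\<lambda>(x, y). append_tuple i (k - i) x y)) (PiE {..<k} A) =
    emeasure ?Q (PiE {..<i} A \<times> PiE {..<k - i} (\<lambda>j. A (i + j)))"
    using Ak append_tuple_measurable[OF ik] by (subst emeasure_distr) auto
  also have "\<dots> = (\<Prod>j<i. emeasure M (A j)) * (\<Prod>j<k - i. emeasure M (A (i + j)))"
    using A ik by (subst I.emeasure_pair_measure_Times) (auto simp: emeasure_power_rectangle)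
  also have "(\<Prod>j<k - i. emeasure M (A (i + j))) = (\<Prod>j\<in>{i..<k}. emeasure M (A j))"
    by (rule prod.reindex_bij_witness[of _ "\<lambda>j. j - i" "\<lambda>j. i + j"]) auto
  also have "(\<Prod>j<i. emeasure M (A j)) * (\<Prod>j\<in>{i..<k}. emeasure M (A j)) = (\<Prod>j<k. emeasure M (A j))"
    using ik by (subst prod.union_disjoint[symmetric]) (auto intro!: prod.cong)
  finally show "emeasure (distr ?Q (pow M k) (\<lambda>(x, y). append_tuple i (k - i) x y)) (PiE {..<k} A) =
    (\<Prod>j<k. emeasure M (A j))" .
qed simp

lemma nn_integral_append_tuple:
  assumes ik: "i \<le> k" and [measurable]: "f \<in> borel_measurable (pow M k)"
  shows "(\<integral>\<^sup>+x. \<integral>\<^sup>+y. f (append_tuple i (k - i) x y) \<partial>pow M (k - i) \<partial>pow M i) =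
    (\<integral>\<^sup>+x. f x \<partial>pow M k)"
proof -
  interpret I: finite_measure "pow M (k - i)" by (rule finite_power_measure)
  note [measurable] = append_tuple_measurable[OF ik]
  have "(\<integral>\<^sup>+x. f x \<partial>pow M k) =
    (\<integral>\<^sup>+p. f ((\<lambda>(x, y). append_tuple i (k - i) x y) p) \<partial>(pow M i \<Otimes>\<^sub>M pow M (k - i)))"
    by (subst distr_append_tuple[OF ik, symmetric], subst nn_integral_distr) auto
  then show ?thesis
    by (subst (asm) I.nn_integral_fst[symmetric]) auto
qed

lemma simple_kernel_measurable [measurable]:
  assumes "\<And>r. r < N \<Longrightarrow> A r \<in> sets M"
  shows "simple_kernel q N A a \<in> borel_measurable (pow M q)"
  unfolding simple_kernel_def
proof (intro borel_measurable_sum borel_measurable_times borel_measurable_const borel_measurable_prod)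
  fix f j assume "f \<in> injective_indices q N" "j \<in> {..<q}"
  then have "A (f j) \<in> sets M" "j \<in> {..<q}" using assms injective_indices_less by auto
  then show "(\<lambda>x. indicat_real (A (f j)) (x j)) \<in> borel_measurable (pow M q)"
    by (intro measurable_compose[OF measurable_component_singleton borel_measurable_indicator]) auto
qed

lemma integral_simple_kernel:
  assumes "\<And>r. r < N \<Longrightarrow> A r \<in> sets M"
  shows "integrable (pow M q) (simple_kernel q N A a)"
    and "(\<integral>x. simple_kernel q N A a x \<partial>pow M q) =
      (\<Sum>f\<in>injective_indices q N. a f * (\<Prod>j<q. measure M (A (f j))))"
proof -
  interpret product_sigma_finite "\<lambda>_ :: nat. M" by (rule product_sigma_finite_const)
  have s: "A (f j) \<in> sets M" if "f \<in> injective_indices q N" "j < q" for f j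
    using assms injective_indices_less that by auto
  have i: "integrable (pow M q) (\<lambda>x. \<Prod>j<q. indicat_real (A (f j)) (x j))"
    if "f \<in> injective_indices q N" for f
    using s[OF that] by (intro product_integrable_prod) (auto simp: integrable_real_indicator less_top[symmetric])
  have e: "(\<integral>x. (\<Prod>j<q. indicat_real (A (f j)) (x j)) \<partial>pow M q) = (\<Prod>j<q. measure M (A (f j)))"
    if "f \<in> injective_indices q N" for f
    using s[OF that] by (subst product_integral_prod) (auto simp: integrable_real_indicator less_top[symmetric])
  show "integrable (pow M q) (simple_kernel q N A a)"
    unfolding simple_kernel_def using i by (intro Bochner_Integration.integrable_sum integrable_mult_right)
  show "(\<integral>x. simple_kernel q N A a x \<partial>pow M q) =
      (\<Sum>f\<in>injective_indices q N. a f * (\<Prod>j<q. measure M (A (f j))))"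
    unfolding simple_kernel_def using i e
    by (subst Bochner_Integration.integral_sum) (auto intro!: integrable_mult_right sum.cong)
qed

lemma integral_simple_kernel_square:
  assumes "disjoint_family_on A {..<N}" "\<And>r. r < N \<Longrightarrow> A r \<in> sets M"
  shows "square_integrable (pow M q) (simple_kernel q N A a)"
    and "(\<integral>x. (simple_kernel q N A a x)\<^sup>2 \<partial>pow M q) = coeff_norm2 q N (\<lambda>r. measure M (A r)) a"
  unfolding square_integrable_def simple_kernel_square[OF assms(1)]
  using integral_simple_kernel[of N A q] simple_kernel_measurable[of N A] assms(2) by (auto simp: coeff_norm2_def)

text \<open>The product of indicators splits into the factors of the first \<open>i\<close>
  coordinates and those of the others; the latter integrate to a product of masses.\<close>

lemma projected_simple_kernel:
  assumes ik: "i \<le> k" and A: "\<And>r. r < N \<Longrightarrow> A r \<in> sets M"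
  shows "projected_kernel M k (simple_kernel k N A a) i x =
    simple_kernel i N A (projected_coeff k N (\<lambda>r. measure M (A r)) a i) x"
proof -
  interpret product_sigma_finite "\<lambda>_ :: nat. M" by (rule product_sigma_finite_const)
  have s: "A (f j) \<in> sets M" if "f \<in> injective_indices k N" "j < k" for f j
    using A injective_indices_less that by auto
  let ?P = "\<lambda>f y. \<Prod>j<k - i. indicat_real (A (f (i + j))) (y j)"
  have split: "(\<Prod>j<k. indicat_real (A (f j)) (append_tuple i (k - i) x y j)) =
    (\<Prod>j<i. indicator (A (f j)) (x j)) * ?P f y" for f y
  proof -
    have "(\<Prod>j<k. indicat_real (A (f j)) (append_tuple i (k - i) x y j)) =
      (\<Prod>j\<in>{..<i} \<union> {i..<k}. indicat_real (A (f j)) (append_tuple i (k - i) x y j))"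
      using ik by (intro prod.cong) auto
    also have "\<dots> = (\<Prod>j<i. indicat_real (A (f j)) (append_tuple i (k - i) x y j)) *
       (\<Prod>j\<in>{i..<k}. indicat_real (A (f j)) (append_tuple i (k - i) x y j))"
      by (rule prod.union_disjoint) auto
    also have "(\<Prod>j<i. indicat_real (A (f j)) (append_tuple i (k - i) x y j)) = (\<Prod>j<i. indicator (A (f j)) (x j))"
      using ik by (intro prod.cong) (auto simp: append_tuple_def)
    also have "(\<Prod>j\<in>{i..<k}. indicat_real (A (f j)) (append_tuple i (k - i) x y j)) = ?P f y"
      by (rule prod.reindex_bij_witness[of _ "\<lambda>j. i + j" "\<lambda>j. j - i"]) (auto simp: append_tuple_def)
    finally show ?thesis .
  qed
  have i: "integrable (pow M (k - i)) (?P f)" if "f \<in> injective_indices k N" for f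
    using s[OF that] by (intro product_integrable_prod) (auto simp: integrable_real_indicator less_top[symmetric])
  have e: "(\<integral>y. ?P f y \<partial>pow M (k - i)) = (\<Prod>j\<in>{i..<k}. measure M (A (f j)))"
    if "f \<in> injective_indices k N" for f
  proof -
    have "(\<integral>y. ?P f y \<partial>pow M (k - i)) = (\<Prod>j<k - i. measure M (A (f (i + j))))"
      using s[OF that] by (subst product_integral_prod) (auto simp: integrable_real_indicator less_top[symmetric])
    also have "\<dots> = (\<Prod>j\<in>{i..<k}. measure M (A (f j)))"
      by (rule prod.reindex_bij_witness[of _ "\<lambda>j. j - i" "\<lambda>j. i + j"]) auto
    finally show ?thesis .
  qed
  have "(\<integral>y. simple_kernel k N A a (append_tuple i (k - i) x y) \<partial>pow M (k - i)) =
    (\<integral>y. (\<Sum>f\<in>injective_indices k N. a f * (\<Prod>j<i. indicator (A (f j)) (x j)) * ?P f y) \<partial>pow M (k - i))"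
    by (simp only: simple_kernel_def split mult.assoc)
  also have "\<dots> = (\<Sum>f\<in>injective_indices k N. a f * (\<Prod>j<i. indicator (A (f j)) (x j)) * (\<Prod>j\<in>{i..<k}. measure M (A (f j))))"
    using i e by (subst Bochner_Integration.integral_sum) (auto intro!: integrable_mult_right sum.cong)
  finally show ?thesis
    unfolding projected_kernel_def simple_kernel_off_diagonal_sum[of i]
    by (subst off_diagonal_sum_projected[OF ik]) simp
qed

lemma projected_kernel_measurable [measurable]:
  assumes ik: "i \<le> k" and [measurable]: "h \<in> borel_measurable (pow M k)"
  shows "projected_kernel M k h i \<in> borel_measurable (pow M i)"
proof -
  interpret I: finite_measure "pow M (k - i)" by (rule finite_power_measure)
  note [measurable] = append_tuple_measurable[OF ik]
  have "(\<lambda>p. h ((\<lambda>(x, y). append_tuple i (k - i) x y) p)) \<in> borel_measurable (pow M i \<Otimes>\<^sub>M pow M (k - i))"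
    by measurable
  then have "(\<lambda>x. \<integral>y. h (append_tuple i (k - i) x y) \<partial>pow M (k - i)) \<in> borel_measurable (pow M i)"
    by (intro I.borel_measurable_lebesgue_integral) (simp add: split_beta')
  then show ?thesis unfolding projected_kernel_def by measurable
qed

lemma append_tuple_section_measurable:
  assumes ik: "i \<le> k" and [measurable]: "h \<in> borel_measurable (pow M k)" and x: "x \<in> space (pow M i)"
  shows "(\<lambda>y. h (append_tuple i (k - i) x y)) \<in> borel_measurable (pow M (k - i))"
proof -
  have "(\<lambda>y. (x, y)) \<in> pow M (k - i) \<rightarrow>\<^sub>M pow M i \<Otimes>\<^sub>M pow M (k - i)"
    using x by simp
  from measurable_compose[OF this measurable_compose[OF append_tuple_measurable[OF ik] assms(2)]]
  show ?thesis by simp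
qed

text \<open>Where the section of \<open>f - g\<close> is not square integrable the right-hand side is infinite, so it is
  enough that the sections of \<open>g\<close> are.\<close>

lemma projected_kernel_diff_bound:
  assumes ik: "i \<le> k" and [measurable]: "f \<in> borel_measurable (pow M k)" "g \<in> borel_measurable (pow M k)"
    and g: "\<And>x. \<bar>g x\<bar> \<le> b"
  shows "nn_dist2 (pow M i) (projected_kernel M k g i) (projected_kernel M k f i) \<le>
    ennreal ((real (k choose i))\<^sup>2 * measure M (space M) ^ (k - i)) * nn_dist2 (pow M k) g f"
proof -
  interpret I: finite_measure "pow M (k - i)" by (rule finite_power_measure)
  let ?c = "(real (k choose i))\<^sup>2 * measure M (space M) ^ (k - i)"
  have pt: "ennreal ((projected_kernel M k g i x - projected_kernel M k f i x)\<^sup>2) \<le>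
     ennreal ?c * (\<integral>\<^sup>+y. ennreal ((g (append_tuple i (k - i) x y) - f (append_tuple i (k - i) x y))\<^sup>2) \<partial>pow M (k - i))"
    if x: "x \<in> space (pow M i)" for x
  proof -
    let ?u = "\<lambda>y. f (append_tuple i (k - i) x y)" and ?v = "\<lambda>y. g (append_tuple i (k - i) x y)"
    let ?J = "nn_dist2 (pow M (k - i)) ?v ?u"
    have [measurable]: "?u \<in> borel_measurable (pow M (k - i))" "?v \<in> borel_measurable (pow M (k - i))"
      by (intro append_tuple_section_measurable[OF ik _ x] assms)+
    show ?thesis
    proof (cases "?J = \<infinity>")
      case True
      show ?thesis
      \<comment> \<open>If the constant is positive the right-hand side is infinite. If it is zero,
        the total mass is zero and at least one variable is integrated out, so the section lives on
        a null space and \<open>?J\<close> cannot be infinite.\<close>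
      proof (cases "?c = 0")
        case True
        then have "measure M (space M) = 0 \<and> k - i \<noteq> 0" using ik by auto
        then have "emeasure (pow M (k - i)) (space (pow M (k - i))) = 0"
          using measure_power_space[of "k - i"] by (simp add: I.emeasure_eq_measure)
        then have null: "space (pow M (k - i)) \<in> null_sets (pow M (k - i))" by auto
        have "AE y in pow M (k - i). ennreal ((?v y - ?u y)\<^sup>2) = 0"
          by (rule AE_I'[OF null]) auto
        then have "?J = 0" by (subst nn_integral_0_iff_AE) auto
        with \<open>?J = \<infinity>\<close> show ?thesis by simp
      next
        case False
        moreover have "0 \<le> ?c" by simp
        ultimately have "ennreal ?c \<noteq> 0" unfolding ennreal_eq_0_iff by linarith
        then have "ennreal ?c * ?J = top" using True by (metis ennreal_mult_eq_top_iff infinity_ennreal_def)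
        then show ?thesis by (simp only: top_greatest)
      qed
    next
      case False
      then have d: "square_integrable (pow M (k - i)) (\<lambda>y. ?v y - ?u y)"
        unfolding square_integrable_iff_nn_integral by (auto simp: less_top)
      have v: "integrable (pow M (k - i)) ?v"
        by (rule I.integrable_const_bound[of _ b]) (use g in auto)
      have "integrable (pow M (k - i)) (\<lambda>y. ?v y - ?u y)"
        using I.square_integrable_imp_integrable d unfolding square_integrable_def by blast
      from Bochner_Integration.integrable_diff[OF v this] have u: "integrable (pow M (k - i)) ?u" by simp
      have "(projected_kernel M k g i x - projected_kernel M k f i x)\<^sup>2 =
        (real (k choose i))\<^sup>2 * (\<integral>y. ?v y - ?u y \<partial>pow M (k - i))\<^sup>2"
        unfolding projected_kernel_def Bochner_Integration.integral_diff[OF v u]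
        by (simp add: power2_eq_square algebra_simps)
      also have "\<dots> \<le> (real (k choose i))\<^sup>2 * (measure M (space M) ^ (k - i) * L2_dist2 (pow M (k - i)) ?v ?u)"
        using I.integral_square_le[OF d] by (intro mult_left_mono) (auto simp: measure_power_space)
      finally have "ennreal ((projected_kernel M k g i x - projected_kernel M k f i x)\<^sup>2) \<le>
        ennreal (?c * L2_dist2 (pow M (k - i)) ?v ?u)"
        by (intro ennreal_leI) (simp add: mult.assoc)
      also have "\<dots> = ennreal ?c * ?J"
        using nn_integral_square_eq[OF d] by (simp add: ennreal_mult)
      finally show ?thesis .
    qed
  qed
  have "nn_dist2 (pow M i) (projected_kernel M k g i) (projected_kernel M k f i) \<le>
    (\<integral>\<^sup>+x. ennreal ?c * (\<integral>\<^sup>+y. ennreal ((g (append_tuple i (k - i) x y) - f (append_tuple i (k - i) x y))\<^sup>2) \<partial>pow M (k - i)) \<partial>pow M i)"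
    by (intro nn_integral_mono pt)
  also have "\<dots> = ennreal ?c * (\<integral>\<^sup>+x. \<integral>\<^sup>+y. ennreal ((g (append_tuple i (k - i) x y) - f (append_tuple i (k - i) x y))\<^sup>2) \<partial>pow M (k - i) \<partial>pow M i)"
  proof (rule nn_integral_cmult)
    have "(\<lambda>p. (\<lambda>x. ennreal ((g x - f x)\<^sup>2)) ((\<lambda>(x, y). append_tuple i (k - i) x y) p)) \<in>
      borel_measurable (pow M i \<Otimes>\<^sub>M pow M (k - i))"
      by (rule measurable_compose[OF append_tuple_measurable[OF ik]]) simp
    then show "(\<lambda>x. \<integral>\<^sup>+y. ennreal ((g (append_tuple i (k - i) x y) - f (append_tuple i (k - i) x y))\<^sup>2) \<partial>pow M (k - i))
      \<in> borel_measurable (pow M i)"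
      by (intro I.borel_measurable_nn_integral) (simp add: split_beta')
  qed
  also have "\<dots> = ennreal ?c * nn_dist2 (pow M k) g f"
    by (subst nn_integral_append_tuple[OF ik]) auto
  finally show ?thesis .
qed

lemma integral_append_tuple:
  fixes f :: "(nat \<Rightarrow> 'a) \<Rightarrow> real"
  assumes ik: "i \<le> k" and f: "integrable (pow M k) f"
  shows "(\<integral>x. \<integral>y. f (append_tuple i (k - i) x y) \<partial>pow M (k - i) \<partial>pow M i) = (\<integral>x. f x \<partial>pow M k)"
proof -
  interpret I: finite_measure "pow M i" by (rule finite_power_measure)
  interpret J: finite_measure "pow M (k - i)" by (rule finite_power_measure)
  interpret pair_sigma_finite "pow M i" "pow M (k - i)" ..
  note D = distr_append_tuple[OF ik] and m = append_tuple_measurable[OF ik]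
  have "integrable (pow M i \<Otimes>\<^sub>M pow M (k - i)) (\<lambda>p. f ((\<lambda>(x, y). append_tuple i (k - i) x y) p))"
    by (rule integrable_distr[OF m]) (simp only: D f)
  from integral_fst'[OF this] integral_distr[OF m borel_measurable_integrable[OF f]] show ?thesis by (simp add: D)
qed

end

lemma integral_power_measure_0:
  fixes f :: "(nat \<Rightarrow> 'a) \<Rightarrow> real"
  shows "(\<integral>x. f x \<partial>pow M 0) = f (\<lambda>_. undefined)"
  by (simp add: PiM_empty lebesgue_integral_count_space_finite)

lemma power_measure_scale:
  assumes "finite_measure M"
  shows "pow (scale_measure (ennreal t) M) n = scale_measure (ennreal t ^ n) (pow M n)"
proof -
  have fm: "finite_measure (scale_measure (ennreal t) M)"
    using assms by (auto intro!: finite_measureI simp: finite_measure.emeasure_eq_measure ennreal_mult_eq_top_iff space_scale_measure)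
  show ?thesis
  proof (rule finite_measure.power_measure_eqI[OF fm, symmetric])
    show "sets (scale_measure (ennreal t ^ n) (pow M n)) = sets (pow (scale_measure (ennreal t) M) n)"
      by (auto intro!: sets_PiM_cong)
    fix A assume "\<And>j. j < n \<Longrightarrow> A j \<in> sets (scale_measure (ennreal t) M)"
    then show "emeasure (scale_measure (ennreal t ^ n) (pow M n)) (PiE {..<n} A) =
      (\<Prod>j<n. emeasure (scale_measure (ennreal t) M) (A j))"
      using finite_measure.emeasure_power_rectangle[OF assms, of n A] by (simp add: prod.distrib)
  qed
qed

section \<open>Multiple integrals as limits of simple integrals\<close>

lemma simple_kernel_refinement:
  assumes C: "disjoint_family_on C {..<K::nat}"
    and A: "\<And>i. i < (N::nat) \<Longrightarrow> A i = (\<Union>r\<in>{r. r < K \<and> u r = i}. C r)"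
  shows "simple_kernel q N A a x = simple_kernel q K C (refined_coeff q N u a) x"
  unfolding simple_kernel_off_diagonal_sum
  by (rule off_diagonal_sum_refine) (rule indicator_refinement[OF C A])

lemma simple_kernel_linear:
  "u * simple_kernel q N A a x + v * simple_kernel q N A b x =
     simple_kernel q N A (\<lambda>f. u * a f + v * b f) x"
  unfolding simple_kernel_off_diagonal_sum by (rule off_diagonal_sum_linear)

lemma simple_integral_linear:
  "u * simple_integral W q N A a w + v * simple_integral W q N A b w =
     simple_integral W q N A (\<lambda>f. u * a f + v * b f) w"
  unfolding simple_integral_off_diagonal_sum by (rule off_diagonal_sum_linear)

lemma simple_kernel_combination:
  assumes "disjoint_family_on A {..<N::nat}" "\<And>i. i < N \<Longrightarrow> A i \<in> sets M"
    and "disjoint_family_on A' {..<N'::nat}" "\<And>i. i < N' \<Longrightarrow> A' i \<in> sets M"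
  obtains K C c where "disjoint_family_on C {..<K::nat}" "\<And>r. r < K \<Longrightarrow> C r \<in> sets M"
    "\<And>x. simple_kernel q K C c x = v * simple_kernel q N A a x + b * simple_kernel q N' A' a' x"
proof -
  obtain K C u u' where C: "disjoint_family_on C {..<K::nat}" "\<forall>r<K. C r \<in> sets M"
    and A: "\<forall>i<N. A i = (\<Union>r\<in>{r. r < K \<and> u r = i}. C r)"
    and A': "\<forall>i<N'. A' i = (\<Union>r\<in>{r. r < K \<and> u' r = i}. C r)"
    by (rule refinement[OF assms])
  note C = C(1) C(2)[rule_format] and A = A[rule_format] and A' = A'[rule_format]
  show ?thesis
    using simple_kernel_refinement[OF C(1) A] simple_kernel_refinement[OF C(1) A']
    by (intro that[OF C, of "\<lambda>f. v * refined_coeff q N u a f + b * refined_coeff q N' u' a' f"])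
      (simp_all add: simple_kernel_linear)
qed

text \<open>The kernel half of \<open>is_multiple_integral\<close>, separated from the noise so that
  one sequence can serve Poisson noises of all intensities and Gaussian noises alike. Finiteness of
  the masses is automatic for the finite measures in question.\<close>

definition kernel_approximation ::
  "'z measure \<Rightarrow> nat \<Rightarrow> (nat \<Rightarrow> nat) \<Rightarrow> (nat \<Rightarrow> nat \<Rightarrow> 'z set) \<Rightarrow> (nat \<Rightarrow> (nat \<Rightarrow> nat) \<Rightarrow> real) \<Rightarrow>
     ((nat \<Rightarrow> 'z) \<Rightarrow> real) \<Rightarrow> bool" where
  "kernel_approximation \<mu> q N A a f \<longleftrightarrow>
     (\<forall>m. disjoint_family_on (A m) {..<N m} \<and> (\<forall>i<N m. A m i \<in> sets \<mu>)) \<and>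
     L2_tendsto (pow \<mu> q) (\<lambda>m. simple_kernel q (N m) (A m) (a m)) f"

lemma L2_tendsto_integral_square_diff:
  assumes s: "\<And>m. square_integrable M (s m)" "square_integrable M f" "L2_tendsto M s f" and g: "square_integrable M g"
  shows "(\<lambda>m. L2_dist2 M (s m) g) \<longlonglongrightarrow> (L2_dist2 M f g)"
proof -
  have [measurable]: "s m \<in> borel_measurable M" "f \<in> borel_measurable M" "g \<in> borel_measurable M" for m
    using s g by (auto simp: square_integrable_def)
  have "L2_tendsto M (\<lambda>m x. s m x + (-1) * g x) (\<lambda>x. f x + (-1) * g x)"
    using s(3) by (intro L2_tendsto_add L2_tendsto_const) auto
  then have "L2_tendsto M (\<lambda>m x. s m x - g x) (\<lambda>x. f x - g x)" by simp
  from L2_tendsto_inner[OF square_integrable_diff[OF s(1) g] square_integrable_diff[OF s(2) g] this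
      square_integrable_diff[OF s(1) g] square_integrable_diff[OF s(2) g] this]
  show ?thesis by (simp add: power2_eq_square)
qed

lemma (in finite_measure) kernel_approximation_square_integrable:
  assumes "kernel_approximation M q N A a f" "f \<in> borel_measurable (pow M q)"
  shows "square_integrable (pow M q) f"
    "square_integrable (pow M q) (simple_kernel q (N m) (A m) (a m))"
proof -
  have s: "square_integrable (pow M q) (simple_kernel q (N m) (A m) (a m))" for m
    using assms(1) by (intro integral_simple_kernel_square) (auto simp: kernel_approximation_def)
  show "square_integrable (pow M q) f"
    by (rule L2_tendsto_square_integrable[OF s assms(2) conjunct2[OF assms(1)[unfolded kernel_approximation_def]]])
  show "square_integrable (pow M q) (simple_kernel q (N m) (A m) (a m))" by (rule s)
qed

context centered_noise begin

lemma simple_integral_square_integrable: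
  assumes A: "disjoint_family_on A {..<N::nat}" "\<And>i. i < N \<Longrightarrow> A i \<in> sets \<mu>"
  shows "square_integrable P (simple_integral W q N A a)"
  unfolding square_integrable_def power2_eq_square
  by (intro conjI simple_integral_measurable simple_integral_covariance(1) A)

text \<open>Over a common refinement the difference is a single simple integral, to which the second
  moment bound applies. This makes integrals of convergent kernels Cauchy and their limits
  independent of the approximation.\<close>

lemma simple_integral_diff_bound:
  assumes A: "disjoint_family_on A {..<N::nat}" "\<And>i. i < N \<Longrightarrow> A i \<in> sets \<mu>"
    and A': "disjoint_family_on A' {..<N'::nat}" "\<And>i. i < N' \<Longrightarrow> A' i \<in> sets \<mu>"
  shows "L2_dist2 P (simple_integral W q N A a) (simple_integral W q N' A' a') \<le>
    fact q * L2_dist2 (pow \<mu> q) (simple_kernel q N A a) (simple_kernel q N' A' a')"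
proof -
  obtain K C u u' where C: "disjoint_family_on C {..<K::nat}" "\<forall>r<K. C r \<in> sets \<mu>"
    and R: "\<forall>i<N. A i = (\<Union>r\<in>{r. r < K \<and> u r = i}. C r)"
    and R': "\<forall>i<N'. A' i = (\<Union>r\<in>{r. r < K \<and> u' r = i}. C r)"
    by (rule refinement[OF assms])
  note C = C(1) C(2)[rule_format] and R = R[rule_format] and R' = R'[rule_format]
  define c where "c = (\<lambda>f. 1 * refined_coeff q N u a f + (-1) * refined_coeff q N' u' a' f)"
  have k: "simple_kernel q N A a x - simple_kernel q N' A' a' x = simple_kernel q K C c x" for x
    unfolding c_def simple_kernel_linear[symmetric]
    using simple_kernel_refinement[OF C(1) R] simple_kernel_refinement[OF C(1) R'] by simp
  have e1: "AE w in P. simple_integral W q N A a w = simple_integral W q K C (refined_coeff q N u a) w"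
    by (rule noise_refinement[OF C R])
  have e2: "AE w in P. simple_integral W q N' A' a' w = simple_integral W q K C (refined_coeff q N' u' a') w"
    by (rule noise_refinement[OF C R'])
  have "AE w in P. simple_integral W q N A a w - simple_integral W q N' A' a' w = simple_integral W q K C c w"
    using e1 e2 unfolding c_def simple_integral_linear[symmetric] by eventually_elim simp
  then have "L2_dist2 P (simple_integral W q N A a) (simple_integral W q N' A' a') =
    (\<integral>w. (simple_integral W q K C c w)\<^sup>2 \<partial>P)"
    using A A' C by (intro integral_cong_AE) (auto intro!: borel_measurable_power borel_measurable_diff simple_integral_measurable)
  also have "\<dots> \<le> fact q * coeff_norm2 q K (\<lambda>r. measure \<mu> (C r)) c"
    using C by (intro simple_integral_bound) auto
  also have "\<dots> = fact q * L2_dist2 (pow \<mu> q) (simple_kernel q N A a) (simple_kernel q N' A' a')"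
    unfolding k using C by (subst \<mu>.integral_simple_kernel_square(2)) auto
  finally show ?thesis .
qed

lemma approximation_integrals_converge:
  assumes f: "f \<in> borel_measurable (pow \<mu> q)" and a: "kernel_approximation \<mu> q N A a f"
  obtains Y where "square_integrable P Y" "L2_tendsto P (\<lambda>m. simple_integral W q (N m) (A m) (a m)) Y"
proof (rule P.L2_complete)
  note A = a[unfolded kernel_approximation_def]
  note sq = \<mu>.kernel_approximation_square_integrable[OF a f]
  let ?k = "\<lambda>m. simple_kernel q (N m) (A m) (a m)" and ?M = "pow \<mu> q"
  show "square_integrable P (simple_integral W q (N m) (A m) (a m))" for m
    using A by (intro simple_integral_square_integrable) auto
  fix e :: real assume "e > 0"
  have "(\<lambda>m. L2_dist2 ?M (?k m) f) \<longlonglongrightarrow> 0"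
    using A sq by (subst L2_tendsto_iff[symmetric]) auto
  \<comment> \<open>The 4 leaves room for two distances to \<open>f\<close>, each doubled by
    \<open>(a + b)^2 <= 2 a^2 + 2 b^2\<close>.\<close>
  then have "\<forall>\<^sub>F m in sequentially. (L2_dist2 ?M (?k m) f) < e / (4 * fact q)"
    using \<open>e > 0\<close> by (intro order_tendstoD) auto
  then obtain m0 where m0: "\<And>m. m \<ge> m0 \<Longrightarrow> (L2_dist2 ?M (?k m) f) < e / (4 * fact q)"
    by (auto simp: eventually_sequentially)
  show "\<exists>m0. \<forall>m\<ge>m0. \<forall>n\<ge>m0. (L2_dist2 P (simple_integral W q (N m) (A m) (a m)) (simple_integral W q (N n) (A n) (a n))) < e"
  proof (intro exI allI impI)
    fix m n assume mn: "m \<ge> m0" "n \<ge> m0"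
    note d = square_integrable_diff[OF sq(2)[of m] sq(1)] square_integrable_diff[OF sq(2)[of n] sq(1)]
    have "L2_dist2 ?M (?k m) (?k n) \<le> (\<integral>x. 2 * (?k m x - f x)\<^sup>2 + 2 * (?k n x - f x)\<^sup>2 \<partial>?M)"
    proof (rule integral_mono)
      show "integrable ?M (\<lambda>x. (?k m x - ?k n x)\<^sup>2)"
        using square_integrable_diff[OF sq(2) sq(2)] by (rule square_integrable_integrable)
      show "integrable ?M (\<lambda>x. 2 * (?k m x - f x)\<^sup>2 + 2 * (?k n x - f x)\<^sup>2)"
        using d[THEN square_integrable_integrable] by simp
      show "(?k m x - ?k n x)\<^sup>2 \<le> 2 * (?k m x - f x)\<^sup>2 + 2 * (?k n x - f x)\<^sup>2" for x
        using square_add_le[of "?k m x - f x" "f x - ?k n x"] by (simp add: power2_commute)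
    qed
    also have "\<dots> = 2 * L2_dist2 ?M (?k m) f + 2 * L2_dist2 ?M (?k n) f"
      using d[THEN square_integrable_integrable] by simp
    also have "\<dots> < e / fact q" using m0[OF mn(1)] m0[OF mn(2)] by (simp add: field_simps)
    finally have "fact q * L2_dist2 ?M (?k m) (?k n) < e" by (simp add: field_simps)
    then show "L2_dist2 P (simple_integral W q (N m) (A m) (a m)) (simple_integral W q (N n) (A n) (a n)) < e"
      using A simple_integral_diff_bound[of "A m" "N m" "A n" "N n" q "a m" "a n"] by auto
  qed
qed

text \<open>Two approximations of the same kernel approach each other in L2, hence by
  \<open>simple_integral_diff_bound\<close> their integrals do so too.\<close>

lemma approximation_integrals_unique:
  assumes f: "f \<in> borel_measurable (pow \<mu> q)"
    and a: "kernel_approximation \<mu> q N A a f" and Y: "L2_tendsto P (\<lambda>m. simple_integral W q (N m) (A m) (a m)) Y"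
    and [measurable]: "Y \<in> borel_measurable P"
    and b: "kernel_approximation \<mu> q N' A' b f"
  shows "L2_tendsto P (\<lambda>m. simple_integral W q (N' m) (A' m) (b m)) Y"
proof -
  note A = a[unfolded kernel_approximation_def] and B = b[unfolded kernel_approximation_def]
  note sqa = \<mu>.kernel_approximation_square_integrable[OF a f] and sqb = \<mu>.kernel_approximation_square_integrable[OF b f]
  let ?k = "\<lambda>m. simple_kernel q (N m) (A m) (a m)" and ?l = "\<lambda>m. simple_kernel q (N' m) (A' m) (b m)"
  let ?I = "\<lambda>m. simple_integral W q (N m) (A m) (a m)" and ?J = "\<lambda>m. simple_integral W q (N' m) (A' m) (b m)"
  let ?M = "pow \<mu> q"
  have [measurable]: "?k m \<in> borel_measurable ?M" "?l m \<in> borel_measurable ?M" "f \<in> borel_measurable ?M" for m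
    using sqa sqb by (auto simp: square_integrable_def)
  have I: "square_integrable P (?I m)" "square_integrable P (?J m)" for m
    using A B by (auto intro!: simple_integral_square_integrable)
  then have [measurable]: "?I m \<in> borel_measurable P" "?J m \<in> borel_measurable P" for m
    by (auto simp: square_integrable_def)
  have "L2_tendsto ?M (\<lambda>m x. ?l m x + (-1) * ?k m x) (\<lambda>x. f x + (-1) * f x)"
    using A B by (intro L2_tendsto_add L2_tendsto_cmult) auto
  then have "L2_tendsto ?M (\<lambda>m x. ?l m x - ?k m x) (\<lambda>x. 0)" by simp
  then have "(\<lambda>m. L2_dist2 ?M (?l m) (?k m)) \<longlonglongrightarrow> 0"
    using L2_tendsto_iff[OF square_integrable_diff[OF sqb(2) sqa(2)] square_integrable_zero] by simp
  then have lim: "(\<lambda>m. fact q * L2_dist2 ?M (?l m) (?k m)) \<longlonglongrightarrow> 0"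
    using tendsto_mult_right_zero by blast
  have "(\<lambda>m. L2_dist2 P (?J m) (?I m)) \<longlonglongrightarrow> 0"
  proof (rule tendsto_sandwich[OF _ _ tendsto_const lim])
    show "\<forall>\<^sub>F m in sequentially. (L2_dist2 P (?J m) (?I m)) \<le> fact q * L2_dist2 ?M (?l m) (?k m)"
      using A B by (intro always_eventually allI simple_integral_diff_bound) auto
  qed simp
  then have "(\<lambda>m. nn_dist2 P (?J m) (?I m)) \<longlonglongrightarrow> 0"
    using nn_integral_square_eq[OF square_integrable_diff[OF I(2) I(1)]] tendsto_ennrealI by fastforce
  then show ?thesis by (intro L2_tendsto_triangle[OF _ _ _ Y]) auto
qed

text \<open>\<open>multiple_integral\<close> is selected by \<open>SOME\<close> through an unknown
  approximating sequence. Existence makes the selection meaningful, and uniqueness transfers its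
  defining limit to any prescribed sequence; every later property of the integral is derived from
  this limit.\<close>

lemma multiple_integral_limit:
  assumes f: "f \<in> borel_measurable (pow \<mu> q)" and a: "kernel_approximation \<mu> q N A a f"
  shows "square_integrable P (multiple_integral P \<mu> W q f)"
    and "L2_tendsto P (\<lambda>m. simple_integral W q (N m) (A m) (a m)) (multiple_integral P \<mu> W q f)"
proof -
  obtain Y where Y: "square_integrable P Y" "L2_tendsto P (\<lambda>m. simple_integral W q (N m) (A m) (a m)) Y"
    using approximation_integrals_converge[OF f a] .
  have "is_multiple_integral P \<mu> W q f Y"
    unfolding is_multiple_integral_def using Y a
    by (auto simp: kernel_approximation_def less_top[symmetric] intro!: exI[of _ N] exI[of _ A] exI[of _ a])
  then have "is_multiple_integral P \<mu> W q f (multiple_integral P \<mu> W q f)"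
    unfolding multiple_integral_def by (rule someI[of "is_multiple_integral P \<mu> W q f"])
  then obtain N' A' b where b: "square_integrable P (multiple_integral P \<mu> W q f)"
    "kernel_approximation \<mu> q N' A' b f"
    "L2_tendsto P (\<lambda>m. simple_integral W q (N' m) (A' m) (b m)) (multiple_integral P \<mu> W q f)"
    unfolding is_multiple_integral_def kernel_approximation_def by blast
  show "square_integrable P (multiple_integral P \<mu> W q f)" by fact
  show "L2_tendsto P (\<lambda>m. simple_integral W q (N m) (A m) (a m)) (multiple_integral P \<mu> W q f)"
    using approximation_integrals_unique[OF f b(2,3) _ a] b(1) by (auto simp: square_integrable_def)
qed

lemma multiple_integral_distance:
  assumes f: "f \<in> borel_measurable (pow \<mu> q)" and a: "kernel_approximation \<mu> q N A a f"
    and B: "disjoint_family_on B {..<K::nat}" "\<And>i. i < K \<Longrightarrow> B i \<in> sets \<mu>"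
  shows "(\<integral>w. (multiple_integral P \<mu> W q f w - simple_integral W q K B b w)\<^sup>2 \<partial>P) \<le>
    fact q * L2_dist2 (pow \<mu> q) f (simple_kernel q K B b)"
proof (rule LIMSEQ_le)
  note A = a[unfolded kernel_approximation_def]
  note sq = \<mu>.kernel_approximation_square_integrable[OF a f]
  show "(\<lambda>m. L2_dist2 P (simple_integral W q (N m) (A m) (a m)) (simple_integral W q K B b)) \<longlonglongrightarrow>
    (\<integral>w. (multiple_integral P \<mu> W q f w - simple_integral W q K B b w)\<^sup>2 \<partial>P)"
    using A B by (intro L2_tendsto_integral_square_diff multiple_integral_limit[OF f a] simple_integral_square_integrable) auto
  show "(\<lambda>m. fact q * L2_dist2 (pow \<mu> q) (simple_kernel q (N m) (A m) (a m)) (simple_kernel q K B b)) \<longlonglongrightarrow>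
    fact q * L2_dist2 (pow \<mu> q) f (simple_kernel q K B b)"
    using A B sq by (intro tendsto_mult tendsto_const L2_tendsto_integral_square_diff \<mu>.integral_simple_kernel_square) auto
  show "\<exists>n0. \<forall>m\<ge>n0. (L2_dist2 P (simple_integral W q (N m) (A m) (a m)) (simple_integral W q K B b)) \<le>
    fact q * L2_dist2 (pow \<mu> q) (simple_kernel q (N m) (A m) (a m)) (simple_kernel q K B b)"
    using A B by (intro exI allI impI simple_integral_diff_bound) auto
qed

lemma multiple_integral_second_moment:
  assumes f: "f \<in> borel_measurable (pow \<mu> q)" and a: "kernel_approximation \<mu> q N A a f"
    and sym: "\<And>m. symmetric_coeff q (N m) (a m)"
  shows "(\<integral>w. (multiple_integral P \<mu> W q f w)\<^sup>2 \<partial>P) = fact q * (\<integral>x. (f x)\<^sup>2 \<partial>pow \<mu> q)"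
proof (rule LIMSEQ_unique)
  note A = a[unfolded kernel_approximation_def]
  note sq = \<mu>.kernel_approximation_square_integrable[OF a f]
  have s: "square_integrable P (simple_integral W q (N m) (A m) (a m))" for m
    using A by (intro simple_integral_square_integrable) auto
  note l = multiple_integral_limit[OF f a]
  show "(\<lambda>m. \<integral>w. (simple_integral W q (N m) (A m) (a m) w)\<^sup>2 \<partial>P) \<longlonglongrightarrow>
    (\<integral>w. (multiple_integral P \<mu> W q f w)\<^sup>2 \<partial>P)"
    using L2_tendsto_inner[OF s l s l] by (simp add: power2_eq_square)
  have e: "(\<integral>w. (simple_integral W q (N m) (A m) (a m) w)\<^sup>2 \<partial>P) =
     fact q * (\<integral>x. (simple_kernel q (N m) (A m) (a m) x)\<^sup>2 \<partial>pow \<mu> q)" for m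
    using A sym by (subst simple_integral_isometry, simp, simp, simp, subst \<mu>.integral_simple_kernel_square(2)) auto
  show "(\<lambda>m. \<integral>w. (simple_integral W q (N m) (A m) (a m) w)\<^sup>2 \<partial>P) \<longlonglongrightarrow>
    fact q * (\<integral>x. (f x)\<^sup>2 \<partial>pow \<mu> q)"
    unfolding e using L2_tendsto_inner[OF sq(2) sq(1) _ sq(2) sq(1)] A
    by (intro tendsto_mult tendsto_const) (simp add: power2_eq_square)
qed

end

section \<open>Partitions of vanishing mesh and density of simple kernels\<close>

text \<open>The cells need not separate the points of the space, which may be far from second countable; nested
  partitions of vanishing mesh are all that is needed for the diagonals to be negligible.\<close>

locale partitioned_measure = finite_measure M for M :: "'z measure" +
  fixes cell :: "nat \<Rightarrow> 'z \<Rightarrow> nat" and K :: "nat \<Rightarrow> nat" and \<epsilon> :: "nat \<Rightarrow> real"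
  assumes cell_measurable [measurable]: "cell n \<in> M \<rightarrow>\<^sub>M count_space UNIV"
    and cell_less: "z \<in> space M \<Longrightarrow> cell n z < K n"
    and cell_refine: "y \<in> space M \<Longrightarrow> z \<in> space M \<Longrightarrow> cell (Suc n) y = cell (Suc n) z \<Longrightarrow> cell n y = cell n z"
    and cell_small: "measure M {z \<in> space M. cell n z = c} \<le> \<epsilon> n"
    and mesh_tendsto: "\<epsilon> \<longlonglongrightarrow> 0"
begin

definition part :: "nat \<Rightarrow> nat \<Rightarrow> 'z set" where "part n c = {z \<in> space M. cell n z = c}"

text \<open>A measurable inner substitute for the set of tuples with distinct coordinates. It
  increases with the level, and in the limit it has full measure.\<close>

definition separated :: "nat \<Rightarrow> nat \<Rightarrow> (nat \<Rightarrow> 'z) set" where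
  "separated q n = {x \<in> space (pow M q). inj_on (\<lambda>j. cell n (x j)) {..<q}}"

lemma part_sets [measurable]: "part n c \<in> sets M"
  unfolding part_def by measurable

lemma disjoint_part: "disjoint_family_on (part n) I"
  by (auto simp: disjoint_family_on_def part_def)

lemma mesh_nonneg: "0 \<le> \<epsilon> n"
  using cell_small[of n 0] measure_nonneg order_trans by blast

lemma sum_measure_part: "(\<Sum>c<K n. measure M (part n c)) = measure M (space M)"
proof -
  have "(\<Union>c<K n. part n c) = space M" using cell_less by (auto simp: part_def)
  moreover have "measure M (\<Union>c<K n. part n c) = (\<Sum>c<K n. measure M (part n c))"
    using disjoint_part by (intro finite_measure_finite_Union) auto
  ultimately show ?thesis by simp
qed

text \<open>Controls two things at once: the measure of pairs of points in a common cell, and the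
  probability that some cell contains two Poisson points.\<close>

lemma sum_square_measure_part: "(\<Sum>c<K n. (measure M (part n c))\<^sup>2) \<le> \<epsilon> n * measure M (space M)"
proof -
  have "(\<Sum>c<K n. (measure M (part n c))\<^sup>2) \<le> (\<Sum>c<K n. \<epsilon> n * measure M (part n c))"
    using cell_small[of n] by (intro sum_mono) (auto simp: power2_eq_square part_def intro!: mult_right_mono)
  then show ?thesis by (simp add: sum_distrib_left[symmetric] sum_measure_part)
qed

lemma cell_in_space: "x \<in> space (pow M q) \<Longrightarrow> j < q \<Longrightarrow> x j \<in> space M"
  by (auto simp: space_PiM PiE_iff)

lemma separated_eq: "separated q n = (\<Union>f\<in>injective_indices q (K n). PiE {..<q} (\<lambda>j. part n (f j)))"
proof (intro equalityI subsetI)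
  fix x assume x: "x \<in> separated q n"
  define f where "f = restrict (\<lambda>j. cell n (x j)) {..<q}"
  have "f \<in> injective_indices q (K n)"
    using x cell_less cell_in_space by (auto simp: f_def injective_indices_def separated_def inj_on_def)
  moreover have "x \<in> PiE {..<q} (\<lambda>j. part n (f j))"
    using x cell_in_space by (auto simp: f_def separated_def part_def space_PiM PiE_iff)
  ultimately show "x \<in> (\<Union>f\<in>injective_indices q (K n). PiE {..<q} (\<lambda>j. part n (f j)))" by auto
next
  fix x assume "x \<in> (\<Union>f\<in>injective_indices q (K n). PiE {..<q} (\<lambda>j. part n (f j)))"
  then obtain f where f: "f \<in> injective_indices q (K n)" "x \<in> PiE {..<q} (\<lambda>j. part n (f j))" by auto
  then have "inj_on (\<lambda>j. cell n (x j)) {..<q} \<longleftrightarrow> inj_on f {..<q}"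
    by (intro inj_on_cong) (auto simp: part_def PiE_iff)
  then show "x \<in> separated q n"
    using f by (auto simp: separated_def injective_indices_def space_PiM PiE_iff part_def)
qed

lemma separated_sets [measurable]: "separated q n \<in> sets (pow M q)"
  unfolding separated_eq by (intro sets.finite_UN finite_injective_indices sets_PiM_I_finite) auto

lemma incseq_separated: "incseq (separated q)"
proof (rule incseq_SucI)
  fix n
  show "separated q n \<subseteq> separated q (Suc n)"
    using cell_refine cell_in_space unfolding separated_def inj_on_def by blast
qed

lemma prod_indicator_PiE:
  "x \<in> extensional {..<q::nat} \<Longrightarrow> (\<Prod>j<q. indicat_real (A j) (x j)) = indicator (PiE {..<q} A) x"
proof -
  assume x: "x \<in> extensional {..<q::nat}"
  show ?thesis
  proof (cases "\<forall>j<q. x j \<in> A j")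
    case True
    then show ?thesis using x by (auto simp: indicator_def PiE_iff)
  next
    case False
    then have "x \<notin> PiE {..<q} A" by auto
    moreover obtain j where "j < q" "x j \<notin> A j" using False by auto
    then have "(\<Prod>j<q. indicat_real (A j) (x j)) = 0" by (intro prod_zero bexI[of _ j]) auto
    ultimately show ?thesis by simp
  qed
qed

lemma disjoint_separated_rectangles:
  "disjoint_family_on (\<lambda>f. PiE {..<q} (\<lambda>j. part n (f j))) (injective_indices q (K n))"
    unfolding disjoint_family_on_def
  proof (intro ballI impI)
    fix f g assume *: "f \<in> injective_indices q (K n)" "g \<in> injective_indices q (K n)" "f \<noteq> g"
    show "PiE {..<q} (\<lambda>j. part n (f j)) \<inter> PiE {..<q} (\<lambda>j. part n (g j)) = {}"
    proof (rule ccontr)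
      assume "PiE {..<q} (\<lambda>j. part n (f j)) \<inter> PiE {..<q} (\<lambda>j. part n (g j)) \<noteq> {}"
      then obtain y where "y \<in> PiE {..<q} (\<lambda>j. part n (f j))" "y \<in> PiE {..<q} (\<lambda>j. part n (g j))" by blast
      then have "f j = g j" if "j < q" for j using that by (auto simp: PiE_iff part_def)
      moreover have "f j = g j" if "\<not> j < q" for j
        using * that by (auto simp: injective_indices_def PiE_iff extensional_def)
      ultimately have "f = g" by blast
      then show False using * by simp
    qed
  qed

lemma indicator_separated:
  assumes x: "x \<in> space (pow M q)"
  shows "simple_kernel q (K n) (part n) (\<lambda>_. 1) x = indicator (separated q n) x"
proof -
  have "simple_kernel q (K n) (part n) (\<lambda>_. 1) x = (\<Sum>f\<in>injective_indices q (K n). indicator (PiE {..<q} (\<lambda>j. part n (f j))) x)"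
    unfolding simple_kernel_def using x by (intro sum.cong refl) (simp add: prod_indicator_PiE space_PiM PiE_iff)
  also have "\<dots> = indicator (separated q n) x"
    unfolding separated_eq by (rule indicator_UN_disjoint[symmetric, OF _ disjoint_separated_rectangles]) simp
  finally show ?thesis .
qed

lemma measure_power_rectangle:
  assumes "\<And>j. j < q \<Longrightarrow> A j \<in> sets M"
  shows "measure (pow M q) (PiE {..<q} A) = (\<Prod>j<q. measure M (A j))"
proof (rule measure_eq_emeasure_eq_ennreal)
  show "emeasure (pow M q) (PiE {..<q} A) = ennreal (\<Prod>j<q. measure M (A j))"
    using emeasure_power_rectangle[OF assms] by (simp add: emeasure_eq_measure prod_ennreal)
qed (simp add: prod_nonneg)

text \<open>A union bound over the pairs of coordinates and the cells that both may share. For a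
  fixed pair the cells contribute the sum of squared masses times the total mass to the power
  \<open>q - 2\<close>; one more factor of the total mass comes from
  \<open>sum_square_measure_part\<close>.\<close>

lemma measure_not_separated:
  "measure (pow M q) (space (pow M q) - separated q n) \<le>
     real q * (real q * (\<epsilon> n * (measure M (space M)) ^ (q - 1)))"
proof -
  interpret Q: finite_measure "pow M q" by (rule finite_power_measure)
  define R where "R i j c = PiE {..<q} (\<lambda>l. if l = i \<or> l = j then part n c else space M)" for i j c
  have R_sets: "R i j c \<in> sets (pow M q)" for i j c
    unfolding R_def by (intro sets_PiM_I_finite) auto
  let ?m = "measure M (space M)"
  have R_meas: "measure (pow M q) (R i j c) = (measure M (part n c))\<^sup>2 * ?m ^ (q - 2)"
    if "i < q" "j < q" "i \<noteq> j" for i j c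
  proof -
    have "measure (pow M q) (R i j c) = (\<Prod>l<q. if l = i \<or> l = j then measure M (part n c) else ?m)"
      unfolding R_def by (subst measure_power_rectangle) (auto intro!: prod.cong)
    also have "\<dots> = (\<Prod>l\<in>{i, j} \<union> ({..<q} - {i, j}). if l = i \<or> l = j then measure M (part n c) else ?m)"
      using that by (intro prod.cong) auto
    also have "\<dots> = (\<Prod>l\<in>{i, j}. measure M (part n c)) * (\<Prod>l\<in>{..<q} - {i, j}. ?m)"
      by (subst prod.union_disjoint) (auto intro!: arg_cong2[where f = "(*)"] prod.cong)
    also have "card ({..<q} - {i, j}) = q - 2" using that by (subst card_Diff_subset) auto
    then have "(\<Prod>l\<in>{i, j}. measure M (part n c)) * (\<Prod>l\<in>{..<q} - {i, j}. ?m) = (measure M (part n c))\<^sup>2 * ?m ^ (q - 2)"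
      using that by (simp add: power2_eq_square)
    finally show ?thesis .
  qed
  have sub: "space (pow M q) - separated q n \<subseteq> (\<Union>i<q. \<Union>j\<in>{..<q} - {i}. \<Union>c<K n. R i j c)"
  proof
    fix x assume x: "x \<in> space (pow M q) - separated q n"
    then obtain i j where ij: "i < q" "j < q" "i \<noteq> j" "cell n (x i) = cell n (x j)"
      by (auto simp: separated_def inj_on_def)
    have "x \<in> R i j (cell n (x i))"
      using x ij by (auto simp: R_def part_def space_PiM PiE_iff)
    moreover have "cell n (x i) < K n" using x ij by (intro cell_less cell_in_space) auto
    ultimately show "x \<in> (\<Union>i<q. \<Union>j\<in>{..<q} - {i}. \<Union>c<K n. R i j c)"
      using ij by (intro UN_I[of i] UN_I[of j] UN_I[of "cell n (x i)"]) auto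
  qed
  have inner: "measure (pow M q) (\<Union>c<K n. R i j c) \<le> \<epsilon> n * ?m ^ (q - 1)"
    if "i < q" "j < q" "i \<noteq> j" for i j
  proof -
    have "measure (pow M q) (\<Union>c<K n. R i j c) \<le> (\<Sum>c<K n. measure (pow M q) (R i j c))"
      using R_sets by (intro measure_UNION_le) auto
    also have "\<dots> = (\<Sum>c<K n. (measure M (part n c))\<^sup>2) * ?m ^ (q - 2)"
      by (simp add: R_meas[OF that] sum_distrib_right)
    also have "\<dots> \<le> (\<epsilon> n * ?m) * ?m ^ (q - 2)"
      by (intro mult_right_mono sum_square_measure_part) simp
    also have "\<dots> = \<epsilon> n * ?m ^ Suc (q - 2)" by simp
    also have "Suc (q - 2) = q - 1" using that by auto
    finally show ?thesis .
  qed
  have "measure (pow M q) (space (pow M q) - separated q n) \<le>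
     measure (pow M q) (\<Union>i<q. \<Union>j\<in>{..<q} - {i}. \<Union>c<K n. R i j c)"
    using R_sets by (intro Q.finite_measure_mono sub sets.finite_UN) auto
  also have "\<dots> \<le> (\<Sum>i<q. measure (pow M q) (\<Union>j\<in>{..<q} - {i}. \<Union>c<K n. R i j c))"
    using R_sets by (intro measure_UNION_le sets.finite_UN) auto
  also have "\<dots> \<le> (\<Sum>i<q. \<Sum>j\<in>{..<q} - {i}. measure (pow M q) (\<Union>c<K n. R i j c))"
    using R_sets by (intro sum_mono measure_UNION_le sets.finite_UN) auto
  also have "\<dots> \<le> (\<Sum>i<q. \<Sum>j\<in>{..<q} - {i}. \<epsilon> n * ?m ^ (q - 1))"
    by (intro sum_mono inner) auto
  also have "\<dots> \<le> (\<Sum>i<q. \<Sum>j<q. \<epsilon> n * ?m ^ (q - 1))"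
    using mesh_nonneg by (intro sum_mono sum_mono2) auto
  also have "\<dots> = real q * (real q * (\<epsilon> n * ?m ^ (q - 1)))" by simp
  finally show ?thesis .
qed

lemma measure_not_separated_tendsto:
  "(\<lambda>n. measure (pow M q) (space (pow M q) - separated q n)) \<longlonglongrightarrow> 0"
proof (rule tendsto_sandwich[OF _ _ tendsto_const])
  have "(\<lambda>n. real q * (real q * (\<epsilon> n * (measure M (space M)) ^ (q - 1)))) \<longlonglongrightarrow> real q * (real q * (0 * measure M (space M) ^ (q - 1)))"
    by (intro tendsto_intros mesh_tendsto)
  then show "(\<lambda>n. real q * (real q * (\<epsilon> n * (measure M (space M)) ^ (q - 1)))) \<longlonglongrightarrow> 0" by simp
  show "\<forall>\<^sub>F n in sequentially. measure (pow M q) (space (pow M q) - separated q n) \<le>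
      real q * (real q * (\<epsilon> n * (measure M (space M)) ^ (q - 1)))"
    by (intro always_eventually allI measure_not_separated)
qed simp

lemma AE_separated: "AE x in pow M q. x \<in> (\<Union>n. separated q n)"
proof -
  interpret Q: finite_measure "pow M q" by (rule finite_power_measure)
  let ?D = "space (pow M q) - (\<Union>n. separated q n)"
  have D: "?D \<in> sets (pow M q)" by auto
  have "measure (pow M q) ?D \<le> 0"
    by (rule LIMSEQ_le_const[OF measure_not_separated_tendsto[of q]])
      (auto intro!: exI[of _ 0] Q.finite_measure_mono)
  then have "measure (pow M q) ?D = 0" using measure_nonneg[of "pow M q" ?D] by linarith
  then have "?D \<in> null_sets (pow M q)" using D by (auto simp: Q.emeasure_eq_measure)
  then show ?thesis by (rule AE_I'[of ?D]) auto
qed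

text \<open>The rectangles off the diagonals: for them the independence of a Poisson measure on
  disjoint sets applies, and their indicators are simple kernels.\<close>

definition disjoint_rectangles :: "nat \<Rightarrow> (nat \<Rightarrow> 'z) set set" where
  "disjoint_rectangles q = {PiE {..<q} A |A. (\<forall>j<q. A j \<in> sets M) \<and> disjoint_family_on A {..<q}}"

text \<open>Inside \<open>separated\<close> any rectangle falls apart into finitely many rectangles
  with pairwise disjoint sides, one for each assignment of distinct cells to the coordinates; the
  general measurable set follows since traces respect complements and countable unions.\<close>

lemma separated_Int_in_sigma:
  assumes "B \<in> sets (pow M q)"
  shows "B \<inter> (\<Union>n. separated q n) \<in> sigma_sets (space (pow M q)) (disjoint_rectangles q)"
proof -
  let ?\<Omega> = "space (pow M q)" and ?S = "\<Union>n. separated q n" and ?G = "disjoint_rectangles q"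
  interpret G: sigma_algebra ?\<Omega> "sigma_sets ?\<Omega> ?G"
  proof (rule sigma_algebra_sigma_sets)
    show "?G \<subseteq> Pow ?\<Omega>" using sets.sets_into_space by (fastforce simp: disjoint_rectangles_def space_PiM PiE_iff)
  qed
  have rect: "PiE {..<q} A \<inter> ?S \<in> sigma_sets ?\<Omega> ?G" if A: "\<And>j. j < q \<Longrightarrow> A j \<in> sets M" for A
  proof -
    have e: "PiE {..<q} A \<inter> ?S = (\<Union>n. \<Union>f\<in>injective_indices q (K n). PiE {..<q} (\<lambda>j. A j \<inter> part n (f j)))"
      unfolding separated_eq by (auto simp: PiE_Int)
    have "PiE {..<q} (\<lambda>j. A j \<inter> part n (f j)) \<in> ?G" if "f \<in> injective_indices q (K n)" for n f
    proof -
      have "disjoint_family_on (\<lambda>j. A j \<inter> part n (f j)) {..<q}"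
        using that by (auto simp: disjoint_family_on_def part_def injective_indices_def inj_on_def)
      then show ?thesis unfolding disjoint_rectangles_def
        by (intro CollectI exI[of _ "\<lambda>j. A j \<inter> part n (f j)"] conjI allI impI refl) (use A in auto)
    qed
    then have "(\<Union>f\<in>injective_indices q (K n). PiE {..<q} (\<lambda>j. A j \<inter> part n (f j))) \<in> sigma_sets ?\<Omega> ?G" for n
      by (intro G.finite_UN finite_injective_indices sigma_sets.Basic)
    then show ?thesis unfolding e by (intro G.countable_nat_UN) auto
  qed
  have S: "?S \<in> sigma_sets ?\<Omega> ?G"
  proof -
    have "?\<Omega> \<inter> ?S = ?S" by (auto simp: separated_def)
    then show ?thesis using rect[of "\<lambda>_. space M"] by (simp add: space_PiM)
  qed
  have "sets (pow M q) = sigma_sets (PiE {..<q} (\<lambda>_. space M)) {PiE {..<q} X |X. X \<in> (\<Pi> j\<in>{..<q}. sets M)}"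
    unfolding sets_PiM by (simp add: prod_algebra_eq_finite)
  then have "B \<in> sigma_sets ?\<Omega> {PiE {..<q} X |X. X \<in> (\<Pi> j\<in>{..<q}. sets M)}" using assms by (simp add: space_PiM)
  then show ?thesis
  proof induction
    case (Basic a)
    then show ?case using rect by auto
  next
    case Empty
    then show ?case by (simp add: sigma_sets.Empty)
  next
    case (Compl a)
    have "(?\<Omega> - a) \<inter> ?S = ?S - (a \<inter> ?S)" by (auto simp: separated_def)
    then show ?case using S Compl.IH by auto
  next
    case (Union a)
    have "(\<Union>i. a i) \<inter> ?S = (\<Union>i. a i \<inter> ?S)" by blast
    moreover have "(\<Union>i. a i \<inter> ?S) \<in> sigma_sets ?\<Omega> ?G"
      using Union.IH by (intro G.countable_nat_UN image_subsetI) 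
    ultimately show ?case by simp
  qed
qed

text \<open>The pi-lambda theorem started from rectangles off the diagonals only. The price is that
  a measurable set is reached after intersection with a set of full measure, which is harmless for
  L2 approximation and for mean counts of tuples.\<close>

lemma separated_induct [consumes 1, case_names empty rectangle complement union]:
  assumes B: "B \<in> sets (pow M q)"
    and "Q {}"
    and rect: "\<And>A. (\<And>j. j < q \<Longrightarrow> A j \<in> sets M) \<Longrightarrow> disjoint_family_on A {..<q} \<Longrightarrow> Q (PiE {..<q} A)"
    and compl: "\<And>B. B \<in> sets (pow M q) \<Longrightarrow> Q B \<Longrightarrow> Q (space (pow M q) - B)"
    and un: "\<And>B :: nat \<Rightarrow> _. disjoint_family B \<Longrightarrow> (\<And>i. B i \<in> sets (pow M q)) \<Longrightarrow> (\<And>i. Q (B i)) \<Longrightarrow> Q (\<Union>i. B i)"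
  shows "Q (B \<inter> (\<Union>n. separated q n))"
proof -
  let ?\<Omega> = "space (pow M q)" and ?G = "disjoint_rectangles q"
  have G: "?G \<subseteq> sets (pow M q)" by (auto simp: disjoint_rectangles_def intro!: sets_PiM_I_finite)
  then have sub: "sigma_sets ?\<Omega> ?G \<subseteq> sets (pow M q)" by (rule sets.sigma_sets_subset)
  have Int: "Int_stable ?G"
  proof (rule Int_stableI)
    fix a b assume "a \<in> ?G" "b \<in> ?G"
    then obtain A B where A: "a = PiE {..<q} A" "\<forall>j<q. A j \<in> sets M" "disjoint_family_on A {..<q}"
      and B: "b = PiE {..<q} B" "\<forall>j<q. B j \<in> sets M"
      unfolding disjoint_rectangles_def by blast
    have "a \<inter> b = PiE {..<q} (\<lambda>j. A j \<inter> B j)" by (simp add: A B PiE_Int)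
    moreover have "disjoint_family_on (\<lambda>j. A j \<inter> B j) {..<q}" using A(3) unfolding disjoint_family_on_def by blast
    ultimately show "a \<inter> b \<in> ?G" unfolding disjoint_rectangles_def
      by (intro CollectI exI[of _ "\<lambda>j. A j \<inter> B j"] conjI allI impI) (use A(2) B(2) in auto)
  qed
  have Pow: "?G \<subseteq> Pow ?\<Omega>" using G sets.sets_into_space by blast
  show ?thesis
  proof (rule sigma_sets_induct_disjoint[OF Int Pow separated_Int_in_sigma[OF B], where P = Q])
    show "Q a" if "a \<in> ?G" for a using that rect unfolding disjoint_rectangles_def by blast
    show "Q {}" by fact
    show "Q (?\<Omega> - a)" if "a \<in> sigma_sets ?\<Omega> ?G" "Q a" for a using compl[of a] that sub by blast
    fix a :: "nat \<Rightarrow> (nat \<Rightarrow> 'z) set"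
    assume a: "disjoint_family a" "range a \<subseteq> sigma_sets ?\<Omega> ?G" "\<And>i. Q (a i)"
    have "a i \<in> sets (pow M q)" for i using a(2) sub by blast
    then show "Q (\<Union>i. a i)" by (rule un[OF a(1) _ a(3)])
  qed
qed

end

section \<open>L2 approximation by off-diagonal simple kernels\<close>

context finite_measure begin

definition approximable :: "nat \<Rightarrow> ((nat \<Rightarrow> 'a) \<Rightarrow> real) \<Rightarrow> bool" where
  "approximable q f \<longleftrightarrow> f \<in> borel_measurable (pow M q) \<and>
     (\<forall>e>0. \<exists>N A a. disjoint_family_on A {..<N::nat} \<and> (\<forall>i<N. A i \<in> sets M) \<and>
        (nn_dist2 (pow M q) (simple_kernel q N A a) f) \<le> ennreal e)"

lemma approximableE:
  assumes "approximable q f" "e > 0"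
  obtains N A a where "disjoint_family_on A {..<N::nat}" "\<forall>i<N. A i \<in> sets M"
    "nn_dist2 (pow M q) (simple_kernel q N A a) f \<le> ennreal e"
  using assms unfolding approximable_def by blast

lemma approximable_simple_kernel:
  assumes "disjoint_family_on A {..<N::nat}" "\<And>i. i < N \<Longrightarrow> A i \<in> sets M"
  shows "approximable q (simple_kernel q N A a)"
  unfolding approximable_def
  by (intro conjI simple_kernel_measurable assms allI impI exI[of _ N] exI[of _ A] exI[of _ a]) (simp_all add: assms)

lemma approximable_limit:
  assumes f: "f \<in> borel_measurable (pow M q)"
    and g: "\<And>e. e > 0 \<Longrightarrow> \<exists>g. approximable q g \<and> (nn_dist2 (pow M q) g f) \<le> ennreal e"
  shows "approximable q f"
  unfolding approximable_def
proof (intro conjI f allI impI)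
  fix e :: real assume e: "e > 0"
  obtain g where g: "approximable q g" "nn_dist2 (pow M q) g f \<le> ennreal (e / 4)"
    using g[of "e / 4"] e by auto
  obtain N A a where A: "disjoint_family_on A {..<N::nat}" "\<forall>i<N. A i \<in> sets M"
    "nn_dist2 (pow M q) (simple_kernel q N A a) g \<le> ennreal (e / 4)"
    by (rule approximableE[OF g(1), of "e / 4"]) (use e in auto)
  have [measurable]: "g \<in> borel_measurable (pow M q)" "f \<in> borel_measurable (pow M q)"
    "simple_kernel q N A a \<in> borel_measurable (pow M q)"
    using g(1) f A by (auto simp: approximable_def intro!: simple_kernel_measurable)
  have "nn_dist2 (pow M q) (simple_kernel q N A a) f \<le>
    2 * nn_dist2 (pow M q) (simple_kernel q N A a) g +
    2 * nn_dist2 (pow M q) g f"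
    using nn_integral_square_add_le[of "\<lambda>x. simple_kernel q N A a x - g x" "pow M q" "\<lambda>x. g x - f x"] by simp
  also have "\<dots> \<le> 2 * ennreal (e / 4) + 2 * ennreal (e / 4)"
    by (intro add_mono mult_left_mono A(3) g(2)) auto
  also have "\<dots> = ennreal e"
    using e by (simp add: ennreal_numeral[symmetric] ennreal_mult'[symmetric] ennreal_plus[symmetric] del: ennreal_numeral ennreal_plus)
  finally show "\<exists>N A a. disjoint_family_on A {..<N::nat} \<and> (\<forall>i<N. A i \<in> sets M) \<and>
        (nn_dist2 (pow M q) (simple_kernel q N A a) f) \<le> ennreal e"
    using A(1,2) by blast
qed

lemma approximable_L2_tendsto:
  assumes "f \<in> borel_measurable (pow M q)" "\<And>m. approximable q (g m)" "L2_tendsto (pow M q) g f"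
  shows "approximable q f"
proof (rule approximable_limit[OF assms(1)])
  fix e :: real assume "e > 0"
  then have "\<forall>\<^sub>F m in sequentially. (nn_dist2 (pow M q) (g m) f) < ennreal e"
    using assms(3) unfolding L2_tendsto_def by (intro order_tendstoD) auto
  then obtain m where "nn_dist2 (pow M q) (g m) f < ennreal e"
    by (auto simp: eventually_sequentially)
  then show "\<exists>g. approximable q g \<and> (nn_dist2 (pow M q) g f) \<le> ennreal e"
    using assms(2) by (intro exI[of _ "g m"]) auto
qed

lemma approximable_sequence:
  assumes "approximable q f"
  obtains N A a where "kernel_approximation M q N A a f"
proof -
  \<comment> \<open>The number of sets, the sets and the coefficients are packed into one triple, so
    that a single choice yields all three sequences.\<close>
  define ok where "ok m t \<longleftrightarrow> disjoint_family_on (fst (snd t)) {..<fst t :: nat} \<and> (\<forall>i<fst t. fst (snd t) i \<in> sets M) \<and>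
    (nn_dist2 (pow M q) (simple_kernel q (fst t) (fst (snd t)) (snd (snd t))) f) \<le>
      ennreal (inverse (real (Suc m)))" for m :: nat and t
  have "\<exists>t. ok m t" for m
  proof -
    obtain N A a where "disjoint_family_on A {..<N::nat}" "\<forall>i<N. A i \<in> sets M"
      "nn_dist2 (pow M q) (simple_kernel q N A a) f \<le> ennreal (inverse (real (Suc m)))"
      by (rule approximableE[OF assms, of "inverse (real (Suc m))"]) auto
    then have "ok m (N, A, a)" by (simp add: ok_def)
    then show ?thesis ..
  qed
  then obtain t where t: "\<And>m. ok m (t m)" by metis
  define N A a where "N m = fst (t m)" and "A m = fst (snd (t m))" and "a m = snd (snd (t m))" for m
  have A: "disjoint_family_on (A m) {..<N m::nat}" "\<forall>i<N m. A m i \<in> sets M"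
    "nn_dist2 (pow M q) (simple_kernel q (N m) (A m) (a m)) f \<le> ennreal (inverse (real (Suc m)))" for m
    using t[of m] by (auto simp: ok_def N_def A_def a_def)
  have "L2_tendsto (pow M q) (\<lambda>m. simple_kernel q (N m) (A m) (a m)) f"
    unfolding L2_tendsto_def
  proof (rule tendsto_sandwich[OF _ _ tendsto_const])
    have "(\<lambda>m. ennreal (inverse (real (Suc m)))) \<longlonglongrightarrow> ennreal 0"
      by (intro tendsto_ennrealI LIMSEQ_inverse_real_of_nat)
    then show "(\<lambda>m. ennreal (inverse (real (Suc m)))) \<longlonglongrightarrow> 0" by simp
  qed (intro always_eventually allI A zero_le)+
  then show ?thesis using that[of N A a] A(1,2) by (simp add: kernel_approximation_def)
qed

lemma approximable_combination:
  assumes f: "approximable q f" and g: "approximable q g"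
  shows "approximable q (\<lambda>x. v * f x + \<beta> * g x)"
proof -
  obtain N A a where a: "kernel_approximation M q N A a f" using approximable_sequence[OF f] .
  obtain N' A' b where b: "kernel_approximation M q N' A' b g" using approximable_sequence[OF g] .
  note a' = a[unfolded kernel_approximation_def] and b' = b[unfolded kernel_approximation_def]
  let ?u = "\<lambda>m x. v * simple_kernel q (N m) (A m) (a m) x + \<beta> * simple_kernel q (N' m) (A' m) (b m) x"
  have ap: "approximable q (?u m)" for m
  proof -
    obtain K C c where C: "disjoint_family_on C {..<K::nat}" "\<And>r. r < K \<Longrightarrow> C r \<in> sets M"
      "\<And>x. simple_kernel q K C c x = ?u m x"
      by (rule simple_kernel_combination[of "A m" "N m" M "A' m" "N' m" q v "a m" \<beta> "b m"]) (use a' b' in auto)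
    have "simple_kernel q K C c = ?u m" using C(3) by auto
    then show ?thesis using approximable_simple_kernel[OF C(1,2), of q c] by simp
  qed
  have [measurable]: "f \<in> borel_measurable (pow M q)" "g \<in> borel_measurable (pow M q)"
    using f g by (auto simp: approximable_def)
  have [measurable]: "simple_kernel q (N m) (A m) (a m) \<in> borel_measurable (pow M q)"
    "simple_kernel q (N' m) (A' m) (b m) \<in> borel_measurable (pow M q)" for m
    using a' b' by (auto intro!: simple_kernel_measurable)
  show ?thesis
  proof (rule approximable_L2_tendsto[OF _ ap])
    show "L2_tendsto (pow M q) ?u (\<lambda>x. v * f x + \<beta> * g x)"
      using a' b' by (intro L2_tendsto_add L2_tendsto_cmult) auto
  qed measurable
qed

lemma approximable_zero: "approximable q (\<lambda>_. 0)"
proof -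
  have "approximable q (simple_kernel q 0 (\<lambda>_. {}) (\<lambda>_. 0))"
    by (rule approximable_simple_kernel) (auto simp: disjoint_family_on_def)
  moreover have "simple_kernel q 0 (\<lambda>_. {} :: 'a set) (\<lambda>_. 0) = (\<lambda>_. 0)" by (auto simp: simple_kernel_def)
  ultimately show ?thesis by simp
qed

lemma approximable_sum:
  assumes "finite I" "\<And>i. i \<in> I \<Longrightarrow> approximable q (f i)"
  shows "approximable q (\<lambda>x. \<Sum>i\<in>I. c i * f i x)"
  using assms
proof (induction I)
  case empty
  then show ?case using approximable_zero by simp
next
  case (insert i I)
  then show ?case using approximable_combination[of q "f i" "\<lambda>x. \<Sum>i\<in>I. c i * f i x" "c i" 1] by simp
qed

lemma approximable_cong_AE:
  assumes "approximable q f" "AE x in pow M q. f x = g x" "g \<in> borel_measurable (pow M q)"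
  shows "approximable q g"
proof (rule approximable_limit[OF assms(3)])
  fix e :: real assume "e > 0"
  have "nn_dist2 (pow M q) f g = (\<integral>\<^sup>+x. 0 \<partial>pow M q)"
    using assms(2) by (intro nn_integral_cong_AE) auto
  then show "\<exists>f. approximable q f \<and> (nn_dist2 (pow M q) f g) \<le> ennreal e"
    using assms(1) by (intro exI[of _ f]) auto
qed

end

lemma simple_approximation:
  fixes f :: "'a \<Rightarrow> real"
  assumes "f \<in> borel_measurable M"
  obtains F where "\<forall>i. simple_function M (F i)" "\<forall>x\<in>space M. (\<lambda>i. F i x) \<longlonglongrightarrow> f x"
    "\<forall>i. \<forall>x\<in>space M. \<bar>F i x\<bar> \<le> 2 * \<bar>f x\<bar>"
  using borel_measurable_implies_sequence_metric[OF assms, of 0] by (auto simp: dist_real_def)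

context partitioned_measure begin

text \<open>Complements in the induction require the constant 1. A simple kernel vanishes on the
  diagonals, so the constant is reached only in the limit, through the indicators of
  \<open>separated\<close>.\<close>

lemma approximable_one: "approximable q (\<lambda>_. 1)"
proof (rule approximable_L2_tendsto[where g = "\<lambda>n. simple_kernel q (K n) (part n) (\<lambda>_. 1)"])
  interpret Q: finite_measure "pow M q" by (rule finite_power_measure)
  show "approximable q (simple_kernel q (K n) (part n) (\<lambda>_. 1))" for n
    by (intro approximable_simple_kernel disjoint_part) auto
  have "(\<integral>\<^sup>+x. ennreal ((simple_kernel q (K n) (part n) (\<lambda>_. 1) x - 1)\<^sup>2) \<partial>pow M q) =
    ennreal (measure (pow M q) (space (pow M q) - separated q n))" for n
  proof -
    have "(\<integral>\<^sup>+x. ennreal ((simple_kernel q (K n) (part n) (\<lambda>_. 1) x - 1)\<^sup>2) \<partial>pow M q) =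
      (\<integral>\<^sup>+x. indicator (space (pow M q) - separated q n) x \<partial>pow M q)"
      by (intro nn_integral_cong) (auto simp: indicator_separated indicator_def)
    then show ?thesis by (simp add: Q.emeasure_eq_measure)
  qed
  moreover have "(\<lambda>n. ennreal (measure (pow M q) (space (pow M q) - separated q n))) \<longlonglongrightarrow> ennreal 0"
    by (intro tendsto_ennrealI measure_not_separated_tendsto)
  ultimately show "L2_tendsto (pow M q) (\<lambda>n. simple_kernel q (K n) (part n) (\<lambda>_. 1)) (\<lambda>_. 1)"
    by (simp add: L2_tendsto_def)
qed simp

lemma approximable_rectangle:
  assumes A: "\<And>j. j < q \<Longrightarrow> A j \<in> sets M" "disjoint_family_on A {..<q}"
  shows "approximable q (indicator (PiE {..<q} A))"
proof (rule approximable_cong_AE)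
  let ?a = "\<lambda>f. if f = restrict id {..<q} then 1 else 0 :: real"
  show "approximable q (simple_kernel q q A ?a)" by (rule approximable_simple_kernel[OF A(2,1)])
  show "indicat_real (PiE {..<q} A) \<in> borel_measurable (pow M q)"
    using A by (intro borel_measurable_indicator sets_PiM_I_finite) auto
  have "simple_kernel q q A ?a x = indicator (PiE {..<q} A) x" if "x \<in> space (pow M q)" for x
  proof -
    have "restrict id {..<q} \<in> injective_indices q q" by (auto simp: injective_indices_def inj_on_def)
    then have "simple_kernel q q A ?a x = (\<Prod>j<q. indicat_real (A (restrict id {..<q} j)) (x j))"
      by (simp add: simple_kernel_def if_distrib[of "\<lambda>c. c * _"] sum.delta cong: if_cong)
    also have "\<dots> = (\<Prod>j<q. indicat_real (A j) (x j))" by (intro prod.cong) auto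
    finally show ?thesis using that by (simp add: prod_indicator_PiE space_PiM PiE_iff)
  qed
  then show "AE x in pow M q. simple_kernel q q A ?a x = indicator (PiE {..<q} A) x" by simp
qed

lemma approximable_indicator:
  assumes B: "B \<in> sets (pow M q)"
  shows "approximable q (indicator B)"
proof (rule approximable_cong_AE)
  interpret Q: finite_measure "pow M q" by (rule finite_power_measure)
  show "approximable q (indicator (B \<inter> (\<Union>n. separated q n)))"
    using B
  proof (induction rule: separated_induct)
    case empty
    then show ?case using approximable_zero by simp
  next
    case (rectangle A)
    then show ?case by (rule approximable_rectangle)
  next
    case (complement B)
    have "AE x in pow M q. 1 * 1 + (-1) * indicat_real B x = indicator (space (pow M q) - B) x"
      by (auto simp: indicator_def)
    then show ?case
      by (rule approximable_cong_AE[OF approximable_combination[OF approximable_one complement(2), of 1 "-1"]])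
        (use complement(1) in auto)
  next
    case (union B)
    show ?case
    proof (rule approximable_L2_tendsto)
      show "indicat_real (\<Union>i. B i) \<in> borel_measurable (pow M q)" using union by auto
      show "approximable q (\<lambda>x. \<Sum>i<n. 1 * indicat_real (B i) x)" for n
        by (rule approximable_sum) (use union in auto)
      have U: "(\<Sum>i<n. 1 * indicat_real (B i) x) = indicator (\<Union>i<n. B i) x" for n x
        using union(1) by (subst indicator_UN_disjoint) (auto simp: disjoint_family_on_def)
      have "(\<integral>\<^sup>+x. ennreal (((\<Sum>i<n. 1 * indicat_real (B i) x) - indicat_real (\<Union>i. B i) x)\<^sup>2) \<partial>pow M q) =
        ennreal (measure (pow M q) (\<Union>i. B i) - measure (pow M q) (\<Union>i<n. B i))" for n
      proof -
        have "(\<integral>\<^sup>+x. ennreal (((\<Sum>i<n. 1 * indicat_real (B i) x) - indicat_real (\<Union>i. B i) x)\<^sup>2) \<partial>pow M q) =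
          (\<integral>\<^sup>+x. indicator ((\<Union>i. B i) - (\<Union>i<n. B i)) x \<partial>pow M q)"
          unfolding U by (intro nn_integral_cong) (auto simp: indicator_def)
        also have "\<dots> = ennreal (measure (pow M q) ((\<Union>i. B i) - (\<Union>i<n. B i)))"
          using union(2) by (simp add: Q.emeasure_eq_measure)
        also have "measure (pow M q) ((\<Union>i. B i) - (\<Union>i<n. B i)) =
          measure (pow M q) (\<Union>i. B i) - measure (pow M q) (\<Union>i<n. B i)"
          using union(2) by (intro Q.finite_measure_Diff) auto
        finally show ?thesis .
      qed
      moreover have "(\<lambda>n. ennreal (measure (pow M q) (\<Union>i. B i) - measure (pow M q) (\<Union>i<n. B i))) \<longlonglongrightarrow>
        ennreal (measure (pow M q) (\<Union>i. B i) - measure (pow M q) (\<Union>n. \<Union>i<n. B i))"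
        using union(2)
        by (intro tendsto_ennrealI tendsto_diff tendsto_const Q.finite_Lim_measure_incseq incseq_SucI) (auto simp: lessThan_Suc)
      moreover have "(\<Union>n. \<Union>i<n. B i) = (\<Union>i. B i)" by auto
      ultimately show "L2_tendsto (pow M q) (\<lambda>n x. \<Sum>i<n. 1 * indicat_real (B i) x) (indicat_real (\<Union>i. B i))"
        unfolding L2_tendsto_def by simp
    qed
  qed
  show "AE x in pow M q. indicat_real (B \<inter> (\<Union>n. separated q n)) x = indicator B x"
    using AE_separated[of q] by eventually_elim (auto simp: indicator_def)
qed (use B in auto)

lemma approximable_square_integrable:
  assumes f: "square_integrable (pow M q) f"
  shows "approximable q f"
proof -
  have [measurable]: "f \<in> borel_measurable (pow M q)" using f by (simp add: square_integrable_def)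
  obtain F where F: "\<forall>i. simple_function (pow M q) (F i)"
    "\<forall>x\<in>space (pow M q). (\<lambda>i. F i x) \<longlonglongrightarrow> f x"
    "\<forall>i. \<forall>x\<in>space (pow M q). \<bar>F i x\<bar> \<le> 2 * \<bar>f x\<bar>"
    by (rule simple_approximation[of f "pow M q"]) measurable
  note F = F[rule_format]
  have Fm [measurable]: "F i \<in> borel_measurable (pow M q)" for i
    using F(1) by (rule borel_measurable_simple_function)
  show ?thesis
  proof (rule approximable_L2_tendsto)
    show "approximable q (F i)" for i
    proof (rule approximable_cong_AE)
      let ?V = "F i ` space (pow M q)"
      show "approximable q (\<lambda>x. \<Sum>v\<in>?V. v * indicat_real (F i -` {v} \<inter> space (pow M q)) x)"
        by (rule approximable_sum) (use F(1)[of i] in \<open>auto simp: simple_function_def intro!: approximable_indicator\<close>)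
      have "(\<Sum>v\<in>?V. v * indicat_real (F i -` {v} \<inter> space (pow M q)) x) = F i x"
        if x: "x \<in> space (pow M q)" for x
      proof -
        have "(\<Sum>v\<in>?V. v * indicat_real (F i -` {v} \<inter> space (pow M q)) x) = (\<Sum>v\<in>?V. if v = F i x then v else 0)"
          using x by (intro sum.cong) (auto simp: indicator_def)
        then show ?thesis using x F(1)[of i] by (simp add: simple_function_def)
      qed
      then show "AE x in pow M q. (\<Sum>v\<in>?V. v * indicat_real (F i -` {v} \<inter> space (pow M q)) x) = F i x"
        by simp
    qed measurable
    \<comment> \<open>The 10 is \<open>2 * 4 + 2\<close>, from
      \<open>(a + b)^2 <= 2 a^2 + 2 b^2\<close> and
      \<open>\<bar>F i x\<bar> \<le> 2 * \<bar>f x\<bar>\<close>.\<close>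
    have bound: "(F i x)\<^sup>2 \<le> 4 * (f x)\<^sup>2" "(F i x - f x)\<^sup>2 \<le> 10 * (f x)\<^sup>2" if "x \<in> space (pow M q)" for i x
    proof -
      have "\<bar>F i x\<bar>\<^sup>2 \<le> (2 * \<bar>f x\<bar>)\<^sup>2" using F(3)[OF that] by (intro power_mono) auto
      then show 1: "(F i x)\<^sup>2 \<le> 4 * (f x)\<^sup>2" by (simp add: power_mult_distrib)
      show "(F i x - f x)\<^sup>2 \<le> 10 * (f x)\<^sup>2" using square_add_le[of "F i x" "- f x"] 1 by simp
    qed
    have sq: "square_integrable (pow M q) (F i)" for i
      unfolding square_integrable_def
    proof (intro conjI Fm, rule Bochner_Integration.integrable_bound)
      show "integrable (pow M q) (\<lambda>x. 4 * (f x)\<^sup>2)" using f by (simp add: square_integrable_def)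
      show "AE x in pow M q. norm ((F i x)\<^sup>2) \<le> norm (4 * (f x)\<^sup>2)" using bound(1) by auto
    qed measurable
    have "(\<lambda>i. L2_dist2 (pow M q) (F i) f) \<longlonglongrightarrow> (\<integral>x. 0 \<partial>pow M q)"
    proof (rule integral_dominated_convergence[where w = "\<lambda>x. 10 * (f x)\<^sup>2"])
      show "integrable (pow M q) (\<lambda>x. 10 * (f x)\<^sup>2)" using f by (simp add: square_integrable_def)
      show "AE x in pow M q. (\<lambda>i. (F i x - f x)\<^sup>2) \<longlonglongrightarrow> 0"
      proof (rule AE_I2)
        fix x assume "x \<in> space (pow M q)"
        then have "(\<lambda>i. (F i x - f x)\<^sup>2) \<longlonglongrightarrow> (f x - f x)\<^sup>2" by (intro tendsto_intros F(2))
        then show "(\<lambda>i. (F i x - f x)\<^sup>2) \<longlonglongrightarrow> 0" by simp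
      qed
      show "AE x in pow M q. norm ((F i x - f x)\<^sup>2) \<le> 10 * (f x)\<^sup>2" for i using bound(2) by auto
    qed measurable
    then show "L2_tendsto (pow M q) F f"
      by (subst L2_tendsto_iff[OF sq f]) simp
  qed measurable
qed

text \<open>The power measure is invariant under permutations, so each permuted sequence of
  approximants converges to the permuted \<open>h\<close>, which is \<open>h\<close> again; the
  average over permutations therefore converges to \<open>h\<close>.\<close>

lemma symmetric_kernel_approximation:
  assumes h: "square_integrable (pow M q) h" and sym: "symmetric_kernel M q h"
  obtains N A a where "kernel_approximation M q N A a h" "\<forall>m. symmetric_coeff q (N m) (a m)"
proof -
  obtain N A a where a: "kernel_approximation M q N A a h"
    using approximable_sequence[OF approximable_square_integrable[OF h]] .
  note a' = a[unfolded kernel_approximation_def]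
  let ?k = "\<lambda>m. simple_kernel q (N m) (A m) (a m)" and ?M = "pow M q"
  have [measurable]: "?k m \<in> borel_measurable ?M" "h \<in> borel_measurable ?M" for m
    using a' h by (auto intro!: simple_kernel_measurable simp: square_integrable_def)
  have perm: "L2_tendsto ?M (\<lambda>m x. ?k m (x \<circ> p)) (\<lambda>x. h (x \<circ> p))" "(\<lambda>x. h (x \<circ> p)) \<in> borel_measurable ?M"
     "\<And>m. (\<lambda>x. ?k m (x \<circ> p)) \<in> borel_measurable ?M" if p: "p permutes {..<q}" for p
  proof -
    note [measurable] = measurable_comp_permutes[OF p]
    have "(\<integral>\<^sup>+x. ennreal ((?k m (x \<circ> p) - h (x \<circ> p))\<^sup>2) \<partial>?M) = nn_dist2 ?M (?k m) h" for m
      by (subst (2) distr_comp_permutes[OF p, symmetric]) (simp add: nn_integral_distr)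
    then show "L2_tendsto ?M (\<lambda>m x. ?k m (x \<circ> p)) (\<lambda>x. h (x \<circ> p))" using a' by (simp add: L2_tendsto_def)
    show "(\<lambda>x. h (x \<circ> p)) \<in> borel_measurable ?M" "\<And>m. (\<lambda>x. ?k m (x \<circ> p)) \<in> borel_measurable ?M" by measurable
  qed
  have "L2_tendsto ?M (\<lambda>m x. (1 / fact q) * (\<Sum>p | p permutes {..<q}. ?k m (x \<circ> p)))
      (\<lambda>x. (1 / fact q) * (\<Sum>p | p permutes {..<q}. h (x \<circ> p)))"
    by (intro L2_tendsto_cmult L2_tendsto_sum borel_measurable_sum perm) auto
  moreover have "AE x in ?M. (1 / fact q) * (\<Sum>p | p permutes {..<q}. h (x \<circ> p)) = h x"
    using sym by (intro AE_I2) (simp add: symmetric_kernel_def card_permutations)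
  ultimately have "L2_tendsto ?M (\<lambda>m. simple_kernel q (N m) (A m) (symmetrized_coeff q (a m))) h"
    by (subst (asm) L2_tendsto_cong_AE[where s' = "\<lambda>m. simple_kernel q (N m) (A m) (symmetrized_coeff q (a m))" and f' = h])
      (auto simp: simple_kernel_symmetrized)
  then have "kernel_approximation M q N A (\<lambda>m. symmetrized_coeff q (a m)) h"
    using a' by (simp add: kernel_approximation_def)
  then show ?thesis by (rule that) (simp add: symmetric_symmetrized_coeff)
qed

text \<open>The sets do not depend on \<open>i\<close>: one approximation of \<open>h\<close> serves
  all its projections, so that integrals of different orders can be compared over one disjoint
  family. Boundedness of simple kernels makes their sections integrable, as
  \<open>projected_kernel_diff_bound\<close> asks.\<close>

lemma kernel_approximation_projected:
  assumes ik: "i \<le> k" and h: "h \<in> borel_measurable (pow M k)" and a: "kernel_approximation M k N A a h"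
  shows "kernel_approximation M i N A (\<lambda>m. projected_coeff k (N m) (\<lambda>r. measure M (A m r)) (a m) i) (projected_kernel M k h i)"
proof -
  note a' = a[unfolded kernel_approximation_def]
  let ?k = "\<lambda>m. simple_kernel k (N m) (A m) (a m)"
  let ?c = "ennreal ((real (k choose i))\<^sup>2 * measure M (space M) ^ (k - i))"
  have [measurable]: "?k m \<in> borel_measurable (pow M k)" for m
    using a' by (auto intro!: simple_kernel_measurable)
  have bd: "\<bar>?k m x\<bar> \<le> (\<Sum>f\<in>injective_indices k (N m). \<bar>a m f\<bar>)" for m x
    unfolding simple_kernel_def
  proof (rule order_trans[OF sum_abs], rule sum_mono)
    fix f
    have "\<bar>\<Prod>j<k. indicat_real (A m (f j)) (x j)\<bar> \<le> 1"
      unfolding abs_prod by (intro prod_le_1) (auto simp: indicator_def)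
    then show "\<bar>a m f * (\<Prod>j<k. indicat_real (A m (f j)) (x j))\<bar> \<le> \<bar>a m f\<bar>"
      by (simp add: abs_mult mult_left_le)
  qed
  have lim: "(\<lambda>m. ?c * nn_dist2 (pow M k) (?k m) h) \<longlonglongrightarrow> ?c * 0"
    using a' unfolding L2_tendsto_def by (intro ennreal_tendsto_cmult) auto
  have "L2_tendsto (pow M i) (\<lambda>m. projected_kernel M k (?k m) i) (projected_kernel M k h i)"
    unfolding L2_tendsto_def
  proof (rule tendsto_sandwich[OF _ _ tendsto_const])
    show "(\<lambda>m. ?c * nn_dist2 (pow M k) (?k m) h) \<longlonglongrightarrow> 0" using lim by simp
    show "\<forall>\<^sub>F m in sequentially. (nn_dist2 (pow M i) (projected_kernel M k (?k m) i) (projected_kernel M k h i)) \<le>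
       ?c * nn_dist2 (pow M k) (?k m) h"
      by (intro always_eventually allI projected_kernel_diff_bound[OF ik h _ bd]) measurable
  qed simp
  moreover have "projected_kernel M k (?k m) i =
      simple_kernel i (N m) (A m) (projected_coeff k (N m) (\<lambda>r. measure M (A m r)) (a m) i)" for m
    using a' by (intro ext projected_simple_kernel[OF ik]) auto
  ultimately show ?thesis using a' by (simp add: kernel_approximation_def)
qed

end

section \<open>Poisson measures and the chaos decomposition of a U-statistic\<close>

lemma L2_tendsto_AE_subseq:
  assumes s: "\<And>m. square_integrable M (s m)" and f: "square_integrable M f" and L: "L2_tendsto M s f"
  obtains r :: "nat \<Rightarrow> nat" where "strict_mono r" "AE x in M. (\<lambda>m. s (r m) x) \<longlonglongrightarrow> f x"
proof -
  have "(\<lambda>m. \<integral>x. norm ((s m x - f x)\<^sup>2) \<partial>M) \<longlonglongrightarrow> 0"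
    using L L2_tendsto_iff[OF s f] by simp
  then obtain r :: "nat \<Rightarrow> nat" where r: "strict_mono r" "AE x in M. (\<lambda>m. (s (r m) x - f x)\<^sup>2) \<longlonglongrightarrow> 0"
    using tendsto_L1_AE_subseq[of M "\<lambda>m x. (s m x - f x)\<^sup>2"]
      square_integrable_integrable[OF square_integrable_diff[OF s f]] by blast
  have "AE x in M. (\<lambda>m. s (r m) x) \<longlonglongrightarrow> f x"
    using r(2)
  proof eventually_elim
    case (elim x)
    then have "(\<lambda>m. sqrt ((s (r m) x - f x)\<^sup>2)) \<longlonglongrightarrow> sqrt 0" by (intro tendsto_intros)
    then have "(\<lambda>m. s (r m) x - f x) \<longlonglongrightarrow> 0" by (simp add: tendsto_rabs_zero_iff)
    then show ?case by (simp add: LIM_zero_iff)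
  qed
  with r(1) show ?thesis by (rule that)
qed

definition poisson_weight :: "real \<Rightarrow> nat \<Rightarrow> real" where
  "poisson_weight a n = exp (- a) * a ^ n / fact n"

lemma poisson_weight_nonneg: "0 \<le> a \<Longrightarrow> 0 \<le> poisson_weight a n"
  by (simp add: poisson_weight_def)

lemma poisson_weight_sums: "poisson_weight a sums 1"
proof -
  have "(\<lambda>n. exp (- a) * (a ^ n /\<^sub>R fact n)) sums (exp (- a) * exp a)"
    by (intro sums_mult exp_converges)
  then show ?thesis
    unfolding poisson_weight_def exp_minus by (simp add: divide_inverse mult_ac)
qed

lemma poisson_weight_Suc: "poisson_weight a (Suc n) * real (Suc n) = a * poisson_weight a n"
  unfolding poisson_weight_def fact_Suc by (simp add: divide_simps del: of_nat_Suc)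

locale poisson_variable = prob_space P for P :: "'w measure" +
  fixes X :: "'w \<Rightarrow> ennreal" and a :: real
  assumes X_measurable [measurable]: "X \<in> borel_measurable P" and a_nonneg: "0 \<le> a"
    and X_law: "\<And>n. measure P {w \<in> space P. X w = of_nat n} = poisson_weight a n"
begin

text \<open>The weights already sum to 1, which leaves probability zero for every other value,
  infinity included.\<close>

lemma AE_nat: "AE w in P. \<exists>n. X w = of_nat n"
proof -
  have "(\<lambda>n. measure P {w \<in> space P. X w = of_nat n}) sums measure P (\<Union>n. {w \<in> space P. X w = of_nat n})"
    by (rule finite_measure_UNION) (auto simp: disjoint_family_on_def)
  then have "prob (\<Union>n. {w \<in> space P. X w = of_nat n}) = 1"
    using poisson_weight_sums[of a] unfolding X_law by (rule sums_unique2)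
  then have "AE w in P. w \<in> (\<Union>n. {w \<in> space P. X w = of_nat n})" by (subst (asm) prob_eq_1) auto
  then show ?thesis by eventually_elim auto
qed

lemma nn_integral_eq:
  "(\<integral>\<^sup>+w. g (enn2real (X w)) \<partial>P) = (\<Sum>n. ennreal (poisson_weight a n) * g (real n))"
proof -
  have "(\<integral>\<^sup>+w. g (enn2real (X w)) \<partial>P) = (\<integral>\<^sup>+w. (\<Sum>n. g (real n) * indicator {w \<in> space P. X w = of_nat n} w) \<partial>P)"
  proof (rule nn_integral_cong_AE)
    show "AE w in P. g (enn2real (X w)) = (\<Sum>n. g (real n) * indicator {w \<in> space P. X w = of_nat n} w)"
      using AE_nat AE_space
    proof eventually_elim
      case (elim w)
      then obtain n where n: "X w = of_nat n" by auto
      have "(\<Sum>i. g (real i) * indicator {w \<in> space P. X w = of_nat i} w) =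
        (\<Sum>i\<in>{n}. g (real i) * indicator {w \<in> space P. X w = of_nat i} w)"
        by (rule suminf_finite) (use n in auto)
      then show ?case using n elim by (simp add: ennreal_of_nat_eq_real_of_nat)
    qed
  qed
  also have "\<dots> = (\<Sum>n. \<integral>\<^sup>+w. g (real n) * indicator {w \<in> space P. X w = of_nat n} w \<partial>P)"
    by (rule nn_integral_suminf) auto
  also have "\<dots> = (\<Sum>n. ennreal (poisson_weight a n) * g (real n))"
    by (simp add: nn_integral_cmult_indicator emeasure_eq_measure X_law mult.commute)
  finally show ?thesis .
qed

text \<open>The recursion \<open>(n + 1) p(n + 1) = a p(n)\<close> of the weights, summed against
  \<open>g\<close>. In this nonnegative form no integrability has to be known, so the moments can be
  read off from it.\<close>

lemma nn_integral_Chen_Stein: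
  "(\<integral>\<^sup>+w. ennreal (enn2real (X w)) * g (enn2real (X w)) \<partial>P) =
     ennreal a * (\<integral>\<^sup>+w. g (enn2real (X w) + 1) \<partial>P)"
proof -
  let ?f = "\<lambda>n. ennreal (poisson_weight a n) * (ennreal (real n) * g (real n))"
  have S: "?f (Suc n) = ennreal a * (ennreal (poisson_weight a n) * g (real n + 1))" for n
  proof -
    have "?f (Suc n) = ennreal (poisson_weight a (Suc n) * real (Suc n)) * g (real n + 1)"
      using poisson_weight_nonneg[OF a_nonneg] by (simp add: ennreal_mult mult.assoc add.commute del: of_nat_Suc)
        (simp add: add.commute)
    also have "\<dots> = ennreal a * ennreal (poisson_weight a n) * g (real n + 1)"
      unfolding poisson_weight_Suc using poisson_weight_nonneg[OF a_nonneg] a_nonneg by (simp add: ennreal_mult)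
    finally show ?thesis by (simp add: mult.assoc)
  qed
  have "(\<lambda>n. ?f (Suc n)) sums (\<Sum>n. ?f (Suc n))" by (intro summable_sums) auto
  then have "?f sums ((\<Sum>n. ?f (Suc n)) + ?f 0)" by (rule sums_Suc)
  then have "(\<Sum>n. ?f n) = (\<Sum>n. ?f (Suc n))" by (simp add: sums_iff)
  then show ?thesis
    using nn_integral_eq[of "\<lambda>x. ennreal x * g x"] nn_integral_eq[of "\<lambda>x. g (x + 1)"] unfolding S by simp
qed

lemma first_moment: "integrable P (\<lambda>w. enn2real (X w))" "expectation (\<lambda>w. enn2real (X w)) = a"
proof -
  have *: "(\<integral>\<^sup>+w. ennreal (enn2real (X w)) \<partial>P) = ennreal a"
    using nn_integral_Chen_Stein[of "\<lambda>_. 1"] by (simp add: emeasure_space_1)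
  then show i: "integrable P (\<lambda>w. enn2real (X w))" by (intro integrableI_nonneg) auto
  show "expectation (\<lambda>w. enn2real (X w)) = a"
    using * a_nonneg by (subst integral_eq_nn_integral) auto
qed

lemma second_moment: "integrable P (\<lambda>w. (enn2real (X w))\<^sup>2)" "expectation (\<lambda>w. (enn2real (X w))\<^sup>2) = a * (a + 1)"
proof -
  have "(\<integral>\<^sup>+w. ennreal ((enn2real (X w))\<^sup>2) \<partial>P) = ennreal a * (\<integral>\<^sup>+w. ennreal (enn2real (X w) + 1) \<partial>P)"
    using nn_integral_Chen_Stein[of ennreal] by (simp add: ennreal_mult' power2_eq_square)
  also have "(\<integral>\<^sup>+w. ennreal (enn2real (X w) + 1) \<partial>P) = ennreal (a + 1)"
    using first_moment by (subst nn_integral_eq_integral) (auto simp: prob_space)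
  finally have *: "(\<integral>\<^sup>+w. ennreal ((enn2real (X w))\<^sup>2) \<partial>P) = ennreal (a * (a + 1))"
    using a_nonneg by (simp add: ennreal_mult)
  then show i: "integrable P (\<lambda>w. (enn2real (X w))\<^sup>2)" by (intro integrableI_nonneg) auto
  show "expectation (\<lambda>w. (enn2real (X w))\<^sup>2) = a * (a + 1)"
    using * a_nonneg by (subst integral_eq_nn_integral) auto
qed

text \<open>On the event, \<open>N (N - 1) >= 1\<close>, and the mean of \<open>N (N - 1)\<close> is
  \<open>a^2\<close> by the Chen-Stein identity with \<open>g(x) = x - 1\<close>. At
  \<open>N = 0\<close> the truncation of \<open>N - 1\<close> by \<open>ennreal\<close> is harmless
  because the other factor vanishes.\<close>

lemma prob_gt_1: "prob {w \<in> space P. \<not> X w \<le> 1} \<le> a\<^sup>2"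
proof -
  have "ennreal (prob {w \<in> space P. \<not> X w \<le> 1}) = (\<integral>\<^sup>+w. indicator {w \<in> space P. \<not> X w \<le> 1} w \<partial>P)"
    by (simp add: emeasure_eq_measure)
  also have "\<dots> \<le> (\<integral>\<^sup>+w. ennreal (enn2real (X w)) * ennreal (enn2real (X w) - 1) \<partial>P)"
  proof (rule nn_integral_mono_AE)
    show "AE w in P. indicator {w \<in> space P. \<not> X w \<le> 1} w \<le> ennreal (enn2real (X w)) * ennreal (enn2real (X w) - 1)"
      using AE_nat
    proof eventually_elim
      case (elim w)
      then obtain n where n: "X w = of_nat n" by auto
      show ?case
      proof (cases "n \<le> 1")
        case True
        then have "X w \<le> 1" using n by (simp add: ennreal_of_nat_eq_real_of_nat)
        then show ?thesis by simp
      next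
        case False
        then have "1 * 1 \<le> real n * (real n - 1)" by (intro mult_mono) auto
        then have "1 \<le> ennreal (real n * (real n - 1))" by (simp add: ennreal_1[symmetric] del: ennreal_1)
        then show ?thesis using n False by (auto simp: ennreal_mult indicator_def ennreal_of_nat_eq_real_of_nat)
      qed
    qed
  qed
  also have "\<dots> = ennreal a * (\<integral>\<^sup>+w. ennreal (enn2real (X w)) \<partial>P)"
    using nn_integral_Chen_Stein[of "\<lambda>x. ennreal (x - 1)"] by simp
  also have "\<dots> = ennreal (a\<^sup>2)"
    using first_moment a_nonneg by (subst nn_integral_eq_integral) (auto simp: power2_eq_square ennreal_mult)
  finally show ?thesis using a_nonneg by (simp add: ennreal_le_iff)
qed

end

locale poisson_process = partitioned_measure M cell K \<epsilon>
  for M :: "'z measure" and cell K \<epsilon> +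
  fixes P :: "'w measure" and \<eta> :: "'w \<Rightarrow> 'z measure"
  assumes poisson: "poisson_measure P M \<eta>"
    and singleton_sets: "z \<in> space M \<Longrightarrow> {z} \<in> sets M"
begin

sublocale P: prob_space P using poisson by (simp add: poisson_measure_def)

lemma sets_eta: "w \<in> space P \<Longrightarrow> sets (\<eta> w) = sets M"
  using poisson by (simp add: poisson_measure_def)

lemma emeasure_eta_measurable [measurable]: "B \<in> sets M \<Longrightarrow> (\<lambda>w. emeasure (\<eta> w) B) \<in> borel_measurable P"
  using poisson by (simp add: poisson_measure_def)

lemma poisson_variable_eta: "B \<in> sets M \<Longrightarrow> poisson_variable P (\<lambda>w. emeasure (\<eta> w) B) (measure M B)"
  using poisson
  by unfold_locales (auto simp: poisson_measure_def poisson_weight_def emeasure_eq_measure)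

lemma measure_eta_measurable [measurable]: "B \<in> sets M \<Longrightarrow> (\<lambda>w. measure (\<eta> w) B) \<in> borel_measurable P"
  unfolding measure_def by measurable

lemma indep_measure_eta:
  assumes "finite (J :: nat set)" "disjoint_family_on D J" "\<And>j. j \<in> J \<Longrightarrow> D j \<in> sets M"
  shows "P.indep_vars (\<lambda>_. borel) (\<lambda>j w. measure (\<eta> w) (D j)) J"
proof -
  have "P.indep_vars (\<lambda>_. borel) (\<lambda>j w. emeasure (\<eta> w) (D j)) J"
    using poisson assms by (auto simp: poisson_measure_def emeasure_eq_measure)
  from P.indep_vars_compose2[OF this, of "\<lambda>_. enn2real" "\<lambda>_. borel"] show ?thesis by (simp add: measure_def)
qed

sublocale noise: centered_noise P M "compensated M \<eta>"
proof
  fix B assume B: "B \<in> sets M"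
  interpret X: poisson_variable P "\<lambda>w. emeasure (\<eta> w) B" "measure M B" by (rule poisson_variable_eta[OF B])
  have c: "compensated M \<eta> B = (\<lambda>w. enn2real (emeasure (\<eta> w) B) - measure M B)"
    by (auto simp: compensated_def measure_def)
  have sq: "(compensated M \<eta> B w)\<^sup>2 = (enn2real (emeasure (\<eta> w) B))\<^sup>2 - 2 * measure M B * enn2real (emeasure (\<eta> w) B) + (measure M B)\<^sup>2" for w
    unfolding c by (simp add: power2_diff)
  show "square_integrable P (compensated M \<eta> B)"
    unfolding square_integrable_def sq using X.first_moment X.second_moment B by (simp add: c)
  show "(\<integral>w. compensated M \<eta> B w \<partial>P) = 0"
    unfolding c using X.first_moment by (simp add: P.prob_space)
  show "(\<integral>w. (compensated M \<eta> B w)\<^sup>2 \<partial>P) = measure M B"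
    unfolding sq using X.first_moment X.second_moment by (simp add: P.prob_space power2_eq_square algebra_simps)
next
  fix J :: "nat set" and D :: "nat \<Rightarrow> 'z set"
  assume "finite J" "disjoint_family_on D J" "\<And>j. j \<in> J \<Longrightarrow> D j \<in> sets M"
  from P.indep_vars_compose2[OF indep_measure_eta[OF this], of "\<lambda>j x. x - measure M (D j)" "\<lambda>_. borel"]
  show "P.indep_vars (\<lambda>_. borel) (\<lambda>j. compensated M \<eta> (D j)) J"
    by (simp add: compensated_def[abs_def])
next
  fix B C assume BC: "B \<in> sets M" "C \<in> sets M" "B \<inter> C = {}"
  \<comment> \<open>Finite additivity of \<open>measure (\<eta> w)\<close> requires a finite total
    mass, which is almost sure because that mass is a Poisson variable.\<close>
  interpret X: poisson_variable P "\<lambda>w. emeasure (\<eta> w) (space M)" "measure M (space M)"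
    by (rule poisson_variable_eta) auto
  show "AE w in P. compensated M \<eta> (B \<union> C) w = compensated M \<eta> B w + compensated M \<eta> C w"
    using X.AE_nat AE_space
  proof eventually_elim
    case (elim w)
    have s: "sets (\<eta> w) = sets M" using elim sets_eta by simp
    then have "space (\<eta> w) = space M" by (rule sets_eq_imp_space_eq)
    then have "emeasure (\<eta> w) (space (\<eta> w)) \<noteq> \<infinity>" using elim by auto
    then interpret E: finite_measure "\<eta> w" by (rule finite_measureI)
    have "measure (\<eta> w) (B \<union> C) = measure (\<eta> w) B + measure (\<eta> w) C"
      using BC s by (intro E.finite_measure_Union) auto
    moreover have "measure M (B \<union> C) = measure M B + measure M C"
      using BC by (intro finite_measure_Union) auto
    ultimately show ?case by (simp add: compensated_def)
  qed
qed

text \<open>Almost sure properties of a realisation. The third clause says that there are no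
  multiple points; the last one puts every tuple of distinct support points into some
  \<open>separated\<close> set.\<close>

definition regular :: "'w \<Rightarrow> bool" where
  "regular w \<longleftrightarrow> finite (support_points (\<eta> w)) \<and> support_points (\<eta> w) \<subseteq> space M \<and>
     (\<forall>B\<in>sets M. measure (\<eta> w) B = real (card (support_points (\<eta> w) \<inter> B))) \<and>
     (\<exists>n. inj_on (cell n) (support_points (\<eta> w)))"

text \<open>By \<open>prob_gt_1\<close> and a union bound over the cells, level \<open>n\<close>
  fails with probability at most \<open>\<epsilon> n\<close> times the total mass, so that all
  levels fail with probability zero.\<close>

lemma AE_single_points: "AE w in P. \<exists>n. \<forall>c<K n. emeasure (\<eta> w) (part n c) \<le> 1"
proof -
  define E where "E n = {w \<in> space P. \<not> (\<forall>c<K n. emeasure (\<eta> w) (part n c) \<le> 1)}" for n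
  have E_sets [measurable]: "E n \<in> sets P" for n unfolding E_def by measurable
  have "P.prob (E n) \<le> \<epsilon> n * measure M (space M)" for n
  proof -
    have "E n = (\<Union>c<K n. {w \<in> space P. \<not> emeasure (\<eta> w) (part n c) \<le> 1})" by (auto simp: E_def)
    also have "P.prob \<dots> \<le> (\<Sum>c<K n. P.prob {w \<in> space P. \<not> emeasure (\<eta> w) (part n c) \<le> 1})"
      by (rule measure_UNION_le) auto
    also have "\<dots> \<le> (\<Sum>c<K n. (measure M (part n c))\<^sup>2)"
      by (intro sum_mono poisson_variable.prob_gt_1 poisson_variable_eta) auto
    also have "\<dots> \<le> \<epsilon> n * measure M (space M)" by (rule sum_square_measure_part)
    finally show ?thesis .
  qed
  moreover have "P.prob (\<Inter>n. E n) \<le> P.prob (E n)" for n by (intro P.finite_measure_mono) auto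
  ultimately have "P.prob (\<Inter>n. E n) \<le> \<epsilon> n * measure M (space M)" for n by (rule order_trans[rotated])
  moreover have "(\<lambda>n. \<epsilon> n * measure M (space M)) \<longlonglongrightarrow> 0 * measure M (space M)" by (intro tendsto_intros mesh_tendsto)
  ultimately have "P.prob (\<Inter>n. E n) \<le> 0" by (intro LIMSEQ_le_const[of "\<lambda>n. \<epsilon> n * measure M (space M)"]) auto
  then have "P.prob (\<Inter>n. E n) = 0" using measure_nonneg[of P "\<Inter>n. E n"] by linarith
  then have "(\<Inter>n. E n) \<in> null_sets P" by (auto simp: P.emeasure_eq_measure)
  then show ?thesis by (rule AE_I'[of "\<Inter>n. E n"]) (auto simp: E_def)
qed

text \<open>The representation as a countable sum of Dirac masses is finite because the total mass
  is. Two indices with points in one cell would give that cell mass 2, so at a good level the points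
  are distinct and separated, and they are exactly the atoms.\<close>

lemma AE_regular: "AE w in P. regular w"
proof -
  interpret X: poisson_variable P "\<lambda>w. emeasure (\<eta> w) (space M)" "measure M (space M)"
    by (rule poisson_variable_eta) auto
  have "AE w in P. \<exists>(I :: nat set) z. z \<in> I \<rightarrow> space M \<and> \<eta> w = distr (count_space I) M z"
    using poisson by (simp add: poisson_measure_def)
  then show ?thesis
    using AE_single_points X.AE_nat
  proof eventually_elim
    case (elim w)
    obtain I :: "nat set" and z where z: "z \<in> I \<rightarrow> space M" and e: "\<eta> w = distr (count_space I) M z"
      using elim(1) by auto
    obtain n where n: "\<And>c. c < K n \<Longrightarrow> emeasure (\<eta> w) (part n c) \<le> 1" using elim(2) by auto
    have em: "emeasure (\<eta> w) B = emeasure (count_space I) (z -` B \<inter> I)" if "B \<in> sets M" for B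
      unfolding e using z that by (subst emeasure_distr) auto
    have "z -` space M \<inter> I = I" using z by auto
    then have "emeasure (count_space I) I \<noteq> \<infinity>" using em[of "space M"] elim(3) by auto
    then have fin: "finite I" by (auto simp: emeasure_count_space split: if_splits)
    have em': "emeasure (\<eta> w) B = of_nat (card (z -` B \<inter> I))" if "B \<in> sets M" for B
      unfolding em[OF that] using fin by (subst emeasure_count_space_finite) auto
    have inj: "inj_on (cell n \<circ> z) I"
    proof (rule inj_onI, rule ccontr)
      fix i j assume ij: "i \<in> I" "j \<in> I" "(cell n \<circ> z) i = (cell n \<circ> z) j" "i \<noteq> j"
      let ?c = "cell n (z i)"
      have "{i, j} \<subseteq> z -` part n ?c \<inter> I" using ij z by (auto simp: part_def)
      then have "card {i, j} \<le> card (z -` part n ?c \<inter> I)" using fin by (intro card_mono) auto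
      then have "2 \<le> card (z -` part n ?c \<inter> I)" using ij by simp
      moreover have "?c < K n" using ij z cell_less by auto
      then have "(of_nat (card (z -` part n ?c \<inter> I)) :: ennreal) \<le> 1" using n[of ?c] em'[of "part n ?c"] by simp
      then have "card (z -` part n ?c \<inter> I) \<le> 1" by (simp add: ennreal_of_nat_eq_real_of_nat)
      ultimately show False by simp
    qed
    have injz: "inj_on z I" using inj by (rule inj_on_imageI2)
    have sp: "space (\<eta> w) = space M" by (simp add: e)
    have S: "support_points (\<eta> w) = z ` I"
    proof (intro equalityI subsetI)
      fix y assume "y \<in> support_points (\<eta> w)"
      then have y: "y \<in> space M" "emeasure (\<eta> w) {y} \<noteq> 0" by (auto simp: support_points_def sp)
      then have "card (z -` {y} \<inter> I) \<noteq> 0" using em'[OF singleton_sets[OF y(1)]] by auto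
      then show "y \<in> z ` I" by (auto simp: card_eq_0_iff)
    next
      fix y assume "y \<in> z ` I"
      then obtain i where i: "i \<in> I" "y = z i" by auto
      then have y: "y \<in> space M" using z by auto
      have "i \<in> z -` {y} \<inter> I" using i by auto
      then have "card (z -` {y} \<inter> I) \<noteq> 0" using fin by (auto simp: card_eq_0_iff)
      then show "y \<in> support_points (\<eta> w)" using em'[OF singleton_sets[OF y]] y by (simp add: support_points_def sp)
    qed
    have "measure (\<eta> w) B = real (card (support_points (\<eta> w) \<inter> B))" if B: "B \<in> sets M" for B
    proof -
      have "z ` (z -` B \<inter> I) = z ` I \<inter> B" by auto
      then have "card (z ` I \<inter> B) = card (z -` B \<inter> I)"
        using card_image[of z "z -` B \<inter> I"] injz by (auto intro: inj_on_subset)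
      then show ?thesis by (simp add: measure_def em'[OF B] S)
    qed
    moreover have "inj_on (cell n) (support_points (\<eta> w))"
      unfolding S using inj by (rule inj_on_imageI)
    ultimately show "regular w" unfolding regular_def S using fin z by auto
  qed
qed

definition tuple_count :: "nat \<Rightarrow> (nat \<Rightarrow> 'z) set \<Rightarrow> 'w \<Rightarrow> real" where
  "tuple_count q B w = real (card (distinct_tuples q (support_points (\<eta> w)) \<inter> B))"

lemma finite_distinct_tuples: "finite S \<Longrightarrow> finite (distinct_tuples q S)"
  unfolding distinct_tuples_def by (rule finite_subset[of _ "{..<q} \<rightarrow>\<^sub>E S"]) (auto intro: finite_PiE)

lemma tuple_count_rectangle:
  assumes "regular w" "\<And>j. j < q \<Longrightarrow> A j \<in> sets M" "disjoint_family_on A {..<q}"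
  shows "tuple_count q (PiE {..<q} A) w = (\<Prod>j<q. measure (\<eta> w) (A j))"
proof -
  let ?S = "support_points (\<eta> w)"
  have "distinct_tuples q ?S \<inter> PiE {..<q} A = PiE {..<q} (\<lambda>j. ?S \<inter> A j)"
  proof (intro equalityI subsetI)
    fix x assume x: "x \<in> PiE {..<q} (\<lambda>j. ?S \<inter> A j)"
    have "inj_on x {..<q}"
    proof (rule inj_onI, rule ccontr)
      fix i j assume ij: "i \<in> {..<q}" "j \<in> {..<q}" "x i = x j" "i \<noteq> j"
      then have "x i \<in> A i \<inter> A j" using x by (auto simp: PiE_iff) (metis IntD2 lessThan_iff)
      then show False using assms(3) ij by (auto simp: disjoint_family_on_def)
    qed
    then show "x \<in> distinct_tuples q ?S \<inter> PiE {..<q} A" using x by (auto simp: distinct_tuples_def PiE_iff)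
  qed (auto simp: distinct_tuples_def PiE_iff)
  then show ?thesis
    using assms(1,2) by (simp add: tuple_count_def card_PiE regular_def)
qed

text \<open>The multivariate Campbell (Mecke) formula for the set \<open>B\<close>. The function
  \<open>g\<close> stands in for \<open>tuple_count q B\<close>, whose measurability is not at
  hand.\<close>

definition campbell :: "nat \<Rightarrow> (nat \<Rightarrow> 'z) set \<Rightarrow> bool" where
  "campbell q B \<longleftrightarrow> (\<exists>g. integrable P g \<and> (AE w in P. tuple_count q B w = g w) \<and>
     (\<integral>w. g w \<partial>P) = measure (pow M q) B)"

lemma campbell_rectangle:
  assumes "\<And>j. j < q \<Longrightarrow> A j \<in> sets M" "disjoint_family_on A {..<q}"
  shows "campbell q (PiE {..<q} A)"
  unfolding campbell_def
proof (intro exI conjI)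
  let ?g = "\<lambda>w. \<Prod>j<q. measure (\<eta> w) (A j)"
  have ind: "P.indep_vars (\<lambda>_. borel) (\<lambda>j w. measure (\<eta> w) (A j)) {..<q}"
    using assms by (intro indep_measure_eta) auto
  have m: "integrable P (\<lambda>w. measure (\<eta> w) (A j))" "(\<integral>w. measure (\<eta> w) (A j) \<partial>P) = measure M (A j)" if "j < q" for j
    using poisson_variable.first_moment[OF poisson_variable_eta[OF assms(1)[OF that]]] by (simp_all add: measure_def)
  show "integrable P ?g" using m by (intro P.indep_vars_integrable[OF _ ind]) auto
  have "(\<integral>w. ?g w \<partial>P) = (\<Prod>j<q. \<integral>w. measure (\<eta> w) (A j) \<partial>P)"
    using m by (intro P.indep_vars_lebesgue_integral[OF _ ind]) auto
  also have "\<dots> = measure (pow M q) (PiE {..<q} A)"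
    using assms m by (simp add: measure_power_rectangle)
  finally show "(\<integral>w. ?g w \<partial>P) = measure (pow M q) (PiE {..<q} A)" .
  show "AE w in P. tuple_count q (PiE {..<q} A) w = ?g w"
    using AE_regular by eventually_elim (rule tuple_count_rectangle[OF _ assms])
qed

lemma campbell_sum:
  assumes "finite I" "disjoint_family_on B I" "\<And>i. i \<in> I \<Longrightarrow> B i \<in> sets (pow M q)"
    and "\<And>i. i \<in> I \<Longrightarrow> campbell q (B i)"
  shows "campbell q (\<Union>i\<in>I. B i)"
proof -
  interpret Q: finite_measure "pow M q" by (rule finite_power_measure)
  have "\<forall>i\<in>I. \<exists>g. integrable P g \<and> (AE w in P. tuple_count q (B i) w = g w) \<and>
     (\<integral>w. g w \<partial>P) = measure (pow M q) (B i)" using assms(4) by (simp add: campbell_def)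
  then obtain g where g: "\<forall>i\<in>I. integrable P (g i) \<and> (AE w in P. tuple_count q (B i) w = g i w) \<and>
     (\<integral>w. g i w \<partial>P) = measure (pow M q) (B i)" by (rule bchoice[THEN exE])
  show ?thesis unfolding campbell_def
  proof (intro exI conjI)
    show "integrable P (\<lambda>w. \<Sum>i\<in>I. g i w)" using g by auto
    show "(\<integral>w. (\<Sum>i\<in>I. g i w) \<partial>P) = measure (pow M q) (\<Union>i\<in>I. B i)"
      using g assms by (subst Q.finite_measure_finite_Union) auto
    have "AE w in P. \<forall>i\<in>I. tuple_count q (B i) w = g i w" using g assms(1) by (intro AE_finite_allI) auto
    then show "AE w in P. tuple_count q (\<Union>i\<in>I. B i) w = (\<Sum>i\<in>I. g i w)"
      using AE_regular
    proof eventually_elim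
      case (elim w)
      let ?T = "distinct_tuples q (support_points (\<eta> w))"
      have "finite ?T" using elim by (auto simp: regular_def intro: finite_distinct_tuples)
      moreover have "?T \<inter> (\<Union>i\<in>I. B i) = (\<Union>i\<in>I. ?T \<inter> B i)" by auto
      ultimately have "card (?T \<inter> (\<Union>i\<in>I. B i)) = (\<Sum>i\<in>I. card (?T \<inter> B i))"
        using assms(1,2) by (simp only:) (rule card_UN_disjoint, auto simp: disjoint_family_on_def)
      then show ?case using elim(1) by (simp add: tuple_count_def)
    qed
  qed
qed

text \<open>A regular realisation has finitely many tuples, so their number in \<open>B n\<close> is
  eventually constant; monotone convergence then passes to the means.\<close>

lemma campbell_incseq:
  assumes B: "incseq B" "\<And>n. B n \<in> sets (pow M q)" "\<And>n. campbell q (B n)"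
  shows "campbell q (\<Union>n. B n)"
proof -
  interpret Q: finite_measure "pow M q" by (rule finite_power_measure)
  have "\<forall>n. \<exists>g. integrable P g \<and> (AE w in P. tuple_count q (B n) w = g w) \<and>
     (\<integral>w. g w \<partial>P) = measure (pow M q) (B n)" using B(3) by (simp add: campbell_def)
  then obtain g where g: "\<forall>n. integrable P (g n) \<and> (AE w in P. tuple_count q (B n) w = g n w) \<and>
     (\<integral>w. g n w \<partial>P) = measure (pow M q) (B n)" by (rule choice[THEN exE])
  define G where "G w = lim (\<lambda>n. g n w)" for w
  have [measurable]: "g n \<in> borel_measurable P" for n using g by auto
  have Gm: "G \<in> borel_measurable P" unfolding G_def by measurable
  have "AE w in P. \<forall>n. tuple_count q (B n) w = g n w" using g by (subst AE_all_countable) auto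
  then have lim: "AE w in P. mono (\<lambda>n. g n w) \<and> (\<lambda>n. g n w) \<longlonglongrightarrow> tuple_count q (\<Union>n. B n) w"
    using AE_regular
  proof eventually_elim
    case (elim w)
    let ?T = "distinct_tuples q (support_points (\<eta> w))"
    have fin: "finite ?T" using elim by (auto simp: regular_def intro: finite_distinct_tuples)
    have mono: "mono (\<lambda>n. g n w)"
    proof (rule monoI)
      fix m n :: nat assume "m \<le> n"
      then have "?T \<inter> B m \<subseteq> ?T \<inter> B n" using B(1) by (auto simp: incseq_def)
      then have "card (?T \<inter> B m) \<le> card (?T \<inter> B n)" using fin by (intro card_mono) auto
      then show "g m w \<le> g n w"
        using elim(1)[rule_format, of m] elim(1)[rule_format, of n] by (simp add: tuple_count_def)
    qed
    have "\<forall>x\<in>?T \<inter> (\<Union>n. B n). \<exists>n. x \<in> B n" by auto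
    then obtain f where f: "\<forall>x\<in>?T \<inter> (\<Union>n. B n). x \<in> B (f x)" by (rule bchoice[THEN exE])
    \<comment> \<open>The last level at which one of the finitely many tuples enters; 0 is inserted
      so that the maximum exists if there is no tuple.\<close>
    define m where "m = Max (insert 0 (f ` (?T \<inter> (\<Union>n. B n))))"
    have "?T \<inter> B n = ?T \<inter> (\<Union>n. B n)" if "n \<ge> m" for n
    proof (intro equalityI subsetI)
      fix x assume x: "x \<in> ?T \<inter> (\<Union>n. B n)"
      then have "f x \<le> m" unfolding m_def using fin by (intro Max_ge) auto
      then have "B (f x) \<subseteq> B n" using B(1) that by (auto simp: incseq_def)
      then show "x \<in> ?T \<inter> B n" using f x by auto
    qed auto
    then have "g n w = tuple_count q (\<Union>n. B n) w" if "n \<ge> m" for n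
      using elim(1) that by (metis tuple_count_def)
    then have "\<forall>\<^sub>F n in sequentially. g n w = tuple_count q (\<Union>n. B n) w" by (auto simp: eventually_sequentially)
    then have "(\<lambda>n. g n w) \<longlonglongrightarrow> tuple_count q (\<Union>n. B n) w" by (rule tendsto_eventually)
    then show ?case using mono by auto
  qed
  then have GE: "AE w in P. tuple_count q (\<Union>n. B n) w = G w"
    by eventually_elim (auto simp: G_def limI)
  have L: "(\<lambda>n. \<integral>w. g n w \<partial>P) \<longlonglongrightarrow> measure (pow M q) (\<Union>n. B n)"
    using g Q.finite_Lim_measure_incseq[of B] B by auto
  have *: "AE w in P. mono (\<lambda>n. g n w)" "AE w in P. (\<lambda>n. g n w) \<longlonglongrightarrow> G w"
    using lim GE by (eventually_elim, auto)+
  have gi: "integrable P (g n)" for n using g by auto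
  show ?thesis unfolding campbell_def
    using integrable_monotone_convergence[OF gi * L Gm] integral_monotone_convergence[OF gi * L Gm] GE by blast
qed

lemma regular_separated:
  assumes "regular w"
  shows "distinct_tuples q (support_points (\<eta> w)) \<subseteq> (\<Union>n. separated q n)"
proof
  fix x assume x: "x \<in> distinct_tuples q (support_points (\<eta> w))"
  obtain n where n: "inj_on (cell n) (support_points (\<eta> w))" using assms by (auto simp: regular_def)
  have "inj_on (cell n \<circ> x) {..<q}"
    using x n by (intro comp_inj_on) (auto simp: distinct_tuples_def PiE_iff intro: inj_on_subset)
  moreover have "x \<in> space (pow M q)"
    using x assms by (auto simp: distinct_tuples_def regular_def space_PiM PiE_iff)
  ultimately show "x \<in> (\<Union>n. separated q n)" by (auto simp: separated_def comp_def)
qed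

lemma campbell_cong:
  assumes "campbell q B" "measure (pow M q) B = measure (pow M q) B'"
    "AE w in P. tuple_count q B' w = tuple_count q B w"
  shows "campbell q B'"
proof -
  obtain g where g: "integrable P g" "AE w in P. tuple_count q B w = g w" "(\<integral>w. g w \<partial>P) = measure (pow M q) B"
    using assms(1) by (auto simp: campbell_def)
  have "AE w in P. tuple_count q B' w = g w" using g(2) assms(3) by eventually_elim simp
  then show ?thesis unfolding campbell_def using g assms(2) by auto
qed

text \<open>The complement step of the induction subtracts from the whole power. That space is, up
  to a null set and along the tuples of every regular realisation, the increasing union of the sets
  \<open>separated q n\<close>, each a finite disjoint union of rectangles off the
  diagonals.\<close>

lemma campbell_space: "campbell q (space (pow M q))"
proof (rule campbell_cong)
  interpret Q: finite_measure "pow M q" by (rule finite_power_measure)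
  show "campbell q (\<Union>n. separated q n)"
  proof (rule campbell_incseq[OF incseq_separated separated_sets])
    fix n
    show "campbell q (separated q n)" unfolding separated_eq
    proof (rule campbell_sum)
      show "disjoint_family_on (\<lambda>f. PiE {..<q} (\<lambda>j. part n (f j))) (injective_indices q (K n))"
        by (rule disjoint_separated_rectangles)
      fix f assume f: "f \<in> injective_indices q (K n)"
      show "PiE {..<q} (\<lambda>j. part n (f j)) \<in> sets (pow M q)" by (intro sets_PiM_I_finite) auto
      show "campbell q (PiE {..<q} (\<lambda>j. part n (f j)))"
        using f by (intro campbell_rectangle) (auto simp: disjoint_family_on_def part_def injective_indices_def inj_on_def)
    qed simp
  qed
  show "measure (pow M q) (\<Union>n. separated q n) = measure (pow M q) (space (pow M q))"
    using AE_separated[of q] by (intro Q.finite_measure_eq_AE) auto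
  show "AE w in P. tuple_count q (space (pow M q)) w = tuple_count q (\<Union>n. separated q n) w"
    using AE_regular
  proof eventually_elim
    case (elim w)
    have "(\<Union>n. separated q n) \<subseteq> space (pow M q)" by (auto simp: separated_def)
    then have "distinct_tuples q (support_points (\<eta> w)) \<inter> space (pow M q) =
      distinct_tuples q (support_points (\<eta> w)) \<inter> (\<Union>n. separated q n)"
      using regular_separated[OF elim, of q] by blast
    then show ?case by (simp add: tuple_count_def)
  qed
qed

lemma campbell_separated:
  assumes B: "B \<in> sets (pow M q)"
  shows "campbell q (B \<inter> (\<Union>n. separated q n))"
  using B
proof (induction rule: separated_induct)
  case empty
  then show ?case unfolding campbell_def by (intro exI[of _ "\<lambda>_. 0"]) (auto simp: tuple_count_def)
next
  case (rectangle A)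
  then show ?case by (rule campbell_rectangle)
next
  case (complement B)
  interpret Q: finite_measure "pow M q" by (rule finite_power_measure)
  obtain g where g: "integrable P g" "AE w in P. tuple_count q B w = g w" "(\<integral>w. g w \<partial>P) = measure (pow M q) B"
    using complement(2) by (auto simp: campbell_def)
  obtain f where f: "integrable P f" "AE w in P. tuple_count q (space (pow M q)) w = f w"
    "(\<integral>w. f w \<partial>P) = measure (pow M q) (space (pow M q))"
    using campbell_space by (auto simp: campbell_def)
  show ?case unfolding campbell_def
  proof (intro exI conjI)
    show "integrable P (\<lambda>w. f w - g w)" using f g by simp
    show "(\<integral>w. f w - g w \<partial>P) = measure (pow M q) (space (pow M q) - B)"
      using f g complement(1) by (simp add: Q.finite_measure_compl)
    show "AE w in P. tuple_count q (space (pow M q) - B) w = f w - g w"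
      using f(2) g(2) AE_regular
    proof eventually_elim
      case (elim w)
      let ?T = "distinct_tuples q (support_points (\<eta> w))" and ?\<Omega> = "space (pow M q)"
      have fin: "finite ?T" using elim by (auto simp: regular_def intro: finite_distinct_tuples)
      have sub: "B \<subseteq> ?\<Omega>" using complement(1) by (rule sets.sets_into_space)
      have "?T \<inter> (?\<Omega> - B) = (?T \<inter> ?\<Omega>) - (?T \<inter> B)" by auto
      then have "card (?T \<inter> (?\<Omega> - B)) = card (?T \<inter> ?\<Omega>) - card (?T \<inter> B)"
        using fin sub by (simp only:) (rule card_Diff_subset, auto)
      moreover have "card (?T \<inter> B) \<le> card (?T \<inter> ?\<Omega>)" using fin sub by (intro card_mono) auto
      ultimately show ?case unfolding elim(1,2)[symmetric] by (simp add: tuple_count_def of_nat_diff)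
    qed
  qed
next
  case (union B)
  have "campbell q (\<Union>n. \<Union>i<n. B i)"
  proof (rule campbell_incseq)
    show "incseq (\<lambda>n. \<Union>i<n. B i)" by (rule incseq_SucI) (auto simp: lessThan_Suc)
    show "(\<Union>i<n. B i) \<in> sets (pow M q)" for n using union by auto
    show "campbell q (\<Union>i<n. B i)" for n
      by (rule campbell_sum) (use union in \<open>auto simp: disjoint_family_on_def\<close>)
  qed
  moreover have "(\<Union>n. \<Union>i<n. B i) = (\<Union>i. B i)" by auto
  ultimately show ?case by simp
qed

text \<open>The expected number of tuples in a null set is zero, hence so is the number itself
  almost surely. This allows almost everywhere convergence of kernels to be evaluated along the
  random tuples.\<close>

lemma AE_distinct_tuples:
  assumes "AE x in pow M q. R x"
  shows "AE w in P. \<forall>x\<in>distinct_tuples q (support_points (\<eta> w)). R x"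
proof -
  interpret Q: finite_measure "pow M q" by (rule finite_power_measure)
  obtain B where B: "B \<in> null_sets (pow M q)" "{x \<in> space (pow M q). \<not> R x} \<subseteq> B"
    using assms by (auto simp: eventually_ae_filter)
  let ?B = "B \<inter> (\<Union>n. separated q n)"
  have "?B \<in> null_sets (pow M q)" using B(1) by (rule null_set_Int2) auto
  then have z: "measure (pow M q) ?B = 0" by (auto simp: measure_def null_sets_def)
  have "campbell q ?B" using B(1) by (intro campbell_separated) auto
  then obtain g where g: "integrable P g" "AE w in P. tuple_count q ?B w = g w" "(\<integral>w. g w \<partial>P) = 0"
    unfolding campbell_def z by auto
  have "AE w in P. 0 \<le> g w" using g(2) by eventually_elim (auto simp: tuple_count_def)
  then have "AE w in P. g w = 0" using integral_nonneg_eq_0_iff_AE[OF g(1)] g(3) by simp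
  then show ?thesis using g(2) AE_regular
  proof eventually_elim
    case (elim w)
    let ?T = "distinct_tuples q (support_points (\<eta> w))"
    have "finite ?T" using elim by (auto simp: regular_def intro: finite_distinct_tuples)
    then have "?T \<inter> ?B = {}" using elim by (auto simp: tuple_count_def)
    moreover have "?T \<subseteq> (\<Union>n. separated q n)" using elim by (intro regular_separated) auto
    ultimately have "x \<notin> B" "x \<in> space (pow M q)" if "x \<in> ?T" for x
      using that by (auto simp: separated_def)
    then show ?case using B(2) by auto
  qed
qed

lemma U_statistic_simple:
  assumes w: "regular w" and A: "disjoint_family_on A {..<N::nat}" "\<And>i. i < N \<Longrightarrow> A i \<in> sets M"
  shows "(\<Sum>x\<in>distinct_tuples k (support_points (\<eta> w)). simple_kernel k N A a x) =
    off_diagonal_sum k N a (\<lambda>j r. measure (\<eta> w) (A r))"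
proof -
  let ?S = "support_points (\<eta> w)"
  have fin: "finite ?S" using w by (simp add: regular_def)
  have "(\<Sum>x\<in>distinct_tuples k ?S. simple_kernel k N A a x) =
    (\<Sum>f\<in>injective_indices k N. \<Sum>x\<in>distinct_tuples k ?S. a f * (\<Prod>j<k. indicator (A (f j)) (x j)))"
    unfolding simple_kernel_def by (rule sum.swap)
  also have "\<dots> = (\<Sum>f\<in>injective_indices k N. a f * (\<Prod>j<k. measure (\<eta> w) (A (f j))))"
  proof (intro sum.cong refl)
    fix f assume f: "f \<in> injective_indices k N"
    have s: "A (f j) \<in> sets M" if "j < k" for j using A(2) injective_indices_less[OF f that] by auto
    have d: "disjoint_family_on (\<lambda>j. A (f j)) {..<k}" unfolding disjoint_family_on_def
    proof (intro ballI impI)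
      fix i j assume ij: "i \<in> {..<k}" "j \<in> {..<k}" "i \<noteq> j"
      then have "f i \<noteq> f j" using f by (auto simp: injective_indices_def inj_on_def)
      then show "A (f i) \<inter> A (f j) = {}"
        using A(1) injective_indices_less[OF f] ij unfolding disjoint_family_on_def by auto
    qed
    have "(\<Sum>x\<in>distinct_tuples k ?S. \<Prod>j<k. indicat_real (A (f j)) (x j)) =
      (\<Sum>x\<in>distinct_tuples k ?S. indicator (PiE {..<k} (\<lambda>j. A (f j))) x)"
      by (intro sum.cong refl prod_indicator_PiE) (auto simp: distinct_tuples_def PiE_iff)
    also have "\<dots> = tuple_count k (PiE {..<k} (\<lambda>j. A (f j))) w"
      using sum.inter_restrict[OF finite_distinct_tuples[OF fin, of k], of "\<lambda>_. 1 :: real" "PiE {..<k} (\<lambda>j. A (f j))"]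
      by (simp add: tuple_count_def indicator_def of_bool_def)
    also have "\<dots> = (\<Prod>j<k. measure (\<eta> w) (A (f j)))"
      by (rule tuple_count_rectangle[OF w s d])
    finally show "(\<Sum>x\<in>distinct_tuples k ?S. a f * (\<Prod>j<k. indicator (A (f j)) (x j))) = a f * (\<Prod>j<k. measure (\<eta> w) (A (f j)))"
      by (simp add: sum_distrib_left[symmetric])
  qed
  finally show ?thesis by (simp add: off_diagonal_sum_def)
qed

lemma U_statistic_simple_chaos:
  assumes w: "regular w" and A: "disjoint_family_on A {..<N::nat}" "\<And>i. i < N \<Longrightarrow> A i \<in> sets M"
    and sym: "symmetric_coeff k N a"
  shows "(\<Sum>x\<in>distinct_tuples k (support_points (\<eta> w)). simple_kernel k N A a x) =
    (\<Sum>i\<le>k. simple_integral (compensated M \<eta>) i N A (projected_coeff k N (\<lambda>r. measure M (A r)) a i) w)"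
proof -
  have "(\<Sum>x\<in>distinct_tuples k (support_points (\<eta> w)). simple_kernel k N A a x) =
    off_diagonal_sum k N a (\<lambda>j r. measure (\<eta> w) (A r))"
    by (rule U_statistic_simple[OF w A])
  also have "\<dots> = off_diagonal_sum k N a (\<lambda>j r. compensated M \<eta> (A r) w + measure M (A r))"
    by (simp add: compensated_def)
  finally show ?thesis
    unfolding simple_integral_off_diagonal_sum by (simp only: off_diagonal_sum_add[OF sym])
qed

text \<open>For simple kernels both sides agree pathwise. Along a subsequence \<open>r\<close> the
  kernels converge almost everywhere, hence along all tuples of almost every realisation; along a
  further subsequence \<open>t\<close> the sums of integrals, which converge in L2, converge almost
  surely. The two limits must agree.\<close>

theorem U_statistic_chaos:
  assumes h: "square_integrable (pow M k) h" and sym: "symmetric_kernel M k h"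
  shows "AE w in P. U_statistic k h \<eta> w =
    (\<Sum>i\<le>k. multiple_integral P M (compensated M \<eta>) i (projected_kernel M k h i) w)"
proof -
  obtain N A a where a: "kernel_approximation M k N A a h" and s: "\<forall>m. symmetric_coeff k (N m) (a m)"
    by (rule symmetric_kernel_approximation[OF h sym])
  have hm: "h \<in> borel_measurable (pow M k)" using h by (simp add: square_integrable_def)
  let ?b = "\<lambda>i m. projected_coeff k (N m) (\<lambda>r. measure M (A m r)) (a m) i"
  let ?I = "\<lambda>i. multiple_integral P M (compensated M \<eta>) i (projected_kernel M k h i)"
  let ?S = "\<lambda>m w. \<Sum>i\<le>k. simple_integral (compensated M \<eta>) i (N m) (A m) (?b i m) w"
  note a' = a[unfolded kernel_approximation_def]
  note lim = noise.multiple_integral_limit[OF projected_kernel_measurable[OF _ hm] kernel_approximation_projected[OF _ hm a]]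
  have Isq: "square_integrable P (?I i)" if "i \<le> k" for i by (rule lim(1)[OF that that])
  have Ssq: "square_integrable P (simple_integral (compensated M \<eta>) i (N m) (A m) (?b i m))" for i m
    using a' by (intro noise.simple_integral_square_integrable) auto
  have L: "L2_tendsto P ?S (\<lambda>w. \<Sum>i\<le>k. ?I i w)"
    using Isq Ssq by (intro L2_tendsto_sum lim(2)) (auto simp: square_integrable_def)
  obtain r where r: "strict_mono r" "AE x in pow M k. (\<lambda>m. simple_kernel k (N (r m)) (A (r m)) (a (r m)) x) \<longlonglongrightarrow> h x"
    by (rule L2_tendsto_AE_subseq[OF kernel_approximation_square_integrable(2)[OF a hm] h conjunct2[OF a']])
  obtain t where t: "strict_mono t" "AE w in P. (\<lambda>m. ?S (r (t m)) w) \<longlonglongrightarrow> (\<Sum>i\<le>k. ?I i w)"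
    by (rule L2_tendsto_AE_subseq[OF square_integrable_sum[OF Ssq] square_integrable_sum[OF Isq] L2_tendsto_subseq[OF L r(1)]]) auto
  show ?thesis
    using AE_distinct_tuples[OF r(2)] t(2) AE_regular
  proof eventually_elim
    case (elim w)
    let ?T = "distinct_tuples k (support_points (\<eta> w))"
    have fin: "finite ?T" using elim by (auto simp: regular_def intro: finite_distinct_tuples)
    have "(\<lambda>m. \<Sum>x\<in>?T. simple_kernel k (N (r m)) (A (r m)) (a (r m)) x) \<longlonglongrightarrow> (\<Sum>x\<in>?T. h x)"
      using elim(1) by (intro tendsto_sum) auto
    from LIMSEQ_subseq_LIMSEQ[OF this t(1)]
    have "(\<lambda>m. \<Sum>x\<in>?T. simple_kernel k (N (r (t m))) (A (r (t m))) (a (r (t m))) x) \<longlonglongrightarrow> (\<Sum>x\<in>?T. h x)"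
      by (simp add: comp_def)
    moreover have "(\<Sum>x\<in>?T. simple_kernel k (N m) (A m) (a m) x) = ?S m w" for m
      using a' by (intro U_statistic_simple_chaos elim s[rule_format]) auto
    ultimately have "(\<Sum>x\<in>?T. h x) = (\<Sum>i\<le>k. ?I i w)" using elim(2) by (simp add: LIMSEQ_unique)
    then show ?case using fin by (simp add: U_statistic_def infsum_finite)
  qed
qed

end

section \<open>Stein's method\<close>

lemma deriv_std_normal_density:
  "(std_normal_density has_real_derivative - x * std_normal_density x) (at x)"
proof -
  have "((\<lambda>x. exp (- x\<^sup>2 / 2)) has_real_derivative - x * exp (- x\<^sup>2 / 2)) (at x)"
    by (auto intro!: derivative_eq_intros)
  from DERIV_cmult[OF this, of "1 / sqrt (2 * pi)"] show ?thesis
    by (simp add: std_normal_density_def[abs_def] mult_ac)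
qed

lemma std_normal_density_pos: "0 < std_normal_density x"
  by (simp add: normal_density_pos)

lemma nonincreasing_to_zero_nonneg:
  fixes \<Phi> :: "real \<Rightarrow> real"
  assumes D: "\<And>y. x \<le> y \<Longrightarrow> (\<Phi> has_real_derivative \<Phi>' y) (at y)" "\<And>y. x \<le> y \<Longrightarrow> \<Phi>' y \<le> 0"
    and lim: "(\<Phi> \<longlongrightarrow> 0) at_top"
  shows "0 \<le> \<Phi> x"
proof (rule tendsto_upperbound[OF lim])
  have "\<Phi> y \<le> \<Phi> x" if "x \<le> y" for y
    using D that by (intro DERIV_nonpos_imp_nonincreasing[of x y \<Phi>]) (auto intro!: exI[of _ "\<Phi>' _"])
  then show "\<forall>\<^sub>F y in at_top. \<Phi> y \<le> \<Phi> x" by (auto simp: eventually_at_top_linorder)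
qed simp

lemma std_normal_density_tendsto_0: "(std_normal_density \<longlongrightarrow> 0) at_top"
  unfolding std_normal_density_def[abs_def] by real_asymp

lemma times_std_normal_density_tendsto_0: "((\<lambda>x. x * std_normal_density x) \<longlongrightarrow> 0) at_top"
  unfolding std_normal_density_def[abs_def] by real_asymp

text \<open>The two half-line comparisons behind the bounds on the Stein solution: the function
  compared with solves the same differential inequality and vanishes at infinity.\<close>

lemma Stein_comparison:
  assumes F: "\<And>x. (F has_real_derivative r x * std_normal_density x) (at x)" and lim: "(F \<longlongrightarrow> 0) at_top"
    and r: "\<And>x. \<bar>r x\<bar> \<le> \<bar>x\<bar> + 1" and x: "1 \<le> x"
  shows "\<bar>F x\<bar> \<le> 2 * std_normal_density x"
proof -
  \<comment> \<open>For \<open>y >= 1\<close> one has \<open>\<bar>r y\<bar> \<le> y + 1\<close> and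
    hence at most \<open>2 * y\<close>, which is why the factor 2 suffices. The signs
    \<open>s = 1\<close> and \<open>s = -1\<close> give the two one-sided bounds.\<close>
  have "0 \<le> 2 * std_normal_density x + s * F x" if s: "\<bar>s\<bar> = 1" for s
  proof (rule nonincreasing_to_zero_nonneg[where x = x and \<Phi> = "\<lambda>x. 2 * std_normal_density x + s * F x"
      and \<Phi>' = "\<lambda>y. (s * r y - 2 * y) * std_normal_density y"])
    fix y assume "x \<le> y"
    show "((\<lambda>x. 2 * std_normal_density x + s * F x) has_real_derivative (s * r y - 2 * y) * std_normal_density y) (at y)"
      by (auto intro!: derivative_eq_intros F deriv_std_normal_density simp: algebra_simps)
    have "s * r y \<le> \<bar>s * r y\<bar>" by simp
    also have "\<dots> \<le> 2 * y" using r[of y] s x \<open>x \<le> y\<close> by (simp add: abs_mult)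
    finally show "(s * r y - 2 * y) * std_normal_density y \<le> 0"
      by (intro mult_nonpos_nonneg) auto
  next
    have "((\<lambda>x. 2 * std_normal_density x + s * F x) \<longlongrightarrow> 2 * 0 + s * 0) at_top"
      by (intro tendsto_intros std_normal_density_tendsto_0 lim)
    then show "((\<lambda>x. 2 * std_normal_density x + s * F x) \<longlongrightarrow> 0) at_top" by simp
  qed
  from this[of 1] this[of "-1"] show ?thesis by auto
qed

lemma Stein_comparison_derivative:
  assumes F: "\<And>x. (F has_real_derivative r x * std_normal_density x) (at x)" and lim: "(F \<longlongrightarrow> 0) at_top"
    and r: "\<And>x. \<bar>r x\<bar> \<le> B" and x: "0 < x"
  shows "\<bar>x * F x\<bar> \<le> B * std_normal_density x"
proof -
  have B: "0 \<le> B" using r[of 0] by linarith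
  \<comment> \<open>The comparison function \<open>B w(x) / x\<close> is the Mills ratio bound; its
    derivative is \<open>-(B + B / x^2) w(x)\<close>, below both \<open>B w\<close> and
    \<open>-B w\<close> in the needed direction.\<close>
  have "0 \<le> B * std_normal_density x / x + s * F x" if s: "\<bar>s\<bar> = 1" for s
  proof (rule nonincreasing_to_zero_nonneg[where x = x and \<Phi> = "\<lambda>x. B * std_normal_density x / x + s * F x"
      and \<Phi>' = "\<lambda>y. (s * r y - B - B / y\<^sup>2) * std_normal_density y"])
    fix y assume y: "x \<le> y"
    then have "y \<noteq> 0" using x by auto
    then show "((\<lambda>x. B * std_normal_density x / x + s * F x) has_real_derivative (s * r y - B - B / y\<^sup>2) * std_normal_density y) (at y)"
      by (auto intro!: derivative_eq_intros F deriv_std_normal_density simp: field_simps power2_eq_square)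
    have "s * r y \<le> \<bar>s * r y\<bar>" by simp
    also have "\<dots> \<le> B" using r[of y] s by (simp add: abs_mult)
    finally have "s * r y \<le> B" .
    moreover have "0 \<le> B / y\<^sup>2" using B by simp
    ultimately have "s * r y - B - B / y\<^sup>2 \<le> 0" by linarith
    then show "(s * r y - B - B / y\<^sup>2) * std_normal_density y \<le> 0"
      by (intro mult_nonpos_nonneg) auto
  next
    have "((\<lambda>x. B * std_normal_density x * inverse x + s * F x) \<longlongrightarrow> B * 0 * 0 + s * 0) at_top"
      by (intro tendsto_intros std_normal_density_tendsto_0 lim tendsto_inverse_0_at_top filterlim_ident)
    then show "((\<lambda>x. B * std_normal_density x / x + s * F x) \<longlongrightarrow> 0) at_top" by (simp add: divide_inverse)
  qed
  from this[of 1] this[of "-1"] have "\<bar>F x\<bar> \<le> B * std_normal_density x / x" by auto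
  then show ?thesis using x by (simp add: abs_mult field_simps)
qed

lemma std_normal_abs_integral_le_1: "(\<integral>x. std_normal_density x * \<bar>x\<bar> \<partial>lborel) \<le> 1"
proof -
  have m: "integrable lborel (\<lambda>x. std_normal_density x * x\<^sup>2)" "(\<integral>x. std_normal_density x * x\<^sup>2 \<partial>lborel) = 1"
    using integrable_std_normal_moment[of 2] integral_std_normal_moment_even[of 1] by (simp_all add: fact_numeral)
  have "(\<integral>x. std_normal_density x * \<bar>x\<bar> \<partial>lborel) \<le> (\<integral>x. (std_normal_density x + std_normal_density x * x\<^sup>2) / 2 \<partial>lborel)"
  proof (rule integral_mono)
    show "integrable lborel (\<lambda>x. std_normal_density x * \<bar>x\<bar>)" using integrable_std_normal_moment_abs[of 1] by simp
    show "integrable lborel (\<lambda>x. (std_normal_density x + std_normal_density x * x\<^sup>2) / 2)" using m by simp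
    fix x :: real
    have "\<bar>x\<bar> \<le> (1 + x\<^sup>2) / 2" using sum_squares_bound[of 1 "\<bar>x\<bar>"] by simp
    then have "std_normal_density x * \<bar>x\<bar> \<le> std_normal_density x * ((1 + x\<^sup>2) / 2)" by (intro mult_left_mono) auto
    then show "std_normal_density x * \<bar>x\<bar> \<le> (std_normal_density x + std_normal_density x * x\<^sup>2) / 2"
      by (simp add: algebra_simps)
  qed
  also have "\<dots> = 1" using m by simp
  finally show ?thesis .
qed

text \<open>The mass below \<open>x - 1\<close> is constant in the upper limit, which reduces the
  improper integral to the fundamental theorem on a compact interval.\<close>

lemma integral_atMost_has_derivative:
  fixes u :: "real \<Rightarrow> real"
  assumes u: "integrable lborel u" and c: "continuous_on UNIV u"
  shows "((\<lambda>x. \<integral>t. indicator {..x} t * u t \<partial>lborel) has_real_derivative u x) (at x)"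
proof -
  have i: "integrable lborel (\<lambda>t. indicator A t * u t)" if "A \<in> sets borel" for A
    using integrable_mult_indicator[OF _ u, of A] that by simp
  have split: "(\<integral>t. indicator {..y} t * u t \<partial>lborel) = (\<integral>t. indicator {..x - 1} t * u t \<partial>lborel) + integral {x - 1..y} u"
    if y: "x - 1 \<le> y" for y
  proof -
    have n: "AE t in lborel. t \<noteq> x - 1"
      by (rule AE_I[of _ _ "{x - 1}"]) auto
    have "(\<integral>t. indicator {..y} t * u t \<partial>lborel) = (\<integral>t. indicator {..x - 1} t * u t + indicator {x - 1..y} t * u t \<partial>lborel)"
    proof (rule integral_cong_AE)
      show "AE t in lborel. indicator {..y} t * u t = indicator {..x - 1} t * u t + indicator {x - 1..y} t * u t"
        using n by eventually_elim (use y in \<open>auto simp: indicator_def\<close>)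
    qed (use i in auto)
    also have "\<dots> = (\<integral>t. indicator {..x - 1} t * u t \<partial>lborel) + (\<integral>t. indicator {x - 1..y} t * u t \<partial>lborel)"
      using i by simp
    also have "(\<integral>t. indicator {x - 1..y} t * u t \<partial>lborel) = integral {x - 1..y} u"
      using set_borel_integral_eq_integral(2)[of "{x - 1..y}" u] i
      by (simp add: set_lebesgue_integral_def set_integrable_def)
    finally show ?thesis .
  qed
  have "((\<lambda>y. integral {x - 1..y} u) has_real_derivative u x) (at x within {x - 1..x + 1})"
    by (rule integral_has_real_derivative) (auto intro: continuous_on_subset[OF c])
  then have "((\<lambda>y. integral {x - 1..y} u) has_real_derivative u x) (at x within {x - 1<..<x + 1})"
    by (rule has_field_derivative_subset) auto
  then have "((\<lambda>y. integral {x - 1..y} u) has_real_derivative u x) (at x)"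
    by (subst (asm) at_within_open) auto
  then have "((\<lambda>y. (\<integral>t. indicator {..x - 1} t * u t \<partial>lborel) + integral {x - 1..y} u) has_real_derivative u x) (at x)"
    by (auto intro!: derivative_eq_intros)
  then show ?thesis
  proof (rule has_field_derivative_transform_within_open[where S = "{x - 1<..}"])
    show "(\<integral>t. indicator {..x - 1} t * u t \<partial>lborel) + integral {x - 1..y} u = (\<integral>t. indicator {..y} t * u t \<partial>lborel)"
      if "y \<in> {x - 1<..}" for y using split[of y] that by simp
  qed auto
qed

definition normal_mean :: "(real \<Rightarrow> real) \<Rightarrow> real" where
  "normal_mean g = (\<integral>x. std_normal_density x * g x \<partial>lborel)"

text \<open>The derivative \<open>f'\<close> solves an equation of the same kind, with the bounded right-hand side \<open>f + g'\<close>;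
  hence the bounds on \<open>f'\<close>.\<close>

lemma Stein_solution:
  assumes g: "\<And>x. (g has_real_derivative g' x) (at x)" "\<And>x. \<bar>g' x\<bar> \<le> 1"
  obtains f f' where "\<And>x. (f has_real_derivative f' x) (at x)" "\<And>x. f' x - x * f x = g x - normal_mean g"
    "\<And>x. \<bar>f x\<bar> \<le> 12" "\<And>x. \<bar>f' x\<bar> \<le> 14" "\<And>x y. \<bar>f' x - f' y\<bar> \<le> 26 * \<bar>x - y\<bar>"
proof -
  let ?w = std_normal_density
  have g_cont: "continuous_on UNIV g" using g(1) DERIV_continuous_on by blast
  then have [measurable]: "g \<in> borel_measurable borel" by (rule borel_measurable_continuous_onI)
  have g_lip: "\<bar>g x - g y\<bar> \<le> \<bar>x - y\<bar>" for x y
    using field_differentiable_bound[of UNIV g g' 1 y x] g by (auto simp: has_field_derivative_at_within)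
  have gw: "integrable lborel (\<lambda>x. ?w x * g x)"
  proof (rule Bochner_Integration.integrable_bound)
    show "integrable lborel (\<lambda>x. \<bar>g 0\<bar> * ?w x + ?w x * \<bar>x\<bar>)"
      using integrable_std_normal_moment_abs[of 1] by simp
    have "\<bar>g x\<bar> \<le> \<bar>g 0\<bar> + \<bar>x\<bar>" for x using g_lip[of x 0] by linarith
    then have "\<bar>?w x * g x\<bar> \<le> ?w x * (\<bar>g 0\<bar> + \<bar>x\<bar>)" for x by (simp add: abs_mult mult_left_mono)
    then show "AE x in lborel. norm (?w x * g x) \<le> norm (\<bar>g 0\<bar> * ?w x + ?w x * \<bar>x\<bar>)" by (simp add: algebra_simps)
  qed measurable
  define c where "c = normal_mean g"
  define r where "r x = g x - c" for x
  define u where "u x = r x * ?w x" for x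
  have w_int: "integrable lborel ?w" by simp
  have u_eq: "u = (\<lambda>x. ?w x * g x - c * ?w x)" by (auto simp: u_def r_def algebra_simps)
  have u_int: "integrable lborel u"
    unfolding u_eq by (intro Bochner_Integration.integrable_diff gw integrable_mult_right w_int)
  have u_0: "(\<integral>x. u x \<partial>lborel) = 0"
    unfolding u_eq using Bochner_Integration.integral_diff[OF gw integrable_mult_right[OF w_int, of c]]
    by (simp add: c_def normal_mean_def)
  \<comment> \<open>The increment of \<open>g\<close> from 0 to \<open>x\<close> is at most
    \<open>\<bar>x\<bar>\<close>, and \<open>g 0\<close> differs from the normal mean of
    \<open>g\<close> by at most the first absolute normal moment, hence by at most 1.\<close>
  have r_bound: "\<bar>r x\<bar> \<le> \<bar>x\<bar> + 1" for x
  proof -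
    have "g 0 - c = (\<integral>x. ?w x * (g 0 - g x) \<partial>lborel)"
      using gw by (simp add: right_diff_distrib c_def normal_mean_def)
    also have "\<bar>\<dots>\<bar> \<le> (\<integral>x. \<bar>?w x * (g 0 - g x)\<bar> \<partial>lborel)" by (rule integral_abs_bound)
    also have "\<dots> \<le> (\<integral>x. ?w x * \<bar>x\<bar> \<partial>lborel)"
    proof (rule integral_mono)
      show "integrable lborel (\<lambda>x. ?w x * \<bar>x\<bar>)" using integrable_std_normal_moment_abs[of 1] by simp
      show "integrable lborel (\<lambda>x. \<bar>?w x * (g 0 - g x)\<bar>)" using gw by (intro integrable_abs) (simp add: right_diff_distrib)
      show "\<bar>?w x * (g 0 - g x)\<bar> \<le> ?w x * \<bar>x\<bar>" for x
        using g_lip[of 0 x] by (simp add: abs_mult mult_left_mono)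
    qed
    also have "\<dots> \<le> 1" by (rule std_normal_abs_integral_le_1)
    finally show ?thesis using g_lip[of x 0] unfolding r_def by linarith
  qed
  \<comment> \<open>The Stein solution is \<open>F\<close> divided by the density. As
    \<open>u\<close> has integral zero, \<open>F\<close> vanishes at both ends of the line.\<close>
  define F where "F x = (\<integral>t. indicator {..x} t * u t \<partial>lborel)" for x
  have u_cont: "continuous_on UNIV u"
    unfolding u_def r_def using g_cont DERIV_continuous_on[OF deriv_std_normal_density]
    by (intro continuous_intros) blast+
  have F_deriv: "(F has_real_derivative r x * ?w x) (at x)" for x
    using integral_atMost_has_derivative[OF u_int u_cont, of x] unfolding F_def u_def by simp
  have F_top: "(F \<longlongrightarrow> 0) at_top"
    unfolding F_def using tendsto_integral_at_top[OF sets_lborel u_int] by (simp add: u_0)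
  have F_bot: "((\<lambda>x. F (- x)) \<longlongrightarrow> 0) at_top"
  proof -
    have "((\<lambda>x. \<integral>t. indicator {..-x} t * u t \<partial>lborel) \<longlongrightarrow> (\<integral>t. 0 \<partial>(lborel::real measure))) at_top"
    proof (rule integral_dominated_convergence_at_top[where w = "\<lambda>t. \<bar>u t\<bar>"])
      have *: "\<forall>\<^sub>F x in at_top. - x < t" for t :: real
        using eventually_gt_at_top[of "- t"] by eventually_elim auto
      show "AE t in lborel. ((\<lambda>x. indicator {..-x} t * u t) \<longlongrightarrow> 0) at_top"
      proof (rule AE_I2)
        fix t :: real
        show "((\<lambda>x. indicator {..-x} t * u t) \<longlongrightarrow> 0) at_top"
          by (rule tendsto_eventually, rule eventually_mono[OF *[of t]]) (auto simp: indicator_def)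
      qed
      show "\<forall>\<^sub>F x in at_top. AE t in lborel. norm (indicator {..-x} t * u t) \<le> \<bar>u t\<bar>"
        by (auto simp: indicator_def)
    qed (use u_int in auto)
    then show ?thesis by (simp add: F_def)
  qed
  \<comment> \<open>The reflection reduces the negative half-line to the comparison on the positive
    one.\<close>
  have F_neg: "((\<lambda>x. - F (- x)) has_real_derivative r (- x) * ?w x) (at x)" for x
  proof -
    have "((\<lambda>x. F (- x)) has_real_derivative (r (- x) * ?w (- x)) * (- 1)) (at x)"
      by (rule DERIV_chain2[OF F_deriv]) (auto intro!: derivative_eq_intros)
    then show ?thesis by (auto intro!: derivative_eq_intros simp: std_normal_density_def)
  qed
  define f where "f x = F x / ?w x" for x
  define f' where "f' x = x * f x + r x" for x
  have w_nz: "?w x \<noteq> 0" for x using std_normal_density_pos[of x] by simp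
  have f_deriv: "(f has_real_derivative f' x) (at x)" for x
  proof -
    have "((\<lambda>x. F x / ?w x) has_real_derivative (r x * ?w x * ?w x - F x * (- x * ?w x)) / (?w x * ?w x)) (at x)"
      by (rule DERIV_divide[OF F_deriv deriv_std_normal_density w_nz])
    moreover have "(r x * ?w x * ?w x - F x * (- x * ?w x)) / (?w x * ?w x) = f' x"
      using w_nz[of x] by (simp add: f'_def f_def field_simps)
    ultimately show ?thesis unfolding f_def[abs_def] by simp
  qed
  have out: "\<bar>F x\<bar> \<le> 2 * ?w x" if "1 \<le> \<bar>x\<bar>" for x
  proof (cases "0 \<le> x")
    case True
    then show ?thesis using that by (intro Stein_comparison[OF F_deriv F_top r_bound]) auto
  next
    case False
    have "((\<lambda>x. - F (- x)) \<longlongrightarrow> 0) at_top" using tendsto_minus[OF F_bot] by simp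
    then have "\<bar>- F (- (- x))\<bar> \<le> 2 * ?w (- x)"
      using that False r_bound by (intro Stein_comparison[OF F_neg]) (auto, metis abs_minus_cancel)
    then show ?thesis by (simp add: std_normal_density_def)
  qed
  \<comment> \<open>Where \<open>1 \<le> \<bar>x\<bar>\<close> the comparison gives 2. Inside,
    \<open>\<bar>F x\<bar>\<close> is at most \<open>2 * ?w 0\<close> for its value at 1 plus
    \<open>4 * ?w 0\<close> for the increment, and \<open>?w 0 \<le> 2 * ?w x\<close>; together this
    is the constant 12.\<close>
  have f_bound: "\<bar>f x\<bar> \<le> 12" for x
  proof (cases "1 \<le> \<bar>x\<bar>")
    case True
    then have "\<bar>f x\<bar> \<le> 2" using out[OF True] std_normal_density_pos[of x] by (simp add: f_def abs_div_pos[symmetric] field_simps)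
    then show ?thesis by simp
  next
    case False
    have w0: "?w y \<le> ?w 0" for y by (simp add: std_normal_density_def divide_right_mono)
    have w1: "?w 0 \<le> 2 * ?w y" if "\<bar>y\<bar> \<le> 1" for y
    proof -
      have "y\<^sup>2 \<le> 1" using power_mono[OF that, of 2] by simp
      then have "exp (y\<^sup>2 / 2) \<le> exp (1 / 2)" by simp
      also have "\<dots> \<le> 2"
      proof (rule power2_le_imp_le)
        have "(exp (1 / 2 :: real))\<^sup>2 = exp 1" by (simp add: power2_eq_square exp_add[symmetric])
        then show "(exp (1 / 2 :: real))\<^sup>2 \<le> 2\<^sup>2" using exp_le by simp
      qed simp
      finally have "1 \<le> 2 * exp (- y\<^sup>2 / 2)" by (simp add: exp_minus field_simps)
      then have "1 / sqrt (2 * pi) * 1 \<le> 1 / sqrt (2 * pi) * (2 * exp (- y\<^sup>2 / 2))" by (intro mult_left_mono) auto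
      then show ?thesis by (simp add: std_normal_density_def)
    qed
    have "\<bar>F 1 - F x\<bar> \<le> (2 * ?w 0) * \<bar>1 - x\<bar>"
    proof -
      have "norm (F 1 - F x) \<le> 2 * ?w 0 * norm (1 - x)"
      proof (rule field_differentiable_bound[of "{-1..1}" F "\<lambda>x. r x * ?w x"])
        fix z :: real assume z: "z \<in> {-1..1}"
        show "(F has_field_derivative r z * ?w z) (at z within {-1..1})"
          by (rule has_field_derivative_at_within[OF F_deriv])
        have "\<bar>r z\<bar> * ?w z \<le> 2 * ?w 0" using z r_bound[of z] w0[of z] by (intro mult_mono) auto
        then show "norm (r z * ?w z) \<le> 2 * ?w 0" by (simp add: abs_mult)
      qed (use False in auto)
      then show ?thesis by simp
    qed
    also have "\<dots> \<le> (2 * ?w 0) * 2" using False by (intro mult_left_mono) auto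
    finally have "\<bar>F x\<bar> \<le> 6 * ?w 0" using out[of 1] w0[of 1] by simp
    also have "\<dots> \<le> 12 * ?w x" using w1[of x] False by simp
    finally show ?thesis using std_normal_density_pos[of x] by (simp add: f_def field_simps abs_div_pos[symmetric])
  qed
  \<comment> \<open>\<open>Q\<close> plays for \<open>f'\<close> the part that \<open>F\<close>
    plays for \<open>f\<close>. Its derivative is \<open>(f + g') w\<close>, with a coefficient
    bounded by \<open>12 + 1 = 13\<close>.\<close>
  define Q where "Q x = f' x * ?w x" for x
  have Q_eq: "Q x = x * F x + r x * ?w x" for x
    using w_nz[of x] by (simp add: Q_def f'_def f_def algebra_simps)
  have f'_deriv: "(f' has_real_derivative f x + x * f' x + g' x) (at x)" for x
    unfolding f'_def[abs_def] r_def
    by (rule derivative_eq_intros f_deriv g(1) | simp add: f'_def r_def)+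
  have Q_deriv: "(Q has_real_derivative (f x + g' x) * ?w x) (at x)" for x
    unfolding Q_def[abs_def]
    by (rule derivative_eq_intros f'_deriv deriv_std_normal_density | simp add: algebra_simps)+
  have Q_neg: "((\<lambda>x. - Q (- x)) has_real_derivative (f (- x) + g' (- x)) * ?w x) (at x)" for x
  proof -
    have "((\<lambda>x. Q (- x)) has_real_derivative ((f (- x) + g' (- x)) * ?w (- x)) * (- 1)) (at x)"
      by (rule DERIV_chain2[OF Q_deriv]) (auto intro!: derivative_eq_intros)
    then show ?thesis by (auto intro!: derivative_eq_intros simp: std_normal_density_def)
  qed
  \<comment> \<open>A crude bound whose only purpose is that \<open>Q\<close> vanishes at both ends
    of the line, as the comparison requires.\<close>
  have Qb: "\<bar>Q x\<bar> \<le> 13 * (\<bar>x\<bar> * ?w x) + ?w x" for x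
  proof -
    have "F x = f x * ?w x" using w_nz[of x] by (simp add: f_def)
    then have "\<bar>x * F x\<bar> \<le> \<bar>x\<bar> * (12 * ?w x)"
      using f_bound[of x] by (simp add: abs_mult mult_left_mono mult_right_mono)
    moreover have "\<bar>r x * ?w x\<bar> \<le> (\<bar>x\<bar> + 1) * ?w x"
      using r_bound[of x] by (simp add: abs_mult mult_right_mono)
    ultimately show ?thesis unfolding Q_eq by (simp add: algebra_simps)
  qed
  have Q_lim: "((\<lambda>x. Q (s * x)) \<longlongrightarrow> 0) at_top" if s: "\<bar>s\<bar> = 1" for s
  proof (rule Lim_null_comparison)
    have "((\<lambda>x. 13 * (x * ?w x) + ?w x) \<longlongrightarrow> 13 * 0 + 0) at_top"
      by (intro tendsto_intros std_normal_density_tendsto_0 times_std_normal_density_tendsto_0)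
    then show "((\<lambda>x. 13 * (x * ?w x) + ?w x) \<longlongrightarrow> 0) at_top" by simp
    show "\<forall>\<^sub>F x in at_top. norm (Q (s * x)) \<le> 13 * (x * ?w x) + ?w x"
      using eventually_ge_at_top[of 0]
    proof eventually_elim
      case (elim x)
      have "s\<^sup>2 = 1" using s by (metis one_power2 power2_abs)
      then have "?w (s * x) = ?w x" by (simp add: std_normal_density_def power_mult_distrib)
      then show ?case using Qb[of "s * x"] s elim by (simp add: abs_mult)
    qed
  qed
  have fg: "\<bar>f x + g' x\<bar> \<le> 13" for x using f_bound[of x] g(2)[of x] by linarith
  have xQ: "\<bar>x * Q x\<bar> \<le> 13 * ?w x" for x
  proof (cases x "0 :: real" rule: linorder_cases)
    case greater
    then show ?thesis using Q_lim[of 1] by (intro Stein_comparison_derivative[OF Q_deriv _ fg]) auto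
  next
    case less
    have "((\<lambda>x. - Q (- x)) \<longlongrightarrow> 0) at_top" using tendsto_minus[OF Q_lim[of "-1"]] by simp
    then have "\<bar>(- x) * (- Q (- (- x)))\<bar> \<le> 13 * ?w (- x)"
      using less fg by (intro Stein_comparison_derivative[OF Q_neg]) auto
    then show ?thesis by (simp add: std_normal_density_def)
  qed (simp add: less_imp_le[OF std_normal_density_pos])
  have xf': "\<bar>x * f' x\<bar> \<le> 13" for x
  proof -
    have "\<bar>x * f' x\<bar> * ?w x \<le> 13 * ?w x" using xQ[of x] by (simp add: Q_def abs_mult mult.assoc)
    then show ?thesis using std_normal_density_pos[of x] by simp
  qed
  \<comment> \<open>Outside the unit interval the bound 13 on \<open>x f'\<close> suffices; inside,
    \<open>f' = x f + r\<close> is at most \<open>12 + 2\<close>.\<close>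
  have f'_bound: "\<bar>f' x\<bar> \<le> 14" for x
  proof (cases "1 \<le> \<bar>x\<bar>")
    case True
    then have "1 * \<bar>f' x\<bar> \<le> \<bar>x\<bar> * \<bar>f' x\<bar>" by (intro mult_right_mono) auto
    then show ?thesis using xf'[of x] by (simp add: abs_mult)
  next
    case False
    have "\<bar>x * f x\<bar> \<le> 1 * 12" unfolding abs_mult using False f_bound[of x] by (intro mult_mono) auto
    moreover have "\<bar>r x\<bar> \<le> 2" using r_bound[of x] False by linarith
    ultimately show ?thesis unfolding f'_def by linarith
  qed
  \<comment> \<open>The second derivative is the sum of \<open>f + g'\<close> and
    \<open>x f'\<close>, each bounded by 13.\<close>
  have f'_lip: "\<bar>f' x - f' y\<bar> \<le> 26 * \<bar>x - y\<bar>" for x y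
  proof -
    have "norm (f' x - f' y) \<le> 26 * norm (x - y)"
    proof (rule field_differentiable_bound[of UNIV f' "\<lambda>x. f x + x * f' x + g' x"])
      show "norm (f z + z * f' z + g' z) \<le> 26" for z using fg[of z] xf'[of z] by simp
    qed (use f'_deriv in auto)
    then show ?thesis by simp
  qed
  show ?thesis
    by (rule that[of f f']) (use f_deriv f_bound f'_bound f'_lip in \<open>auto simp: f'_def r_def c_def\<close>)
qed

text \<open>The mean value inequality for \<open>t\<close> mapped to
  \<open>f (y + t b) - t b f'(y)\<close> on the unit interval. It yields the constant
  \<open>L\<close> in place of the optimal \<open>L / 2\<close>, which costs nothing for the
  rate.\<close>

lemma field_differentiable_lipschitz_remainder:
  fixes f f' :: "real \<Rightarrow> real"
  assumes f: "\<And>x. (f has_real_derivative f' x) (at x)" and L: "\<And>x y. \<bar>f' x - f' y\<bar> \<le> L * \<bar>x - y\<bar>"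
  shows "\<bar>f (y + b) - f y - b * f' y\<bar> \<le> L * b\<^sup>2"
proof -
  have L0: "0 \<le> L" using L[of 1 0] by (auto intro: order_trans[OF abs_ge_zero])
  have D: "((\<lambda>t. f (y + t * b) - t * b * f' y) has_real_derivative b * (f' (y + t * b) - f' y)) (at t)" for t
  proof -
    have "((\<lambda>t. f (y + t * b)) has_real_derivative f' (y + t * b) * b) (at t)"
      by (rule DERIV_chain2[OF f]) (auto intro!: derivative_eq_intros)
    then show ?thesis by (auto intro!: derivative_eq_intros simp: algebra_simps)
  qed
  have "norm ((f (y + 1 * b) - 1 * b * f' y) - (f (y + 0 * b) - 0 * b * f' y)) \<le> L * b\<^sup>2 * norm (1 - 0 :: real)"
  proof (rule field_differentiable_bound[of "{0..1}" "\<lambda>t. f (y + t * b) - t * b * f' y" "\<lambda>t. b * (f' (y + t * b) - f' y)"])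
    fix t :: real assume t: "t \<in> {0..1}"
    show "((\<lambda>t. f (y + t * b) - t * b * f' y) has_field_derivative b * (f' (y + t * b) - f' y)) (at t within {0..1})"
      by (rule has_field_derivative_at_within[OF D])
    have "\<bar>f' (y + t * b) - f' y\<bar> \<le> L * \<bar>b\<bar>"
    proof -
      have "\<bar>f' (y + t * b) - f' y\<bar> \<le> L * (\<bar>t\<bar> * \<bar>b\<bar>)" using L[of "y + t * b" y] by (simp add: abs_mult)
      also have "\<dots> \<le> L * (1 * \<bar>b\<bar>)" using t L0 by (intro mult_left_mono mult_right_mono) auto
      finally show ?thesis by simp
    qed
    then have "\<bar>b\<bar> * \<bar>f' (y + t * b) - f' y\<bar> \<le> \<bar>b\<bar> * (L * \<bar>b\<bar>)" by (intro mult_left_mono) auto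
    then show "norm (b * (f' (y + t * b) - f' y)) \<le> L * b\<^sup>2"
      by (simp add: abs_mult power2_eq_square mult_ac)
  qed auto
  then show ?thesis by (simp add: algebra_simps)
qed

context poisson_variable begin

abbreviation N where "N w \<equiv> enn2real (X w)"

text \<open>The nonnegative identity applied to \<open>g + B\<close>; the contribution of
  \<open>B\<close> cancels because the mean is \<open>a\<close>.\<close>

lemma Chen_Stein:
  assumes [measurable]: "g \<in> borel_measurable borel" and bound: "\<And>x. \<bar>g x\<bar> \<le> B"
  shows "integrable P (\<lambda>w. N w * g (N w))"
    and "expectation (\<lambda>w. N w * g (N w)) = a * expectation (\<lambda>w. g (N w + 1))"
proof -
  note N1 = first_moment
  have iN: "integrable P (\<lambda>w. N w * g (N w))"
  proof (rule Bochner_Integration.integrable_bound)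
    show "integrable P (\<lambda>w. B * N w)" using N1 by simp
    have "\<bar>N w * g (N w)\<bar> \<le> B * N w" for w
      using mult_left_mono[OF bound[of "N w"], of "N w"] by (simp add: abs_mult mult.commute)
    then show "AE w in P. norm (N w * g (N w)) \<le> norm (B * N w)"
      by (auto intro: order_trans[OF _ abs_ge_self])
  qed measurable
  show "integrable P (\<lambda>w. N w * g (N w))" by fact
  have i1: "integrable P (\<lambda>w. g (N w + 1))"
    by (rule integrable_const_bound[of _ B]) (auto simp: bound)
  have p: "0 \<le> g x + B" for x using bound[of x] by linarith
  have "ennreal (expectation (\<lambda>w. N w * (g (N w) + B))) = (\<integral>\<^sup>+w. ennreal (N w * (g (N w) + B)) \<partial>P)"
  proof (rule nn_integral_eq_integral[symmetric])
    show "integrable P (\<lambda>w. N w * (g (N w) + B))" using iN N1 by (simp add: distrib_left)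
    show "AE w in P. 0 \<le> N w * (g (N w) + B)" using p by (intro AE_I2 mult_nonneg_nonneg) auto
  qed
  also have "\<dots> = ennreal a * (\<integral>\<^sup>+w. ennreal (g (N w + 1) + B) \<partial>P)"
    using nn_integral_Chen_Stein[of "\<lambda>x. ennreal (g x + B)"] p by (simp add: ennreal_mult)
  also have "(\<integral>\<^sup>+w. ennreal (g (N w + 1) + B) \<partial>P) = ennreal (expectation (\<lambda>w. g (N w + 1) + B))"
    using i1 p by (intro nn_integral_eq_integral) auto
  finally have "ennreal (expectation (\<lambda>w. N w * (g (N w) + B))) = ennreal (a * expectation (\<lambda>w. g (N w + 1) + B))"
    using a_nonneg by (simp add: ennreal_mult')
  then have "expectation (\<lambda>w. N w * (g (N w) + B)) = a * expectation (\<lambda>w. g (N w + 1) + B)"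
    using a_nonneg p by (subst (asm) ennreal_inj) (auto intro!: mult_nonneg_nonneg integral_nonneg)
  then show "expectation (\<lambda>w. N w * g (N w)) = a * expectation (\<lambda>w. g (N w + 1))"
    using iN N1 i1 by (simp add: distrib_left prob_space)
qed

text \<open>Here \<open>b\<close> is the effect of one additional point. After the Chen-Stein
  identity the expectation is \<open>a\<close> times the mean of the remainder
  \<open>f (b (N + 1) + s) - f (b N + s) - b f'(b N + s)\<close>, which is of second order in
  \<open>b\<close>.\<close>

lemma Chen_Stein_smooth:
  assumes f: "\<And>x. (f has_real_derivative f' x) (at x)" "\<And>x. \<bar>f x\<bar> \<le> B" "\<And>x. \<bar>f' x\<bar> \<le> B'"
    and L: "\<And>x y. \<bar>f' x - f' y\<bar> \<le> L * \<bar>x - y\<bar>"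
  shows "\<bar>expectation (\<lambda>w. (N w - a) * f (b * N w + s) - a * b * f' (b * N w + s))\<bar> \<le> L * b\<^sup>2 * a"
proof -
  have f_cont: "continuous_on UNIV f" using f(1) DERIV_continuous_on by blast
  have [measurable]: "f \<in> borel_measurable borel" using f_cont by (rule borel_measurable_continuous_onI)
  have "L-lipschitz_on UNIV f'"
    using L order_trans[OF abs_ge_zero L[of 1 0]] by (auto simp: lipschitz_on_def dist_real_def)
  then have "continuous_on UNIV f'" by (rule lipschitz_on_continuous_on)
  then have [measurable]: "f' \<in> borel_measurable borel" by (rule borel_measurable_continuous_onI)
  let ?g = "\<lambda>x. f (b * x + s)"
  have m: "?g \<in> borel_measurable borel" by measurable
  note CS = Chen_Stein[of ?g B, OF m f(2)]
  have i: "integrable P (\<lambda>w. ?g (N w))" "integrable P (\<lambda>w. ?g (N w + 1))" "integrable P (\<lambda>w. f' (b * N w + s))"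
    using f(2,3) by (auto intro!: integrable_const_bound[where B = B and f = "\<lambda>w. f (_ w)"]
      integrable_const_bound[where B = B' and f = "\<lambda>w. f' (_ w)"])
  have "expectation (\<lambda>w. (N w - a) * f (b * N w + s) - a * b * f' (b * N w + s)) =
    expectation (\<lambda>w. N w * ?g (N w)) - a * expectation (\<lambda>w. ?g (N w)) - a * b * expectation (\<lambda>w. f' (b * N w + s))"
    using CS(1) i by (simp add: left_diff_distrib)
  also have "\<dots> = a * expectation (\<lambda>w. ?g (N w + 1) - ?g (N w) - b * f' (b * N w + s))"
    unfolding CS(2) using i by (simp add: algebra_simps)
  finally have e: "expectation (\<lambda>w. (N w - a) * f (b * N w + s) - a * b * f' (b * N w + s)) =
    a * expectation (\<lambda>w. ?g (N w + 1) - ?g (N w) - b * f' (b * N w + s))" .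
  have "\<bar>expectation (\<lambda>w. ?g (N w + 1) - ?g (N w) - b * f' (b * N w + s))\<bar> \<le>
    expectation (\<lambda>w. \<bar>?g (N w + 1) - ?g (N w) - b * f' (b * N w + s)\<bar>)" by (rule integral_abs_bound)
  also have "\<dots> \<le> expectation (\<lambda>_. L * b\<^sup>2)"
  proof (rule integral_mono)
    show "integrable P (\<lambda>w. \<bar>?g (N w + 1) - ?g (N w) - b * f' (b * N w + s)\<bar>)" using i by (intro integrable_abs) simp
    show "\<bar>?g (N w + 1) - ?g (N w) - b * f' (b * N w + s)\<bar> \<le> L * b\<^sup>2" for w
      using field_differentiable_lipschitz_remainder[OF f(1) L, of "b * N w + s" b] by (simp add: algebra_simps)
  qed simp
  finally have "\<bar>expectation (\<lambda>w. ?g (N w + 1) - ?g (N w) - b * f' (b * N w + s))\<bar> \<le> L * b\<^sup>2" by (simp add: prob_space)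
  from mult_left_mono[OF this a_nonneg] show ?thesis
    unfolding e using a_nonneg by (simp add: abs_mult mult.commute)
qed

end

text \<open>By independence the joint law is a product, and Fubini integrates over the law of
  \<open>X\<close> first, with the value of \<open>Y\<close> held fixed.\<close>

lemma (in prob_space) indep_var_integral_bound:
  fixes X Y :: "'a \<Rightarrow> real" and \<Psi> :: "real \<Rightarrow> real \<Rightarrow> real"
  assumes ind: "indep_var borel X borel Y" and \<Psi> [measurable]: "(\<lambda>(x, y). \<Psi> x y) \<in> borel_measurable (borel \<Otimes>\<^sub>M borel)"
    and int: "integrable M (\<lambda>w. \<Psi> (X w) (Y w))"
    and bound: "\<And>y. \<bar>expectation (\<lambda>w. \<Psi> (X w) y)\<bar> \<le> B"
  shows "\<bar>expectation (\<lambda>w. \<Psi> (X w) (Y w))\<bar> \<le> B"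
proof -
  have X [measurable]: "X \<in> borel_measurable M" and Y [measurable]: "Y \<in> borel_measurable M"
    using ind by (auto dest: indep_var_rv1 indep_var_rv2)
  interpret X: prob_space "distr M borel X" by (rule prob_space_distr) simp
  interpret Y: prob_space "distr M borel Y" by (rule prob_space_distr) simp
  interpret XY: pair_sigma_finite "distr M borel X" "distr M borel Y" ..
  have D: "distr M (borel \<Otimes>\<^sub>M borel) (\<lambda>w. (X w, Y w)) = distr M borel X \<Otimes>\<^sub>M distr M borel Y"
    using ind unfolding indep_var_distribution_eq by simp
  have s: "sets (distr M borel X \<Otimes>\<^sub>M distr M borel Y) = sets (borel \<Otimes>\<^sub>M borel)" by (intro sets_pair_measure_cong) auto
  have "integrable (distr M (borel \<Otimes>\<^sub>M borel) (\<lambda>w. (X w, Y w))) (\<lambda>(x, y). \<Psi> x y)"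
    using int integrable_distr_eq[of "\<lambda>w. (X w, Y w)" M "borel \<Otimes>\<^sub>M borel" "\<lambda>(x, y). \<Psi> x y"] by simp
  then have i: "integrable (distr M borel X \<Otimes>\<^sub>M distr M borel Y) (\<lambda>(x, y). \<Psi> x y)" unfolding D .
  have "expectation (\<lambda>w. \<Psi> (X w) (Y w)) = (\<integral>p. (\<lambda>(x, y). \<Psi> x y) p \<partial>distr M (borel \<Otimes>\<^sub>M borel) (\<lambda>w. (X w, Y w)))"
    by (subst integral_distr) auto
  also have "\<dots> = (\<integral>y. \<integral>x. \<Psi> x y \<partial>distr M borel X \<partial>distr M borel Y)"
    unfolding D using XY.integral_snd[OF i] by simp
  finally have e: "expectation (\<lambda>w. \<Psi> (X w) (Y w)) = (\<integral>y. \<integral>x. \<Psi> x y \<partial>distr M borel X \<partial>distr M borel Y)" .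
  have inner: "(\<integral>x. \<Psi> x y \<partial>distr M borel X) = expectation (\<lambda>w. \<Psi> (X w) y)" for y
  proof (rule integral_distr)
    have "(\<lambda>x. (x, y)) \<in> borel \<rightarrow>\<^sub>M borel \<Otimes>\<^sub>M borel" by measurable
    from measurable_compose[OF this \<Psi>] show "(\<lambda>x. \<Psi> x y) \<in> borel_measurable borel" by simp
  qed simp
  have "\<bar>\<integral>y. \<integral>x. \<Psi> x y \<partial>distr M borel X \<partial>distr M borel Y\<bar> \<le> (\<integral>y. \<bar>\<integral>x. \<Psi> x y \<partial>distr M borel X\<bar> \<partial>distr M borel Y)"
    by (rule integral_abs_bound)
  also have "\<dots> \<le> (\<integral>y. B \<partial>distr M borel Y)"
    using XY.integrable_snd[OF i] bound by (intro integral_mono integrable_abs) (auto simp: inner)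
  also have "\<dots> = B" using Y.prob_space by simp
  finally show ?thesis unfolding e .
qed

context poisson_process begin

text \<open>Each Poisson variable is treated by the Chen--Stein identity, the others being frozen by
  independence.\<close>

lemma normal_approximation_simple:
  assumes A: "disjoint_family_on A {..<n::nat}" "\<And>i. i < n \<Longrightarrow> A i \<in> sets M"
    and g: "\<And>x. (g has_real_derivative g' x) (at x)" "\<And>x. \<bar>g' x\<bar> \<le> 1"
  shows "\<bar>(\<integral>w. g (\<Sum>i<n. b i * compensated M \<eta> (A i) w) \<partial>P) - normal_mean g\<bar> \<le>
    14 * \<bar>1 - (\<Sum>i<n. (b i)\<^sup>2 * measure M (A i))\<bar> + 26 * (\<Sum>i<n. \<bar>b i\<bar> ^ 3 * measure M (A i))"
proof -
  obtain f f' where f: "\<And>x. (f has_real_derivative f' x) (at x)" "\<And>x. f' x - x * f x = g x - normal_mean g"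
    "\<And>x. \<bar>f x\<bar> \<le> 12" "\<And>x. \<bar>f' x\<bar> \<le> 14" "\<And>x y. \<bar>f' x - f' y\<bar> \<le> 26 * \<bar>x - y\<bar>"
    using Stein_solution[of g g', OF g] by metis
  have f_cont: "continuous_on UNIV f" using f(1) DERIV_continuous_on by blast
  then have [measurable]: "f \<in> borel_measurable borel" by (rule borel_measurable_continuous_onI)
  have "26-lipschitz_on UNIV f'" using f(5) by (auto simp: lipschitz_on_def dist_real_def)
  then have "continuous_on UNIV f'" by (rule lipschitz_on_continuous_on)
  then have [measurable]: "f' \<in> borel_measurable borel" by (rule borel_measurable_continuous_onI)
  define X where "X i w = enn2real (emeasure (\<eta> w) (A i))" for i w
  define a where "a i = measure M (A i)" for i
  define Z where "Z w = (\<Sum>i<n. b i * (X i w - a i))" for w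
  have X_var: "poisson_variable P (\<lambda>w. emeasure (\<eta> w) (A i)) (a i)" if "i < n" for i
    unfolding a_def by (rule poisson_variable_eta[OF A(2)[OF that]])
  have Xm [measurable]: "X i \<in> borel_measurable P" if "i < n" for i
    using A(2)[OF that] unfolding X_def[abs_def] by measurable
  have Zm [measurable]: "Z \<in> borel_measurable P" unfolding Z_def[abs_def] using Xm by (intro borel_measurable_sum) auto
  have Xi: "integrable P (X i)" if "i < n" for i
    using poisson_variable.first_moment(1)[OF X_var[OF that]] by (simp add: X_def[abs_def])
  have indX: "P.indep_vars (\<lambda>_. borel) X {..<n}"
    using indep_measure_eta[of "{..<n}" A] A unfolding X_def[abs_def] measure_def by auto
  have i1: "integrable P (\<lambda>w. (X i w - a i) * f (Z w))" if "i < n" for i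
  proof (rule Bochner_Integration.integrable_bound)
    show "integrable P (\<lambda>w. 12 * \<bar>X i w - a i\<bar>)" using Xi[OF that] by simp
    have "\<bar>(X i w - a i) * f (Z w)\<bar> \<le> 12 * \<bar>X i w - a i\<bar>" for w
      using mult_left_mono[OF f(3)[of "Z w"], of "\<bar>X i w - a i\<bar>"] by (simp add: abs_mult mult.commute)
    then show "AE w in P. norm ((X i w - a i) * f (Z w)) \<le> norm (12 * \<bar>X i w - a i\<bar>)" by simp
  qed (use that in measurable)
  have i2: "integrable P (\<lambda>w. f' (Z w))"
    by (rule P.integrable_const_bound[of _ 14]) (auto simp: f(4))
  have one: "\<bar>(\<integral>w. (X i w - a i) * f (Z w) - a i * b i * f' (Z w) \<partial>P)\<bar> \<le> 26 * (b i)\<^sup>2 * a i" if i: "i < n" for i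
  proof -
    interpret V: poisson_variable P "\<lambda>w. emeasure (\<eta> w) (A i)" "a i" by (rule X_var[OF i])
    let ?R = "\<lambda>w. (\<Sum>j\<in>{..<n} - {i}. b j * X j w)"
    let ?s = "\<Sum>j<n. b j * a j"
    \<comment> \<open>The weighted sum of the other variables, \<open>y\<close>, enters
      \<open>Chen_Stein_smooth\<close> only through the shift \<open>y - ?s\<close>.\<close>
    let ?\<Psi> = "\<lambda>x y. (x - a i) * f (b i * x + (y - ?s)) - a i * b i * f' (b i * x + (y - ?s))"
    have ins: "insert i ({..<n} - {i}) = {..<n}" using i by auto
    \<comment> \<open>The other variables are multiplied by their coefficients while the i-th one is
      kept as it is, so that the independence of one variable from the sum of the rest applies to
      \<open>X i\<close> itself.\<close>
    have "P.indep_vars (\<lambda>_. borel) (\<lambda>j w. (\<lambda>j x. if j = i then x else b j * x) j (X j w)) {..<n}"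
      by (rule P.indep_vars_compose2[OF indX]) auto
    then have ind: "P.indep_var borel (X i) borel ?R"
      using P.indep_vars_sum[of "{..<n} - {i}" i "\<lambda>j w. if j = i then X j w else b j * X j w"] ins by simp
    have Z: "Z w = b i * X i w + (?R w - ?s)" for w
    proof -
      have "Z w = (\<Sum>j<n. b j * X j w) - ?s" by (simp add: Z_def right_diff_distrib sum_subtractf)
      also have "(\<Sum>j<n. b j * X j w) = b i * X i w + ?R w" using i by (simp add: sum.remove)
      finally show ?thesis by simp
    qed
    have "\<bar>\<integral>w. ?\<Psi> (X i w) (?R w) \<partial>P\<bar> \<le> 26 * (b i)\<^sup>2 * a i"
    proof (rule P.indep_var_integral_bound[OF ind])
      show "(\<lambda>(x, y). ?\<Psi> x y) \<in> borel_measurable (borel \<Otimes>\<^sub>M borel)" by measurable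
      show "integrable P (\<lambda>w. ?\<Psi> (X i w) (?R w))" using i1[OF i] i2 unfolding Z by simp
      show "\<bar>\<integral>w. ?\<Psi> (X i w) y \<partial>P\<bar> \<le> 26 * (b i)\<^sup>2 * a i" for y
        using V.Chen_Stein_smooth[OF f(1,3,4,5), of "b i" "y - ?s"] unfolding X_def .
    qed
    then show ?thesis unfolding Z .
  qed
  \<comment> \<open>The Stein equation at \<open>Z\<close>, with the terms
    \<open>a i * (b i)^2 * f'\<close> subtracted and added: they complete each summand to a
    Chen-Stein error and leave the variance defect as a factor of \<open>f'\<close>. This is the
    origin of the constants 14 and 26.\<close>
  have g_eq: "g (Z w) - normal_mean g = f' (Z w) * (1 - (\<Sum>i<n. (b i)\<^sup>2 * a i)) -
     (\<Sum>i<n. b i * ((X i w - a i) * f (Z w) - a i * b i * f' (Z w)))" for w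
  proof -
    have "Z w * f (Z w) = (\<Sum>i<n. b i * ((X i w - a i) * f (Z w)))"
      by (simp add: Z_def sum_distrib_right mult.assoc)
    then show ?thesis
      unfolding f(2)[symmetric] by (simp add: right_diff_distrib sum_subtractf sum_distrib_left power2_eq_square mult_ac)
  qed
  have i3: "integrable P (\<lambda>w. b i * ((X i w - a i) * f (Z w) - a i * b i * f' (Z w)))" if "i < n" for i
    using i1[OF that] i2 by simp
  have gi: "integrable P (\<lambda>w. g (Z w) - normal_mean g)"
    unfolding g_eq using i2 i3 by (intro Bochner_Integration.integrable_diff Bochner_Integration.integrable_sum integrable_mult_left) auto
  have "integrable P (\<lambda>w. g (Z w))" using Bochner_Integration.integrable_add[OF gi, of "\<lambda>_. normal_mean g"] by simp
  then have "(\<integral>w. g (Z w) \<partial>P) - normal_mean g = (\<integral>w. g (Z w) - normal_mean g \<partial>P)" by (simp add: P.prob_space)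
  also have "\<dots> = (\<integral>w. f' (Z w) \<partial>P) * (1 - (\<Sum>i<n. (b i)\<^sup>2 * a i)) -
     (\<Sum>i<n. b i * (\<integral>w. (X i w - a i) * f (Z w) - a i * b i * f' (Z w) \<partial>P))"
    unfolding g_eq using i2 i3
    by (subst Bochner_Integration.integral_diff) (auto simp: Bochner_Integration.integral_sum intro!: Bochner_Integration.integrable_sum)
  finally have e: "(\<integral>w. g (Z w) \<partial>P) - normal_mean g = (\<integral>w. f' (Z w) \<partial>P) * (1 - (\<Sum>i<n. (b i)\<^sup>2 * a i)) -
     (\<Sum>i<n. b i * (\<integral>w. (X i w - a i) * f (Z w) - a i * b i * f' (Z w) \<partial>P))" .
  have "\<bar>\<integral>w. f' (Z w) \<partial>P\<bar> \<le> (\<integral>w. \<bar>f' (Z w)\<bar> \<partial>P)" by (rule integral_abs_bound)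
  also have "\<dots> \<le> (\<integral>w. 14 \<partial>P)" using i2 f(4) by (intro integral_mono integrable_abs) auto
  finally have b1: "\<bar>(\<integral>w. f' (Z w) \<partial>P) * (1 - (\<Sum>i<n. (b i)\<^sup>2 * a i))\<bar> \<le> 14 * \<bar>1 - (\<Sum>i<n. (b i)\<^sup>2 * a i)\<bar>"
    unfolding abs_mult by (intro mult_right_mono) (auto simp: P.prob_space)
  have "\<bar>\<Sum>i<n. b i * (\<integral>w. (X i w - a i) * f (Z w) - a i * b i * f' (Z w) \<partial>P)\<bar> \<le>
    (\<Sum>i<n. \<bar>b i\<bar> * (26 * (b i)\<^sup>2 * a i))"
    using one by (intro order_trans[OF sum_abs] sum_mono) (auto simp: abs_mult intro!: mult_left_mono)
  also have "\<dots> = 26 * (\<Sum>i<n. \<bar>b i\<bar> ^ 3 * a i)"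
    unfolding sum_distrib_left by (intro sum.cong refl) (simp add: power3_eq_cube power2_eq_square abs_mult[symmetric] mult_ac)
  finally have b2: "\<bar>\<Sum>i<n. b i * (\<integral>w. (X i w - a i) * f (Z w) - a i * b i * f' (Z w) \<partial>P)\<bar> \<le> 26 * (\<Sum>i<n. \<bar>b i\<bar> ^ 3 * a i)" .
  have Zc: "Z w = (\<Sum>i<n. b i * compensated M \<eta> (A i) w)" for w
    by (simp add: Z_def X_def a_def compensated_def measure_def)
  show ?thesis
    unfolding Zc[symmetric] a_def[symmetric] e using b1 b2 by linarith
qed

end

section \<open>Gaussian measures\<close>

text \<open>Normalised, the weight is a probability density. The hypothesis says that
  \<open>X\<close> has the same characteristic function under the reweighted law, hence the same law
  by Levy's uniqueness theorem.\<close>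

lemma (in prob_space) weight_indep:
  assumes [measurable]: "X \<in> borel_measurable M" "w \<in> borel_measurable M"
    and w: "\<And>v. 0 \<le> w v" "\<And>v. w v \<le> c"
    and char: "\<And>s. (\<integral>v. complex_of_real (w v) * iexp (s * X v) \<partial>M) =
       complex_of_real (\<integral>v. w v \<partial>M) * (\<integral>v. iexp (s * X v) \<partial>M)"
    and B: "B \<in> sets borel"
  shows "(\<integral>v. w v * indicator B (X v) \<partial>M) = (\<integral>v. w v \<partial>M) * prob {v \<in> space M. X v \<in> B}"
proof -
  have wi: "integrable M w" by (rule integrable_const_bound[of _ c]) (auto simp: w)
  define m where "m = (\<integral>v. w v \<partial>M)"
  have m0: "0 \<le> m" unfolding m_def using w by (intro Bochner_Integration.integral_nonneg) auto
  show ?thesis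
  proof (cases "m = 0")
    case True
    then have "AE v in M. w v = 0"
      using integral_nonneg_eq_0_iff_AE[OF wi] w by (auto simp: m_def)
    then have "(\<integral>v. w v * indicator B (X v) \<partial>M) = 0" by (intro integral_eq_zero_AE) auto
    then show ?thesis using True by (simp add: m_def)
  next
    case False
    then have m: "0 < m" using m0 by simp
    define D where "D = density M (\<lambda>v. ennreal (w v / m))"
    have D_meas [measurable]: "X \<in> borel_measurable D" by (simp add: D_def)
    have "emeasure D (space D) = (\<integral>\<^sup>+v. ennreal (w v / m) \<partial>M)"
      by (simp add: D_def emeasure_density cong: nn_integral_cong_simp)
    also have "\<dots> = ennreal (\<integral>v. w v / m \<partial>M)"
      using wi w m by (intro nn_integral_eq_integral) auto
    also have "\<dots> = 1" using m by (simp add: m_def)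
    finally interpret D: prob_space D by (rule prob_spaceI)
    have r: "real_distribution (distr D borel X)" "real_distribution (distr M borel X)"
      using D.real_distribution_distr[OF D_meas] real_distribution_distr by auto
    have "char (distr D borel X) = char (distr M borel X)"
    proof
      fix s
      have "char (distr D borel X) s = (\<integral>v. iexp (s * X v) \<partial>D)"
        unfolding char_def by (subst integral_distr) auto
      also have "\<dots> = (\<integral>v. (w v / m) *\<^sub>R iexp (s * X v) \<partial>M)"
        unfolding D_def using w m by (subst integral_density) auto
      also have "\<dots> = (\<integral>v. complex_of_real (1 / m) * (complex_of_real (w v) * iexp (s * X v)) \<partial>M)"
        by (intro Bochner_Integration.integral_cong refl) (simp add: scaleR_conv_of_real)
      also have "\<dots> = complex_of_real (1 / m) * (\<integral>v. complex_of_real (w v) * iexp (s * X v) \<partial>M)"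
        by (rule integral_mult_right_zero)
      also have "\<dots> = (\<integral>v. iexp (s * X v) \<partial>M)"
        unfolding char using m by (simp add: m_def[symmetric])
      also have "\<dots> = char (distr M borel X) s"
        unfolding char_def by (subst integral_distr) auto
      finally show "char (distr D borel X) s = char (distr M borel X) s" .
    qed
    then have eq: "distr D borel X = distr M borel X" by (rule Levy_uniqueness[OF r])
    have "(\<integral>v. indicat_real B (X v) \<partial>D) = (\<integral>v. indicat_real B (X v) \<partial>M)"
    proof -
      have "(\<integral>v. indicat_real B (X v) \<partial>D) = (\<integral>x. indicat_real B x \<partial>distr D borel X)"
        using B by (subst integral_distr) auto
      also have "\<dots> = (\<integral>v. indicat_real B (X v) \<partial>M)"
        unfolding eq using B by (subst integral_distr) auto
      finally show ?thesis .
    qed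
    moreover have "(\<integral>v. indicat_real B (X v) \<partial>D) = (\<integral>v. (w v / m) * indicat_real B (X v) \<partial>M)"
      unfolding D_def using w m B by (subst integral_density) auto
    moreover have "(\<integral>v. indicat_real B (X v) \<partial>M) = prob {v \<in> space M. X v \<in> B}"
    proof -
      have "(\<integral>v. indicat_real B (X v) \<partial>M) = (\<integral>v. indicat_real {v \<in> space M. X v \<in> B} v \<partial>M)"
        by (intro Bochner_Integration.integral_cong refl) (auto simp: indicator_def)
      then show ?thesis using B by simp
    qed
    ultimately have "(\<integral>v. w v * indicator B (X v) \<partial>M) / m = prob {v \<in> space M. X v \<in> B}" by simp
    then show ?thesis using m by (simp add: m_def[symmetric] field_simps)
  qed
qed

text \<open>Uniqueness of characteristic functions for a bounded complex weight \<open>V\<close> in place of a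
  probability, obtained from the nonnegative weights \<open>1 + Re V\<close> and \<open>1 + Re (- \<i> V)\<close>.\<close>

lemma (in prob_space) Re_weight_indep:
  fixes V :: "'a \<Rightarrow> complex"
  assumes X [measurable]: "X \<in> borel_measurable M" and V [measurable]: "V \<in> borel_measurable M"
    and bound: "\<And>w. norm (V w) \<le> 1"
    and char: "\<And>s. (\<integral>w. V w * iexp (s * X w) \<partial>M) = (\<integral>w. V w \<partial>M) * (\<integral>w. iexp (s * X w) \<partial>M)"
    and B: "B \<in> sets borel"
  shows "(\<integral>w. Re (V w) * indicator B (X w) \<partial>M) = Re (\<integral>w. V w \<partial>M) * prob {w \<in> space M. X w \<in> B}"
proof -
  have [measurable]: "(\<lambda>w. cnj (V w)) \<in> borel_measurable M"
    by (rule measurable_compose[OF V borel_measurable_continuous_onI]) (intro continuous_intros)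
  have Vi: "integrable M V" by (rule integrable_const_bound[of _ 1]) (auto simp: bound)
  have bRe: "\<bar>Re (V w)\<bar> \<le> 1" for w using bound[of w] abs_Re_le_cmod[of "V w"] by linarith
  have ei: "integrable M (\<lambda>w. iexp (s * X w))" and Ve: "integrable M (\<lambda>w. V w * iexp (s * X w))"
    and Vc: "integrable M (\<lambda>w. cnj (V w) * iexp (s * X w))" for s
    by (rule integrable_const_bound[of _ 1]; auto simp: norm_mult bound)+
  \<comment> \<open>Conjugating the hypothesis at \<open>- s\<close> gives it for the conjugate of
    \<open>V\<close>; adding the two gives it for the real part.\<close>
  have char': "(\<integral>w. cnj (V w) * iexp (s * X w) \<partial>M) = cnj (\<integral>w. V w \<partial>M) * (\<integral>w. iexp (s * X w) \<partial>M)" for s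
  proof -
    have e: "iexp (s * x) = cnj (iexp (- s * x))" for x by (simp add: exp_cnj)
    have "(\<integral>w. cnj (V w) * iexp (s * X w) \<partial>M) = (\<integral>w. cnj (V w * iexp (- s * X w)) \<partial>M)"
      by (simp only: e complex_cnj_mult)
    also have "\<dots> = cnj (\<integral>w. V w * iexp (- s * X w) \<partial>M)"
      using integral_bounded_linear[OF bounded_linear_cnj Ve[of "- s"]] by simp
    also have "\<dots> = cnj (\<integral>w. V w \<partial>M) * (\<integral>w. cnj (iexp (- s * X w)) \<partial>M)"
      unfolding char complex_cnj_mult using integral_bounded_linear[OF bounded_linear_cnj ei[of "- s"]] by simp
    finally show ?thesis by (simp only: e[symmetric])
  qed
  have Re_eq: "complex_of_real (Re z) = (z + cnj z) / 2" for z by (simp add: complex_eq_iff)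
  have ind: "(\<lambda>w. indicat_real B (X w)) \<in> borel_measurable M" using B by measurable
  have i: "integrable M (\<lambda>w. indicat_real B (X w))" "integrable M (\<lambda>w. Re (V w) * indicator B (X w))"
    by (rule integrable_const_bound[of _ 1]; use bRe ind in \<open>auto simp: indicator_def intro!: borel_measurable_times\<close>)+
  have "(\<integral>w. indicat_real B (X w) \<partial>M) = (\<integral>w. indicat_real {w \<in> space M. X w \<in> B} w \<partial>M)"
    by (intro Bochner_Integration.integral_cong refl) (auto simp: indicator_def)
  then have pB: "(\<integral>w. indicat_real B (X w) \<partial>M) = prob {w \<in> space M. X w \<in> B}" using B by simp
  have "(\<integral>w. (1 + Re (V w)) * indicator B (X w) \<partial>M) = (\<integral>w. 1 + Re (V w) \<partial>M) * prob {w \<in> space M. X w \<in> B}"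
  proof (rule weight_indep[OF X, where c = 2])
    show "0 \<le> 1 + Re (V w)" "1 + Re (V w) \<le> 2" for w using bRe[of w] by auto
    fix s
    have "(\<integral>w. complex_of_real (1 + Re (V w)) * iexp (s * X w) \<partial>M) =
      (\<integral>w. iexp (s * X w) + (V w * iexp (s * X w) + cnj (V w) * iexp (s * X w)) / 2 \<partial>M)"
      unfolding of_real_add Re_eq by (simp add: distrib_right add_divide_distrib)
    also have "\<dots> = (1 + ((\<integral>w. V w \<partial>M) + cnj (\<integral>w. V w \<partial>M)) / 2) * (\<integral>w. iexp (s * X w) \<partial>M)"
      using ei[of s] Ve[of s] Vc[of s] char[of s] char'[of s] by (simp add: field_simps)
    also have "1 + ((\<integral>w. V w \<partial>M) + cnj (\<integral>w. V w \<partial>M)) / 2 = complex_of_real (\<integral>w. 1 + Re (V w) \<partial>M)"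
      using Vi by (simp add: prob_space Re_eq[symmetric])
    finally show "(\<integral>w. complex_of_real (1 + Re (V w)) * iexp (s * X w) \<partial>M) =
      complex_of_real (\<integral>w. 1 + Re (V w) \<partial>M) * (\<integral>w. iexp (s * X w) \<partial>M)" .
  qed (use B in measurable)
  then show ?thesis using i Vi by (simp add: distrib_right prob_space pB)
qed

lemma (in prob_space) complex_weight_indep:
  fixes V :: "'a \<Rightarrow> complex"
  assumes X [measurable]: "X \<in> borel_measurable M" and V [measurable]: "V \<in> borel_measurable M"
    and bound: "\<And>w. norm (V w) \<le> 1"
    and char: "\<And>s. (\<integral>w. V w * iexp (s * X w) \<partial>M) = (\<integral>w. V w \<partial>M) * (\<integral>w. iexp (s * X w) \<partial>M)"
    and B: "B \<in> sets borel"
  shows "(\<integral>w. V w * indicator B (X w) \<partial>M) = (\<integral>w. V w \<partial>M) * prob {w \<in> space M. X w \<in> B}"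
proof -
  have "(\<lambda>w. indicator B (X w) :: complex) \<in> borel_measurable M" using B by measurable
  then have VB: "integrable M (\<lambda>w. V w * indicator B (X w))"
    by (intro integrable_const_bound[of _ 1] borel_measurable_times V) (auto simp: indicator_def bound)
  have r: "Re (indicator B x) = indicator B x" "Im (indicator B x) = 0" for x :: real
    by (simp_all add: indicator_def)
  \<comment> \<open>The hypothesis is linear in \<open>V\<close>, and the real part of
    \<open>- \<i> * V\<close> is the imaginary part of \<open>V\<close>.\<close>
  have "(\<integral>w. - \<i> * V w * iexp (s * X w) \<partial>M) = (\<integral>w. - \<i> * V w \<partial>M) * (\<integral>w. iexp (s * X w) \<partial>M)" for s
    using char[of s] unfolding mult.assoc integral_mult_right_zero by simp
  from Re_weight_indep[OF X _ _ this B] Re_weight_indep[OF X V bound char B] show ?thesis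
    using bound by (intro complex_eqI) (simp_all add: integral_Re[OF VB, symmetric] integral_Im[OF VB, symmetric] r norm_mult)
qed

text \<open>Kac's criterion; the indicators of the events are brought in one at a time.\<close>

theorem (in prob_space) indep_vars_characteristic_function:
  fixes X :: "'i \<Rightarrow> 'a \<Rightarrow> real"
  assumes J: "finite J" and X: "\<And>j. j \<in> J \<Longrightarrow> X j \<in> borel_measurable M"
    and char: "\<And>u. (\<integral>w. iexp (\<Sum>j\<in>J. u j * X j w) \<partial>M) = (\<Prod>j\<in>J. \<integral>w. iexp (u j * X j w) \<partial>M)"
  shows "indep_vars (\<lambda>_. borel) X J"
proof (cases "J = {}")
  case True
  then show ?thesis by (simp add: indep_vars_def indep_sets_def)
next
  case False
  \<comment> \<open>Interpolates between the factorised characteristic function, \<open>K\<close>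
    empty, and the factorised probabilities, \<open>K = J\<close>: indicators for the coordinates in
    \<open>K\<close>, exponentials with free frequencies for the rest.\<close>
  have key: "(\<integral>w. (\<Prod>j\<in>K. indicator (B j) (X j w)) * iexp (\<Sum>j\<in>J - K. u j * X j w) \<partial>M) =
      (\<Prod>j\<in>K. complex_of_real (prob {w \<in> space M. X j w \<in> B j})) * (\<Prod>j\<in>J - K. \<integral>w. iexp (u j * X j w) \<partial>M)"
    if K: "K \<subseteq> J" and B: "\<And>j. B j \<in> sets borel" for K B u
    using finite_subset[OF K J] K
  proof (induction K arbitrary: u)
    case empty
    then show ?case using char by simp
  next
    case (insert k K)
    let ?R = "J - insert k K"
    have k: "k \<in> J" "J - K = insert k ?R" using insert by auto
    have fR: "finite ?R" "k \<notin> ?R" using J by auto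
    note [measurable] = X[OF k(1)]
    let ?V = "\<lambda>w. (\<Prod>j\<in>K. indicator (B j) (X j w)) * iexp (\<Sum>j\<in>?R. u j * X j w)"
    have [measurable]: "(\<lambda>w. \<Sum>j\<in>?R. u j * X j w) \<in> borel_measurable M"
      by (intro borel_measurable_sum borel_measurable_times borel_measurable_const X) auto
    have "(\<lambda>w. \<Prod>j\<in>K. indicator (B j) (X j w) :: complex) \<in> borel_measurable M"
      using insert.prems by (intro borel_measurable_prod measurable_compose[OF X borel_measurable_indicator[OF B]]) auto
    then have Vm: "?V \<in> borel_measurable M" by measurable
    have Vb: "norm (?V w) \<le> 1" for w
      unfolding norm_mult prod_norm[symmetric] by (auto simp: indicator_def intro!: prod_le_1)
    have IH: "(\<integral>w. (\<Prod>j\<in>K. indicator (B j) (X j w)) * iexp (\<Sum>j\<in>J - K. v j * X j w) \<partial>M) =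
      (\<Prod>j\<in>K. complex_of_real (prob {w \<in> space M. X j w \<in> B j})) * (\<Prod>j\<in>J - K. \<integral>w. iexp (v j * X j w) \<partial>M)" for v
      using insert by auto
    have IHs: "(\<integral>w. ?V w * iexp (s * X k w) \<partial>M) =
      (\<Prod>j\<in>K. complex_of_real (prob {w \<in> space M. X j w \<in> B j})) * ((\<integral>w. iexp (s * X k w) \<partial>M) * (\<Prod>j\<in>?R. \<integral>w. iexp (u j * X j w) \<partial>M))" for s
    proof -
      have s: "(\<Sum>j\<in>J - K. (u(k := s)) j * X j w) = s * X k w + (\<Sum>j\<in>?R. u j * X j w)" for w
        unfolding k(2) using fR by (subst sum.insert) (auto intro!: sum.cong)
      have p: "(\<Prod>j\<in>J - K. \<integral>w. iexp ((u(k := s)) j * X j w) \<partial>M) =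
        (\<integral>w. iexp (s * X k w) \<partial>M) * (\<Prod>j\<in>?R. \<integral>w. iexp (u j * X j w) \<partial>M)"
        unfolding k(2) using fR by (subst prod.insert) (auto intro!: prod.cong)
      have e: "?V w * iexp (s * X k w) = (\<Prod>j\<in>K. indicator (B j) (X j w)) * iexp (\<Sum>j\<in>J - K. (u(k := s)) j * X j w)" for w
        unfolding s by (simp add: exp_add distrib_left)
      show ?thesis unfolding e IH p ..
    qed
    have V0: "(\<integral>w. ?V w \<partial>M) = (\<Prod>j\<in>K. complex_of_real (prob {w \<in> space M. X j w \<in> B j})) * (\<Prod>j\<in>?R. \<integral>w. iexp (u j * X j w) \<partial>M)"
      using IHs[of 0] by (simp add: prob_space)
    have "(\<integral>w. ?V w * indicator (B k) (X k w) \<partial>M) = (\<integral>w. ?V w \<partial>M) * prob {w \<in> space M. X k w \<in> B k}"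
    proof (rule complex_weight_indep[OF X[OF k(1)] Vm Vb _ B])
      show "(\<integral>w. ?V w * iexp (s * X k w) \<partial>M) = (\<integral>w. ?V w \<partial>M) * (\<integral>w. iexp (s * X k w) \<partial>M)" for s
        unfolding IHs V0 by (simp add: mult_ac)
    qed
    moreover have "?V w * indicator (B k) (X k w) =
      (\<Prod>j\<in>insert k K. indicator (B j) (X j w)) * iexp (\<Sum>j\<in>?R. u j * X j w)" for w
      using insert.hyps by (simp add: mult_ac)
    ultimately show ?case unfolding V0 using insert.hyps by (simp add: mult_ac)
  qed
  have "indep_vars (\<lambda>_. borel) X J \<longleftrightarrow> (\<forall>A\<in>(\<Pi> i\<in>J. sets borel). prob (\<Inter>j\<in>J. X j -` A j \<inter> space M) = (\<Prod>j\<in>J. prob (X j -` A j \<inter> space M)))"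
    by (rule indep_vars_finite[OF False J])
      (auto simp: X sets.sigma_sets_eq[of borel, simplified] Int_stable_def)
  moreover have "prob (\<Inter>j\<in>J. X j -` A j \<inter> space M) = (\<Prod>j\<in>J. prob (X j -` A j \<inter> space M))"
    if A: "A \<in> (\<Pi> i\<in>J. sets borel)" for A
  proof -
    \<comment> \<open>Outside \<open>J\<close> nothing is known of \<open>A\<close>, whereas
      \<open>key\<close> asks for a Borel set at every index.\<close>
    define B where "B j = (if j \<in> J then A j else {})" for j
    have B: "B j \<in> sets borel" for j using A by (auto simp: B_def)
    have e: "(\<Prod>j\<in>J. indicator (B j) (X j w)) = complex_of_real (indicat_real (\<Inter>j\<in>J. X j -` A j \<inter> space M) w)"
      if "w \<in> space M" for w
    proof (cases "\<forall>j\<in>J. X j w \<in> A j")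
      case True
      then show ?thesis using that by (simp add: B_def)
    next
      case False
      then obtain j where j: "j \<in> J" "X j w \<notin> A j" by auto
      then have "(\<Prod>j\<in>J. indicator (B j) (X j w)) = (0 :: complex)"
        using J by (intro prod_zero bexI[of _ j]) (auto simp: B_def)
      moreover have "w \<notin> (\<Inter>j\<in>J. X j -` A j \<inter> space M)" using j by blast
      ultimately show ?thesis by (simp only: indicator_simps of_real_0 not_False_eq_True)
    qed
    have s: "(\<Inter>j\<in>J. X j -` A j \<inter> space M) \<in> sets M"
      using False J A X by (intro sets.finite_INT) (auto intro!: measurable_sets)
    have "complex_of_real (prob (\<Inter>j\<in>J. X j -` A j \<inter> space M)) = (\<integral>w. complex_of_real (indicat_real (\<Inter>j\<in>J. X j -` A j \<inter> space M) w) \<partial>M)"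
      using s by (subst integral_complex_of_real) simp
    also have "\<dots> = (\<integral>w. (\<Prod>j\<in>J. indicator (B j) (X j w)) * iexp (\<Sum>j\<in>J - J. 0 * X j w) \<partial>M)"
      by (intro Bochner_Integration.integral_cong refl) (simp add: e)
    also have "\<dots> = (\<Prod>j\<in>J. complex_of_real (prob {w \<in> space M. X j w \<in> B j})) * (\<Prod>j\<in>J - J. \<integral>w. iexp (0 * X j w) \<partial>M)"
      by (rule key[OF subset_refl B])
    also have "\<dots> = (\<Prod>j\<in>J. complex_of_real (prob {w \<in> space M. X j w \<in> B j}))" by simp
    also have "\<dots> = complex_of_real (\<Prod>j\<in>J. prob (X j -` A j \<inter> space M))"
      by (auto simp: B_def vimage_def Int_def conj_commute intro!: prod.cong)
    finally show ?thesis by (simp only: of_real_eq_iff)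
  qed
  ultimately show ?thesis by blast
qed

lemma (in prob_space) centered_gaussian_moments:
  assumes Y: "centered_gaussian M Y"
  shows "square_integrable M Y" "expectation Y = 0"
    "(\<integral>w. iexp (u * Y w) \<partial>M) = exp (complex_of_real (- (u\<^sup>2 * expectation (\<lambda>w. (Y w)\<^sup>2) / 2)))"
proof -
  have [measurable]: "Y \<in> borel_measurable M" using Y by (simp add: centered_gaussian_def)
  from Y consider "AE w in M. Y w = 0" | s where "s > 0" "distributed M lborel Y (normal_density 0 s)"
    by (auto simp: centered_gaussian_def)
  then have "square_integrable M Y \<and> expectation Y = 0 \<and>
    (\<integral>w. iexp (u * Y w) \<partial>M) = exp (complex_of_real (- (u\<^sup>2 * expectation (\<lambda>w. (Y w)\<^sup>2) / 2)))"
  proof cases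
    case 1
    have "integrable M (\<lambda>w. (Y w)\<^sup>2)"
      by (rule integrable_const_bound[of _ 0]) (use 1 in \<open>auto\<close>)
    moreover have "expectation (\<lambda>w. (Y w)\<^sup>2) = 0" by (rule integral_eq_zero_AE) (use 1 in auto)
    moreover have "expectation Y = 0" by (rule integral_eq_zero_AE[OF 1])
    moreover have "(\<integral>w. iexp (u * Y w) \<partial>M) = (\<integral>w. 1 \<partial>M)" by (rule integral_cong_AE) (use 1 in auto)
    ultimately show ?thesis by (simp add: square_integrable_def prob_space)
  next
    case 2
    note D = 2(2)
    have "integrable lborel (\<lambda>x. normal_density 0 s x * x\<^sup>2)"
      using integrable_normal_moment[OF 2(1), of 0 2] by simp
    then have i: "integrable M (\<lambda>w. (Y w)\<^sup>2)"
      by (subst (asm) distributed_integrable[OF D]) auto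
    have m: "expectation Y = 0"
      using distributed_integral[OF D, of "\<lambda>x. x"] integral_normal_moment_nz_1[OF 2(1), of 0] by simp
    have v: "expectation (\<lambda>w. (Y w)\<^sup>2) = s\<^sup>2"
    proof -
      have "expectation (\<lambda>w. (Y w)\<^sup>2) = (\<integral>x. normal_density 0 s x * x\<^sup>2 \<partial>lborel)"
        using distributed_integral[OF D, of "\<lambda>x. x\<^sup>2"] by simp
      also have "\<dots> = s\<^sup>2" using integral_normal_moment_even[OF 2(1), of 0 1] by (simp add: fact_numeral)
      finally show ?thesis .
    qed
    have "distributed M lborel (\<lambda>w. (Y w - 0) / s) std_normal_density"
      using D normal_standard_normal_convert[OF 2(1)] by simp
    then have d: "distr M lborel (\<lambda>w. Y w / s) = density lborel std_normal_density" by (simp add: distributed_def)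
    have "(\<integral>w. iexp (u * Y w) \<partial>M) = (\<integral>w. iexp ((u * s) * (Y w / s)) \<partial>M)" using 2(1) by simp
    also have "\<dots> = (\<integral>x. iexp ((u * s) * x) \<partial>distr M lborel (\<lambda>w. Y w / s))"
      by (subst integral_distr) auto
    also have "\<dots> = char std_normal_distribution (u * s)" unfolding d char_def by simp
    also have "\<dots> = exp (complex_of_real (- (u\<^sup>2 * expectation (\<lambda>w. (Y w)\<^sup>2) / 2)))"
      unfolding char_std_normal_distribution v by (simp add: power_mult_distrib flip: exp_of_real)
    finally show ?thesis using i m by (simp add: square_integrable_def)
  qed
  then show "square_integrable M Y" "expectation Y = 0"
    "(\<integral>w. iexp (u * Y w) \<partial>M) = exp (complex_of_real (- (u\<^sup>2 * expectation (\<lambda>w. (Y w)\<^sup>2) / 2)))" by auto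
qed

text \<open>Additivity holds because the covariance makes the variance of
  \<open>G (B \<union> C) - G B - G C\<close> zero. Independence on disjoint sets holds because
  their covariances vanish, so that the characteristic function of any linear combination
  factorises.\<close>

lemma gaussian_measure_centered_noise:
  assumes G: "gaussian_measure Q \<mu> G" and fin: "finite_measure \<mu>"
  shows "centered_noise Q \<mu> G"
proof -
  interpret \<mu>: finite_measure \<mu> by fact
  interpret Q: prob_space Q using G by (simp add: gaussian_measure_def)
  have cov: "(\<integral>w. G B w * G C w \<partial>Q) = measure \<mu> (B \<inter> C)" if "B \<in> sets \<mu>" "C \<in> sets \<mu>" for B C
    using G that by (auto simp: gaussian_measure_def \<mu>.emeasure_eq_measure)
  have lin: "centered_gaussian Q (\<lambda>w. \<Sum>B\<in>\<B>. a B * G B w)" if "finite \<B>" "\<B> \<subseteq> sets \<mu>" for \<B> a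
    using G that by (auto simp: gaussian_measure_def \<mu>.emeasure_eq_measure)
  have single: "centered_gaussian Q (G B)" if "B \<in> sets \<mu>" for B using lin[of "{B}" "\<lambda>_. 1"] that by simp
  note sq = Q.centered_gaussian_moments(1)[OF single]
  have prod_int: "integrable Q (\<lambda>w. G B w * G C w)" if "B \<in> sets \<mu>" "C \<in> sets \<mu>" for B C
    using square_integrable_mult sq that by blast
  show ?thesis
  proof
    show "square_integrable Q (G B)" if "B \<in> sets \<mu>" for B by (rule sq[OF that])
    show "(\<integral>w. G B w \<partial>Q) = 0" if "B \<in> sets \<mu>" for B by (rule Q.centered_gaussian_moments(2)[OF single[OF that]])
    show "(\<integral>w. (G B w)\<^sup>2 \<partial>Q) = measure \<mu> B" if "B \<in> sets \<mu>" for B using cov[OF that that] by (simp add: power2_eq_square)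
  next
    fix B C assume B: "B \<in> sets \<mu>" and C: "C \<in> sets \<mu>" and BC: "B \<inter> C = {}"
    have BC': "B \<union> C \<in> sets \<mu>" using B C by auto
    have e: "(G (B \<union> C) w - (G B w + G C w))\<^sup>2 = G (B \<union> C) w * G (B \<union> C) w + G B w * G B w + G C w * G C w
        - 2 * (G (B \<union> C) w * G B w) - 2 * (G (B \<union> C) w * G C w) + 2 * (G B w * G C w)" for w
      by (simp add: power2_eq_square algebra_simps)
    have i: "integrable Q (\<lambda>w. (G (B \<union> C) w - (G B w + G C w))\<^sup>2)"
      unfolding e using prod_int B C BC' by simp
    have "(\<integral>w. (G (B \<union> C) w - (G B w + G C w))\<^sup>2 \<partial>Q) = measure \<mu> (B \<union> C) + measure \<mu> B + measure \<mu> C - 2 * measure \<mu> B - 2 * measure \<mu> C + 2 * measure \<mu> {}"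
    proof -
      have s: "(B \<union> C) \<inter> B = B" "(B \<union> C) \<inter> C = C" by auto
      show ?thesis unfolding e using prod_int B C BC' cov BC by (simp add: s)
    qed
    also have "\<dots> = 0" using B C BC by (simp add: \<mu>.finite_measure_Union)
    finally have "AE w in Q. (G (B \<union> C) w - (G B w + G C w))\<^sup>2 = 0"
      using integral_nonneg_eq_0_iff_AE[OF i] by simp
    then show "AE w in Q. G (B \<union> C) w = G B w + G C w" by simp
  next
    fix J :: "nat set" and D :: "nat \<Rightarrow> 'b set"
    assume J: "finite J" and disj: "disjoint_family_on D J" and D: "\<And>j. j \<in> J \<Longrightarrow> D j \<in> sets \<mu>"
    have var: "(\<integral>w. (\<Sum>j\<in>J. u j * G (D j) w)\<^sup>2 \<partial>Q) = (\<Sum>j\<in>J. (u j)\<^sup>2 * measure \<mu> (D j))" for u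
    proof -
      have "(\<Sum>j\<in>J. u j * G (D j) w)\<^sup>2 = (\<Sum>i\<in>J. \<Sum>j\<in>J. u i * u j * (G (D i) w * G (D j) w))" for w
        unfolding power2_eq_square sum_product by (intro sum.cong refl) simp
      then have "(\<integral>w. (\<Sum>j\<in>J. u j * G (D j) w)\<^sup>2 \<partial>Q) = (\<Sum>i\<in>J. \<Sum>j\<in>J. u i * u j * measure \<mu> (D i \<inter> D j))"
        using D prod_int by (simp add: Bochner_Integration.integral_sum cov)
      also have "\<dots> = (\<Sum>i\<in>J. \<Sum>j\<in>J. if j = i then (u i)\<^sup>2 * measure \<mu> (D i) else 0)"
        using disj by (intro sum.cong refl) (auto simp: disjoint_family_on_def power2_eq_square)
      finally show ?thesis using J by simp
    qed
    \<comment> \<open>\<open>D\<close> need not be injective, as the empty set may occur several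
      times. Since Gaussianity is given for sums over a set of sets, coefficients of equal sets are
      collected first.\<close>
    have gauss: "centered_gaussian Q (\<lambda>w. \<Sum>j\<in>J. u j * G (D j) w)" for u
    proof -
      have "(\<Sum>j\<in>J. u j * G (D j) w) = (\<Sum>B\<in>D ` J. (\<Sum>j | j \<in> J \<and> D j = B. u j) * G B w)" for w
        unfolding sum.image_gen[OF J, of "\<lambda>j. u j * G (D j) w" D] sum_distrib_right by (intro sum.cong refl) auto
      moreover have "centered_gaussian Q (\<lambda>w. \<Sum>B\<in>D ` J. (\<Sum>j | j \<in> J \<and> D j = B. u j) * G B w)"
        by (rule lin) (use J D in auto)
      ultimately show ?thesis by simp
    qed
    show "Q.indep_vars (\<lambda>_. borel) (\<lambda>j. G (D j)) J"
    proof (rule Q.indep_vars_characteristic_function[OF J])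
      show "G (D j) \<in> borel_measurable Q" if "j \<in> J" for j using sq[OF D[OF that]] by (simp add: square_integrable_def)
      fix u :: "nat \<Rightarrow> real"
      have "(\<integral>w. iexp (\<Sum>j\<in>J. u j * G (D j) w) \<partial>Q) = exp (complex_of_real (- ((\<Sum>j\<in>J. (u j)\<^sup>2 * measure \<mu> (D j)) / 2)))"
        using Q.centered_gaussian_moments(3)[OF gauss, of 1 u] by (simp add: var)
      also have "\<dots> = (\<Prod>j\<in>J. exp (complex_of_real (- ((u j)\<^sup>2 * measure \<mu> (D j) / 2))))"
        using J by (simp add: exp_sum[symmetric] sum_negf sum_divide_distrib)
      also have "\<dots> = (\<Prod>j\<in>J. \<integral>w. iexp (u j * G (D j) w) \<partial>Q)"
      proof (intro prod.cong refl)
        fix j assume j: "j \<in> J"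
        show "exp (complex_of_real (- ((u j)\<^sup>2 * measure \<mu> (D j) / 2))) = (\<integral>w. iexp (u j * G (D j) w) \<partial>Q)"
          using Q.centered_gaussian_moments(3)[OF single[OF D[OF j]], of "u j"] cov[OF D[OF j] D[OF j]]
          by (simp add: power2_eq_square)
      qed
      finally show "(\<integral>w. iexp (\<Sum>j\<in>J. u j * G (D j) w) \<partial>Q) = (\<Prod>j\<in>J. \<integral>w. iexp (u j * G (D j) w) \<partial>Q)" .
    qed
  qed
qed

section \<open>Weak convergence\<close>

lemma Lipschitz_borel_measurable:
  fixes g :: "real \<Rightarrow> real"
  assumes "\<And>x y. \<bar>g x - g y\<bar> \<le> L * \<bar>x - y\<bar>"
  shows "continuous_on UNIV g" "g \<in> borel_measurable borel"
proof -
  have "L-lipschitz_on UNIV g"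
    using assms order_trans[OF abs_ge_zero assms[of 1 0]] by (auto simp: lipschitz_on_def dist_real_def)
  then show "continuous_on UNIV g" by (rule lipschitz_on_continuous_on)
  then show "g \<in> borel_measurable borel" by (rule borel_measurable_continuous_onI)
qed

lemma Lipschitz_integrable:
  fixes g :: "real \<Rightarrow> real"
  assumes g: "\<And>x y. \<bar>g x - g y\<bar> \<le> L * \<bar>x - y\<bar>" and M: "finite_measure M" and Z: "integrable M Z"
  shows "integrable M (\<lambda>w. g (Z w))"
proof -
  interpret finite_measure M by fact
  have [measurable]: "g \<in> borel_measurable borel" by (rule Lipschitz_borel_measurable(2)[OF g])
  show ?thesis
  proof (rule Bochner_Integration.integrable_bound)
    show "integrable M (\<lambda>w. \<bar>g 0\<bar> + L * \<bar>Z w\<bar>)" using Z by simp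
    have "\<bar>g z\<bar> \<le> \<bar>g 0\<bar> + L * \<bar>z\<bar>" for z using g[of z 0] by simp
    then show "AE w in M. norm (g (Z w)) \<le> norm (\<bar>g 0\<bar> + L * \<bar>Z w\<bar>)" by (auto intro: order_trans[OF _ abs_ge_self])
    show "(\<lambda>w. g (Z w)) \<in> borel_measurable M" using Z by measurable
  qed
qed

lemma prob_space_std_normal: "prob_space std_normal_distribution"
  using real_dist_normal_dist by (simp add: real_distribution_def)

lemma std_normal_integral: 
  assumes [measurable]: "g \<in> borel_measurable borel"
  shows "(\<integral>x. g x \<partial>std_normal_distribution) = normal_mean g"
  unfolding normal_mean_def by (subst integral_density) (auto simp: mult.commute)

lemma integrable_std_normal_ident: "integrable std_normal_distribution (\<lambda>x. x)"
  using integrable_std_normal_moment[of 1] by (subst integrable_density) (auto simp: mult.commute)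

text \<open>The mean of \<open>g\<close> over \<open>[x, x + e]\<close>: its derivative is a
  difference quotient of \<open>g\<close>. Needed because Stein's method is carried out for
  differentiable functions, while the Wasserstein distance tests all Lipschitz ones.\<close>

lemma Lipschitz_smoothing:
  fixes g :: "real \<Rightarrow> real"
  assumes g: "\<And>x y. \<bar>g x - g y\<bar> \<le> \<bar>x - y\<bar>" and e: "e > 0"
  obtains h h' where "\<forall>x. (h has_real_derivative h' x) (at x)" "\<forall>x. \<bar>h' x\<bar> \<le> 1" "\<forall>x. \<bar>h x - g x\<bar> \<le> e"
proof -
  have c: "continuous_on UNIV g" using g by (intro Lipschitz_borel_measurable(1)[of g 1]) simp
  have H: "((\<lambda>z. integral {a..z} g) has_real_derivative g z) (at z)" if "a < z" for a z
  proof -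
    have "((\<lambda>z. integral {a..z} g) has_real_derivative g z) (at z within {a..z + 1})"
      using that by (intro integral_has_real_derivative continuous_on_subset[OF c]) auto
    then have "((\<lambda>z. integral {a..z} g) has_real_derivative g z) (at z within {a<..<z + 1})"
      by (rule has_field_derivative_subset) auto
    then show ?thesis using that by (subst (asm) at_within_open) auto
  qed
  define h where "h x = (1 / e) * integral {x..x + e} g" for x
  \<comment> \<open>With a base point \<open>a\<close> both ends of the window become upper limits
    of integrals, so that \<open>h\<close> can be differentiated.\<close>
  have h_eq: "h y = (1 / e) * (integral {a..y + e} g - integral {a..y} g)" if "a < y" for a y
  proof -
    have "integral {a..y} g + integral {y..y + e} g = integral {a..y + e} g"
      using that e by (intro Henstock_Kurzweil_Integration.integral_combine integrable_continuous_real continuous_on_subset[OF c]) auto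
    then show ?thesis by (simp add: h_def)
  qed
  have D: "(h has_real_derivative (g (x + e) - g x) / e) (at x)" for x
  proof (rule has_field_derivative_transform_within_open)
    have "((\<lambda>y. integral {x - 1..y + e} g) has_real_derivative g (x + e) * 1) (at x)"
      using e by (intro DERIV_chain2[OF H]) (auto intro!: derivative_eq_intros)
    then have "((\<lambda>y. (1 / e) * (integral {x - 1..y + e} g - integral {x - 1..y} g)) has_real_derivative (1 / e) * (g (x + e) * 1 - g x)) (at x)"
      by (intro DERIV_cmult DERIV_diff H) auto
    then show "((\<lambda>y. (1 / e) * (integral {x - 1..y + e} g - integral {x - 1..y} g)) has_real_derivative (g (x + e) - g x) / e) (at x)"
      by simp
    show "open {x - 1<..}" "x \<in> {x - 1<..}" by auto
    show "(1 / e) * (integral {x - 1..y + e} g - integral {x - 1..y} g) = h y" if "y \<in> {x - 1<..}" for y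
      using h_eq[of "x - 1" y] that by simp
  qed
  have close: "\<bar>h x - g x\<bar> \<le> e" for x
  proof -
    have "\<exists>z>x. z < x + e \<and> integral {x - 1..x + e} g - integral {x - 1..x} g = (x + e - x) * g z"
      using e by (intro MVT2 H) auto
    then obtain z where z: "x < z" "z < x + e" "integral {x - 1..x + e} g - integral {x - 1..x} g = e * g z" by auto
    have "h x = g z" using h_eq[of "x - 1" x] z(3) e by simp
    then show ?thesis using g[of z x] z by auto
  qed
  show ?thesis
  proof (rule that[of h "\<lambda>x. (g (x + e) - g x) / e"])
    show "\<forall>x. \<bar>(g (x + e) - g x) / e\<bar> \<le> 1" using g e by (auto simp: abs_div_pos[symmetric] divide_le_eq) (metis abs_of_pos add_diff_cancel_left')
  qed (use D close in auto)
qed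

lemma normal_approximation_Lipschitz:
  assumes P: "prob_space P" and Z: "integrable P Z"
    and smooth: "\<And>g g'. (\<And>x. (g has_real_derivative g' x) (at x)) \<Longrightarrow> (\<And>x. \<bar>g' x\<bar> \<le> 1) \<Longrightarrow>
      \<bar>(\<integral>w. g (Z w) \<partial>P) - normal_mean g\<bar> \<le> \<delta>"
    and g: "\<And>x y. \<bar>g x - g y\<bar> \<le> \<bar>x - y\<bar>"
  shows "\<bar>(\<integral>w. g (Z w) \<partial>P) - normal_mean g\<bar> \<le> \<delta>"
proof (rule field_le_epsilon)
  interpret P: prob_space P by fact
  interpret N: prob_space std_normal_distribution by (rule prob_space_std_normal)
  fix e :: real assume "e > 0"
  then have e: "e / 2 > 0" by simp
  obtain h h' where h: "\<forall>x. (h has_real_derivative h' x) (at x)" "\<forall>x. \<bar>h' x\<bar> \<le> 1" "\<forall>x. \<bar>h x - g x\<bar> \<le> e / 2"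
    by (rule Lipschitz_smoothing[OF g e])
  have hL: "\<bar>h x - h y\<bar> \<le> 1 * \<bar>x - y\<bar>" for x y
    using field_differentiable_bound[of UNIV h h' 1 y x] h by (auto simp: has_field_derivative_at_within)
  have gL: "\<bar>g x - g y\<bar> \<le> 1 * \<bar>x - y\<bar>" for x y using g by simp
  have diff: "\<bar>(\<integral>w. h (Y w) \<partial>M) - (\<integral>w. g (Y w) \<partial>M)\<bar> \<le> e / 2" if "prob_space M" "integrable M Y" for M :: "'b measure" and Y
  proof -
    interpret M: prob_space M by fact
    have i: "integrable M (\<lambda>w. h (Y w))" "integrable M (\<lambda>w. g (Y w))"
      using Lipschitz_integrable[OF hL M.finite_measure_axioms that(2)] Lipschitz_integrable[OF gL M.finite_measure_axioms that(2)] by auto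
    have "\<bar>(\<integral>w. h (Y w) \<partial>M) - (\<integral>w. g (Y w) \<partial>M)\<bar> = \<bar>\<integral>w. h (Y w) - g (Y w) \<partial>M\<bar>"
      using i by simp
    also have "\<dots> \<le> (\<integral>w. \<bar>h (Y w) - g (Y w)\<bar> \<partial>M)" by (rule integral_abs_bound)
    also have "\<dots> \<le> (\<integral>w. e / 2 \<partial>M)" using i h(3) by (intro integral_mono integrable_abs) auto
    finally show ?thesis by (simp add: M.prob_space)
  qed
  have "\<bar>normal_mean h - normal_mean g\<bar> \<le> e / 2"
    using diff[OF prob_space_std_normal integrable_std_normal_ident]
      std_normal_integral[OF Lipschitz_borel_measurable(2)[OF hL]] std_normal_integral[OF Lipschitz_borel_measurable(2)[OF gL]] by simp
  moreover have "\<bar>(\<integral>w. h (Z w) \<partial>P) - (\<integral>w. g (Z w) \<partial>P)\<bar> \<le> e / 2" by (rule diff[OF P Z])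
  moreover have "\<bar>(\<integral>w. h (Z w) \<partial>P) - normal_mean h\<bar> \<le> \<delta>" using smooth[of h h'] h by auto
  ultimately show "\<bar>(\<integral>w. g (Z w) \<partial>P) - normal_mean g\<bar> \<le> \<delta> + e" by linarith
qed

lemma cts_step_Lipschitz:
  assumes "a < b"
  shows "\<bar>cts_step a b x - cts_step a b y\<bar> \<le> (1 / (b - a)) * \<bar>x - y\<bar>"
  using assms by (auto simp: cts_step_def divide_simps abs_if)

lemma cts_step_bounds: "a < b \<Longrightarrow> \<bar>cts_step a b x\<bar> \<le> 1"
  by (auto simp: cts_step_def divide_simps)

lemma cts_step_continuous: "a < b \<Longrightarrow> continuous_on UNIV (cts_step a b)"
  by (rule uniformly_continuous_imp_continuous[OF cts_step_uniformly_continuous])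

text \<open>Piecewise linear steps determine weak convergence, and after division by a constant they
  are admissible in the Lipschitz estimate.\<close>

lemma weak_conv_normal:
  assumes P: "\<And>n. prob_space (P n)" and Z: "\<And>n. integrable (P n) (Z n)" and \<delta>: "\<delta> \<longlonglongrightarrow> 0"
    and approx: "\<And>n g. (\<And>x y. \<bar>g x - g y\<bar> \<le> \<bar>x - y\<bar>) \<Longrightarrow> \<bar>(\<integral>w. g (Z n w) \<partial>P n) - normal_mean g\<bar> \<le> \<delta> n"
    and c: "c \<ge> 0"
  shows "weak_conv_m (\<lambda>n. distr (P n) borel (\<lambda>w. c * Z n w)) (distr std_normal_distribution borel (\<lambda>x. c * x))"
proof (rule integral_cts_step_conv_imp_weak_conv)
  show "\<And>n. real_distribution (distr (P n) borel (\<lambda>w. c * Z n w))"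
    using Z by (intro prob_space.real_distribution_distr P) auto
  show "real_distribution (distr std_normal_distribution borel (\<lambda>x. c * x))"
    by (intro prob_space.real_distribution_distr prob_space_std_normal) auto
  fix a b :: real assume ab: "a < b"
  have cm [measurable]: "cts_step a b \<in> borel_measurable borel"
    by (rule borel_measurable_continuous_onI[OF cts_step_continuous[OF ab]])
  have [measurable]: "Z n \<in> borel_measurable (P n)" for n using Z by auto
  \<comment> \<open>The summand 1 keeps \<open>L\<close> positive when \<open>c = 0\<close>.\<close>
  define L where "L = (c + 1) / (b - a)"
  have L: "L > 0" using ab c by (simp add: L_def)
  define g where "g x = cts_step a b (c * x) / L" for x
  have g: "\<bar>g x - g y\<bar> \<le> \<bar>x - y\<bar>" for x y
  proof -
    have "\<bar>cts_step a b (c * x) - cts_step a b (c * y)\<bar> \<le> (1 / (b - a)) * \<bar>c * x - c * y\<bar>" by (rule cts_step_Lipschitz[OF ab])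
    also have "\<bar>c * x - c * y\<bar> = c * \<bar>x - y\<bar>" using c by (simp add: abs_mult right_diff_distrib[symmetric])
    also have "\<dots> \<le> (c + 1) * \<bar>x - y\<bar>" by (intro mult_right_mono) auto
    finally have "\<bar>cts_step a b (c * x) - cts_step a b (c * y)\<bar> \<le> L * \<bar>x - y\<bar>" using ab by (simp add: L_def divide_right_mono)
    then show ?thesis using L by (simp add: g_def diff_divide_distrib[symmetric] abs_div_pos[symmetric] pos_divide_le_eq mult.commute)
  qed
  have gm: "g \<in> borel_measurable borel" unfolding g_def[abs_def] by measurable
  have "(\<lambda>n. (\<integral>w. g (Z n w) \<partial>P n) - normal_mean g) \<longlonglongrightarrow> 0"
    by (rule Lim_null_comparison[OF _ \<delta>]) (auto intro!: always_eventually approx g)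
  then have "(\<lambda>n. L * (\<integral>w. g (Z n w) \<partial>P n)) \<longlonglongrightarrow> L * normal_mean g"
    by (intro tendsto_mult_left) (simp add: LIM_zero_iff)
  moreover have "L * (\<integral>w. g (Z n w) \<partial>P n) = (\<integral>x. cts_step a b x \<partial>distr (P n) borel (\<lambda>w. c * Z n w))" for n
    using L by (subst integral_distr) (auto simp: g_def)
  moreover have "L * normal_mean g = (\<integral>x. cts_step a b x \<partial>distr std_normal_distribution borel (\<lambda>x. c * x))"
    unfolding std_normal_integral[OF gm, symmetric] using L by (subst integral_distr) (auto simp: g_def[abs_def])
  ultimately show "(\<lambda>n. \<integral>x. cts_step a b x \<partial>distr (P n) borel (\<lambda>w. c * Z n w)) \<longlonglongrightarrow>
    (\<integral>x. cts_step a b x \<partial>distr std_normal_distribution borel (\<lambda>x. c * x))" by simp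
qed

lemma distr_PiM_components:
  fixes Y :: "nat \<Rightarrow> 'a \<Rightarrow> real"
  assumes I: "finite I" and \<Omega>: "\<And>i. prob_space (\<Omega> i)" and Y: "\<And>i. Y i \<in> borel_measurable (\<Omega> i)"
  shows "distr (PiM I \<Omega>) (PiM I (\<lambda>_. borel)) (\<lambda>x. \<lambda>i\<in>I. Y i (x i)) = PiM I (\<lambda>i. distr (\<Omega> i) borel (Y i))"
proof -
  interpret \<Omega>: product_prob_space \<Omega> by (intro product_prob_spaceI \<Omega>)
  interpret D: product_prob_space "\<lambda>i. distr (\<Omega> i) borel (Y i)"
    by (intro product_prob_spaceI prob_space.prob_space_distr \<Omega> Y)
  have m: "(\<lambda>x. \<lambda>i\<in>I. Y i (x i)) \<in> PiM I \<Omega> \<rightarrow>\<^sub>M PiM I (\<lambda>_. borel)"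
    by (intro measurable_restrict measurable_compose[OF measurable_component_singleton[of _ _ \<Omega>] Y])
  show ?thesis
  proof (rule D.PiM_eqI[OF I])
    show "sets (distr (PiM I \<Omega>) (PiM I (\<lambda>_. borel)) (\<lambda>x. \<lambda>i\<in>I. Y i (x i))) = sets (PiM I (\<lambda>i. distr (\<Omega> i) borel (Y i)))"
      by (auto intro!: sets_PiM_cong)
    fix A assume A: "\<And>i. i \<in> I \<Longrightarrow> A i \<in> sets (distr (\<Omega> i) borel (Y i))"
    then have A': "\<And>i. i \<in> I \<Longrightarrow> A i \<in> sets borel" by simp
    have "(\<lambda>x. \<lambda>i\<in>I. Y i (x i)) -` Pi\<^sub>E I A \<inter> space (PiM I \<Omega>) = Pi\<^sub>E I (\<lambda>i. Y i -` A i \<inter> space (\<Omega> i))"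
      by (auto simp: space_PiM PiE_iff)
    then have "emeasure (distr (PiM I \<Omega>) (PiM I (\<lambda>_. borel)) (\<lambda>x. \<lambda>i\<in>I. Y i (x i))) (Pi\<^sub>E I A) =
      emeasure (PiM I \<Omega>) (Pi\<^sub>E I (\<lambda>i. Y i -` A i \<inter> space (\<Omega> i)))"
      using A' I by (subst emeasure_distr[OF m]) (auto intro!: sets_PiM_I_finite)
    also have "\<dots> = (\<Prod>i\<in>I. emeasure (\<Omega> i) (Y i -` A i \<inter> space (\<Omega> i)))"
      using A' Y I by (intro \<Omega>.emeasure_PiM) (auto intro: measurable_sets)
    also have "\<dots> = (\<Prod>i\<in>I. emeasure (distr (\<Omega> i) borel (Y i)) (A i))"
      using A' Y by (intro prod.cong refl) (simp add: emeasure_distr)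
    finally show "emeasure (distr (PiM I \<Omega>) (PiM I (\<lambda>_. borel)) (\<lambda>x. \<lambda>i\<in>I. Y i (x i))) (Pi\<^sub>E I A) =
      (\<Prod>i\<in>I. emeasure (distr (\<Omega> i) borel (Y i)) (A i))" .
  qed
qed

text \<open>Skorohod's theorem is applied in each coordinate, and the representations are put on a product space.\<close>

lemma indep_weak_conv:
  fixes X :: "nat \<Rightarrow> nat \<Rightarrow> 'a \<Rightarrow> real" and Y :: "nat \<Rightarrow> 'b \<Rightarrow> real" and p :: "(nat \<Rightarrow> real) \<Rightarrow> real"
  assumes I: "finite I" "I \<noteq> {}" and P: "\<And>n. prob_space (P n)" and Q: "prob_space Q"
    and X: "\<And>n. prob_space.indep_vars (P n) (\<lambda>_. borel) (X n) I"
    and Y: "prob_space.indep_vars Q (\<lambda>_. borel) Y I"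
    and W: "\<And>i. i \<in> I \<Longrightarrow> weak_conv_m (\<lambda>n. distr (P n) borel (X n i)) (distr Q borel (Y i))"
    and p: "p \<in> borel_measurable (PiM I (\<lambda>_. borel))" "\<And>x. \<bar>p x\<bar> \<le> B"
    and p_cont: "\<And>x y. (\<And>i. i \<in> I \<Longrightarrow> (\<lambda>n. x n i) \<longlonglongrightarrow> y i) \<Longrightarrow> (\<lambda>n. p (x n)) \<longlonglongrightarrow> p y"
  shows "(\<lambda>n. \<integral>v. p (\<lambda>i\<in>I. X n i v) \<partial>P n) \<longlonglongrightarrow> (\<integral>v. p (\<lambda>i\<in>I. Y i v) \<partial>Q)"
proof -
  have Xm: "X n i \<in> borel_measurable (P n)" if "i \<in> I" for n i
    using X[of n] that by (simp add: prob_space.indep_vars_def2[OF P])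
  have Ym: "Y i \<in> borel_measurable Q" if "i \<in> I" for i
    using Y that by (simp add: prob_space.indep_vars_def2[OF Q])
  \<comment> \<open>The triple consists of a probability space, a representing sequence and its
    limit. Indices outside \<open>I\<close> receive a trivial space, since a product of probability
    spaces is set up over all indices.\<close>
  define good where "good i S \<longleftrightarrow> prob_space (fst S) \<and> (\<forall>n. fst (snd S) n \<in> borel_measurable (fst S)) \<and>
    snd (snd S) \<in> borel_measurable (fst S) \<and>
    (i \<in> I \<longrightarrow> (\<forall>n. distr (fst S) borel (fst (snd S) n) = distr (P n) borel (X n i)) \<and>
      distr (fst S) borel (snd (snd S)) = distr Q borel (Y i) \<and>
      (\<forall>x\<in>space (fst S). (\<lambda>n. fst (snd S) n x) \<longlonglongrightarrow> snd (snd S) x))"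
    for i and S :: "real measure \<times> (nat \<Rightarrow> real \<Rightarrow> real) \<times> (real \<Rightarrow> real)"
  have "\<exists>S. good i S" for i
  proof (cases "i \<in> I")
    case True
    have "\<exists>(\<Omega> :: real measure) (Ys :: nat \<Rightarrow> real \<Rightarrow> real) (Yl :: real \<Rightarrow> real). prob_space \<Omega> \<and> (\<forall>n. Ys n \<in> borel_measurable \<Omega>) \<and>
      (\<forall>n. distr \<Omega> borel (Ys n) = distr (P n) borel (X n i)) \<and> Yl \<in> \<Omega> \<rightarrow>\<^sub>M lborel \<and>
      distr \<Omega> borel Yl = distr Q borel (Y i) \<and> (\<forall>x\<in>space \<Omega>. (\<lambda>n. Ys n x :: real) \<longlonglongrightarrow> Yl x)"
      using True by (intro Skorohod W prob_space.real_distribution_distr P Q Xm Ym)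
    then obtain \<Omega> Ys Yl where "good i (\<Omega>, Ys, Yl)" using True by (auto simp: good_def)
    then show ?thesis by blast
  next
    case False
    have "good i (return borel 0, \<lambda>_ _. 0, \<lambda>_. 0)" using False by (auto simp: good_def prob_space_return)
    then show ?thesis by blast
  qed
  then obtain S where S: "\<And>i. good i (S i)" by metis
  define \<Omega> where "\<Omega> i = fst (S i)" for i
  define Ys where "Ys n i = fst (snd (S i)) n" for n i
  define Yl where "Yl i = snd (snd (S i))" for i
  have \<Omega>: "prob_space (\<Omega> i)" and Ysm: "Ys n i \<in> borel_measurable (\<Omega> i)" and Ylm: "Yl i \<in> borel_measurable (\<Omega> i)" for i n
    using S[of i] by (auto simp: good_def \<Omega>_def Ys_def Yl_def)
  have Ysd: "distr (\<Omega> i) borel (Ys n i) = distr (P n) borel (X n i)" and Yld: "distr (\<Omega> i) borel (Yl i) = distr Q borel (Y i)"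
    and lim: "x \<in> space (\<Omega> i) \<Longrightarrow> (\<lambda>n. Ys n i x) \<longlonglongrightarrow> Yl i x" if "i \<in> I" for i n x
    using S[of i] that by (auto simp: good_def \<Omega>_def Ys_def Yl_def)
  interpret \<Omega>: product_prob_space \<Omega> by (intro product_prob_spaceI \<Omega>)
  interpret \<Omega>I: prob_space "PiM I \<Omega>" by (rule prob_space_PiM) (rule \<Omega>)
  \<comment> \<open>Independence makes the joint law the product of its marginals, and the
    representation on the product space has the same marginals.\<close>
  have transfer: "(\<integral>v. p (\<lambda>i\<in>I. Z i v) \<partial>R) = (\<integral>x. p (\<lambda>i\<in>I. V i (x i)) \<partial>PiM I \<Omega>)"
    if R: "prob_space R" and Z: "prob_space.indep_vars R (\<lambda>_. borel) Z I" and Zm: "\<And>i. i \<in> I \<Longrightarrow> Z i \<in> borel_measurable R"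
      and V: "\<And>i. V i \<in> borel_measurable (\<Omega> i)" and d: "\<And>i. i \<in> I \<Longrightarrow> distr (\<Omega> i) borel (V i) = distr R borel (Z i)"
    for R :: "'c measure" and Z V
  proof -
    have m1: "(\<lambda>v. \<lambda>i\<in>I. Z i v) \<in> R \<rightarrow>\<^sub>M PiM I (\<lambda>_. borel)" by (intro measurable_restrict Zm)
    have m2: "(\<lambda>x. \<lambda>i\<in>I. V i (x i)) \<in> PiM I \<Omega> \<rightarrow>\<^sub>M PiM I (\<lambda>_. borel)"
      by (intro measurable_restrict measurable_compose[OF measurable_component_singleton[of _ _ \<Omega>] V])
    have "(\<integral>v. p (\<lambda>i\<in>I. Z i v) \<partial>R) = (\<integral>y. p y \<partial>distr R (PiM I (\<lambda>_. borel)) (\<lambda>v. \<lambda>i\<in>I. Z i v))"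
      by (rule integral_distr[symmetric, OF m1 p(1)])
    also have "distr R (PiM I (\<lambda>_. borel)) (\<lambda>v. \<lambda>i\<in>I. Z i v) = PiM I (\<lambda>i. distr R borel (Z i))"
      using prob_space.indep_vars_iff_distr_eq_PiM'[OF R I(2) Zm] Z by simp
    also have "\<dots> = PiM I (\<lambda>i. distr (\<Omega> i) borel (V i))" by (intro PiM_cong) (auto simp: d)
    also have "\<dots> = distr (PiM I \<Omega>) (PiM I (\<lambda>_. borel)) (\<lambda>x. \<lambda>i\<in>I. V i (x i))"
      by (rule distr_PiM_components[symmetric, OF I(1) \<Omega> V])
    also have "(\<integral>y. p y \<partial>\<dots>) = (\<integral>x. p (\<lambda>i\<in>I. V i (x i)) \<partial>PiM I \<Omega>)"
      by (rule integral_distr[OF m2 p(1)])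
    finally show ?thesis .
  qed
  have "(\<lambda>n. \<integral>x. p (\<lambda>i\<in>I. Ys n i (x i)) \<partial>PiM I \<Omega>) \<longlonglongrightarrow> (\<integral>x. p (\<lambda>i\<in>I. Yl i (x i)) \<partial>PiM I \<Omega>)"
  proof (rule integral_dominated_convergence[where w = "\<lambda>_. B"])
    show "(\<lambda>x. p (\<lambda>i\<in>I. Yl i (x i))) \<in> borel_measurable (PiM I \<Omega>)"
      by (intro measurable_compose[OF _ p(1)] measurable_restrict measurable_compose[OF measurable_component_singleton[of _ _ \<Omega>] Ylm])
    show "(\<lambda>x. p (\<lambda>i\<in>I. Ys n i (x i))) \<in> borel_measurable (PiM I \<Omega>)" for n
      by (intro measurable_compose[OF _ p(1)] measurable_restrict measurable_compose[OF measurable_component_singleton[of _ _ \<Omega>] Ysm])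
    show "AE x in PiM I \<Omega>. (\<lambda>n. p (\<lambda>i\<in>I. Ys n i (x i))) \<longlonglongrightarrow> p (\<lambda>i\<in>I. Yl i (x i))"
      by (intro AE_I2 p_cont) (auto simp: space_PiM PiE_iff intro!: lim)
  qed (auto simp: p(2))
  then show ?thesis
    using transfer[OF P X Xm Ysm Ysd] transfer[OF Q Y Ym Ylm Yld] by simp
qed

lemma partitioned_measure_scale:
  assumes "partitioned_measure M cell K \<epsilon>" "0 \<le> t"
  shows "partitioned_measure (scale_measure (ennreal t) M) cell K (\<lambda>n. t * \<epsilon> n)"
proof -
  interpret partitioned_measure M cell K \<epsilon> by fact
  show ?thesis
  proof (intro partitioned_measure.intro partitioned_measure_axioms.intro)
    show "finite_measure (scale_measure (ennreal t) M)"
      by (rule finite_measureI) (simp add: space_scale_measure emeasure_eq_measure ennreal_mult_eq_top_iff)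
    show "cell n \<in> scale_measure (ennreal t) M \<rightarrow>\<^sub>M count_space UNIV" for n
      using cell_measurable[of n] by (simp add: measurable_def space_scale_measure)
    show "cell n z < K n" if "z \<in> space (scale_measure (ennreal t) M)" for n z
      using that cell_less by (simp add: space_scale_measure)
    show "cell n y = cell n z" if "y \<in> space (scale_measure (ennreal t) M)" "z \<in> space (scale_measure (ennreal t) M)"
      "cell (Suc n) y = cell (Suc n) z" for n y z
      using cell_refine[of y z n] that by (simp only: space_scale_measure)
    show "measure (scale_measure (ennreal t) M) {z \<in> space (scale_measure (ennreal t) M). cell n z = c} \<le> t * \<epsilon> n" for n c
      using cell_small[of n c] \<open>0 \<le> t\<close> by (simp add: space_scale_measure measure_scale_measure mult_left_mono)
    show "(\<lambda>n. t * \<epsilon> n) \<longlonglongrightarrow> 0" using tendsto_mult_right_zero[OF mesh_tendsto] by simp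
  qed
qed

lemma (in prob_space) distr_centered_gaussian:
  assumes Y: "centered_gaussian M Y"
  shows "distr M borel Y = distr std_normal_distribution borel (\<lambda>x. sqrt (expectation (\<lambda>w. (Y w)\<^sup>2)) * x)"
proof (rule Levy_uniqueness)
  let ?v = "expectation (\<lambda>w. (Y w)\<^sup>2)"
  have [measurable]: "Y \<in> borel_measurable M" using Y by (simp add: centered_gaussian_def)
  show "real_distribution (distr M borel Y)" by (rule real_distribution_distr) simp
  show "real_distribution (distr std_normal_distribution borel (\<lambda>x. sqrt ?v * x))"
    by (intro prob_space.real_distribution_distr prob_space_std_normal) auto
  show "char (distr M borel Y) = char (distr std_normal_distribution borel (\<lambda>x. sqrt ?v * x))"
  proof
    fix u
    have "char (distr M borel Y) u = exp (complex_of_real (- (u\<^sup>2 * ?v / 2)))"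
      unfolding char_def centered_gaussian_moments(3)[OF Y, symmetric] by (subst integral_distr) auto
    moreover have "char (distr std_normal_distribution borel (\<lambda>x. sqrt ?v * x)) u = char std_normal_distribution (u * sqrt ?v)"
      unfolding char_def by (subst integral_distr) (auto simp: mult_ac)
    moreover have "\<dots> = exp (complex_of_real (- (u\<^sup>2 * ?v / 2)))"
      unfolding char_std_normal_distribution by (simp add: power_mult_distrib flip: exp_of_real)
    ultimately show "char (distr M borel Y) u = char (distr std_normal_distribution borel (\<lambda>x. sqrt ?v * x)) u" by simp
  qed
qed

context poisson_process begin

text \<open>The case of a single set with coefficient \<open>v^(-1/2)\<close>, where
  \<open>v\<close> is its mass: the variance defect vanishes and the third-order term is
  \<open>v^(-3/2) v\<close>.\<close>

lemma normal_approximation_set: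
  assumes A: "A \<in> sets M" and v: "measure M A > 0" and g: "\<And>x y. \<bar>g x - g y\<bar> \<le> \<bar>x - y\<bar>"
  shows "\<bar>(\<integral>w. g (compensated M \<eta> A w / sqrt (measure M A)) \<partial>P) - normal_mean g\<bar> \<le> 26 / sqrt (measure M A)"
proof (rule normal_approximation_Lipschitz[OF P.prob_space_axioms _ _ g])
  show "integrable P (\<lambda>w. compensated M \<eta> A w / sqrt (measure M A))" using noise.noise_integrable[OF A] by simp
  fix g g' :: "real \<Rightarrow> real" assume g: "\<And>x. (g has_real_derivative g' x) (at x)" "\<And>x. \<bar>g' x\<bar> \<le> 1"
  let ?s = "sqrt (measure M A)"
  have s: "?s > 0" "?s * ?s = measure M A" using v by auto
  have "\<bar>(\<integral>w. g (\<Sum>i<1::nat. 1 / ?s * compensated M \<eta> A w) \<partial>P) - normal_mean g\<bar> \<le>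
    14 * \<bar>1 - (\<Sum>i<1::nat. (1 / ?s)\<^sup>2 * measure M A)\<bar> + 26 * (\<Sum>i<1::nat. \<bar>1 / ?s\<bar> ^ 3 * measure M A)"
    using A g by (intro normal_approximation_simple[of "\<lambda>_. A" 1 g g' "\<lambda>_. 1 / ?s"]) (auto simp: disjoint_family_on_def)
  also have "\<dots> = 26 / ?s"
  proof -
    have "?s ^ 3 = measure M A * ?s" by (simp only: power3_eq_cube s(2))
    then have "\<bar>1 / ?s\<bar> ^ 3 * measure M A = 1 / ?s" using v by (simp add: power_divide)
    moreover have "(1 / ?s)\<^sup>2 * measure M A = 1" using v by (simp add: power_divide)
    ultimately show ?thesis by simp
  qed
  finally show "\<bar>(\<integral>w. g (compensated M \<eta> A w / ?s) \<partial>P) - normal_mean g\<bar> \<le> 26 / ?s" by simp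
qed

end

lemma (in prob_space) Lipschitz_L2_bound:
  assumes g: "\<And>x y. \<bar>g x - g y\<bar> \<le> L * \<bar>x - y\<bar>" and Y: "square_integrable M Y" and Z: "square_integrable M Z"
  shows "\<bar>expectation (\<lambda>w. g (Y w)) - expectation (\<lambda>w. g (Z w))\<bar> \<le> L * sqrt (expectation (\<lambda>w. (Y w - Z w)\<^sup>2))"
proof -
  have L: "0 \<le> L" using order_trans[OF abs_ge_zero g[of 1 0]] by simp
  have int: "integrable M W" if "square_integrable M W" for W
    using that square_integrable_imp_integrable unfolding square_integrable_def by blast
  note gi = Lipschitz_integrable[OF g finite_measure_axioms int[OF Y]] Lipschitz_integrable[OF g finite_measure_axioms int[OF Z]]
  have d: "square_integrable M (\<lambda>w. Y w - Z w)" by (rule square_integrable_diff[OF Y Z])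
  then have d': "square_integrable M (\<lambda>w. \<bar>Y w - Z w\<bar>)"
    using borel_measurable_abs by (auto simp: square_integrable_def)
  have "\<bar>expectation (\<lambda>w. g (Y w)) - expectation (\<lambda>w. g (Z w))\<bar> = \<bar>expectation (\<lambda>w. g (Y w) - g (Z w))\<bar>"
    using gi by simp
  also have "\<dots> \<le> expectation (\<lambda>w. \<bar>g (Y w) - g (Z w)\<bar>)" by (rule integral_abs_bound)
  also have "\<dots> \<le> expectation (\<lambda>w. L * \<bar>Y w - Z w\<bar>)"
    using gi int[OF d'] g by (intro integral_mono integrable_abs) auto
  also have "\<dots> = L * expectation (\<lambda>w. \<bar>Y w - Z w\<bar>)" by simp
  also have "\<dots> \<le> L * sqrt (expectation (\<lambda>w. (Y w - Z w)\<^sup>2))"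
  proof (intro mult_left_mono L real_le_rsqrt)
    show "(expectation (\<lambda>w. \<bar>Y w - Z w\<bar>))\<^sup>2 \<le> expectation (\<lambda>w. (Y w - Z w)\<^sup>2)"
      using integral_square_le[OF d'] by (simp add: prob_space)
  qed
  finally show ?thesis .
qed

section \<open>Kernels of order 0 and 1, and the moments of the chaoses\<close>

lemma simple_integral_0: "simple_integral W 0 N A a w = a (\<lambda>_. undefined)"
proof -
  have "injective_indices 0 N = {\<lambda>_. undefined}" by (auto simp: injective_indices_def)
  then show ?thesis by (simp add: simple_integral_def)
qed

lemma off_diagonal_sum_1: "off_diagonal_sum 1 N a Y = (\<Sum>r<N. a (\<lambda>j\<in>{..<1}. r) * Y 0 r)"
  unfolding off_diagonal_sum_def
proof (rule sum.reindex_bij_witness[of _ "\<lambda>r. \<lambda>j\<in>{..<1}. r" "\<lambda>f. f 0"])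
  fix f assume "f \<in> injective_indices 1 N"
  then show *: "(\<lambda>j\<in>{..<1}. f 0) = f" and "f 0 \<in> {..<N}"
    by (auto simp: injective_indices_def PiE_iff extensional_def fun_eq_iff restrict_def)
  show "a (\<lambda>j\<in>{..<1}. f 0) * Y 0 (f 0) = a f * (\<Prod>j<1. Y j (f j))" unfolding * by simp
qed (auto simp: injective_indices_def inj_on_def)

lemma measurable_constant_tuple: "(\<lambda>z. \<lambda>i\<in>{..<1::nat}. z) \<in> M \<rightarrow>\<^sub>M pow M 1"
  by (intro measurable_restrict) auto

lemma (in finite_measure) power_measure_1: "pow M 1 = distr M (pow M 1) (\<lambda>z. \<lambda>i\<in>{..<1::nat}. z)"
proof (rule power_measure_eqI[symmetric])
  fix A :: "nat \<Rightarrow> 'a set" assume A: "\<And>j. j < 1 \<Longrightarrow> A j \<in> sets M"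
  have "(\<lambda>z. \<lambda>i\<in>{..<1::nat}. z) -` PiE {..<1} A \<inter> space M = A 0"
    using A[of 0] sets.sets_into_space by (auto simp: PiE_iff)
  then show "emeasure (distr M (pow M 1) (\<lambda>z. \<lambda>i\<in>{..<1::nat}. z)) (PiE {..<1} A) = (\<Prod>j<1. emeasure M (A j))"
    using A by (subst emeasure_distr[OF measurable_constant_tuple]) (auto intro!: sets_PiM_I_finite)
qed simp

lemma (in finite_measure) integral_power_measure_1:
  fixes f :: "(nat \<Rightarrow> 'a) \<Rightarrow> real"
  assumes "f \<in> borel_measurable (pow M 1)"
  shows "(\<integral>x. f x \<partial>pow M 1) = (\<integral>z. f (\<lambda>i\<in>{..<1::nat}. z) \<partial>M)"
    and "integrable (pow M 1) f \<longleftrightarrow> integrable M (\<lambda>z. f (\<lambda>i\<in>{..<1::nat}. z))"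
  by (subst power_measure_1, rule integral_distr[OF measurable_constant_tuple assms])
    (subst power_measure_1, rule integrable_distr_eq[OF measurable_constant_tuple assms])

text \<open>The identity is stated for every \<open>u\<close>, so that the function, its square and
  its absolute third power are represented by the same sets.\<close>

lemma simple_function_enum:
  fixes F :: "'a \<Rightarrow> real"
  assumes "simple_function M F"
  obtains n :: nat and A v where "disjoint_family_on A {..<n}" "\<forall>r<n. A r \<in> sets M"
    "\<And>u z. z \<in> space M \<Longrightarrow> u (F z) = (\<Sum>r<n. u (v r) * indicat_real (A r) z :: real)"
proof -
  let ?V = "F ` space M"
  have fin: "finite ?V" using assms by (simp add: simple_function_def)
  then obtain v where v: "bij_betw v {..<card ?V} ?V" by (metis ex_bij_betw_nat_finite lessThan_atLeast0)
  define A where "A r = F -` {v r} \<inter> space M" for r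
  show ?thesis
  proof (rule that)
    show "disjoint_family_on A {..<card ?V}"
      using v by (auto simp: disjoint_family_on_def A_def bij_betw_def inj_on_def)
    have "v r \<in> ?V" if "r < card ?V" for r using v that by (auto simp: bij_betw_def)
    then show "\<forall>r<card ?V. A r \<in> sets M" using assms unfolding A_def simple_function_def by blast
    fix u :: "real \<Rightarrow> real" and z assume z: "z \<in> space M"
    have "(\<Sum>r<card ?V. u (v r) * indicat_real (A r) z) = (\<Sum>y\<in>?V. u y * indicat_real (F -` {y} \<inter> space M) z)"
      unfolding A_def by (rule sum.reindex_bij_betw[OF v])
    also have "\<dots> = (\<Sum>y\<in>?V. if y = F z then u y else 0)" using z by (intro sum.cong) (auto simp: indicator_def)
    also have "\<dots> = u (F z)" using fin z by simp
    finally show "u (F z) = (\<Sum>r<card ?V. u (v r) * indicat_real (A r) z)" ..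
  qed
qed

context poisson_process begin

abbreviation chaos :: "nat \<Rightarrow> ((nat \<Rightarrow> 'z) \<Rightarrow> real) \<Rightarrow> nat \<Rightarrow> 'w \<Rightarrow> real" where
  "chaos k h i \<equiv> multiple_integral P M (compensated M \<eta>) i (projected_kernel M k h i)"

text \<open>All these facts pass to the limit along one symmetric approximation of \<open>h\<close>,
  which approximates every projected kernel over the same sets.\<close>

lemma chaos_moments:
  assumes h: "square_integrable (pow M k) h" and sym: "symmetric_kernel M k h"
  shows chaos_square_integrable: "i \<le> k \<Longrightarrow> square_integrable P (chaos k h i)"
    and chaos_orthogonal: "i \<le> k \<Longrightarrow> j \<le> k \<Longrightarrow> i \<noteq> j \<Longrightarrow> (\<integral>w. chaos k h i w * chaos k h j w \<partial>P) = 0"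
    and chaos_second_moment: "i \<le> k \<Longrightarrow> (\<integral>w. (chaos k h i w)\<^sup>2 \<partial>P) = fact i * (\<integral>x. (projected_kernel M k h i x)\<^sup>2 \<partial>pow M i)"
    and chaos_mean: "1 \<le> i \<Longrightarrow> i \<le> k \<Longrightarrow> (\<integral>w. chaos k h i w \<partial>P) = 0"
    and chaos_0: "AE w in P. chaos k h 0 w = (\<integral>w. chaos k h 0 w \<partial>P)"
proof -
  obtain N A a where a: "kernel_approximation M k N A a h" and s: "\<forall>m. symmetric_coeff k (N m) (a m)"
    by (rule symmetric_kernel_approximation[OF h sym])
  have hm: "h \<in> borel_measurable (pow M k)" using h by (simp add: square_integrable_def)
  let ?b = "\<lambda>i m. projected_coeff k (N m) (\<lambda>r. measure M (A m r)) (a m) i"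
  let ?S = "\<lambda>i m. simple_integral (compensated M \<eta>) i (N m) (A m) (?b i m)"
  note a' = a[unfolded kernel_approximation_def]
  note lim = noise.multiple_integral_limit[OF projected_kernel_measurable[OF _ hm] kernel_approximation_projected[OF _ hm a]]
  have Isq: "square_integrable P (chaos k h i)" if "i \<le> k" for i by (rule lim(1)[OF that that])
  have L: "L2_tendsto P (?S i) (chaos k h i)" if "i \<le> k" for i by (rule lim(2)[OF that that])
  have Ssq: "square_integrable P (?S i m)" for i m
    using a' by (intro noise.simple_integral_square_integrable) auto
  show "i \<le> k \<Longrightarrow> square_integrable P (chaos k h i)" by (rule Isq)
  show "(\<integral>w. chaos k h i w * chaos k h j w \<partial>P) = 0" if "i \<le> k" "j \<le> k" "i \<noteq> j"
  proof (rule LIMSEQ_unique)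
    show "(\<lambda>m. \<integral>w. ?S i m w * ?S j m w \<partial>P) \<longlonglongrightarrow> (\<integral>w. chaos k h i w * chaos k h j w \<partial>P)"
      by (rule L2_tendsto_inner[OF Ssq Isq[OF that(1)] L[OF that(1)] Ssq Isq[OF that(2)] L[OF that(2)]])
    have "(\<integral>w. ?S i m w * ?S j m w \<partial>P) = 0" for m
      using a' that by (intro noise.simple_integral_orthogonal) auto
    then show "(\<lambda>m. \<integral>w. ?S i m w * ?S j m w \<partial>P) \<longlonglongrightarrow> 0" by simp
  qed
  show "(\<integral>w. (chaos k h i w)\<^sup>2 \<partial>P) = fact i * (\<integral>x. (projected_kernel M k h i x)\<^sup>2 \<partial>pow M i)" if "i \<le> k"
    using s by (intro noise.multiple_integral_second_moment[OF projected_kernel_measurable[OF that hm]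
        kernel_approximation_projected[OF that hm a]] symmetric_projected_coeff that) auto
  have one: "square_integrable P (\<lambda>_. 1)" by (simp add: square_integrable_def)
  show "(\<integral>w. chaos k h i w \<partial>P) = 0" if "1 \<le> i" "i \<le> k"
  proof (rule LIMSEQ_unique)
    show "(\<lambda>m. \<integral>w. ?S i m w \<partial>P) \<longlonglongrightarrow> (\<integral>w. chaos k h i w \<partial>P)"
      using L2_tendsto_inner[OF Ssq Isq[OF that(2)] L[OF that(2)] one one L2_tendsto_const] by simp
    have "(\<integral>w. ?S i m w \<partial>P) = 0" for m using a' that by (intro noise.simple_integral_mean) auto
    then show "(\<lambda>m. \<integral>w. ?S i m w \<partial>P) \<longlonglongrightarrow> 0" by simp
  qed
  \<comment> \<open>Simple integrals of order 0 are constants. In the L2 limit the second moment is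
    therefore the square of the mean, and the variance is zero.\<close>
  let ?E = "\<integral>w. chaos k h 0 w \<partial>P" and ?c = "\<lambda>m. ?b 0 m (\<lambda>_. undefined)"
  note sq0 = Isq[OF le0] and L0 = L[OF le0]
  have "(\<lambda>m. \<integral>w. ?S 0 m w * 1 \<partial>P) \<longlonglongrightarrow> (\<integral>w. chaos k h 0 w * 1 \<partial>P)"
    using sq0 L0 by (intro L2_tendsto_inner one Ssq L2_tendsto_const) auto
  then have c1: "?c \<longlonglongrightarrow> ?E" by (simp add: simple_integral_0 P.prob_space)
  have "(\<lambda>m. \<integral>w. ?S 0 m w * ?S 0 m w \<partial>P) \<longlonglongrightarrow> (\<integral>w. chaos k h 0 w * chaos k h 0 w \<partial>P)"
    using sq0 L0 by (intro L2_tendsto_inner Ssq) auto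
  then have "(\<lambda>m. ?c m * ?c m) \<longlonglongrightarrow> (\<integral>w. (chaos k h 0 w)\<^sup>2 \<partial>P)" by (simp add: simple_integral_0 P.prob_space power2_eq_square)
  then have "(\<integral>w. (chaos k h 0 w)\<^sup>2 \<partial>P) = ?E\<^sup>2"
    using tendsto_mult[OF c1 c1] LIMSEQ_unique by (fastforce simp: power2_eq_square)
  moreover have i0: "integrable P (chaos k h 0)" "integrable P (\<lambda>w. (chaos k h 0 w)\<^sup>2)"
    using sq0 P.square_integrable_imp_integrable unfolding square_integrable_def by blast+
  ultimately have var0: "P.variance (chaos k h 0) = 0" by (simp add: P.variance_eq)
  have i1: "integrable P (\<lambda>w. (chaos k h 0 w - ?E)\<^sup>2)"
    unfolding power2_diff using i0 by simp
  have "AE w in P. (chaos k h 0 w - ?E)\<^sup>2 = 0"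
    using integral_nonneg_eq_0_iff_AE[OF i1] var0 by simp
  then show "AE w in P. chaos k h 0 w = ?E" by simp
qed

text \<open>The fourth moment of the kernel is what the contraction condition (1) gives for \<open>i = 1\<close>.\<close>

lemma normal_approximation_first_order:
  assumes f: "f \<in> borel_measurable (pow M 1)" and f4: "integrable (pow M 1) (\<lambda>x. (f x)^4)"
    and d: "d > 0" and g: "\<And>x. (g has_real_derivative g' x) (at x)" "\<And>x. \<bar>g' x\<bar> \<le> 1"
  shows "\<bar>(\<integral>\<omega>. g (multiple_integral P M (compensated M \<eta>) 1 f \<omega> / d) \<partial>P) - normal_mean g\<bar> \<le>
    14 * \<bar>1 - (\<integral>x. (f x)\<^sup>2 \<partial>pow M 1) / d\<^sup>2\<bar> + 26 * ((\<integral>x. \<bar>f x\<bar>^3 \<partial>pow M 1) / d^3)"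
proof -
  define F where "F z = f (\<lambda>i\<in>{..<1::nat}. z)" for z
  have Fm [measurable]: "F \<in> borel_measurable M"
    unfolding F_def[abs_def] by (rule measurable_compose[OF measurable_constant_tuple f])
  note [measurable] = f
  have F4: "integrable M (\<lambda>z. (F z)^4)"
    using f4 integral_power_measure_1(2)[of "\<lambda>x. (f x)^4"] by (simp add: F_def)
  \<comment> \<open>A finite measure and the fourth moment give the lower ones, by
    \<open>\<bar>x\<bar>^p \<le> 1 + x^4\<close>. The powers 2 and 3 are those of the variance and
    of the Stein error.\<close>
  have pow: "integrable M (\<lambda>z. \<bar>F z\<bar>^p)" if "p \<le> 4" for p
  proof (rule Bochner_Integration.integrable_bound)
    show "integrable M (\<lambda>z. 1 + (F z)^4)" using F4 by simp
    have "\<bar>x\<bar>^p \<le> 1 + x^4" for x :: real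
    proof (cases "\<bar>x\<bar> \<le> 1")
      case True
      then have "\<bar>x\<bar>^p \<le> 1" by (simp add: power_le_one)
      moreover have "0 \<le> x^4" by (rule zero_le_even_power) simp
      ultimately show ?thesis by linarith
    next
      case False
      then have "\<bar>x\<bar>^p \<le> \<bar>x\<bar>^4" using that by (intro power_increasing) auto
      then show ?thesis by simp
    qed
    then show "AE z in M. norm (\<bar>F z\<bar>^p) \<le> norm (1 + (F z)^4)" by (auto intro: order_trans[OF _ abs_ge_self])
  qed measurable
  have F2: "square_integrable M F" using pow[of 2] by (simp add: square_integrable_def)
  have f2: "square_integrable (pow M 1) f"
    using F2 integral_power_measure_1(2)[of "\<lambda>x. (f x)\<^sup>2"] f by (simp add: square_integrable_def F_def)
  obtain S where S: "\<forall>i. simple_function M (S i)" "\<forall>z\<in>space M. (\<lambda>i. S i z) \<longlonglongrightarrow> F z"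
    "\<forall>i. \<forall>z\<in>space M. \<bar>S i z\<bar> \<le> 2 * \<bar>F z\<bar>"
    by (rule simple_approximation[OF Fm])
  have Sm [measurable]: "S i \<in> borel_measurable M" for i using S(1) borel_measurable_simple_function by blast
  define ok where "ok i T \<longleftrightarrow> disjoint_family_on (fst (snd T)) {..<fst T} \<and> (\<forall>r<fst T. fst (snd T) r \<in> sets M) \<and>
    (\<forall>s. \<forall>z\<in>space M. s (S i z) = (\<Sum>r<fst T. s (snd (snd T) r) * indicat_real (fst (snd T) r) z))"
    for i and T :: "nat \<times> (nat \<Rightarrow> 'z set) \<times> (nat \<Rightarrow> real)"
  have "\<exists>T. ok i T" for i
  proof -
    obtain n A v where "disjoint_family_on A {..<n::nat}" "\<forall>r<n. A r \<in> sets M"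
      "\<And>s z. z \<in> space M \<Longrightarrow> s (S i z) = (\<Sum>r<n. s (v r) * indicat_real (A r) z :: real)"
      using simple_function_enum[of M "S i"] S(1) by metis
    then have "ok i (n, A, v)" by (simp add: ok_def)
    then show ?thesis ..
  qed
  then obtain T where T: "\<And>i. ok i (T i)" by metis
  define n A v where "n i = fst (T i)" and "A i = fst (snd (T i))" and "v i = snd (snd (T i))" for i
  have A: "disjoint_family_on (A i) {..<n i}" "\<And>r. r < n i \<Longrightarrow> A i r \<in> sets M"
    and rep: "\<And>s z. z \<in> space M \<Longrightarrow> s (S i z) = (\<Sum>r<n i. s (v i r) * indicat_real (A i r) z)" for i
    using T[of i] by (auto simp: ok_def n_def A_def v_def)
  have S_int: "(\<integral>z. s (S i z) \<partial>M) = (\<Sum>r<n i. s (v i r) * measure M (A i r))" for s i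
  proof -
    have "(\<integral>z. s (S i z) \<partial>M) = (\<integral>z. (\<Sum>r<n i. s (v i r) * indicat_real (A i r) z) \<partial>M)"
      by (intro Bochner_Integration.integral_cong refl rep)
    also have "\<dots> = (\<Sum>r<n i. s (v i r) * measure M (A i r))"
      using A(2) by (subst Bochner_Integration.integral_sum) (auto simp: emeasure_eq_measure intro!: sum.cong)
    finally show ?thesis .
  qed
  define b where "b i u = v i (u 0)" for i and u :: "nat \<Rightarrow> nat"
  have ker: "simple_kernel 1 (n i) (A i) (b i) (\<lambda>j\<in>{..<1::nat}. z) = S i z" if "z \<in> space M" for i z
    using rep[OF that, of "\<lambda>x. x" i] by (simp add: simple_kernel_off_diagonal_sum off_diagonal_sum_1[unfolded One_nat_def] b_def)
  \<comment> \<open>Dominated convergence with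
    \<open>\<bar>S i\<bar> \<le> 2 * \<bar>F\<bar>\<close>, used three times: for the second and
    third moments, with constants \<open>4 = 2^2\<close> and \<open>8 = 2^3\<close>, and for the L2
    distance to \<open>F\<close>, with constant \<open>9 = 3^2\<close>.\<close>
  have lim: "(\<lambda>i. \<integral>z. s (S i z) (F z) \<partial>M) \<longlonglongrightarrow> (\<integral>z. s (F z) (F z) \<partial>M)"
    if s: "\<And>y. continuous_on UNIV (\<lambda>x. s x y)" and m: "\<And>i. (\<lambda>z. s (S i z) (F z)) \<in> borel_measurable M" "(\<lambda>z. s (F z) (F z)) \<in> borel_measurable M"
      and bd: "\<And>x y. \<bar>x\<bar> \<le> 2 * \<bar>y\<bar> \<Longrightarrow> \<bar>s x y\<bar> \<le> c * \<bar>y\<bar>^p" and p: "p \<le> 4" for s :: "real \<Rightarrow> real \<Rightarrow> real" and c p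
  proof (rule integral_dominated_convergence[where w = "\<lambda>z. c * \<bar>F z\<bar>^p"])
    show "integrable M (\<lambda>z. c * \<bar>F z\<bar>^p)" using pow[OF p] by simp
    show "AE z in M. (\<lambda>i. s (S i z) (F z)) \<longlonglongrightarrow> s (F z) (F z)"
    proof (rule AE_I2)
      fix z assume "z \<in> space M"
      then have "(\<lambda>i. S i z) \<longlonglongrightarrow> F z" using S(2) by auto
      then show "(\<lambda>i. s (S i z) (F z)) \<longlonglongrightarrow> s (F z) (F z)"
        using continuous_on_tendsto_compose[OF s[of "F z"]] by auto
    qed
    show "AE z in M. norm (s (S i z) (F z)) \<le> c * \<bar>F z\<bar>^p" for i using S(3) bd by auto
  qed (use m in auto)
  have L2: "(\<lambda>i. \<integral>z. (S i z)\<^sup>2 \<partial>M) \<longlonglongrightarrow> (\<integral>z. (F z)\<^sup>2 \<partial>M)"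
  proof (rule lim[of "\<lambda>x _. x\<^sup>2" 4 2])
    show "\<bar>x\<^sup>2\<bar> \<le> 4 * \<bar>y\<bar>\<^sup>2" if "\<bar>x\<bar> \<le> 2 * \<bar>y\<bar>" for x y :: real
      using power_mono[OF that, of 2] by (simp add: power_mult_distrib)
  qed (auto intro!: continuous_intros)
  have L3: "(\<lambda>i. \<integral>z. \<bar>S i z\<bar>^3 \<partial>M) \<longlonglongrightarrow> (\<integral>z. \<bar>F z\<bar>^3 \<partial>M)"
  proof (rule lim[of "\<lambda>x _. \<bar>x\<bar>^3" 8 3])
    show "\<bar>\<bar>x\<bar>^3\<bar> \<le> 8 * \<bar>y\<bar>^3" if "\<bar>x\<bar> \<le> 2 * \<bar>y\<bar>" for x y :: real
      using power_mono[OF that, of 3] by (simp add: power_mult_distrib)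
  qed (auto intro!: continuous_intros)
  have D: "(\<lambda>i. L2_dist2 M (S i) F) \<longlonglongrightarrow> (L2_dist2 M F F)"
  proof (rule lim[of "\<lambda>x y. (x - y)\<^sup>2" 9 2])
    show "\<bar>(x - y)\<^sup>2\<bar> \<le> 9 * \<bar>y\<bar>\<^sup>2" if "\<bar>x\<bar> \<le> 2 * \<bar>y\<bar>" for x y :: real
    proof -
      have "\<bar>x - y\<bar> \<le> 3 * \<bar>y\<bar>" using that by linarith
      from power_mono[OF this, of 2] show ?thesis by (simp add: power_mult_distrib)
    qed
  qed (auto intro!: continuous_intros)
  have km: "simple_kernel 1 (n i) (A i) (b i) \<in> borel_measurable (pow M 1)" for i
    by (rule simple_kernel_measurable) (rule A(2))
  have "L2_tendsto (pow M 1) (\<lambda>i. simple_kernel 1 (n i) (A i) (b i)) f"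
  proof (subst L2_tendsto_iff[OF integral_simple_kernel_square(1)[OF A] f2])
    have "L2_dist2 (pow M 1) (simple_kernel 1 (n i) (A i) (b i)) f = L2_dist2 M (S i) F" for i
    proof -
      have "(\<lambda>x. (simple_kernel 1 (n i) (A i) (b i) x - f x)\<^sup>2) \<in> borel_measurable (pow M 1)"
        using km[of i] by measurable
      from integral_power_measure_1(1)[OF this] show ?thesis
        by (simp add: F_def ker[unfolded One_nat_def] cong: Bochner_Integration.integral_cong)
    qed
    then show "(\<lambda>i. L2_dist2 (pow M 1) (simple_kernel 1 (n i) (A i) (b i)) f) \<longlonglongrightarrow> 0" using D by simp
  qed
  then have ap: "kernel_approximation M 1 n A b f" using A by (simp add: kernel_approximation_def)
  let ?I = "multiple_integral P M (compensated M \<eta>) 1 f" and ?S = "\<lambda>i. simple_integral (compensated M \<eta>) 1 (n i) (A i) (b i)"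
  note I = noise.multiple_integral_limit[OF f ap]
  have Ssq: "square_integrable P (?S i)" for i by (rule noise.simple_integral_square_integrable) (rule A)+
  have gL: "\<bar>g x - g y\<bar> \<le> 1 * \<bar>x - y\<bar>" for x y
    using field_differentiable_bound[of UNIV g g' 1 y x] g by (auto simp: has_field_derivative_at_within)
  have gL': "\<bar>g (x / d) - g (y / d)\<bar> \<le> (1 / d) * \<bar>x - y\<bar>" for x y
    using gL[of "x / d" "y / d"] d by (simp add: diff_divide_distrib[symmetric] abs_div_pos[symmetric])
  have "(\<lambda>i. \<integral>\<omega>. (?S i \<omega> - ?I \<omega>)\<^sup>2 \<partial>P) \<longlonglongrightarrow> 0"
    using L2_tendsto_iff[OF Ssq I(1)] I(2) by simp
  then have z: "(\<lambda>i. (1 / d) * sqrt (\<integral>\<omega>. (?S i \<omega> - ?I \<omega>)\<^sup>2 \<partial>P)) \<longlonglongrightarrow> (1 / d) * sqrt 0"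
    by (intro tendsto_intros)
  have "(\<lambda>i. (\<integral>\<omega>. g (?S i \<omega> / d) \<partial>P) - (\<integral>\<omega>. g (?I \<omega> / d) \<partial>P)) \<longlonglongrightarrow> 0"
  proof (rule Lim_null_comparison)
    show "(\<lambda>i. (1 / d) * sqrt (\<integral>\<omega>. (?S i \<omega> - ?I \<omega>)\<^sup>2 \<partial>P)) \<longlonglongrightarrow> 0" using z by simp
    show "\<forall>\<^sub>F i in sequentially. norm ((\<integral>\<omega>. g (?S i \<omega> / d) \<partial>P) - (\<integral>\<omega>. g (?I \<omega> / d) \<partial>P)) \<le> (1 / d) * sqrt (\<integral>\<omega>. (?S i \<omega> - ?I \<omega>)\<^sup>2 \<partial>P)"
      using P.Lipschitz_L2_bound[of "\<lambda>x. g (x / d)" "1 / d", OF gL' Ssq I(1)] by (intro always_eventually allI) simp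
  qed
  then have G: "(\<lambda>i. \<integral>\<omega>. g (?S i \<omega> / d) \<partial>P) \<longlonglongrightarrow> (\<integral>\<omega>. g (?I \<omega> / d) \<partial>P)" by (simp add: LIM_zero_iff)
  have bound: "\<bar>(\<integral>\<omega>. g (?S i \<omega> / d) \<partial>P) - normal_mean g\<bar> \<le>
    14 * \<bar>1 - (\<integral>z. (S i z)\<^sup>2 \<partial>M) / d\<^sup>2\<bar> + 26 * ((\<integral>z. \<bar>S i z\<bar>^3 \<partial>M) / d^3)" for i
  proof -
    have e: "?S i \<omega> / d = (\<Sum>r<n i. (v i r / d) * compensated M \<eta> (A i r) \<omega>)" for \<omega>
      by (simp add: simple_integral_off_diagonal_sum off_diagonal_sum_1[unfolded One_nat_def] b_def sum_divide_distrib)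
    have "(\<Sum>r<n i. (v i r / d)\<^sup>2 * measure M (A i r)) = (\<integral>z. (S i z)\<^sup>2 \<partial>M) / d\<^sup>2"
      unfolding S_int[of "\<lambda>x. x\<^sup>2"] by (simp add: power_divide sum_divide_distrib)
    moreover have "(\<Sum>r<n i. \<bar>v i r / d\<bar>^3 * measure M (A i r)) = (\<integral>z. \<bar>S i z\<bar>^3 \<partial>M) / d^3"
      unfolding S_int[of "\<lambda>x. \<bar>x\<bar>^3"] using d by (simp add: power_divide sum_divide_distrib abs_divide)
    ultimately show ?thesis
      unfolding e using normal_approximation_simple[of "A i" "n i" g g' "\<lambda>r. v i r / d", OF A g] by simp
  qed
  have "\<bar>(\<integral>\<omega>. g (?I \<omega> / d) \<partial>P) - normal_mean g\<bar> \<le> 14 * \<bar>1 - (\<integral>z. (F z)\<^sup>2 \<partial>M) / d\<^sup>2\<bar> + 26 * ((\<integral>z. \<bar>F z\<bar>^3 \<partial>M) / d^3)"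
  proof (rule LIMSEQ_le)
    show "(\<lambda>i. \<bar>(\<integral>\<omega>. g (?S i \<omega> / d) \<partial>P) - normal_mean g\<bar>) \<longlonglongrightarrow> \<bar>(\<integral>\<omega>. g (?I \<omega> / d) \<partial>P) - normal_mean g\<bar>"
      by (intro tendsto_intros G)
    show "(\<lambda>i. 14 * \<bar>1 - (\<integral>z. (S i z)\<^sup>2 \<partial>M) / d\<^sup>2\<bar> + 26 * ((\<integral>z. \<bar>S i z\<bar>^3 \<partial>M) / d^3)) \<longlonglongrightarrow>
      14 * \<bar>1 - (\<integral>z. (F z)\<^sup>2 \<partial>M) / d\<^sup>2\<bar> + 26 * ((\<integral>z. \<bar>F z\<bar>^3 \<partial>M) / d^3)"
      using d by (intro tendsto_intros L2 L3) auto
  qed (use bound in auto)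
  then show ?thesis
    using integral_power_measure_1(1)[of "\<lambda>x. (f x)\<^sup>2"] integral_power_measure_1(1)[of "\<lambda>x. \<bar>f x\<bar>^3"] f
    by (simp add: F_def)
qed

end

section \<open>Large intensity\<close>

lemma scale_measure_eq_density: "scale_measure r M = density M (\<lambda>_. r)"
  by (rule measure_eqI) (auto simp: emeasure_density nn_integral_cmult_indicator)

lemma integral_scale_measure:
  fixes f :: "'a \<Rightarrow> real"
  assumes "f \<in> borel_measurable M" "0 < c"
  shows "integrable (scale_measure (ennreal c) M) f \<longleftrightarrow> integrable M f"
    and "(\<integral>x. f x \<partial>scale_measure (ennreal c) M) = c * (\<integral>x. f x \<partial>M)"
  unfolding scale_measure_eq_density
  using assms by (simp_all add: integrable_density integral_density)

lemma square_integrable_scale_measure: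
  assumes "0 < c"
  shows "square_integrable (scale_measure (ennreal c) M) f \<longleftrightarrow> square_integrable M f"
proof -
  have "f \<in> borel_measurable (scale_measure (ennreal c) M) \<longleftrightarrow> f \<in> borel_measurable M"
    by (simp add: measurable_def space_scale_measure)
  then show ?thesis
    using integral_scale_measure(1)[of "\<lambda>x. (f x)\<^sup>2" M c] assms by (auto simp: square_integrable_def)
qed

lemma integral_scale_measure':
  fixes f :: "'a \<Rightarrow> real"
  assumes "0 < c"
  shows "(\<integral>x. f x \<partial>scale_measure (ennreal c) M) = c * (\<integral>x. f x \<partial>M)"
proof (cases "f \<in> borel_measurable M")
  case True
  then show ?thesis by (rule integral_scale_measure(2)[OF _ assms])
next
  case False
  then have "f \<notin> borel_measurable (scale_measure (ennreal c) M)" by (simp add: measurable_def space_scale_measure)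
  then have "\<not> integrable (scale_measure (ennreal c) M) f" "\<not> integrable M f" using False by auto
  then show ?thesis by (simp add: not_integrable_integral_eq)
qed

lemma (in prob_space) orthogonal_sum_second_moment:
  assumes "finite I" and sq: "\<And>i. i \<in> I \<Longrightarrow> square_integrable M (Y i)"
    and orth: "\<And>i j. i \<in> I \<Longrightarrow> j \<in> I \<Longrightarrow> i \<noteq> j \<Longrightarrow> expectation (\<lambda>w. Y i w * Y j w) = 0"
  shows "expectation (\<lambda>w. (\<Sum>i\<in>I. Y i w)\<^sup>2) = (\<Sum>i\<in>I. expectation (\<lambda>w. (Y i w)\<^sup>2))"
proof -
  have "expectation (\<lambda>w. (\<Sum>i\<in>I. Y i w)\<^sup>2) = (\<Sum>i\<in>I. \<Sum>j\<in>I. expectation (\<lambda>w. Y i w * Y j w))"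
    unfolding power2_eq_square sum_product
    using square_integrable_mult[OF sq sq] by (simp add: Bochner_Integration.integral_sum)
  also have "\<dots> = (\<Sum>i\<in>I. \<Sum>j\<in>I. if j = i then expectation (\<lambda>w. (Y i w)\<^sup>2) else 0)"
    using orth by (intro sum.cong refl) (auto simp: power2_eq_square)
  finally show ?thesis using assms(1) by simp
qed

locale scaled_poisson = partitioned_measure M cell K \<epsilon>
  for M :: "'z measure" and cell K \<epsilon> +
  fixes P :: "real \<Rightarrow> 'w measure" and \<eta> :: "real \<Rightarrow> 'w \<Rightarrow> 'z measure"
    and k :: nat and h :: "(nat \<Rightarrow> 'z) \<Rightarrow> real"
  assumes singleton_sets: "z \<in> space M \<Longrightarrow> {z} \<in> sets M"
    and poisson: "0 < t \<Longrightarrow> poisson_measure (P t) (scale_measure (ennreal t) M) (\<eta> t)"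
    and k: "1 \<le> k"
    and h: "square_integrable (pow M k) h" "symmetric_kernel M k h"
    and F_L2: "0 < t \<Longrightarrow> square_integrable (P t) (U_statistic k h (\<eta> t))"
begin

abbreviation Ms :: "real \<Rightarrow> 'z measure" where "Ms t \<equiv> scale_measure (ennreal t) M"
abbreviation hk :: "nat \<Rightarrow> (nat \<Rightarrow> 'z) \<Rightarrow> real" where "hk \<equiv> projected_kernel M k h"
abbreviation F :: "real \<Rightarrow> 'w \<Rightarrow> real" where "F t \<equiv> U_statistic k h (\<eta> t)"
abbreviation Fi :: "nat \<Rightarrow> real \<Rightarrow> 'w \<Rightarrow> real" where
  "Fi i t \<equiv> multiple_integral (P t) (Ms t) (compensated (Ms t) (\<eta> t)) i (\<lambda>x. t ^ (k - i) * hk i x)"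
abbreviation mean :: "real \<Rightarrow> real" where "mean t \<equiv> prob_space.expectation (P t) (F t)"
abbreviation var :: "real \<Rightarrow> real" where "var t \<equiv> prob_space.variance (P t) (F t)"

text \<open>The squared norm of the i-th kernel with its isometry factor at intensity 1; at
  intensity \<open>t\<close> the second moment of the i-th chaos is
  \<open>\<kappa> i * t ^ (2 * k - i)\<close>.\<close>

definition \<kappa> :: "nat \<Rightarrow> real" where "\<kappa> i = fact i * (\<integral>x. (hk i x)\<^sup>2 \<partial>pow M i)"

lemma \<kappa>_nonneg: "0 \<le> \<kappa> i" by (simp add: \<kappa>_def)

lemma process: "0 < t \<Longrightarrow> poisson_process (Ms t) cell K (\<lambda>n. t * \<epsilon> n) (P t) (\<eta> t)"
  by (intro poisson_process.intro poisson_process_axioms.intro partitioned_measure_scale[OF partitioned_measure_axioms] poisson)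
    (auto simp: space_scale_measure singleton_sets)

lemma prob_space_P: "0 < t \<Longrightarrow> prob_space (P t)"
  using poisson by (simp add: poisson_measure_def)

lemma power_Ms: "0 < t \<Longrightarrow> pow (Ms t) n = scale_measure (ennreal (t ^ n)) (pow M n)"
  by (subst power_measure_scale[OF finite_measure_axioms]) (simp add: ennreal_power)

lemma measurable_pow_Ms: "0 < t \<Longrightarrow> f \<in> borel_measurable (pow M n) \<Longrightarrow> f \<in> borel_measurable (pow (Ms t) n)"
  by (simp add: power_Ms measurable_def space_scale_measure)

lemma h_Ms: "0 < t \<Longrightarrow> square_integrable (pow (Ms t) k) h" "0 < t \<Longrightarrow> symmetric_kernel (Ms t) k h"
  using h by (simp_all add: power_Ms square_integrable_scale_measure symmetric_kernel_def space_scale_measure)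

lemma projected_kernel_Ms: "0 < t \<Longrightarrow> projected_kernel (Ms t) k h i = (\<lambda>x. t ^ (k - i) * hk i x)"
  by (auto simp: projected_kernel_def power_Ms integral_scale_measure' fun_eq_iff)

lemma hk_measurable: "i \<le> k \<Longrightarrow> hk i \<in> borel_measurable (pow M i)"
  using h(1) by (intro projected_kernel_measurable) (auto simp: square_integrable_def)

lemma hk_approximation:
  obtains N A a where "\<forall>i\<le>k. kernel_approximation M i N A (a i) (hk i)"
proof -
  have hm: "h \<in> borel_measurable (pow M k)" using h by (simp add: square_integrable_def)
  obtain N A a where a: "kernel_approximation M k N A a h" "\<forall>m. symmetric_coeff k (N m) (a m)"
    by (rule symmetric_kernel_approximation[OF h])
  show ?thesis
    by (rule that[of N A "\<lambda>i m. projected_coeff k (N m) (\<lambda>r. measure M (A m r)) (a m) i"])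
      (auto intro: kernel_approximation_projected hm a(1))
qed

lemma hk_square_integrable: "i \<le> k \<Longrightarrow> square_integrable (pow M i) (hk i)"
proof -
  assume i: "i \<le> k"
  obtain N A a where "\<forall>i\<le>k. kernel_approximation M i N A (a i) (hk i)" by (rule hk_approximation)
  then show ?thesis using kernel_approximation_square_integrable(1)[OF _ hk_measurable[OF i]] i by blast
qed

text \<open>\<open>hk 0\<close> is the integral of \<open>h\<close>, and the integral of
  \<open>hk 1\<close> is \<open>k\<close> times that. Hence the mean of \<open>F t\<close> vanishes
  with the first kernel, which permits the limit theorem of higher order to be free of
  centring.\<close>

lemma \<kappa>_0: "\<kappa> 1 = 0 \<Longrightarrow> \<kappa> 0 = 0"
proof -
  assume 1: "\<kappa> 1 = 0"
  have "integrable (pow M k) h"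
    using finite_measure.square_integrable_imp_integrable[OF finite_power_measure] h(1) unfolding square_integrable_def by blast
  note I = integral_append_tuple[OF _ this]
  have "integrable (pow M 1) (\<lambda>x. (hk 1 x)\<^sup>2)" using hk_square_integrable[OF k] by (simp add: square_integrable_def)
  then have "AE x in pow M 1. (hk 1 x)\<^sup>2 = 0"
    using 1 by (subst integral_nonneg_eq_0_iff_AE[symmetric]) (auto simp: \<kappa>_def)
  then have "(\<integral>x. hk 1 x \<partial>pow M 1) = 0" by (intro integral_eq_zero_AE) auto
  then have "(\<integral>x. h x \<partial>pow M k) = 0" using I[OF k] k by (simp add: projected_kernel_def)
  then have "(\<integral>y. h (append_tuple 0 k (\<lambda>_. undefined) y) \<partial>pow M k) = 0"
    using I[of 0] integral_power_measure_0[of M] by simp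
  then show ?thesis using integral_power_measure_0[of M] by (simp add: \<kappa>_def projected_kernel_def)
qed

lemma
  assumes t: "0 < t"
  shows Fi_square_integrable: "i \<le> k \<Longrightarrow> square_integrable (P t) (Fi i t)"
    and Fi_orthogonal: "i \<le> k \<Longrightarrow> j \<le> k \<Longrightarrow> i \<noteq> j \<Longrightarrow> (\<integral>w. Fi i t w * Fi j t w \<partial>P t) = 0"
    and Fi_second_moment: "i \<le> k \<Longrightarrow> (\<integral>w. (Fi i t w)\<^sup>2 \<partial>P t) = \<kappa> i * t ^ (2 * k - i)"
    and Fi_mean: "1 \<le> i \<Longrightarrow> i \<le> k \<Longrightarrow> (\<integral>w. Fi i t w \<partial>P t) = 0"
    and Fi_0: "AE w in P t. Fi 0 t w = (\<integral>w. Fi 0 t w \<partial>P t)"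
    and F_chaos: "AE w in P t. F t w = (\<Sum>i\<le>k. Fi i t w)"
proof -
  interpret Q: poisson_process "Ms t" cell K "\<lambda>n. t * \<epsilon> n" "P t" "\<eta> t" by (rule process[OF t])
  note [simp] = projected_kernel_Ms[OF t]
  note m = h_Ms[OF t]
  show "i \<le> k \<Longrightarrow> square_integrable (P t) (Fi i t)" using Q.chaos_square_integrable[OF m, of i] by simp
  show "i \<le> k \<Longrightarrow> j \<le> k \<Longrightarrow> i \<noteq> j \<Longrightarrow> (\<integral>w. Fi i t w * Fi j t w \<partial>P t) = 0"
    using Q.chaos_orthogonal[OF m, of i j] by simp
  show "1 \<le> i \<Longrightarrow> i \<le> k \<Longrightarrow> (\<integral>w. Fi i t w \<partial>P t) = 0" using Q.chaos_mean[OF m, of i] by simp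
  show "AE w in P t. Fi 0 t w = (\<integral>w. Fi 0 t w \<partial>P t)" using Q.chaos_0[OF m] by simp
  show "AE w in P t. F t w = (\<Sum>i\<le>k. Fi i t w)" using Q.U_statistic_chaos[OF m] by simp
  assume i: "i \<le> k"
  \<comment> \<open>The control measure contributes \<open>t^i\<close> and the squared factor of the
    kernel \<open>t^(2 (k - i))\<close>.\<close>
  have "(\<integral>w. (Fi i t w)\<^sup>2 \<partial>P t) = fact i * (\<integral>x. (t ^ (k - i) * hk i x)\<^sup>2 \<partial>pow (Ms t) i)"
    using Q.chaos_second_moment[OF m i] by simp
  also have "\<dots> = fact i * (t ^ i * ((t ^ (k - i))\<^sup>2 * (\<integral>x. (hk i x)\<^sup>2 \<partial>pow M i)))"
    using t by (simp add: power_Ms integral_scale_measure' power_mult_distrib)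
  also have "\<dots> = \<kappa> i * (t ^ i * (t ^ (k - i))\<^sup>2)" by (simp add: \<kappa>_def)
  also have "t ^ i * (t ^ (k - i))\<^sup>2 = t ^ (2 * k - i)"
  proof -
    have "i + (k - i) * 2 = 2 * k - i" using i by simp
    then show ?thesis by (metis power_add power_mult)
  qed
  finally show "(\<integral>w. (Fi i t w)\<^sup>2 \<partial>P t) = \<kappa> i * t ^ (2 * k - i)" .
qed

lemma integrable_of_L2: "prob_space N \<Longrightarrow> square_integrable N Y \<Longrightarrow> integrable N Y"
  using finite_measure.square_integrable_imp_integrable[OF prob_space.finite_measure] unfolding square_integrable_def by blast

lemma mean_eq: "0 < t \<Longrightarrow> mean t = (\<integral>w. Fi 0 t w \<partial>P t)"
proof -
  assume t: "0 < t"
  interpret Q: prob_space "P t" by (rule prob_space_P[OF t])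
  have i: "integrable (P t) (Fi i t)" if "i \<le> k" for i
    by (rule integrable_of_L2[OF Q.prob_space_axioms Fi_square_integrable[OF t that]])
  have "mean t = (\<integral>w. (\<Sum>i\<le>k. Fi i t w) \<partial>P t)"
    using F_chaos[OF t] F_L2[OF t] i by (intro integral_cong_AE) (auto simp: square_integrable_def)
  also have "\<dots> = (\<Sum>i\<le>k. \<integral>w. Fi i t w \<partial>P t)" using i by (intro Bochner_Integration.integral_sum) auto
  also have "\<dots> = (\<Sum>i\<in>{0}. \<integral>w. Fi i t w \<partial>P t)"
    by (rule sum.mono_neutral_right) (auto intro!: Fi_mean[OF t])
  finally show ?thesis by simp
qed

text \<open>The chaos of order 0 is almost surely constant, and the constant is the mean because all
  the other chaoses are centred.\<close>

lemma F_decomposition: "0 < t \<Longrightarrow> AE w in P t. F t w = mean t + (\<Sum>i=1..k. Fi i t w)"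
proof -
  assume t: "0 < t"
  have "{..k} = insert 0 {1..k}" by auto
  then have s: "(\<Sum>i\<le>k. Fi i t w) = Fi 0 t w + (\<Sum>i=1..k. Fi i t w)" for w by simp
  show ?thesis using F_chaos[OF t] Fi_0[OF t] unfolding s mean_eq[OF t] by eventually_elim simp
qed

lemma second_moment_sum:
  assumes t: "0 < t" and I: "I \<subseteq> {..k}"
  shows "(\<integral>w. (\<Sum>i\<in>I. Fi i t w)\<^sup>2 \<partial>P t) = (\<Sum>i\<in>I. \<kappa> i * t ^ (2 * k - i))"
proof -
  interpret Q: prob_space "P t" by (rule prob_space_P[OF t])
  have "(\<integral>w. (\<Sum>i\<in>I. Fi i t w)\<^sup>2 \<partial>P t) = (\<Sum>i\<in>I. \<integral>w. (Fi i t w)\<^sup>2 \<partial>P t)"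
    using I finite_subset[OF I] by (intro Q.orthogonal_sum_second_moment Fi_square_integrable[OF t] Fi_orthogonal[OF t]) auto
  also have "\<dots> = (\<Sum>i\<in>I. \<kappa> i * t ^ (2 * k - i))" using I by (intro sum.cong refl Fi_second_moment[OF t]) auto
  finally show ?thesis .
qed

lemma variance_F: "0 < t \<Longrightarrow> var t = (\<Sum>i=1..k. \<kappa> i * t ^ (2 * k - i))"
proof -
  assume t: "0 < t"
  have "var t = (\<integral>w. (\<Sum>i=1..k. Fi i t w)\<^sup>2 \<partial>P t)"
  proof (rule integral_cong_AE)
    show "AE w in P t. (F t w - mean t)\<^sup>2 = (\<Sum>i=1..k. Fi i t w)\<^sup>2"
      using F_decomposition[OF t] by eventually_elim simp
    show "(\<lambda>w. (F t w - mean t)\<^sup>2) \<in> borel_measurable (P t)" using F_L2[OF t] by (auto simp: square_integrable_def)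
    show "(\<lambda>w. (\<Sum>i=1..k. Fi i t w)\<^sup>2) \<in> borel_measurable (P t)"
      using Fi_square_integrable[OF t] by (auto simp: square_integrable_def intro!: borel_measurable_power borel_measurable_sum)
  qed
  also have "\<dots> = (\<Sum>i=1..k. \<kappa> i * t ^ (2 * k - i))" by (rule second_moment_sum[OF t]) auto
  finally show ?thesis .
qed

lemma variance_Fi: "0 < t \<Longrightarrow> 1 \<le> i \<Longrightarrow> i \<le> k \<Longrightarrow> prob_space.variance (P t) (Fi i t) = \<kappa> i * t ^ (2 * k - i)"
  using Fi_mean[of t i] Fi_second_moment[of t i] by simp

text \<open>Relative to the term of order \<open>q\<close>, the i-th term of the variance is a
  constant times \<open>t^-(i - q)\<close>: it vanishes in the limit for \<open>i > q\<close> and is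
  zero for \<open>i < q\<close>.\<close>

lemma variance_asymptotics:
  assumes q: "1 \<le> q" "q \<le> k" "\<kappa> q > 0" "\<And>i. 1 \<le> i \<Longrightarrow> i < q \<Longrightarrow> \<kappa> i = 0"
  shows "var \<sim>[at_top] (\<lambda>t. prob_space.variance (P t) (Fi q t))"
    and "(\<lambda>t. prob_space.variance (P t) (Fi q t)) \<sim>[at_top] (\<lambda>t. \<kappa> q * t ^ (2 * k - q))"
proof -
  have ev: "\<forall>\<^sub>F t in at_top. prob_space.variance (P t) (Fi q t) = \<kappa> q * t ^ (2 * k - q)"
    using eventually_gt_at_top[of 0] by eventually_elim (rule variance_Fi[OF _ q(1,2)])
  show e2: "(\<lambda>t. prob_space.variance (P t) (Fi q t)) \<sim>[at_top] (\<lambda>t. \<kappa> q * t ^ (2 * k - q))"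
    using asymp_equiv_cong[OF ev, of "\<lambda>t. \<kappa> q * t ^ (2 * k - q)" "\<lambda>t. \<kappa> q * t ^ (2 * k - q)"] by simp
  have "var \<sim>[at_top] (\<lambda>t. \<kappa> q * t ^ (2 * k - q))"
  proof (rule asymp_equivI')
    have "((\<lambda>t. \<Sum>i=1..k. (\<kappa> i / \<kappa> q) * (inverse t) ^ (i - q)) \<longlongrightarrow> (\<Sum>i=1..k. if i = q then 1 else 0)) at_top"
    proof (intro tendsto_sum)
      fix i assume i: "i \<in> {1..k}"
      consider "i < q" | "i = q" | "i > q" by linarith
      then show "((\<lambda>t. (\<kappa> i / \<kappa> q) * (inverse t) ^ (i - q)) \<longlongrightarrow> (if i = q then 1 else 0)) at_top"
      proof cases
        case 1
        then show ?thesis using q(4)[of i] i by simp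
      next
        case 2
        then show ?thesis using q(3) by simp
      next
        case 3
        have "((\<lambda>t. (\<kappa> i / \<kappa> q) * (inverse t :: real) ^ (i - q)) \<longlongrightarrow> (\<kappa> i / \<kappa> q) * 0 ^ (i - q)) at_top"
          by (intro tendsto_intros tendsto_inverse_0_at_top filterlim_ident)
        then show ?thesis using 3 by (simp add: power_0_left)
      qed
    qed
    moreover have "(\<Sum>i=1..k. if i = q then 1 else (0::real)) = 1" using q by simp
    moreover have "\<forall>\<^sub>F t in at_top. (\<Sum>i=1..k. (\<kappa> i / \<kappa> q) * (inverse t) ^ (i - q)) = var t / (\<kappa> q * t ^ (2 * k - q))"
      using eventually_gt_at_top[of 0]
    proof eventually_elim
      case (elim t)
      have "(\<kappa> i / \<kappa> q) * (inverse t) ^ (i - q) = \<kappa> i * t ^ (2 * k - i) / (\<kappa> q * t ^ (2 * k - q))" if i: "i \<in> {1..k}" for i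
      proof (cases "i < q")
        case True
        then show ?thesis using q(4)[of i] i by simp
      next
        case False
        then have "2 * k - q = (2 * k - i) + (i - q)" using i by auto
        then show ?thesis using elim q(3) by (simp add: power_add power_inverse field_simps)
      qed
      then show ?case unfolding variance_F[OF elim] sum_divide_distrib by (intro sum.cong refl)
    qed
    ultimately show "((\<lambda>t. var t / (\<kappa> q * t ^ (2 * k - q))) \<longlongrightarrow> 1) at_top" by (simp add: Lim_transform_eventually)
  qed
  then show "var \<sim>[at_top] (\<lambda>t. prob_space.variance (P t) (Fi q t))"
    by (rule asymp_equiv_trans[OF _ asymp_equiv_symI[OF e2]])
qed

text \<open>The chaoses of order at least \<open>2\<close> are negligible against the first one, up to \<open>O(t\<^sup>-\<^sup>1\<^sup>/\<^sup>2)\<close>.\<close>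

lemma first_order_normal_approximation:
  assumes pos: "\<kappa> 1 > 0" and f4: "integrable (pow M 1) (\<lambda>x. (hk 1 x)^4)"
  obtains C where "\<And>t g. 1 \<le> t \<Longrightarrow> (\<And>x y. \<bar>g x - g y\<bar> \<le> \<bar>x - y\<bar>) \<Longrightarrow>
    \<bar>(\<integral>w. g ((F t w - mean t) / sqrt (var t)) \<partial>P t) - normal_mean g\<bar> \<le> C * t powr (- 1 / 2)"
proof -
  \<comment> \<open>\<open>C1 / t\<close> will bound the variance of the chaoses of order at least 2
    relative to that of the first chaos, for \<open>t >= 1\<close>; \<open>C3\<close> is the
    normalised third moment of the first kernel.\<close>
  define C1 where "C1 = (\<Sum>i=2..k. \<kappa> i) / \<kappa> 1"
  define C3 where "C3 = (\<integral>x. \<bar>hk 1 x\<bar>^3 \<partial>pow M 1) / (sqrt (\<kappa> 1))^3"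
  have C1: "0 \<le> C1" unfolding C1_def using pos \<kappa>_nonneg by (intro divide_nonneg_pos sum_nonneg) auto
  have main: "\<bar>(\<integral>w. g ((F t w - mean t) / sqrt (var t)) \<partial>P t) - normal_mean g\<bar> \<le> (C1 + sqrt C1 + 26 * C3) * t powr (- 1 / 2)"
    if t1: "1 \<le> t" and g: "\<And>x y. \<bar>g x - g y\<bar> \<le> \<bar>x - y\<bar>" for t g
  proof -
    have t: "0 < t" using t1 by simp
    interpret Q: poisson_process "Ms t" cell K "\<lambda>n. t * \<epsilon> n" "P t" "\<eta> t" by (rule process[OF t])
    \<comment> \<open>The standard deviation of the first chaos, to be compared with the standard
      deviation \<open>v\<close> of \<open>F t\<close>.\<close>
    define s where "s = t ^ (k - 1) * sqrt t * sqrt (\<kappa> 1)"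
    have s: "0 < s" using t pos by (simp add: s_def)
    have s2: "s\<^sup>2 = \<kappa> 1 * t ^ (2 * k - 1)"
    proof -
      have "s\<^sup>2 = \<kappa> 1 * (t * (t ^ (k - 1))\<^sup>2)" using t pos by (simp add: s_def power_mult_distrib)
      also have "t * (t ^ (k - 1))\<^sup>2 = t ^ Suc ((k - 1) * 2)" by (simp add: power_mult)
      also have "Suc ((k - 1) * 2) = 2 * k - 1" using k by simp
      finally show ?thesis .
    qed
    have tp: "t powr (- 1 / 2) = 1 / sqrt t" 
      using powr_minus_divide[of t "1 / 2"] powr_half_sqrt[of t] t by simp
    define R where "R w = (\<Sum>i=2..k. Fi i t w)" for w
    have I1: "square_integrable (P t) (Fi 1 t)" using Fi_square_integrable[OF t, of 1] k by simp
    have Rsq: "square_integrable (P t) R"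
      unfolding R_def[abs_def] by (intro square_integrable_sum Fi_square_integrable[OF t]) auto
    have R2: "(\<integral>w. (R w)\<^sup>2 \<partial>P t) = (\<Sum>i=2..k. \<kappa> i * t ^ (2 * k - i))"
      unfolding R_def by (rule second_moment_sum[OF t]) auto
    have kk: "{1..k} = insert 1 {2..k}" using k by auto
    have V: "var t = s\<^sup>2 + (\<integral>w. (R w)\<^sup>2 \<partial>P t)"
      unfolding variance_F[OF t] R2 s2 kk by simp
    have Rle: "(\<integral>w. (R w)\<^sup>2 \<partial>P t) / s\<^sup>2 \<le> C1 / t"
    proof -
      have "(\<integral>w. (R w)\<^sup>2 \<partial>P t) \<le> (\<Sum>i=2..k. \<kappa> i * t ^ (2 * k - 2))"
        unfolding R2 using t1 \<kappa>_nonneg by (intro sum_mono mult_left_mono power_increasing) auto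
      also have "\<dots> = C1 * \<kappa> 1 * t ^ (2 * k - 2)" 
      proof -
        have "C1 * \<kappa> 1 = (\<Sum>i=2..k. \<kappa> i)" using pos by (simp only: C1_def) simp
        then show ?thesis by (simp only: sum_distrib_right)
      qed
      finally have "(\<integral>w. (R w)\<^sup>2 \<partial>P t) / s\<^sup>2 \<le> C1 * \<kappa> 1 * t ^ (2 * k - 2) / s\<^sup>2"
        by (rule divide_right_mono) simp
      also have "\<dots> = C1 / t"
      proof -
        have "2 * k - 1 = Suc (2 * k - 2)" using k by simp
        then show ?thesis unfolding s2 using t pos by simp
      qed
      finally show ?thesis .
    qed
    define v where "v = sqrt (var t)"
    have v: "s \<le> v" "0 < v"
    proof -
      have "sqrt (s\<^sup>2) \<le> v" unfolding v_def V by (intro real_sqrt_le_mono) simp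
      then show "s \<le> v" using s by simp
      then show "0 < v" using s by simp
    qed
    have v2: "v\<^sup>2 = s\<^sup>2 + (\<integral>w. (R w)\<^sup>2 \<partial>P t)" unfolding v_def V by simp
    let ?Y = "\<lambda>w. Fi 1 t w / s"
    have E1: "\<bar>(\<integral>w. g (?Y w) \<partial>P t) - normal_mean g\<bar> \<le> 26 * (C3 / sqrt t)"
    proof (rule normal_approximation_Lipschitz[OF Q.P.prob_space_axioms _ _ g])
      show "integrable (P t) ?Y" using integrable_of_L2[OF Q.P.prob_space_axioms I1] by simp
      fix g g' :: "real \<Rightarrow> real" assume g: "\<And>x. (g has_real_derivative g' x) (at x)" "\<And>x. \<bar>g' x\<bar> \<le> 1"
      have hm: "hk 1 \<in> borel_measurable (pow M 1)" by (rule hk_measurable[OF k])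
      let ?f = "\<lambda>x. t ^ (k - 1) * hk 1 x"
      have fm: "?f \<in> borel_measurable (pow (Ms t) 1)"
        by (rule measurable_pow_Ms[OF t]) (use hm in measurable)
      have fi4: "integrable (pow (Ms t) 1) (\<lambda>x. (?f x)^4)"
      proof -
        have "(\<lambda>x. (?f x)^4) \<in> borel_measurable (pow M 1)" using hm by measurable
        moreover have "integrable (pow M 1) (\<lambda>x. (?f x)^4)" unfolding power_mult_distrib using f4 by simp
        ultimately show ?thesis unfolding power_Ms[OF t] using t by (subst integral_scale_measure(1)) auto
      qed
      have two: "(\<integral>x. (?f x)\<^sup>2 \<partial>pow (Ms t) 1) / s\<^sup>2 = 1"
      proof -
        have "(\<integral>x. (?f x)\<^sup>2 \<partial>pow (Ms t) 1) = t * ((t ^ (k - 1))\<^sup>2 * \<kappa> 1)"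
          unfolding power_Ms[OF t] using t by (simp add: integral_scale_measure' power_mult_distrib \<kappa>_def)
        also have "\<dots> = s\<^sup>2" using t pos by (simp add: s_def power_mult_distrib)
        finally show ?thesis using s by simp
      qed
      have three: "(\<integral>x. \<bar>?f x\<bar>^3 \<partial>pow (Ms t) 1) / s^3 = C3 / sqrt t"
      proof -
        have e: "(\<integral>x. \<bar>?f x\<bar>^3 \<partial>pow (Ms t) 1) = t * ((t ^ (k - 1))^3 * (\<integral>x. \<bar>hk 1 x\<bar>^3 \<partial>pow M 1))"
          unfolding power_Ms[OF t] using t by (simp add: integral_scale_measure' power_mult_distrib abs_mult)
        have "(sqrt t)^3 = t * sqrt t" using t by (simp add: power3_eq_cube)
        then have s3: "s^3 = (t ^ (k - 1))^3 * (t * sqrt t) * (sqrt (\<kappa> 1))^3" by (simp add: s_def power_mult_distrib)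
        show ?thesis unfolding e s3 C3_def using t pos by simp
      qed
      show "\<bar>(\<integral>w. g (?Y w) \<partial>P t) - normal_mean g\<bar> \<le> 26 * (C3 / sqrt t)"
        using Q.normal_approximation_first_order[OF fm fi4 s g] unfolding two three by simp
    qed
    \<comment> \<open>First the remainder \<open>R\<close> is dropped at the normalisation
      \<open>v\<close>, at the cost of its relative L2 norm. Then \<open>v\<close> is replaced by
      \<open>s\<close>, at the cost of \<open>1 - s / v\<close>, which is at most
      \<open>1 - (s / v)^2\<close>, the share of \<open>R\<close> in the variance, and hence even of
      order \<open>1 / t\<close>.\<close>
    have E2: "\<bar>(\<integral>w. g ((Fi 1 t w + R w) / v) \<partial>P t) - (\<integral>w. g (?Y w) \<partial>P t)\<bar> \<le> (C1 + sqrt C1) / sqrt t"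
    proof -
      have gL: "\<bar>g x - g y\<bar> \<le> 1 * \<bar>x - y\<bar>" for x y using g by simp
      have sqs: "square_integrable (P t) (\<lambda>w. Fi 1 t w / c)" "square_integrable (P t) (\<lambda>w. (Fi 1 t w + R w) / c)" for c
        using square_integrable_cmult[OF I1, of "inverse c"] square_integrable_cmult[OF square_integrable_add[OF I1 Rsq], of "inverse c"]
        by (simp_all add: divide_inverse mult.commute)
      have a: "\<bar>(\<integral>w. g ((Fi 1 t w + R w) / v) \<partial>P t) - (\<integral>w. g (Fi 1 t w / v) \<partial>P t)\<bar> \<le> sqrt C1 / sqrt t"
      proof -
        have "\<bar>(\<integral>w. g ((Fi 1 t w + R w) / v) \<partial>P t) - (\<integral>w. g (Fi 1 t w / v) \<partial>P t)\<bar> \<le>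
          1 * sqrt (\<integral>w. ((Fi 1 t w + R w) / v - Fi 1 t w / v)\<^sup>2 \<partial>P t)"
          by (rule Q.P.Lipschitz_L2_bound[OF gL sqs(2) sqs(1)])
        also have "(\<integral>w. ((Fi 1 t w + R w) / v - Fi 1 t w / v)\<^sup>2 \<partial>P t) = (\<integral>w. (R w)\<^sup>2 \<partial>P t) / v\<^sup>2"
          by (simp add: diff_divide_distrib[symmetric] power_divide)
        also have "1 * sqrt ((\<integral>w. (R w)\<^sup>2 \<partial>P t) / v\<^sup>2) \<le> sqrt (C1 / t)"
        proof -
          have "(\<integral>w. (R w)\<^sup>2 \<partial>P t) / v\<^sup>2 \<le> (\<integral>w. (R w)\<^sup>2 \<partial>P t) / s\<^sup>2"
            using s v by (intro divide_left_mono power_mono mult_pos_pos) auto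
          then show ?thesis using Rle by simp
        qed
        finally show ?thesis by (simp add: real_sqrt_divide)
      qed
      have b: "\<bar>(\<integral>w. g (Fi 1 t w / v) \<partial>P t) - (\<integral>w. g (?Y w) \<partial>P t)\<bar> \<le> C1 / sqrt t"
      proof -
        have "\<bar>(\<integral>w. g (Fi 1 t w / v) \<partial>P t) - (\<integral>w. g (?Y w) \<partial>P t)\<bar> \<le>
          1 * sqrt (\<integral>w. (Fi 1 t w / v - Fi 1 t w / s)\<^sup>2 \<partial>P t)"
          by (rule Q.P.Lipschitz_L2_bound[OF gL sqs(1) sqs(1)])
        also have "(\<integral>w. (Fi 1 t w / v - Fi 1 t w / s)\<^sup>2 \<partial>P t) = (1 - s / v)\<^sup>2"
        proof -
          have "(Fi 1 t w / v - Fi 1 t w / s)\<^sup>2 = (1 / v - 1 / s)\<^sup>2 * (Fi 1 t w)\<^sup>2" for w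
            by (simp add: power_mult_distrib[symmetric] left_diff_distrib)
          then have "(\<integral>w. (Fi 1 t w / v - Fi 1 t w / s)\<^sup>2 \<partial>P t) = (1 / v - 1 / s)\<^sup>2 * s\<^sup>2"
            using Fi_second_moment[OF t k] by (simp add: s2)
          also have "\<dots> = (s / v - 1)\<^sup>2" using s by (simp add: power_mult_distrib[symmetric] left_diff_distrib)
          finally show ?thesis by (simp add: power2_commute)
        qed
        also have "1 * sqrt ((1 - s / v)\<^sup>2) = 1 - s / v" using s v by simp
        also have "\<dots> \<le> 1 - (s / v)\<^sup>2"
        proof -
          have "(s / v)\<^sup>2 \<le> s / v" using s v mult_left_le[of "s / v" "s / v"] by (simp add: power2_eq_square)
          then show ?thesis by simp
        qed
        also have "\<dots> = (\<integral>w. (R w)\<^sup>2 \<partial>P t) / v\<^sup>2" 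
        proof -
          have "1 - (s / v)\<^sup>2 = (v\<^sup>2 - s\<^sup>2) / v\<^sup>2" using v by (simp add: power_divide diff_divide_distrib)
          then show ?thesis using v2 by simp
        qed
        also have "\<dots> \<le> (\<integral>w. (R w)\<^sup>2 \<partial>P t) / s\<^sup>2"
          using s v by (intro divide_left_mono power_mono mult_pos_pos) auto
        also have "\<dots> \<le> C1 / t" by (rule Rle)
        also have "\<dots> \<le> C1 / sqrt t"
        proof (rule divide_left_mono[OF _ C1])
          show "sqrt t \<le> t" using t1 by (intro real_le_lsqrt) (auto simp: power2_eq_square)
        qed (use t in auto)
        finally show ?thesis .
      qed
      show ?thesis using a b unfolding add_divide_distrib by linarith
    qed
    have "(\<integral>w. g ((F t w - mean t) / sqrt (var t)) \<partial>P t) = (\<integral>w. g ((Fi 1 t w + R w) / v) \<partial>P t)"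
    proof (rule integral_cong_AE)
      have gm [measurable]: "g \<in> borel_measurable borel" using g by (intro Lipschitz_borel_measurable(2)[of g 1]) simp
      have [measurable]: "F t \<in> borel_measurable (P t)" "Fi 1 t \<in> borel_measurable (P t)" "R \<in> borel_measurable (P t)"
        using F_L2[OF t] I1 Rsq by (auto simp: square_integrable_def)
      show "(\<lambda>w. g ((F t w - mean t) / sqrt (var t))) \<in> borel_measurable (P t)" by measurable
      show "(\<lambda>w. g ((Fi 1 t w + R w) / v)) \<in> borel_measurable (P t)" by measurable
      show "AE w in P t. g ((F t w - mean t) / sqrt (var t)) = g ((Fi 1 t w + R w) / v)"
        using F_decomposition[OF t] unfolding v_def R_def kk by eventually_elim simp
    qed
    then have "\<bar>(\<integral>w. g ((F t w - mean t) / sqrt (var t)) \<partial>P t) - normal_mean g\<bar> \<le> (C1 + sqrt C1) / sqrt t + 26 * (C3 / sqrt t)"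
      using E1 E2 by linarith
    also have "\<dots> = (C1 + sqrt C1 + 26 * C3) * t powr (- 1 / 2)" unfolding tp by (simp add: add_divide_distrib)
    finally show ?thesis .
  qed
  show ?thesis by (rule that[of "C1 + sqrt C1 + 26 * C3"]) (rule main)
qed

end

section \<open>Convergence in law of the dominant chaos of order at least 2\<close>

lemma simple_integral_cmult: "simple_integral W q N A (\<lambda>f. c * a f) w = c * simple_integral W q N A a w"
  by (simp add: simple_integral_def sum_distrib_left mult.assoc)

lemma simple_kernel_cmult: "simple_kernel q N A (\<lambda>f. c * a f) x = c * simple_kernel q N A a x"
  by (simp add: simple_kernel_def sum_distrib_left mult.assoc)

lemma simple_integral_noise_cmult:
  "simple_integral (\<lambda>B w. c * W B w) q N A a w = c ^ q * simple_integral W q N A a w"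
  by (simp add: simple_integral_def prod.distrib sum_distrib_left mult.left_commute)

lemma off_diagonal_sum_tendsto:
  assumes "\<And>r. r < N \<Longrightarrow> (\<lambda>n. x n r) \<longlonglongrightarrow> y r"
  shows "(\<lambda>n. off_diagonal_sum q N a (\<lambda>_. x n)) \<longlonglongrightarrow> off_diagonal_sum q N a (\<lambda>_. y)"
  unfolding off_diagonal_sum_def
  by (intro tendsto_sum tendsto_mult tendsto_const tendsto_prod assms) (auto simp: injective_indices_def PiE_iff)

text \<open>Limits at infinity are tested along sequences. Replacing a sequence by its maximum with
  1 changes finitely many terms and makes every intensity at least 1, as the estimates
  require.\<close>

lemma weak_conv_along_sequentiallyI:
  fixes L :: "real \<Rightarrow> real measure"
  assumes "\<And>r. (\<And>n. 1 \<le> r n) \<Longrightarrow> filterlim r at_top sequentially \<Longrightarrow> weak_conv_m (\<lambda>n. L (r n)) N"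
  shows "weak_conv_along L N at_top"
  unfolding weak_conv_along_def
proof (intro allI impI tendsto_at_topI_sequentially)
  fix x :: real and X :: "nat \<Rightarrow> real" assume x: "isCont (cdf N) x" and X: "filterlim X at_top sequentially"
  have ev: "\<forall>\<^sub>F n in sequentially. max 1 (X n) = X n"
    using filterlim_at_top_dense[THEN iffD1, OF X, rule_format, of 1] by eventually_elim simp
  have "filterlim (\<lambda>n. max 1 (X n)) at_top sequentially"
    using X by (rule filterlim_at_top_mono) simp
  then have "(\<lambda>n. cdf (L (max 1 (X n))) x) \<longlonglongrightarrow> cdf N x"
    using assms[of "\<lambda>n. max 1 (X n)"] x by (simp add: weak_conv_m_def weak_conv_def)
  then show "(\<lambda>n. cdf (L (X n)) x) \<longlonglongrightarrow> cdf N x"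
    by (rule Lim_transform_eventually) (use ev in eventually_elim, simp)
qed

lemma weak_conv_m_unique:
  assumes "\<And>n. real_distribution (L n)" "real_distribution N" "real_distribution N'"
    and "weak_conv_m L N" "weak_conv_m L N'"
  shows "N = N'"
proof (rule Levy_uniqueness[OF assms(2,3)])
  show "char N = char N'"
    using levy_continuity1[OF assms(1,2,4)] levy_continuity1[OF assms(1,3,5)] by (auto intro: LIMSEQ_unique)
qed

lemma gaussian_measure_scale:
  assumes G: "gaussian_measure Q (scale_measure (ennreal (1 / c)) M) G" and fin: "finite_measure M" and c: "0 < c"
  shows "gaussian_measure Q M (\<lambda>B w. sqrt c * G B w)"
proof -
  interpret M: finite_measure M by fact
  let ?M = "scale_measure (ennreal (1 / c)) M"
  have fin': "emeasure ?M B < \<infinity>" for B by (simp add: M.emeasure_eq_measure ennreal_mult_less_top)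
  have m: "measure ?M B = measure M B / c" for B using c by (simp add: measure_def enn2real_mult)
  show ?thesis
    unfolding gaussian_measure_def
  proof (intro conjI allI impI ballI)
    show "prob_space Q" using G by (simp add: gaussian_measure_def)
    fix \<B> :: "'b set set" and a :: "'b set \<Rightarrow> real"
    assume B: "finite \<B>" "\<forall>B\<in>\<B>. B \<in> sets M \<and> emeasure M B < \<infinity>"
    then have "centered_gaussian Q (\<lambda>w. \<Sum>B\<in>\<B>. (a B * sqrt c) * G B w)"
      using G fin' unfolding gaussian_measure_def by simp
    then show "centered_gaussian Q (\<lambda>w. \<Sum>B\<in>\<B>. a B * (sqrt c * G B w))" by (simp add: mult.assoc)
  next
    fix B C assume "B \<in> sets M" "C \<in> sets M"
    then have e: "(\<integral>w. G B w * G C w \<partial>Q) = measure M (B \<inter> C) / c"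
      using G fin' by (simp add: gaussian_measure_def m)
    have "(\<integral>w. sqrt c * G B w * (sqrt c * G C w) \<partial>Q) = (\<integral>w. c * (G B w * G C w) \<partial>Q)"
      using c by (intro Bochner_Integration.integral_cong refl) simp
    also have "\<dots> = measure M (B \<inter> C)" using e c by simp
    finally show "(\<integral>w. sqrt c * G B w * (sqrt c * G C w) \<partial>Q) = measure M (B \<inter> C)" .
  qed
qed

lemma kernel_approximation_scale:
  assumes "kernel_approximation M q N A a f" and fin: "finite_measure M" and f: "f \<in> borel_measurable (pow M q)"
  shows "kernel_approximation (scale_measure (ennreal c) M) q N A a f"
proof -
  have "(\<lambda>m. ennreal c ^ q * nn_dist2 (pow M q) (simple_kernel q (N m) (A m) (a m)) f) \<longlonglongrightarrow> ennreal c ^ q * 0"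
    using assms(1) by (intro ennreal_tendsto_cmult) (auto simp: kernel_approximation_def L2_tendsto_def ennreal_power[symmetric] power_less_top_ennreal)
  moreover have "simple_kernel q (N m) (A m) (a m) \<in> borel_measurable (pow M q)" for m
    using assms(1) by (intro finite_measure.simple_kernel_measurable[OF fin]) (auto simp: kernel_approximation_def)
  then have "(\<lambda>x. ennreal ((simple_kernel q (N m) (A m) (a m) x - f x)\<^sup>2)) \<in> borel_measurable (pow M q)" for m
    using f by measurable
  ultimately show ?thesis
    using assms(1)
    by (simp add: kernel_approximation_def L2_tendsto_def power_measure_scale[OF fin] nn_integral_scale_measure)
qed

text \<open>Compares \<open>U n\<close> with \<open>S n m\<close>, then \<open>S n m\<close> with
  \<open>T m\<close>, then \<open>T m\<close> with \<open>V\<close>. The outer errors are uniform in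
  \<open>n\<close> up to \<open>\<delta> n\<close>, so \<open>m\<close> is fixed first and
  \<open>n\<close> is sent to infinity afterwards; test functions are Lipschitz steps, which turn L2
  errors into errors of expectations.\<close>

lemma (in prob_space) weak_limit_approximation:
  fixes U :: "nat \<Rightarrow> 'b \<Rightarrow> real" and S :: "nat \<Rightarrow> nat \<Rightarrow> 'b \<Rightarrow> real"
  assumes P: "\<And>n. prob_space (P n)" and U: "\<And>n. square_integrable (P n) (U n)"
    and S: "\<And>n m. square_integrable (P n) (S n m)" and V: "square_integrable M V" and T: "\<And>m. square_integrable M (T m)"
    and US: "\<And>n m. (L2_dist2 (P n) (U n) (S n m)) \<le> \<delta> n + D m"
    and VT: "\<And>m. (L2_dist2 M V (T m)) \<le> D m"
    and lim: "\<delta> \<longlonglongrightarrow> 0" "D \<longlonglongrightarrow> 0"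
    and ST: "\<And>m (g :: real \<Rightarrow> real). continuous_on UNIV g \<Longrightarrow> (\<And>x. \<bar>g x\<bar> \<le> 1) \<Longrightarrow>
      (\<lambda>n. \<integral>w. g (S n m w) \<partial>P n) \<longlonglongrightarrow> expectation (\<lambda>w. g (T m w))"
  shows "weak_conv_m (\<lambda>n. distr (P n) borel (U n)) (distr M borel V)"
proof (rule integral_cts_step_conv_imp_weak_conv)
  have [measurable]: "U n \<in> borel_measurable (P n)" "V \<in> borel_measurable M" for n using U V by (auto simp: square_integrable_def)
  show "real_distribution (distr (P n) borel (U n))" for n by (intro prob_space.real_distribution_distr P) simp
  show "real_distribution (distr M borel V)" by (intro real_distribution_distr) simp
  fix a b :: real assume ab: "a < b"
  let ?g = "cts_step a b" and ?L = "1 / (b - a)"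
  note c = cts_step_continuous[OF ab]
  note [measurable] = borel_measurable_continuous_onI[OF c]
  note L = cts_step_Lipschitz[OF ab]
  have L0: "0 < ?L" using ab by simp
  have "(\<lambda>n. \<integral>w. ?g (U n w) \<partial>P n) \<longlonglongrightarrow> expectation (\<lambda>w. ?g (V w))"
  proof (rule LIMSEQ_I)
    fix e :: real assume e: "0 < e"
    have "(\<lambda>m. ?L * sqrt (0 + D m) + 0 + ?L * sqrt (D m)) \<longlonglongrightarrow> ?L * sqrt (0 + 0) + 0 + ?L * sqrt 0"
      by (intro tendsto_intros lim)
    then have "\<forall>\<^sub>F m in sequentially. ?L * sqrt (0 + D m) + 0 + ?L * sqrt (D m) < e" using e by (intro order_tendstoD(2)) auto
    then obtain m where m: "?L * sqrt (0 + D m) + 0 + ?L * sqrt (D m) < e" by (auto simp: eventually_sequentially)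
    let ?d = "\<lambda>n. \<bar>(\<integral>w. ?g (S n m w) \<partial>P n) - expectation (\<lambda>w. ?g (T m w))\<bar>"
    have "?d \<longlonglongrightarrow> 0"
      using ST[OF c cts_step_bounds[OF ab], of m] by (intro tendsto_rabs_zero) (simp add: LIM_zero)
    then have "(\<lambda>n. ?L * sqrt (\<delta> n + D m) + ?d n + ?L * sqrt (D m)) \<longlonglongrightarrow> ?L * sqrt (0 + D m) + 0 + ?L * sqrt (D m)"
      by (intro tendsto_intros lim)
    then have "\<forall>\<^sub>F n in sequentially. ?L * sqrt (\<delta> n + D m) + ?d n + ?L * sqrt (D m) < e" using m by (rule order_tendstoD(2))
    then obtain n0 where n0: "\<And>n. n0 \<le> n \<Longrightarrow> ?L * sqrt (\<delta> n + D m) + ?d n + ?L * sqrt (D m) < e"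
      by (auto simp: eventually_sequentially)
    have 1: "\<bar>(\<integral>w. ?g (U n w) \<partial>P n) - (\<integral>w. ?g (S n m w) \<partial>P n)\<bar> \<le> ?L * sqrt (\<delta> n + D m)" for n
      using prob_space.Lipschitz_L2_bound[OF P L U S, of n m] US[of n m] L0
      by (meson mult_left_mono order_trans real_sqrt_le_mono less_imp_le)
    have 2: "\<bar>expectation (\<lambda>w. ?g (V w)) - expectation (\<lambda>w. ?g (T m w))\<bar> \<le> ?L * sqrt (D m)"
      using Lipschitz_L2_bound[OF L V T, of m] VT[of m] L0
      by (meson mult_left_mono order_trans real_sqrt_le_mono less_imp_le)
    have "\<bar>(\<integral>w. ?g (U n w) \<partial>P n) - expectation (\<lambda>w. ?g (V w))\<bar> \<le> ?L * sqrt (\<delta> n + D m) + ?d n + ?L * sqrt (D m)" for n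
      using 1[of n] 2 by linarith
    then show "\<exists>n0. \<forall>n\<ge>n0. norm ((\<integral>w. ?g (U n w) \<partial>P n) - expectation (\<lambda>w. ?g (V w))) < e"
      using n0 by (intro exI[of _ n0]) (auto intro: le_less_trans)
  qed
  then show "(\<lambda>n. integral\<^sup>L (distr (P n) borel (U n)) ?g) \<longlonglongrightarrow> integral\<^sup>L (distr M borel V) ?g"
    by (simp add: integral_distr)
qed

context scaled_poisson begin

abbreviation noise :: "real \<Rightarrow> 'z set \<Rightarrow> 'w \<Rightarrow> real" where "noise t \<equiv> compensated (Ms t) (\<eta> t)"

lemma measure_Ms: "0 < t \<Longrightarrow> measure (Ms t) A = t * measure M A"
  by (simp add: measure_def enn2real_mult)

text \<open>The Poisson mass of a set of positive measure is normalised by its standard deviation,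
  where the Stein bound tends to zero. A null set has to be treated apart, since that normalisation
  divides by zero; there both laws are degenerate.\<close>

lemma compensated_weak_conv:
  assumes A: "A \<in> sets M" and r: "\<And>n. 1 \<le> r n" "filterlim r at_top sequentially" and G: "gaussian_measure Q M G"
  shows "weak_conv_m (\<lambda>n. distr (P (r n)) borel (\<lambda>w. r n powr (- 1 / 2) * noise (r n) A w)) (distr Q borel (G A))"
proof -
  have t: "0 < r n" for n using r(1)[of n] by simp
  interpret G: centered_noise Q M G by (rule gaussian_measure_centered_noise[OF G finite_measure_axioms])
  have "centered_gaussian Q (\<lambda>w. \<Sum>B\<in>{A}. 1 * G B w)"
    using G A unfolding gaussian_measure_def by (elim conjE allE[of _ "{A}"] allE[of _ "\<lambda>_. 1"]) (auto simp: emeasure_eq_measure)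
  then have "centered_gaussian Q (G A)" by simp
  from G.P.distr_centered_gaussian[OF this]
  have law: "distr Q borel (G A) = distr std_normal_distribution borel (\<lambda>x. sqrt (measure M A) * x)"
    using G.noise_variance[OF A] by simp
  show ?thesis
  proof (cases "measure M A = 0")
    case True
    have "distr (P (r n)) borel (\<lambda>w. r n powr (- 1 / 2) * noise (r n) A w) = return borel 0" for n
    proof -
      interpret Q: poisson_process "Ms (r n)" cell K "\<lambda>m. r n * \<epsilon> m" "P (r n)" "\<eta> (r n)" by (rule process[OF t])
      have A': "A \<in> sets (Ms (r n))" using A by simp
      note [measurable] = Q.noise.noise_measurable[OF A']
      have "(\<integral>w. (noise (r n) A w)\<^sup>2 \<partial>P (r n)) = 0"
        using Q.noise.noise_variance[OF A'] measure_Ms[OF t] True by simp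
      then have "AE w in P (r n). (noise (r n) A w)\<^sup>2 = 0"
        using Q.noise.noise_integrable_sq[OF A'] by (subst (asm) integral_nonneg_eq_0_iff_AE) auto
      then have "AE w in P (r n). r n powr (- 1 / 2) * noise (r n) A w = 0" by eventually_elim simp
      then have "distr (P (r n)) borel (\<lambda>w. r n powr (- 1 / 2) * noise (r n) A w) = distr (P (r n)) borel (\<lambda>_. 0)"
        by (intro distr_cong_AE) auto
      then show ?thesis by (simp add: Q.P.distr_const)
    qed
    moreover have "distr Q borel (G A) = return borel 0"
    proof -
      have "distr Q borel (G A) = distr std_normal_distribution borel (\<lambda>_. 0)"
        unfolding law True by (intro distr_cong) auto
      then show ?thesis by (simp add: prob_space.distr_const[OF prob_space_std_normal])
    qed
    ultimately show ?thesis by (simp add: weak_conv_m_def weak_conv_def)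
  next
    case False
    then have v: "0 < measure M A" using measure_nonneg[of M A] by linarith
    let ?s = "\<lambda>n. sqrt (r n * measure M A)"
    have "weak_conv_m (\<lambda>n. distr (P (r n)) borel (\<lambda>w. sqrt (measure M A) * (noise (r n) A w / ?s n)))
      (distr std_normal_distribution borel (\<lambda>x. sqrt (measure M A) * x))"
    proof (rule weak_conv_normal)
      show "prob_space (P (r n))" for n by (rule prob_space_P[OF t])
      show "integrable (P (r n)) (\<lambda>w. noise (r n) A w / ?s n)" for n
      proof -
        interpret Q: poisson_process "Ms (r n)" cell K "\<lambda>m. r n * \<epsilon> m" "P (r n)" "\<eta> (r n)" by (rule process[OF t])
        show ?thesis using Q.noise.noise_integrable[of A] A by simp
      qed
      show "(\<lambda>n. 26 / ?s n) \<longlonglongrightarrow> 0"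
        by (intro real_tendsto_divide_at_top[OF tendsto_const] filterlim_compose[OF sqrt_at_top]
            filterlim_at_top_mult_tendsto_pos[OF tendsto_const v r(2), simplified mult.commute])
      show "\<bar>(\<integral>w. g (noise (r n) A w / ?s n) \<partial>P (r n)) - normal_mean g\<bar> \<le> 26 / ?s n"
        if "\<And>x y. \<bar>g x - g y\<bar> \<le> \<bar>x - y\<bar>" for n g
      proof -
        interpret Q: poisson_process "Ms (r n)" cell K "\<lambda>m. r n * \<epsilon> m" "P (r n)" "\<eta> (r n)" by (rule process[OF t])
        show ?thesis using Q.normal_approximation_set[OF _ _ that, of A] A v t[of n] by (simp add: measure_Ms[OF t])
      qed
    qed simp
    moreover have "sqrt (measure M A) * (noise (r n) A w / ?s n) = r n powr (- 1 / 2) * noise (r n) A w" for n w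
      using powr_minus_divide[of "r n" "1 / 2"] powr_half_sqrt[of "r n"] t[of n] v by (simp add: real_sqrt_mult)
    ultimately show ?thesis unfolding law by simp
  qed
qed

text \<open>The integrand is a bounded continuous function of finitely many independent masses, to
  which \<open>indep_weak_conv\<close> applies. Its index set must be nonempty; for
  \<open>N = 0\<close> the simple integral is a constant.\<close>

lemma simple_integral_weak_conv:
  fixes g :: "real \<Rightarrow> real"
  assumes A: "disjoint_family_on A {..<N::nat}" "\<And>i. i < N \<Longrightarrow> A i \<in> sets M"
    and T: "\<And>n. 1 \<le> T n" "filterlim T at_top sequentially" and G: "gaussian_measure Q M G"
    and g: "continuous_on UNIV g" "\<And>x. \<bar>g x\<bar> \<le> 1"
  shows "(\<lambda>n. \<integral>w. g (simple_integral (\<lambda>B w. T n powr (- 1 / 2) * noise (T n) B w) q N A a w) \<partial>P (T n)) \<longlonglongrightarrow>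
    (\<integral>w. g (simple_integral G q N A a w) \<partial>Q)"
proof -
  have t: "0 < T n" for n using T(1)[of n] by simp
  interpret G: centered_noise Q M G by (rule gaussian_measure_centered_noise[OF G finite_measure_axioms])
  have [measurable]: "g \<in> borel_measurable borel" by (rule borel_measurable_continuous_onI[OF g(1)])
  have Pn: "prob_space (P (T n))" for n by (rule prob_space_P[OF t])
  let ?X = "\<lambda>n r w. T n powr (- 1 / 2) * noise (T n) (A r) w"
  let ?p = "\<lambda>y. g (off_diagonal_sum q N a (\<lambda>_ r. y r))"
  have idx: "f j < N" if "f \<in> injective_indices q N" "j < q" for f j
    using that by (auto simp: injective_indices_def)
  have re: "off_diagonal_sum q N a (\<lambda>_ r. (\<lambda>i\<in>{..<N}. y i) r) = off_diagonal_sum q N a (\<lambda>_ r. y r)" for y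
    unfolding off_diagonal_sum_def using idx by (intro sum.cong refl arg_cong2[of _ _ _ _ "(*)"] prod.cong) auto
  show ?thesis
  proof (cases "N = 0")
    case True
    then have "off_diagonal_sum q N a (\<lambda>_ r. x r) = off_diagonal_sum q N a (\<lambda>_ r. y r)" for x y :: "nat \<Rightarrow> real"
      unfolding off_diagonal_sum_def using idx by (intro sum.cong refl arg_cong2[of _ _ _ _ "(*)"] prod.cong) auto
    then obtain c where "\<And>x. off_diagonal_sum q N a (\<lambda>_ r. x r :: real) = c" by metis
    then show ?thesis
      using prob_space.prob_space[OF Pn] G.P.prob_space by (simp add: simple_integral_off_diagonal_sum)
  next
    case False
    have "(\<lambda>n. \<integral>w. ?p (\<lambda>r\<in>{..<N}. ?X n r w) \<partial>P (T n)) \<longlonglongrightarrow> (\<integral>w. ?p (\<lambda>r\<in>{..<N}. G (A r) w) \<partial>Q)"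
    proof (rule indep_weak_conv[where B = 1])
      show "prob_space.indep_vars (P (T n)) (\<lambda>_. borel) (?X n) {..<N}" for n
      proof -
        interpret Q: poisson_process "Ms (T n)" cell K "\<lambda>m. T n * \<epsilon> m" "P (T n)" "\<eta> (T n)" by (rule process[OF t])
        have "Q.P.indep_vars (\<lambda>_. borel) (\<lambda>r. noise (T n) (A r)) {..<N}" using A by (intro Q.noise.noise_indep) auto
        then show ?thesis
          using Q.P.indep_vars_compose2[of "\<lambda>_. borel" "\<lambda>r. noise (T n) (A r)" "{..<N}" "\<lambda>_ x. T n powr (- 1 / 2) * x" "\<lambda>_. borel"] by simp
      qed
      show "prob_space.indep_vars Q (\<lambda>_. borel) (\<lambda>r. G (A r)) {..<N}" using A by (intro G.noise_indep) auto
      show "weak_conv_m (\<lambda>n. distr (P (T n)) borel (?X n r)) (distr Q borel (G (A r)))" if "r \<in> {..<N}" for r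
        using A that by (intro compensated_weak_conv T G) auto
      show "?p \<in> borel_measurable (PiM {..<N} (\<lambda>_. borel))"
        unfolding off_diagonal_sum_def
        by (intro measurable_compose[OF _ \<open>g \<in> borel_measurable borel\<close>] borel_measurable_sum borel_measurable_times borel_measurable_const borel_measurable_prod
            measurable_component_singleton) (auto intro: idx)
      show "(\<lambda>n. ?p (x n)) \<longlonglongrightarrow> ?p y" if "\<And>i. i \<in> {..<N} \<Longrightarrow> (\<lambda>n. x n i) \<longlonglongrightarrow> y i" for x y
        using that by (intro continuous_on_tendsto_compose[OF g(1)] off_diagonal_sum_tendsto) auto
    qed (use False Pn G.P.prob_space_axioms g(2) in auto)
    then show ?thesis unfolding re by (simp add: simple_integral_off_diagonal_sum)
  qed
qed

text \<open>With \<open>c = t^(q/2-k)\<close> the chaos of order \<open>i\<close> has second moment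
  \<open>\<kappa> i * t^(q-i)\<close> after scaling: the orders above \<open>q\<close> are at most
  of size \<open>1 / t\<close>, those below vanish, order 0 by \<open>\<kappa>_0\<close>, and at
  order \<open>q\<close> the isometry gives an error independent of \<open>t\<close>. The factors 2
  come from splitting a square of a sum.\<close>

lemma U_statistic_approximation:
  assumes q: "2 \<le> q" "q \<le> k" "\<And>i. 1 \<le> i \<Longrightarrow> i < q \<Longrightarrow> \<kappa> i = 0" and t1: "1 \<le> t"
    and a: "kernel_approximation M q N A a (hk q)"
  shows "square_integrable (P t) (simple_integral (\<lambda>B w. t powr (- 1 / 2) * noise t B w) q (N m) (A m) (a m))"
    and "(\<integral>w. (t powr (real q / 2 - real k) * F t w -
        simple_integral (\<lambda>B w. t powr (- 1 / 2) * noise t B w) q (N m) (A m) (a m) w)\<^sup>2 \<partial>P t) \<le>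
      2 * (\<Sum>i\<in>{q<..k}. \<kappa> i) / t + 2 * (fact q * L2_dist2 (pow M q) (hk q) (simple_kernel q (N m) (A m) (a m)))"
proof -
  have t: "0 < t" using t1 by simp
  interpret Q: poisson_process "Ms t" cell K "\<lambda>n. t * \<epsilon> n" "P t" "\<eta> t" by (rule process[OF t])
  have Am: "disjoint_family_on (A m) {..<N m}" "\<And>i. i < N m \<Longrightarrow> A m i \<in> sets (Ms t)"
    using a by (auto simp: kernel_approximation_def)
  define c where "c = t powr (real q / 2 - real k)"
  have c2: "c\<^sup>2 * t ^ (2 * k - i) = t powr (real q - real i)" if "i \<le> k" for i
  proof -
    have "c\<^sup>2 = t powr (real q - 2 * real k)" unfolding c_def power2_eq_square powr_add[symmetric] by simp
    moreover have "t ^ (2 * k - i) = t powr (2 * real k - real i)" using t that by (simp add: powr_realpow[symmetric] of_nat_diff)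
    ultimately show ?thesis by (simp add: powr_add[symmetric])
  qed
  let ?S = "simple_integral (noise t) q (N m) (A m)"
  let ?b = "\<lambda>p. t ^ (k - q) * a m p"
  \<comment> \<open>The noise scaled by \<open>t^(-1/2)\<close> in each of the \<open>q\<close>
    variables reproduces both the normalisation \<open>c\<close> of \<open>F t\<close> and the
    factor \<open>t^(k-q)\<close> of its kernel.\<close>
  have "(t powr (- 1 / 2)) ^ q = c * t ^ (k - q)"
  proof -
    have "(t powr (- 1 / 2)) ^ q = t powr (- (real q / 2))" using t by (simp add: powr_realpow[symmetric] powr_powr)
    also have "- (real q / 2) = (real q / 2 - real k) + real (k - q)" using q by (simp add: of_nat_diff field_simps)
    finally show ?thesis using t by (simp add: powr_add c_def powr_realpow)
  qed
  then have S: "simple_integral (\<lambda>B w. t powr (- 1 / 2) * noise t B w) q (N m) (A m) (a m) w = c * ?S ?b w" for w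
    unfolding simple_integral_noise_cmult simple_integral_cmult by simp
  have sqS: "square_integrable (P t) (?S ?b)" by (rule Q.noise.simple_integral_square_integrable[OF Am])
  show "square_integrable (P t) (simple_integral (\<lambda>B w. t powr (- 1 / 2) * noise t B w) q (N m) (A m) (a m))"
    unfolding S[abs_def] by (rule square_integrable_cmult[OF sqS])
  define R where "R w = (\<Sum>i\<in>{q<..k}. Fi i t w)" for w
  have sqR: "square_integrable (P t) R" unfolding R_def[abs_def] by (intro square_integrable_sum Fi_square_integrable[OF t]) auto
  have sqF: "square_integrable (P t) (Fi q t)" by (rule Fi_square_integrable[OF t q(2)])
  have R2: "c\<^sup>2 * (\<integral>w. (R w)\<^sup>2 \<partial>P t) \<le> (\<Sum>i\<in>{q<..k}. \<kappa> i) / t"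
  proof -
    have "c\<^sup>2 * (\<integral>w. (R w)\<^sup>2 \<partial>P t) = c\<^sup>2 * (\<Sum>i\<in>{q<..k}. \<kappa> i * t ^ (2 * k - i))"
      unfolding R_def by (subst second_moment_sum[OF t]) auto
    also have "\<dots> = (\<Sum>i\<in>{q<..k}. \<kappa> i * t powr (real q - real i))"
      unfolding sum_distrib_left by (intro sum.cong refl) (simp add: c2[symmetric])
    also have "\<dots> \<le> (\<Sum>i\<in>{q<..k}. \<kappa> i * t powr (- 1))"
      using t1 \<kappa>_nonneg by (intro sum_mono mult_left_mono powr_mono) auto
    also have "\<dots> = (\<Sum>i\<in>{q<..k}. \<kappa> i) / t" using t by (simp add: sum_distrib_right[symmetric] powr_minus divide_inverse)
    finally show ?thesis .
  qed
  have small: "AE w in P t. Fi i t w = 0" if i: "i < q" for i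
  proof -
    have "\<kappa> i = 0" using q(1,3) \<kappa>_0 i by (cases "i = 0") auto
    then have "(\<integral>w. (Fi i t w)\<^sup>2 \<partial>P t) = 0" using Fi_second_moment[OF t, of i] i q by simp
    moreover have "integrable (P t) (\<lambda>w. (Fi i t w)\<^sup>2)"
      using Fi_square_integrable[OF t, of i] i q by (simp add: square_integrable_def)
    ultimately have "AE w in P t. (Fi i t w)\<^sup>2 = 0" by (subst (asm) integral_nonneg_eq_0_iff_AE) auto
    then show ?thesis by eventually_elim simp
  qed
  have F: "AE w in P t. F t w = Fi q t w + R w"
  proof -
    have "{..k} = {..<q} \<union> insert q {q<..k}" using q by auto
    then have s: "(\<Sum>i\<le>k. Fi i t w) = (\<Sum>i<q. Fi i t w) + (Fi q t w + R w)" for w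
      unfolding R_def by (simp only:) (subst sum.union_disjoint, auto)
    have "AE w in P t. \<forall>i\<in>{..<q}. Fi i t w = 0" using small by (intro AE_finite_allI) auto
    then show ?thesis using F_chaos[OF t] unfolding s by eventually_elim simp
  qed
  have distance: "c\<^sup>2 * L2_dist2 (P t) (Fi q t) (?S ?b) \<le>
    fact q * L2_dist2 (pow M q) (hk q) (simple_kernel q (N m) (A m) (a m))" (is "_ \<le> fact q * ?D")
  proof -
    let ?f = "\<lambda>x. t ^ (k - q) * hk q x"
    have fm: "?f \<in> borel_measurable (pow (Ms t) q)"
      by (rule measurable_pow_Ms[OF t]) (use hk_measurable[OF q(2)] in measurable)
    have am: "kernel_approximation (Ms t) q N A (\<lambda>m p. t ^ (k - q) * a m p) ?f"
    proof -
      have "kernel_approximation (Ms t) q N A a (hk q)" by (rule kernel_approximation_scale[OF a finite_measure_axioms hk_measurable[OF q(2)]])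
      moreover have "simple_kernel q (N m) (A m) (a m) \<in> borel_measurable (pow (Ms t) q)" for m
        using a by (intro Q.simple_kernel_measurable) (auto simp: kernel_approximation_def)
      moreover have "hk q \<in> borel_measurable (pow (Ms t) q)"
        by (rule measurable_pow_Ms[OF t hk_measurable[OF q(2)]])
      ultimately show ?thesis
        unfolding kernel_approximation_def simple_kernel_cmult by (auto intro: L2_tendsto_cmult)
    qed
    have "L2_dist2 (P t) (Fi q t) (?S ?b) \<le>
      fact q * L2_dist2 (pow (Ms t) q) ?f (simple_kernel q (N m) (A m) ?b)"
      by (rule Q.noise.multiple_integral_distance[OF fm am Am])
    also have "L2_dist2 (pow (Ms t) q) ?f (simple_kernel q (N m) (A m) ?b) = t ^ (2 * k - q) * ?D"
    proof -
      have "(?f x - simple_kernel q (N m) (A m) ?b x)\<^sup>2 = (t ^ (k - q))\<^sup>2 * (hk q x - simple_kernel q (N m) (A m) (a m) x)\<^sup>2" for x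
        unfolding simple_kernel_cmult by (simp add: right_diff_distrib[symmetric] power_mult_distrib)
      then have "L2_dist2 (pow (Ms t) q) ?f (simple_kernel q (N m) (A m) ?b) = t ^ q * ((t ^ (k - q))\<^sup>2 * ?D)"
        using t by (simp add: power_Ms integral_scale_measure')
      moreover have "t ^ q * (t ^ (k - q))\<^sup>2 = t ^ (2 * k - q)"
      proof -
        have "q + (k - q) * 2 = 2 * k - q" using q by simp
        then show ?thesis by (metis power_add power_mult)
      qed
      ultimately show ?thesis by (simp add: mult.assoc[symmetric])
    qed
    finally have "c\<^sup>2 * L2_dist2 (P t) (Fi q t) (?S ?b) \<le> c\<^sup>2 * (fact q * (t ^ (2 * k - q) * ?D))" by (rule mult_left_mono) simp
    also have "\<dots> = (c\<^sup>2 * t ^ (2 * k - q)) * (fact q * ?D)" by simp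
    also have "\<dots> = fact q * ?D" using c2[OF q(2)] t by simp
    finally show ?thesis .
  qed
  have "(\<integral>w. (c * F t w - c * ?S ?b w)\<^sup>2 \<partial>P t) = (\<integral>w. (c * R w + c * (Fi q t w - ?S ?b w))\<^sup>2 \<partial>P t)"
  proof (rule integral_cong_AE)
    show "AE w in P t. (c * F t w - c * ?S ?b w)\<^sup>2 = (c * R w + c * (Fi q t w - ?S ?b w))\<^sup>2"
      using F by eventually_elim (simp add: algebra_simps)
  qed (use F_L2[OF t] sqS sqR sqF in \<open>auto simp: square_integrable_def\<close>)
  also have "\<dots> \<le> (\<integral>w. 2 * c\<^sup>2 * (R w)\<^sup>2 + 2 * c\<^sup>2 * (Fi q t w - ?S ?b w)\<^sup>2 \<partial>P t)"
  proof (rule integral_mono)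
    show "integrable (P t) (\<lambda>w. (c * R w + c * (Fi q t w - ?S ?b w))\<^sup>2)"
      by (intro square_integrable_integrable square_integrable_add square_integrable_cmult square_integrable_diff sqR sqF sqS)
    show "integrable (P t) (\<lambda>w. 2 * c\<^sup>2 * (R w)\<^sup>2 + 2 * c\<^sup>2 * (Fi q t w - ?S ?b w)\<^sup>2)"
      by (intro Bochner_Integration.integrable_add integrable_mult_right square_integrable_integrable square_integrable_diff sqR sqF sqS)
    show "(c * R w + c * (Fi q t w - ?S ?b w))\<^sup>2 \<le> 2 * c\<^sup>2 * (R w)\<^sup>2 + 2 * c\<^sup>2 * (Fi q t w - ?S ?b w)\<^sup>2" for w
      using square_add_le[of "c * R w" "c * (Fi q t w - ?S ?b w)"] by (simp add: power_mult_distrib)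
  qed
  also have "\<dots> = 2 * (c\<^sup>2 * (\<integral>w. (R w)\<^sup>2 \<partial>P t)) + 2 * (c\<^sup>2 * L2_dist2 (P t) (Fi q t) (?S ?b))"
    using square_integrable_integrable[OF sqR] square_integrable_integrable[OF square_integrable_diff[OF sqF sqS]] by simp
  also have "\<dots> \<le> 2 * (\<Sum>i\<in>{q<..k}. \<kappa> i) / t + 2 * (fact q * ?D)" using R2 distance by simp
  finally show "(\<integral>w. (t powr (real q / 2 - real k) * F t w -
        simple_integral (\<lambda>B w. t powr (- 1 / 2) * noise t B w) q (N m) (A m) (a m) w)\<^sup>2 \<partial>P t) \<le>
      2 * (\<Sum>i\<in>{q<..k}. \<kappa> i) / t + 2 * (fact q * ?D)" unfolding S c_def[symmetric] .
qed

theorem higher_order_weak_conv: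
  assumes q: "2 \<le> q" "q \<le> k" "\<And>i. 1 \<le> i \<Longrightarrow> i < q \<Longrightarrow> \<kappa> i = 0"
    and r: "\<And>n. 1 \<le> r n" "filterlim r at_top sequentially" and G: "gaussian_measure Q M G"
  shows "weak_conv_m (\<lambda>n. distr (P (r n)) borel (\<lambda>w. r n powr (real q / 2 - real k) * F (r n) w))
    (distr Q borel (multiple_integral Q M G q (hk q)))"
proof -
  have t: "0 < r n" for n using r(1)[of n] by simp
  interpret G: centered_noise Q M G by (rule gaussian_measure_centered_noise[OF G finite_measure_axioms])
  obtain N A a where "\<forall>i\<le>k. kernel_approximation M i N A (a i) (hk i)" by (rule hk_approximation)
  then have a: "kernel_approximation M q N A (a q) (hk q)" using q by simp
  note hm = hk_measurable[OF q(2)]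
  have A: "disjoint_family_on (A m) {..<N m}" "i < N m \<Longrightarrow> A m i \<in> sets M" for m i
    using a by (auto simp: kernel_approximation_def)
  define D where "D m = 2 * (fact q * L2_dist2 (pow M q) (hk q) (simple_kernel q (N m) (A m) (a q m)))" for m
  have D: "D \<longlonglongrightarrow> 0"
  proof -
    note sq = kernel_approximation_square_integrable[OF a hm]
    have "(\<lambda>m. L2_dist2 (pow M q) (simple_kernel q (N m) (A m) (a q m)) (hk q)) \<longlonglongrightarrow> 0"
      using a L2_tendsto_iff[OF sq(2) sq(1), of "\<lambda>m. m"] by (simp add: kernel_approximation_def)
    then have "(\<lambda>m. 2 * (fact q * L2_dist2 (pow M q) (simple_kernel q (N m) (A m) (a q m)) (hk q))) \<longlonglongrightarrow> 2 * (fact q * 0)"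
      by (intro tendsto_intros)
    then show ?thesis unfolding D_def[abs_def] by (simp add: power2_commute)
  qed
  show ?thesis
  proof (rule G.P.weak_limit_approximation)
    show "prob_space (P (r n))" for n by (rule prob_space_P[OF t])
    show "square_integrable (P (r n)) (\<lambda>w. r n powr (real q / 2 - real k) * F (r n) w)" for n
      by (rule square_integrable_cmult[OF F_L2[OF t]])
    show "square_integrable (P (r n)) (simple_integral (\<lambda>B w. r n powr (- 1 / 2) * noise (r n) B w) q (N m) (A m) (a q m))" for n m
      by (rule U_statistic_approximation(1)[OF q r(1) a])
    show "(\<integral>w. (r n powr (real q / 2 - real k) * F (r n) w -
        simple_integral (\<lambda>B w. r n powr (- 1 / 2) * noise (r n) B w) q (N m) (A m) (a q m) w)\<^sup>2 \<partial>P (r n)) \<le>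
      2 * (\<Sum>i\<in>{q<..k}. \<kappa> i) / r n + D m" for n m
      unfolding D_def by (rule U_statistic_approximation(2)[OF q r(1) a])
    show "square_integrable Q (multiple_integral Q M G q (hk q))" by (rule G.multiple_integral_limit(1)[OF hm a])
    show "square_integrable Q (simple_integral G q (N m) (A m) (a q m))" for m
      by (rule G.simple_integral_square_integrable[OF A])
    show "L2_dist2 Q (multiple_integral Q M G q (hk q)) (simple_integral G q (N m) (A m) (a q m)) \<le> D m" for m
    proof -
      have "0 \<le> fact q * L2_dist2 (pow M q) (hk q) (simple_kernel q (N m) (A m) (a q m))" by simp
      moreover have "L2_dist2 Q (multiple_integral Q M G q (hk q)) (simple_integral G q (N m) (A m) (a q m)) \<le>
        fact q * L2_dist2 (pow M q) (hk q) (simple_kernel q (N m) (A m) (a q m))"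
        by (rule G.multiple_integral_distance[OF hm a A])
      ultimately show ?thesis unfolding D_def by linarith
    qed
    show "(\<lambda>n. 2 * (\<Sum>i\<in>{q<..k}. \<kappa> i) / r n) \<longlonglongrightarrow> 0" by (rule real_tendsto_divide_at_top[OF tendsto_const r(2)])
    show "D \<longlonglongrightarrow> 0" by (rule D)
    show "(\<lambda>n. \<integral>w. g (simple_integral (\<lambda>B w. r n powr (- 1 / 2) * noise (r n) B w) q (N m) (A m) (a q m) w) \<partial>P (r n)) \<longlonglongrightarrow>
      (\<integral>w. g (simple_integral G q (N m) (A m) (a q m) w) \<partial>Q)"
      if "continuous_on UNIV g" "\<And>x. \<bar>g x\<bar> \<le> 1" for m and g :: "real \<Rightarrow> real"
      by (rule simple_integral_weak_conv[OF A r G that])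
  qed
qed

text \<open>Both integrals are L2 limits of simple integrals over the same sets and coefficients;
  the factor \<open>sqrt c\<close> of the noise occurs once in each of the \<open>q\<close>
  variables.\<close>

lemma multiple_integral_scaled_gaussian:
  assumes q: "q \<le> k" and c: "0 < c" and G: "gaussian_measure Q (scale_measure (ennreal (1 / c)) M) G"
  shows "distr Q borel (\<lambda>w. c powr (real q / 2) * multiple_integral Q (scale_measure (ennreal (1 / c)) M) G q (hk q) w) =
    distr Q borel (multiple_integral Q M (\<lambda>B w. sqrt c * G B w) q (hk q))"
proof -
  let ?M = "scale_measure (ennreal (1 / c)) M" and ?G = "\<lambda>B w. sqrt c * G B w"
  have fin: "finite_measure ?M"
    by (auto intro!: finite_measureI simp: emeasure_eq_measure ennreal_mult_eq_top_iff space_scale_measure)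
  interpret G: centered_noise Q ?M G by (rule gaussian_measure_centered_noise[OF G fin])
  interpret G': centered_noise Q M ?G
    by (rule gaussian_measure_centered_noise[OF gaussian_measure_scale[OF G finite_measure_axioms c] finite_measure_axioms])
  obtain N A a where "\<forall>i\<le>k. kernel_approximation M i N A (a i) (hk i)" by (rule hk_approximation)
  then have a: "kernel_approximation M q N A (a q) (hk q)" using q by simp
  have a': "kernel_approximation ?M q N A (a q) (hk q)" by (rule kernel_approximation_scale[OF a finite_measure_axioms hk_measurable[OF q]])
  note hm = hk_measurable[OF q]
  have hm': "hk q \<in> borel_measurable (pow ?M q)"
    using hm unfolding power_measure_scale[OF finite_measure_axioms] by (simp add: measurable_def space_scale_measure)
  note l = G.multiple_integral_limit[OF hm' a'] G'.multiple_integral_limit[OF hm a]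
  have A: "disjoint_family_on (A m) {..<N m}" "i < N m \<Longrightarrow> A m i \<in> sets M" "i < N m \<Longrightarrow> A m i \<in> sets ?M" for m i
    using a by (auto simp: kernel_approximation_def)
  have m: "simple_integral G q (N m) (A m) (a q m) \<in> borel_measurable Q" "simple_integral ?G q (N m) (A m) (a q m) \<in> borel_measurable Q"
    "multiple_integral Q ?M G q (hk q) \<in> borel_measurable Q" "multiple_integral Q M ?G q (hk q) \<in> borel_measurable Q" for m
    using G.simple_integral_square_integrable[OF A(1,3)] G'.simple_integral_square_integrable[OF A(1,2)] l
    by (auto simp: square_integrable_def)
  have s: "simple_integral ?G q (N m) (A m) (a q m) w = c powr (real q / 2) * simple_integral G q (N m) (A m) (a q m) w" for m w
  proof -
    have "sqrt c ^ q = c powr (real q / 2)" using c by (simp add: powr_half_sqrt[symmetric] powr_realpow[symmetric] powr_powr)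
    then show ?thesis by (simp add: simple_integral_noise_cmult)
  qed
  have "AE w in Q. c powr (real q / 2) * multiple_integral Q ?M G q (hk q) w = multiple_integral Q M ?G q (hk q) w"
  proof (rule L2_tendsto_unique)
    show "L2_tendsto Q (\<lambda>m. simple_integral ?G q (N m) (A m) (a q m)) (\<lambda>w. c powr (real q / 2) * multiple_integral Q ?M G q (hk q) w)"
      unfolding s[abs_def] using l m by (intro L2_tendsto_cmult) auto
  qed (use l m in auto)
  then show ?thesis using m by (intro distr_cong_AE) auto
qed

lemma higher_order_limit_law_unique:
  assumes q: "2 \<le> q" "q \<le> k" "\<And>i. 1 \<le> i \<Longrightarrow> i < q \<Longrightarrow> \<kappa> i = 0"
    and G: "gaussian_measure Q M G" and G': "gaussian_measure Q' M G'"
  shows "distr Q borel (multiple_integral Q M G q (hk q)) = distr Q' borel (multiple_integral Q' M G' q (hk q))"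
proof -
  let ?r = "\<lambda>n. 1 + real n"
  have r: "1 \<le> ?r n" "filterlim ?r at_top sequentially" for n
    by (auto intro!: filterlim_tendsto_add_at_top[OF tendsto_const] filterlim_real_sequentially)
  interpret G: centered_noise Q M G by (rule gaussian_measure_centered_noise[OF G finite_measure_axioms])
  interpret G': centered_noise Q' M G' by (rule gaussian_measure_centered_noise[OF G' finite_measure_axioms])
  obtain N A a where "\<forall>i\<le>k. kernel_approximation M i N A (a i) (hk i)" by (rule hk_approximation)
  then have a: "kernel_approximation M q N A (a q) (hk q)" using q by simp
  note hm = hk_measurable[OF q(2)]
  have F: "(\<lambda>w. ?r n powr (real q / 2 - real k) * F (?r n) w) \<in> borel_measurable (P (?r n))" for n
    by (intro borel_measurable_times borel_measurable_const square_integrable_measurable F_L2) simp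
  show ?thesis
  proof (rule weak_conv_m_unique[OF _ _ _ higher_order_weak_conv[OF q r G] higher_order_weak_conv[OF q r G']])
    show "real_distribution (distr (P (?r n)) borel (\<lambda>w. ?r n powr (real q / 2 - real k) * F (?r n) w))" for n
      by (intro prob_space.real_distribution_distr prob_space_P F) simp
    show "real_distribution (distr Q borel (multiple_integral Q M G q (hk q)))"
      by (intro G.P.real_distribution_distr square_integrable_measurable G.multiple_integral_limit(1)[OF hm a])
    show "real_distribution (distr Q' borel (multiple_integral Q' M G' q (hk q)))"
      by (intro G'.P.real_distribution_distr square_integrable_measurable G'.multiple_integral_limit(1)[OF hm a])
  qed
qed

theorem first_order_convergence:
  assumes pos: "\<kappa> 1 > 0" and f4: "integrable (pow M 1) (\<lambda>x. (hk 1 x)^4)"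
  defines "L \<equiv> \<lambda>t. distr (P t) borel (\<lambda>w. (F t w - mean t) / sqrt (var t))"
  shows "weak_conv_along L std_normal_distribution at_top"
    and "\<exists>C. \<forall>\<^sub>F t in at_top. wasserstein_dist (L t) std_normal_distribution \<le> ennreal (C * t powr (- 1 / 2))"
proof -
  obtain C where C: "\<And>t g. 1 \<le> t \<Longrightarrow> (\<And>x y. \<bar>g x - g y\<bar> \<le> \<bar>x - y\<bar>) \<Longrightarrow>
    \<bar>(\<integral>w. g ((F t w - mean t) / sqrt (var t)) \<partial>P t) - normal_mean g\<bar> \<le> C * t powr (- 1 / 2)"
    by (rule first_order_normal_approximation[OF pos f4]) blast
  have Fm: "(\<lambda>w. (F t w - mean t) / sqrt (var t)) \<in> borel_measurable (P t)" if "1 \<le> t" for t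
    using F_L2[of t] that
    by (intro borel_measurable_divide borel_measurable_diff borel_measurable_const) (auto simp: square_integrable_def)
  show "weak_conv_along L std_normal_distribution at_top"
  proof (rule weak_conv_along_sequentiallyI)
    fix r :: "nat \<Rightarrow> real" assume r: "\<And>n. 1 \<le> r n" "filterlim r at_top sequentially"
    have t: "0 < r n" for n using r(1)[of n] by simp
    have "((\<lambda>t::real. C * t powr (- 1 / 2)) \<longlongrightarrow> C * 0) at_top"
      by (intro tendsto_intros tendsto_neg_powr filterlim_ident) auto
    from filterlim_compose[OF this r(2)] have lim: "(\<lambda>n. C * r n powr (- 1 / 2)) \<longlonglongrightarrow> 0" by simp
    have "integrable (P (r n)) (\<lambda>w. (F (r n) w - mean (r n)) / sqrt (var (r n)))" for n
    proof -
      interpret Q: prob_space "P (r n)" by (rule prob_space_P[OF t])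
      have "integrable (P (r n)) (F (r n))" by (rule integrable_of_L2[OF Q.prob_space_axioms F_L2[OF t]])
      then show ?thesis by simp
    qed
    then have "weak_conv_m (\<lambda>n. distr (P (r n)) borel (\<lambda>w. 1 * ((F (r n) w - mean (r n)) / sqrt (var (r n)))))
      (distr std_normal_distribution borel (\<lambda>x. 1 * x))"
      by (intro weak_conv_normal[OF prob_space_P[OF t] _ lim] C r(1)) auto
    moreover have "distr std_normal_distribution borel (\<lambda>x. x) = std_normal_distribution"
      by (rule measure_eqI) (auto simp: emeasure_distr)
    ultimately show "weak_conv_m (\<lambda>n. L (r n)) std_normal_distribution" by (simp add: L_def)
  qed
  have "wasserstein_dist (L t) std_normal_distribution \<le> ennreal (C * t powr (- 1 / 2))" if t: "1 \<le> t" for t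
    unfolding wasserstein_dist_def
  proof (rule SUP_least)
    fix g :: "real \<Rightarrow> real" assume "g \<in> {g. 1-lipschitz_on UNIV g}"
    then have g: "\<bar>g x - g y\<bar> \<le> 1 * \<bar>x - y\<bar>" for x y by (auto simp: lipschitz_on_def dist_real_def)
    note gm = Lipschitz_borel_measurable(2)[OF g]
    have "\<bar>(\<integral>x. g x \<partial>L t) - (\<integral>x. g x \<partial>std_normal_distribution)\<bar> \<le> C * t powr (- 1 / 2)"
      unfolding L_def integral_distr[OF Fm[OF t] gm] std_normal_integral[OF gm] using g by (intro C[OF t]) simp
    then show "ennreal \<bar>(\<integral>x. g x \<partial>L t) - (\<integral>x. g x \<partial>std_normal_distribution)\<bar> \<le> ennreal (C * t powr (- 1 / 2))"
      by (rule ennreal_leI)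
  qed
  then show "\<exists>C. \<forall>\<^sub>F t in at_top. wasserstein_dist (L t) std_normal_distribution \<le> ennreal (C * t powr (- 1 / 2))"
    by (intro exI[of _ C] eventually_mono[OF eventually_ge_at_top[of 1]])
qed

end

section \<open>Slabs of a compact Euclidean set\<close>

text \<open>The slab lies in the box with side \<open>[a, a + d]\<close> in direction
  \<open>e\<close> and \<open>[-R, R]\<close> in all the others; \<open>c\<close> below is the
  vector of the half-sides of these other directions.\<close>

lemma measure_lborel_slab_le:
  fixes e :: "'a :: euclidean_space"
  assumes X: "X \<in> sets borel" "\<And>x b. x \<in> X \<Longrightarrow> b \<in> Basis \<Longrightarrow> \<bar>x \<bullet> b\<bar> \<le> R" and e: "e \<in> Basis" and "0 \<le> R" "0 \<le> d"
  shows "measure lborel {x \<in> X. x \<bullet> e \<in> {a..a + d}} \<le> (2 * R) ^ (DIM('a) - 1) * d"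
proof -
  define c where "c = R *\<^sub>R (\<Sum>b\<in>Basis - {e}. b)"
  let ?l = "a *\<^sub>R e - c" and ?u = "(a + d) *\<^sub>R e + c"
  have c: "c \<bullet> b = (if b = e then 0 else R)" if "b \<in> Basis" for b
  proof -
    have "(\<Sum>x\<in>Basis - {e}. x) \<bullet> b = (\<Sum>x\<in>Basis - {e}. if x = b then 1 else 0)"
      unfolding inner_sum_left using that by (intro sum.cong refl) (auto simp: inner_Basis)
    also have "\<dots> = (if b = e then 0 else 1)" using that by simp
    finally show ?thesis unfolding c_def inner_scaleR_left by (simp only:) simp
  qed
  have l: "?l \<bullet> b = (if b = e then a else - R)" "?u \<bullet> b = (if b = e then a + d else R)" if "b \<in> Basis" for b
    using that e by (auto simp: inner_diff_left inner_add_left c inner_Basis)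
  have "measure lborel {x \<in> X. x \<bullet> e \<in> {a..a + d}} \<le> measure lborel (cbox ?l ?u)"
  proof (rule measure_mono_fmeasurable)
    show "{x \<in> X. x \<bullet> e \<in> {a..a + d}} \<subseteq> cbox ?l ?u"
    proof
      fix x assume x: "x \<in> {x \<in> X. x \<bullet> e \<in> {a..a + d}}"
      show "x \<in> cbox ?l ?u"
        unfolding mem_box
      proof
        fix b :: 'a assume b: "b \<in> Basis"
        show "?l \<bullet> b \<le> x \<bullet> b \<and> x \<bullet> b \<le> ?u \<bullet> b" using x X(2)[of x b] b unfolding l[OF b] by auto
      qed
    qed
    have "X \<inter> (\<lambda>x. x \<bullet> e) -` {a..a + d} \<in> sets borel"
      by (rule sets.Int[OF X(1) borel_closed[OF continuous_closed_vimage]]) (auto intro: continuous_intros)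
    moreover have "X \<inter> (\<lambda>x. x \<bullet> e) -` {a..a + d} = {x \<in> X. x \<bullet> e \<in> {a..a + d}}" by auto
    ultimately show "{x \<in> X. x \<bullet> e \<in> {a..a + d}} \<in> sets lborel" by simp
  qed simp
  also have "\<dots> = (\<Prod>b\<in>Basis. if b = e then d else 2 * R)"
    unfolding measure_lborel_cbox_eq using assms(4,5) l by (auto intro!: prod.cong simp: inner_diff_left)
  also have "\<dots> = (2 * R) ^ (DIM('a) - 1) * d"
    using e by (subst prod.remove[of _ e]) (auto simp: mult.commute)
  finally show ?thesis .
qed

text \<open>The number of a slab at one level is the integer half of its number at the next, so
  dyadic slabs are nested; nonnegativity ensures that \<open>nat\<close> identifies nothing
  further.\<close>

lemma floor_nat_half_cong:
  fixes x y :: real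
  assumes "0 \<le> x" "0 \<le> y" "nat \<lfloor>2 * x\<rfloor> = nat \<lfloor>2 * y\<rfloor>"
  shows "nat \<lfloor>x\<rfloor> = nat \<lfloor>y\<rfloor>"
proof -
  have h: "\<lfloor>z\<rfloor> = \<lfloor>2 * z\<rfloor> div 2" for z :: real
    using floor_divide_real_eq_div[of 2 "2 * z"] by simp
  have "\<lfloor>2 * x\<rfloor> = \<lfloor>2 * y\<rfloor>" using assms by (simp add: nat_eq_iff)
  then show ?thesis unfolding h[of x] h[of y] by simp
qed

text \<open>Cutting \<open>X\<close> into dyadic slabs of thickness \<open>2\<^sup>-\<^sup>n\<close> orthogonal to a coordinate axis suffices: no
  partition of \<open>M\<close> is needed.\<close>

lemma slab_partition:
  fixes X :: "'a :: euclidean_space set" and \<nu> :: "'m measure"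
  assumes X: "compact X" and \<nu>: "prob_space \<nu>"
  obtains cell K \<epsilon> where "partitioned_measure (restrict_space lborel X \<Otimes>\<^sub>M \<nu>) cell K \<epsilon>"
proof -
  let ?\<mu> = "restrict_space lborel X \<Otimes>\<^sub>M \<nu>"
  interpret \<nu>: prob_space \<nu> by fact
  have Xs: "X \<in> sets borel" using X by (simp add: borel_closed compact_imp_closed)
  have fin: "emeasure lborel X < \<infinity>"
    using emeasure_bounded_finite[OF compact_imp_bounded[OF X]] .
  interpret X: finite_measure "restrict_space lborel X"
    using fin Xs by (intro finite_measureI) (auto simp: emeasure_restrict_space space_restrict_space)
  interpret pair_sigma_finite "restrict_space lborel X" \<nu> ..
  have times: "emeasure ?\<mu> (A \<times> space \<nu>) = emeasure lborel A" if "A \<in> sets borel" "A \<subseteq> X" for A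
    using that Xs \<nu>.emeasure_space_1
    by (subst \<nu>.emeasure_pair_measure_Times) (auto simp: sets_restrict_space_iff emeasure_restrict_space)
  have space: "space ?\<mu> = X \<times> space \<nu>" by (simp add: space_pair_measure space_restrict_space)
  obtain R where R: "0 < R" "\<And>x. x \<in> X \<Longrightarrow> norm x \<le> R"
    using compact_imp_bounded[OF X] unfolding bounded_pos by auto
  have Rb: "\<bar>x \<bullet> b\<bar> \<le> R" if "x \<in> X" "b \<in> Basis" for x b
    using Basis_le_norm[OF that(2), of x] R(2)[OF that(1)] by linarith
  obtain e :: 'a where e: "e \<in> Basis" using nonempty_Basis by blast
  \<comment> \<open>The shift by \<open>R\<close> makes the argument of the floor nonnegative on the
    space, so that \<open>nat\<close> does not merge slabs.\<close>
  define cell where "cell n z = nat \<lfloor>2 ^ n * (fst z \<bullet> e + R)\<rfloor>" for n :: nat and z :: "'a \<times> 'm"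
  define K where "K n = Suc (nat \<lfloor>2 ^ n * (2 * R)\<rfloor>)" for n :: nat
  define \<epsilon> where "\<epsilon> n = (2 * R) ^ (DIM('a) - 1) * (1 / 2) ^ n" for n
  have pos: "0 \<le> 2 ^ n * (fst z \<bullet> e + R)" if "z \<in> space ?\<mu>" for n :: nat and z
    using Rb[OF _ e, of "fst z"] that unfolding space by auto
  have fst_m: "(\<lambda>z. fst z \<bullet> e) \<in> borel_measurable ?\<mu>"
  proof -
    have "(\<lambda>x. x \<bullet> e) \<in> borel_measurable (restrict_space lborel X)"
      by (intro measurable_restrict_space1) simp
    then show ?thesis by (rule measurable_compose[OF measurable_fst])
  qed
  have "partitioned_measure ?\<mu> cell K \<epsilon>"
  proof (intro partitioned_measure.intro partitioned_measure_axioms.intro)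
    have "emeasure ?\<mu> (space ?\<mu>) = emeasure lborel X" unfolding space by (rule times[OF Xs]) simp
    then show "finite_measure ?\<mu>" using fin by (intro finite_measureI) simp
    show cm: "cell n \<in> ?\<mu> \<rightarrow>\<^sub>M count_space UNIV" for n
      unfolding cell_def using fst_m by measurable
    show "cell n z < K n" if "z \<in> space ?\<mu>" for n z
    proof -
      have "2 ^ n * (fst z \<bullet> e + R) \<le> 2 ^ n * (2 * R)"
        using Rb[OF _ e, of "fst z"] that unfolding space by (intro mult_left_mono) auto
      then show ?thesis unfolding cell_def K_def by (intro le_imp_less_Suc nat_mono floor_mono)
    qed
    show "cell n y = cell n z" if "y \<in> space ?\<mu>" "z \<in> space ?\<mu>" "cell (Suc n) y = cell (Suc n) z" for y z n
      using floor_nat_half_cong[OF pos[OF that(1), of n] pos[OF that(2), of n]] that(3) by (simp add: cell_def mult.assoc)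
    show "measure ?\<mu> {z \<in> space ?\<mu>. cell n z = c} \<le> \<epsilon> n" for n c
    proof -
      let ?a = "real c / 2 ^ n - R"
      let ?S = "{x \<in> X. x \<bullet> e \<in> {?a..?a + (1 / 2) ^ n}}"
      have "X \<inter> (\<lambda>x. x \<bullet> e) -` {?a..?a + (1 / 2) ^ n} \<in> sets borel"
        by (rule sets.Int[OF Xs borel_closed[OF continuous_closed_vimage]]) (auto intro: continuous_intros)
      moreover have "X \<inter> (\<lambda>x. x \<bullet> e) -` {?a..?a + (1 / 2) ^ n} = ?S" by auto
      ultimately have S: "?S \<in> sets borel" by (simp only:)
      have sub: "{z \<in> space ?\<mu>. cell n z = c} \<subseteq> ?S \<times> space \<nu>"
      proof
        fix z assume z: "z \<in> {z \<in> space ?\<mu>. cell n z = c}"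
        let ?w = "2 ^ n * (fst z \<bullet> e + R)"
        have "real c = of_int \<lfloor>?w\<rfloor>" using z pos[of z n] by (auto simp: cell_def)
        then have "real c \<le> ?w" "?w \<le> real c + 1" by linarith+
        then have "fst z \<bullet> e \<in> {?a..?a + (1 / 2) ^ n}" by (simp add: field_simps power_one_over)
        then show "z \<in> ?S \<times> space \<nu>" using z unfolding space by auto
      qed
      have "?S \<times> space \<nu> \<in> sets ?\<mu>"
        using S Xs by (intro pair_measureI) (auto simp: sets_restrict_space_iff)
      then have "emeasure ?\<mu> {z \<in> space ?\<mu>. cell n z = c} \<le> emeasure ?\<mu> (?S \<times> space \<nu>)"
        by (rule emeasure_mono[OF sub])
      also have "\<dots> = emeasure lborel ?S" using S by (intro times) auto
      finally have "measure ?\<mu> {z \<in> space ?\<mu>. cell n z = c} \<le> measure lborel ?S"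
        unfolding measure_def using emeasure_mono[of ?S X lborel] fin Xs by (intro enn2real_mono) auto
      also have "\<dots> \<le> \<epsilon> n"
        unfolding \<epsilon>_def using R(1) Rb by (intro measure_lborel_slab_le Xs e) auto
      finally show ?thesis .
    qed
    show "\<epsilon> \<longlonglongrightarrow> 0"
      unfolding \<epsilon>_def[abs_def] by (intro tendsto_mult_right_zero LIMSEQ_power_zero) simp
  qed
  then show thesis by (rule that)
qed

section \<open>The limit theorem for geometric U-statistics\<close>

lemma projected_kernel_self: "x \<in> space (pow M k) \<Longrightarrow> projected_kernel M k h k x = h x"
proof -
  assume "x \<in> space (pow M k)"
  then have "append_tuple k 0 x y = x" for y
    by (auto simp: append_tuple_def space_PiM PiE_def extensional_def fun_eq_iff)
  then show ?thesis using integral_power_measure_0[of M "\<lambda>_. h x"] by (simp add: projected_kernel_def)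
qed

text \<open>With \<open>l = 0\<close> no variable is integrated out. Square integrability of this
  contraction is therefore integrability of the fourth power of the first kernel.\<close>

lemma contraction_order_1:
  assumes w: "w \<in> space (pow M 1)"
  shows "contraction M 1 1 1 0 f f w = (f w)\<^sup>2"
proof -
  have "append_tuple 1 0 w z = w" for z
    using w by (auto simp: append_tuple_def space_PiM PiE_def extensional_def fun_eq_iff)
  then show ?thesis
    using integral_power_measure_0[of M "contraction_integrand 1 1 1 0 f f w"]
    by (simp add: contraction_def contraction_integrand_def power2_eq_square)
qed

theorem theorem7p3:
  fixes X :: "(real ^ 'd) set"
    and \<nu> :: "'m :: t2_space measure"
    and \<mu> :: "((real ^ 'd) \<times> 'm) measure"
    and k q1 :: nat
    and h :: "(nat \<Rightarrow> (real ^ 'd) \<times> 'm) \<Rightarrow> real"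
    and P :: "real \<Rightarrow> 'w measure"
    and \<eta> :: "real \<Rightarrow> 'w \<Rightarrow> ((real ^ 'd) \<times> 'm) measure"
    and \<mu>\<^sub>s :: "real \<Rightarrow> ((real ^ 'd) \<times> 'm) measure"
    and hk :: "nat \<Rightarrow> (nat \<Rightarrow> (real ^ 'd) \<times> 'm) \<Rightarrow> real"
    and F :: "real \<Rightarrow> 'w \<Rightarrow> real"
    and Fi :: "nat \<Rightarrow> real \<Rightarrow> 'w \<Rightarrow> real"
    and var mean :: "real \<Rightarrow> real"
  assumes X: "compact X" "uminus ` X = X" "0 \<in> interior X" "frontier X \<in> null_sets lborel"
    and M: "locally_compact_space (euclidean :: 'm topology)"
    and \<nu>: "prob_space \<nu>" "sets \<nu> = sets borel"
    and \<mu>: "\<mu> = restrict_space lborel X \<Otimes>\<^sub>M \<nu>"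
    and k: "k \<ge> 1"
    and h: "integrable (power_measure \<mu> k) h" "square_integrable (power_measure \<mu> k) h"
      "symmetric_kernel \<mu> k h" "\<not> (AE x in power_measure \<mu> k. h x = 0)"
    and \<mu>s: "\<And>t. \<mu>\<^sub>s t = scale_measure (ennreal t) \<mu>"
    and \<eta>: "\<And>t. t > 0 \<Longrightarrow> poisson_measure (P t) (\<mu>\<^sub>s t) (\<eta> t)"
    and F: "\<And>t. F t = U_statistic k h (\<eta> t)"
    and F_L2: "\<And>t. t > 0 \<Longrightarrow> square_integrable (P t) (F t)"
    and hk: "\<And>i. hk i = projected_kernel \<mu> k h i"
    and Fi: "\<And>i t. Fi i t = multiple_integral (P t) (\<mu>\<^sub>s t) (compensated (\<mu>\<^sub>s t) (\<eta> t)) i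
                              (\<lambda>x. t ^ (k - i) * hk i x)"
    and T: "\<And>t. t > 0 \<Longrightarrow> assumption_T (\<mu>\<^sub>s t) k (\<lambda>i x. t ^ (k - i) * hk i x)"
    and q1: "q1 = (LEAST q. 1 \<le> q \<and> q \<le> k \<and> L2_norm (power_measure \<mu> q) (hk q) > 0)"
    and mean: "\<And>t. mean t = prob_space.expectation (P t) (F t)"
    and var: "\<And>t. var t = prob_space.variance (P t) (F t)"
  shows
    "(\<forall>t>0. AE \<omega> in P t. F t \<omega> = mean t + (\<Sum>i=1..k. Fi i t \<omega>)) \<and>
     (\<exists>c>0.
        var \<sim>[at_top] (\<lambda>t. prob_space.variance (P t) (Fi q1 t)) \<and>
        (\<lambda>t. prob_space.variance (P t) (Fi q1 t)) \<sim>[at_top] (\<lambda>t. c * t ^ (2 * k - q1))) \<and>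
     (q1 = 1 \<longrightarrow>
        (let law = (\<lambda>t. distr (P t) borel (\<lambda>\<omega>. (F t \<omega> - mean t) / sqrt (var t)));
             N = density lborel (\<lambda>x. ennreal (std_normal_density x))
         in weak_conv_along law N at_top \<and>
            (\<exists>C. \<forall>\<^sub>F t in at_top. wasserstein_dist (law t) N \<le> ennreal (C * t powr (- 1 / 2))))) \<and>
     (q1 \<ge> 2 \<longrightarrow>
        (let \<mu>' = scale_measure (1 / emeasure \<mu> (space \<mu>)) \<mu>;
             V = (\<lambda>(Q :: 'v measure) G \<omega>. measure \<mu> (space \<mu>) powr (real q1 / 2) *
                                        multiple_integral Q \<mu>' G q1 (hk q1) \<omega>)
         in (\<forall>Q G'. gaussian_measure Q \<mu>' G' \<longrightarrow>
               weak_conv_along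
                 (\<lambda>t. distr (P t) borel (\<lambda>\<omega>. t powr (real q1 / 2 - real k) * F t \<omega>))
                 (distr Q borel (V Q G')) at_top) \<and>
            (\<forall>Q G' (R :: 'u measure) G. gaussian_measure Q \<mu>' G' \<longrightarrow> gaussian_measure R \<mu> G \<longrightarrow>
               distr Q borel (V Q G') =
               distr R borel (multiple_integral R \<mu> G q1 (hk q1)))))"
proof -
  obtain cell K \<epsilon> where "partitioned_measure \<mu> cell K \<epsilon>"
    unfolding \<mu> by (rule slab_partition[OF X(1) \<nu>(1)])
  then interpret pm: partitioned_measure \<mu> cell K \<epsilon> .
  have space: "space \<mu> = X \<times> UNIV"
    using sets_eq_imp_space_eq[OF \<nu>(2)] by (simp add: \<mu> space_pair_measure space_restrict_space)
  have single: "{z} \<in> sets \<mu>" if "z \<in> space \<mu>" for z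
  proof -
    have "X \<in> sets lborel" using X(1) by (simp add: borel_closed compact_imp_closed)
    then have "{fst z} \<in> sets (restrict_space lborel X)" using that by (simp add: space sets_restrict_space_iff mem_Times_iff)
    then have "{fst z} \<times> {snd z} \<in> sets \<mu>" unfolding \<mu> by (rule pair_measureI) (simp add: \<nu>(2))
    then show ?thesis by (simp add: insert_Times_insert)
  qed
  interpret S: scaled_poisson \<mu> cell K \<epsilon> P \<eta> k h
    using single \<eta> k h(2,3) F_L2 by unfold_locales (simp_all add: \<mu>s F)
  have eq: "hk = projected_kernel \<mu> k h" "\<mu>\<^sub>s = (\<lambda>t. scale_measure (ennreal t) \<mu>)"
    "F = (\<lambda>t. U_statistic k h (\<eta> t))" "mean = S.mean" "var = S.var"
    by (rule ext, rule hk, rule ext, rule \<mu>s, rule ext, rule F, rule ext, simp only: mean F, rule ext, simp only: var F)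
  have Fi': "Fi = S.Fi" using Fi by (simp add: fun_eq_iff eq)
  have \<kappa>: "L2_norm (pow \<mu> i) (hk i) > 0 \<longleftrightarrow> S.\<kappa> i > 0" for i
    unfolding L2_norm_def S.\<kappa>_def eq(1) by (simp add: zero_less_mult_iff)
  \<comment> \<open>The projection onto all \<open>k\<close> variables is \<open>h\<close> itself,
    which is not almost everywhere zero; hence the least index \<open>q1\<close> exists and is at
    most \<open>k\<close>.\<close>
  have k0: "S.\<kappa> k > 0"
  proof (rule ccontr)
    assume "\<not> S.\<kappa> k > 0"
    then have "S.\<kappa> k = 0" using S.\<kappa>_nonneg[of k] by linarith
    then have "(\<integral>x. (S.hk k x)\<^sup>2 \<partial>pow \<mu> k) = 0" by (simp add: S.\<kappa>_def)
    moreover have "(\<integral>x. (S.hk k x)\<^sup>2 \<partial>pow \<mu> k) = (\<integral>x. (h x)\<^sup>2 \<partial>pow \<mu> k)"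
      by (intro Bochner_Integration.integral_cong refl) (simp add: projected_kernel_self)
    ultimately have "AE x in pow \<mu> k. (h x)\<^sup>2 = 0"
      using h(2) by (subst integral_nonneg_eq_0_iff_AE[symmetric]) (auto simp: square_integrable_def)
    then show False using h(4) by simp
  qed
  let ?Q = "\<lambda>q. 1 \<le> q \<and> q \<le> k \<and> L2_norm (pow \<mu> q) (hk q) > 0"
  have "?Q q1" unfolding q1 by (rule LeastI[of ?Q k]) (use k k0 in \<open>simp add: \<kappa>\<close>)
  then have q: "1 \<le> q1" "q1 \<le> k" "S.\<kappa> q1 > 0" by (simp_all add: \<kappa>)
  have lower: "S.\<kappa> i = 0" if "1 \<le> i" "i < q1" for i
  proof -
    have "\<not> ?Q i" using that(2) unfolding q1 by (rule not_less_Least)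
    then show ?thesis using that q(2) S.\<kappa>_nonneg[of i] by (simp add: \<kappa>)
  qed
  have part1: "\<forall>t>0. AE \<omega> in P t. F t \<omega> = mean t + (\<Sum>i=1..k. Fi i t \<omega>)"
    using S.F_decomposition by (simp only: eq Fi') blast
  have part2: "\<exists>c>0. var \<sim>[at_top] (\<lambda>t. prob_space.variance (P t) (Fi q1 t)) \<and>
        (\<lambda>t. prob_space.variance (P t) (Fi q1 t)) \<sim>[at_top] (\<lambda>t. c * t ^ (2 * k - q1))"
    using S.variance_asymptotics[OF q lower] q(3) unfolding eq Fi' by blast
  have part3: "weak_conv_along (\<lambda>t. distr (P t) borel (\<lambda>\<omega>. (F t \<omega> - mean t) / sqrt (var t))) std_normal_distribution at_top \<and>
      (\<exists>C. \<forall>\<^sub>F t in at_top. wasserstein_dist (distr (P t) borel (\<lambda>\<omega>. (F t \<omega> - mean t) / sqrt (var t))) std_normal_distribution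
        \<le> ennreal (C * t powr (- 1 / 2)))" if "q1 = 1"
  proof -
    have "square_integrable (pow \<mu> 1) (contraction \<mu> 1 1 1 0 (hk 1) (hk 1))"
    proof -
      \<comment> \<open>At intensity 1 both the scaling of the measure and the powers of
        \<open>t\<close> in front of the kernels are trivial.\<close>
      have "assumption_T \<mu> k hk" using T[of 1] by (simp add: \<mu>s)
      moreover have "1 \<in> {1..k}" "1 \<in> {1..1::nat}" using k by auto
      ultimately have "square_integrable (pow \<mu> 1) (contraction \<mu> 1 1 1 (1 - 1) (hk 1) (hk 1))"
        unfolding assumption_T_def by blast
      then show ?thesis by simp
    qed
    then have "integrable (pow \<mu> 1) (\<lambda>w. (contraction \<mu> 1 1 1 0 (hk 1) (hk 1) w)\<^sup>2)" by (simp add: square_integrable_def)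
    also have "integrable (pow \<mu> 1) (\<lambda>w. (contraction \<mu> 1 1 1 0 (hk 1) (hk 1) w)\<^sup>2) \<longleftrightarrow>
      integrable (pow \<mu> 1) (\<lambda>w. (hk 1 w) ^ 4)"
      by (intro Bochner_Integration.integrable_cong refl) (simp only: contraction_order_1 power_mult[symmetric], simp)
    finally have "integrable (pow \<mu> 1) (\<lambda>x. (S.hk 1 x) ^ 4)" by (simp only: eq)
    then show ?thesis using S.first_order_convergence q(3) that unfolding eq by blast
  qed
  let ?m = "measure \<mu> (space \<mu>)"
  \<comment> \<open>If the total mass were zero, so would be that of the k-th power since
    \<open>k >= 1\<close>, and \<open>h\<close> would vanish almost everywhere.\<close>
  have m: "0 < ?m"
  proof (rule ccontr)
    assume "\<not> 0 < ?m"
    then have "emeasure \<mu> (space \<mu>) = 0" using measure_nonneg[of \<mu> "space \<mu>"] by (simp add: pm.emeasure_eq_measure)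
    then have "emeasure (pow \<mu> k) (space (pow \<mu> k)) = 0"
      unfolding space_PiM using k by (subst pm.emeasure_power_rectangle) (auto intro!: bexI[of _ 0])
    then show False using h(4) emeasure_0_AE by blast
  qed
  have scale: "1 / emeasure \<mu> (space \<mu>) = ennreal (1 / ?m)"
    using m by (simp add: pm.emeasure_eq_measure divide_ennreal[symmetric])
  let ?\<mu> = "scale_measure (1 / emeasure \<mu> (space \<mu>)) \<mu>"
  have law: "distr Q borel (\<lambda>\<omega>. ?m powr (real q1 / 2) * multiple_integral Q ?\<mu> G q1 (hk q1) \<omega>) =
      distr Q borel (multiple_integral Q \<mu> (\<lambda>B \<omega>. sqrt ?m * G B \<omega>) q1 (hk q1))"
    and G: "gaussian_measure Q \<mu> (\<lambda>B \<omega>. sqrt ?m * G B \<omega>)"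
    if "gaussian_measure Q ?\<mu> G" for Q :: "'v measure" and G
    using S.multiple_integral_scaled_gaussian[OF q(2) m] gaussian_measure_scale[OF _ pm.finite_measure_axioms m] that
    unfolding scale eq by blast+
  have part4: "weak_conv_along (\<lambda>t. distr (P t) borel (\<lambda>\<omega>. t powr (real q1 / 2 - real k) * F t \<omega>))
      (distr Q borel (\<lambda>\<omega>. ?m powr (real q1 / 2) * multiple_integral Q ?\<mu> G q1 (hk q1) \<omega>)) at_top"
    if "2 \<le> q1" "gaussian_measure Q ?\<mu> G" for Q :: "'v measure" and G
    unfolding law[OF that(2)] unfolding eq
    by (intro weak_conv_along_sequentiallyI S.higher_order_weak_conv that(1) q lower G[OF that(2)])
  have part5: "distr Q borel (\<lambda>\<omega>. ?m powr (real q1 / 2) * multiple_integral Q ?\<mu> G q1 (hk q1) \<omega>) =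
      distr R borel (multiple_integral R \<mu> G' q1 (hk q1))"
    if "2 \<le> q1" "gaussian_measure Q ?\<mu> G" "gaussian_measure R \<mu> G'" for Q :: "'v measure" and G and R :: "'u measure" and G'
    unfolding law[OF that(2)] unfolding eq
    by (intro S.higher_order_limit_law_unique that q lower G[OF that(2)])
  show ?thesis unfolding Let_def using part1 part2 part3 part4 part5 by simp
qed

end
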